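(* Let $N\ge2$, $T>0$, $\nu\ge0$. Let $(v,p)$ be a weak solution to $(NS)_\nu$ on $\mathbb{R}^N\times(0,T)$ with $f\in L^1(0,T;L^1_{loc,\sigma}(\mathbb{R}^N))$ such that either (A) $$\int_0^T\int_{\mathbb{R}^N}\frac{|v(x,t)|^2+|p(x,t)|}{1+|x|}\,dx\,dt<\infty,$$ or (B) $p(x,t)\to0$ as $|x|\to\infty$ for almost every $t\in(0,T)$, and $v\in L^2(0,T;L^q(\mathbb{R}^N))$ for some $q$ with $2<q<\frac{2N}{N-1}$. Suppose there exists $w\in L^1(0,\infty)$ such that, for some constant $C>0$, $0<w(r)\le\frac{C}{1+r}$ for almost every $r\in[0,\infty)$, and $$\int_{\mathbb{R}^N}p(x,t)\left[w(|x|)+\frac{N-1}{|x|}\int_0^{|x|}w(s)\,ds\right]dx\ge0\quad\text{for almost every } t\in(0,T).$$ Then $v(x,t)=0$ almost everywhere on $\mathbb{R}^N\times(0,T)$.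
   Context: For $N\ge 2$ and $\nu\ge0$, $(NS)_\nu$ denotes the Navier-Stokes equations on $\mathbb{R}^N$ (the Euler equations when $\nu=0$): $\partial_t v+(v\cdot\nabla)v=-\nabla p+\nu\Delta v+f$, $\operatorname{div} v=0$, with velocity $v=(v^1,\dots,v^N)(x,t)$, pressure $p(x,t)$, external force $f=(f^1,\dots,f^N)(x,t)$ and viscosity $\nu$. For $q\in[1,\infty]$, $L^q_{loc,\sigma}(\mathbb{R}^N)$ is the class of vector fields in $[L^q_{loc}(\mathbb{R}^N)]^N$ that are divergence free in the sense of distributions. For $a,b\in\mathbb{R}^N$, $a\otimes b$ is the $N\times N$ matrix with $(a\otimes b)_{ij}=a_ib_j$; for $N\times N$ matrices, $A:B=\sum_{i,j=1}^N A_{ij}B_{ij}$. Weak solution: a pair $(v,p)\in L^2(0,T;L^2_{loc,\sigma}(\mathbb{R}^N))\times L^1(0,T;L^1_{loc}(\mathbb{R}^N))$ is a weak solution of $(NS)_\nu$ on $\mathbb{R}^N\times(0,T)$ with $f\in L^1(0,T;L^1_{loc,\sigma}(\mathbb{R}^N))$ if $$-\int_0^T\!\int_{\mathbb{R}^N} v\cdot\phi(x)\,\xi'(t)\,dx\,dt-\int_0^T\!\int_{\mathbb{R}^N} v\otimes v:\nabla\phi(x)\,\xi(t)\,dx\,dt=\int_0^T\!\int_{\mathbb{R}^N} p\,\operatorname{div}\phi(x)\,\xi(t)\,dx\,dt+\nu\int_0^T\!\int_{\mathbb{R}^N} v\cdot\Delta\phi(x)\,\xi(t)\,dx\,dt+\int_0^T\!\int_{\mathbb{R}^N}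 f\cdot\phi(x)\,\xi(t)\,dx\,dt$$ for all $\xi\in C^1_0(0,T)$ and $\phi\in[C_0^\infty(\mathbb{R}^N)]^N$ (subscript $0$ denotes compact support). *)

theory Defs
  imports "HOL-Analysis.Analysis"
begin

definition partial_deriv :: "'n \<Rightarrow> (real ^ 'n \<Rightarrow> 'b::real_normed_vector) \<Rightarrow> real ^ 'n \<Rightarrow> 'b" where
  "partial_deriv i g x = frechet_derivative g (at x) (axis i 1)"

definition gradient :: "(real ^ 'n \<Rightarrow> real) \<Rightarrow> real ^ 'n \<Rightarrow> real ^ 'n" where
  "gradient g x = (\<chi> i. partial_deriv i g x)"

text \<open>
  Entry \<open>(i, j)\<close> is the \<open>j\<close>-th partial derivative of the \<open>i\<close>-th component.  The transposed
  convention gives the same weak formulation, the matrix being contracted with the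
  symmetric \<open>v \<otimes> v\<close> only.
\<close>
definition vector_gradient :: "(real ^ 'n \<Rightarrow> real ^ 'n) \<Rightarrow> real ^ 'n \<Rightarrow> real ^ 'n ^ 'n" where
  "vector_gradient \<phi> x = (\<chi> i j. partial_deriv j (\<lambda>y. \<phi> y $ i) x)"

definition divergence :: "(real ^ 'n \<Rightarrow> real ^ 'n) \<Rightarrow> real ^ 'n \<Rightarrow> real" where
  "divergence \<phi> x = (\<Sum>i\<in>UNIV. partial_deriv i (\<lambda>y. \<phi> y $ i) x)"

definition laplacian :: "(real ^ 'n \<Rightarrow> 'b::real_normed_vector) \<Rightarrow> real ^ 'n \<Rightarrow> 'b" where
  "laplacian g x = (\<Sum>i\<in>UNIV. partial_deriv i (partial_deriv i g) x)"

definition outer_product :: "real ^ 'n \<Rightarrow> real ^ 'n \<Rightarrow> real ^ 'n ^ 'n" where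
  "outer_product a b = (\<chi> i j. a $ i * b $ j)"

definition contraction :: "real ^ 'n ^ 'n \<Rightarrow> real ^ 'n ^ 'n \<Rightarrow> real" where
  "contraction A B = (\<Sum>i\<in>UNIV. \<Sum>j\<in>UNIV. A $ i $ j * B $ i $ j)"

primrec k_times_differentiable ::
    "nat \<Rightarrow> ('a::real_normed_vector \<Rightarrow> 'b::real_normed_vector) \<Rightarrow> bool" where
  "k_times_differentiable 0 g \<longleftrightarrow> continuous_on UNIV g"
| "k_times_differentiable (Suc k) g \<longleftrightarrow> (\<forall>x. g differentiable (at x)) \<and>
     (\<forall>d. k_times_differentiable k (\<lambda>x. frechet_derivative g (at x) d))"

definition smooth :: "('a::real_normed_vector \<Rightarrow> 'b::real_normed_vector) \<Rightarrow> bool" where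
  "smooth g \<longleftrightarrow> (\<forall>k. k_times_differentiable k g)"

definition compact_support_in :: "'a::metric_space set \<Rightarrow> ('a \<Rightarrow> 'b::zero) \<Rightarrow> bool" where
  "compact_support_in S g \<longleftrightarrow>
     compact (closure {x \<in> S. g x \<noteq> 0}) \<and> closure {x \<in> S. g x \<noteq> 0} \<subseteq> S"

definition space_test_functions :: "(real ^ 'n \<Rightarrow> 'b::real_normed_vector) set" where
  "space_test_functions = {\<phi>. smooth \<phi> \<and> compact_support_in UNIV \<phi>}"

text \<open>Only the values on \<open>(0, T)\<close> of a member of this set are constrained.\<close>
definition time_test_functions :: "real \<Rightarrow> (real \<Rightarrow> real) set" where
  "time_test_functions T =
     {\<xi>. \<xi> C1_differentiable_on {0<..<T} \<and> compact_support_in {0<..<T} \<xi>}"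

definition Lq_space :: "real \<Rightarrow> 'a::euclidean_space set \<Rightarrow> ('a \<Rightarrow> 'b::euclidean_space) set" where
  "Lq_space q S = {u. u \<in> borel_measurable (lebesgue_on S) \<and>
     integrable (lebesgue_on S) (\<lambda>x. norm (u x) powr q)}"

definition Lq_norm :: "real \<Rightarrow> 'a::euclidean_space set \<Rightarrow> ('a \<Rightarrow> 'b::euclidean_space) \<Rightarrow> real" where
  "Lq_norm q S u = (LINT x|lebesgue_on S. norm (u x) powr q) powr (1 / q)"

definition Lq_loc :: "real \<Rightarrow> ('a::euclidean_space \<Rightarrow> 'b::euclidean_space) set" where
  "Lq_loc q = {u. \<forall>K. compact K \<longrightarrow> u \<in> Lq_space q K}"

definition Lq_loc_seminorms :: "real \<Rightarrow> (('a::euclidean_space \<Rightarrow> 'b::euclidean_space) \<Rightarrow> real) set" where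
  "Lq_loc_seminorms q = {Lq_norm q K |K. compact K}"

definition weakly_divergence_free :: "(real ^ 'n \<Rightarrow> real ^ 'n) \<Rightarrow> bool" where
  "weakly_divergence_free u \<longleftrightarrow>
     (\<forall>\<psi>\<in>space_test_functions. (LINT x|lebesgue. u x \<bullet> gradient \<psi> x) = 0)"

definition Lq_loc_sigma :: "real \<Rightarrow> (real ^ 'n \<Rightarrow> real ^ 'n) set" where
  "Lq_loc_sigma q = {u \<in> Lq_loc q. weakly_divergence_free u}"

text \<open>
  \<open>time_Lr r T X P\<close> is \<open>L\<^sup>r(0, T; X)\<close> for a function space \<open>X\<close> whose topology is generated by
  the set \<open>P\<close> of seminorms (one norm, or the norms over compact sets for the local spaces).
  Its elements are represented by functions of \<open>(x, t)\<close> that are jointly Lebesgue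
  measurable.
\<close>
definition time_Lr :: "real \<Rightarrow> real \<Rightarrow> ('a::euclidean_space \<Rightarrow> 'b::euclidean_space) set \<Rightarrow>
    (('a \<Rightarrow> 'b) \<Rightarrow> real) set \<Rightarrow> ('a \<Rightarrow> real \<Rightarrow> 'b) set" where
  "time_Lr r T X P = {u.
     (\<lambda>(x, t). u x t) \<in> borel_measurable (lebesgue_on (UNIV \<times> {0<..<T})) \<and>
     (AE t in lebesgue_on {0<..<T}. (\<lambda>x. u x t) \<in> X) \<and>
     (\<forall>N\<in>P. integrable (lebesgue_on {0<..<T}) (\<lambda>t. N (\<lambda>x. u x t) powr r))}"

definition space_time_integral :: "real \<Rightarrow> (real ^ 'n \<Rightarrow> real \<Rightarrow> real) \<Rightarrow> real" where
  "space_time_integral T g = (LINT t|lebesgue_on {0<..<T}. (LINT x|lebesgue. g x t))"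

definition weak_solution_NS :: "real \<Rightarrow> real \<Rightarrow> (real ^ 'n \<Rightarrow> real \<Rightarrow> real ^ 'n) \<Rightarrow>
    (real ^ 'n \<Rightarrow> real \<Rightarrow> real ^ 'n) \<Rightarrow> (real ^ 'n \<Rightarrow> real \<Rightarrow> real) \<Rightarrow> bool" where
  "weak_solution_NS \<nu> T f v p \<longleftrightarrow>
     f \<in> time_Lr 1 T (Lq_loc_sigma 1) (Lq_loc_seminorms 1) \<and>
     v \<in> time_Lr 2 T (Lq_loc_sigma 2) (Lq_loc_seminorms 2) \<and>
     p \<in> time_Lr 1 T (Lq_loc 1) (Lq_loc_seminorms 1) \<and>
     (\<forall>\<xi>\<in>time_test_functions T. \<forall>\<phi>\<in>space_test_functions.
        - space_time_integral T (\<lambda>x t. (v x t \<bullet> \<phi> x) * deriv \<xi> t)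
        - space_time_integral T
            (\<lambda>x t. contraction (outer_product (v x t) (v x t)) (vector_gradient \<phi> x) * \<xi> t)
        = space_time_integral T (\<lambda>x t. p x t * divergence \<phi> x * \<xi> t)
          + \<nu> * space_time_integral T (\<lambda>x t. (v x t \<bullet> laplacian \<phi> x) * \<xi> t)
          + space_time_integral T (\<lambda>x t. (f x t \<bullet> \<phi> x) * \<xi> t))"

definition decay_A :: "real \<Rightarrow> (real ^ 'n \<Rightarrow> real \<Rightarrow> real ^ 'n) \<Rightarrow> (real ^ 'n \<Rightarrow> real \<Rightarrow> real) \<Rightarrow> bool" where
  "decay_A T v p \<longleftrightarrow>
     (\<integral>\<^sup>+ t. (\<integral>\<^sup>+ x. ennreal (((norm (v x t))\<^sup>2 + \<bar>p x t\<bar>) / (1 + norm x)) \<partial>lebesgue)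
        \<partial>lebesgue_on {0<..<T}) < \<infinity>"

text \<open>
  For fixed \<open>t\<close> the pressure is an almost-everywhere class, so its limit at infinity is the
  essential one: for every \<open>\<epsilon> > 0\<close> there is \<open>R\<close> with \<open>\<bar>p x t\<bar> < \<epsilon>\<close> for almost every \<open>x\<close> with
  \<open>norm x \<ge> R\<close>.  The pointwise limit of a representative is a special case.
\<close>
definition decay_B :: "real \<Rightarrow> (real ^ 'n \<Rightarrow> real \<Rightarrow> real ^ 'n) \<Rightarrow> (real ^ 'n \<Rightarrow> real \<Rightarrow> real) \<Rightarrow> bool" where
  "decay_B T v p \<longleftrightarrow>
     (AE t in lebesgue_on {0<..<T}.
        ((\<lambda>x. p x t) \<longlongrightarrow> 0) (inf at_infinity (ae_filter lebesgue))) \<and>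
     (\<exists>q. 2 < q \<and> q < 2 * real CARD('n) / (real CARD('n) - 1) \<and>
        v \<in> time_Lr 2 T (Lq_space q UNIV) {Lq_norm q UNIV})"

end

theory Submission
  imports Defs "HOL-Real_Asymp.Real_Asymp" "HOL-Computational_Algebra.Polynomial"
begin

text \<open>
  Fix a time. Testing the equation with a gradient field \<open>V = \<nabla>\<Psi>\<close> of compact support removes
  everything that is linear in the velocity and in the force: \<open>v\<close> and \<open>f\<close> are divergence free, and
  \<open>\<Delta>V\<close> is again a gradient, so the time derivative, the viscous term and the force all vanish. What
  remains is, for almost every time, a stationary identity between velocity and pressure,
  \<open>\<integral> v \<otimes> v : \<nabla>V + p div V = 0\<close>, in which the viscosity no longer occurs.

  Now let \<open>\<Psi>\<close> be radial about the origin with radial derivative \<open>W(r) = \<integral>\<^sub>0\<^sup>r w\<close>, and write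
  \<open>e = x / r\<close>. Then \<open>V = W e\<close>, \<open>\<nabla>V = w e \<otimes> e + (W / r) (I - e \<otimes> e)\<close> and
  \<open>div V = w + (N - 1) W / r\<close>. The pressure term is the one that the hypothesis declares nonnegative.
  The velocity term is \<open>w (v \<bullet> e)\<^sup>2 + (W / r) (\<bar>v\<bar>\<^sup>2 - (v \<bullet> e)\<^sup>2)\<close>, also nonnegative because \<open>w\<close> and
  \<open>W\<close> are positive. Both integrals are therefore zero, and so is \<open>v\<close>. This is the lemma
  \<open>velocity_vanishes\<close>.

  The field \<open>V\<close> is neither smooth nor compactly supported, so the identity has to be extended to it.
  Rotational symmetry reduces this to one variable. Smooth functions of \<open>\<bar>x - y\<bar>\<^sup>2\<close> are pushed to
  \<open>\<Psi> = (a - \<bar>x - y\<bar>\<^sup>2)\<^sub>+\<^sup>2 / 2\<close>, which yields an identity on every ball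
  (\<open>radial_identity_of_smooth\<close>); the balls generate all Borel profiles (\<open>integral_profile\<close>), and
  \<open>\<nabla>V\<close> is a limit of these with \<open>\<bar>\<nabla>V\<bar>\<close> bounded by a multiple of \<open>1 / (1 + \<bar>x\<bar>)\<close>
  (\<open>weighted_identity\<close>). The limit needs \<open>(\<bar>v\<bar>\<^sup>2 + \<bar>p\<bar>) / (1 + \<bar>x\<bar>)\<close> to be integrable. In case (A)
  this is the hypothesis at almost every time.

  In case (B) only \<open>\<bar>v\<bar>\<^sup>2 \<in> L\<^sup>s\<close> with \<open>s = q / 2 < N / (N - 1)\<close> and \<open>p \<rightarrow> 0\<close> are known. Hoelder's inequality
  handles the velocity, since \<open>1 / (1 + \<bar>x\<bar>)\<close> lies in the dual space \<open>L\<^sup>s\<^sup>'\<close>, as \<open>s' > N\<close>. For the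
  pressure one would quote the \<open>L\<^sup>s\<close> boundedness of Riesz transforms; the heat flow gives the needed
  estimate directly. Gaussian profiles in the stationary identity give
  \<open>\<Delta> P\<^sub>t p = - \<Sum> \<partial>\<^sub>i \<partial>\<^sub>j P\<^sub>t (v\<^sub>i v\<^sub>j)\<close> for the heat semigroup \<open>P\<^sub>t\<close> (\<open>heat_identity\<close>). Hence for a
  continuous compactly supported \<open>g\<close> the pairing \<open>\<integral> g P\<^sub>2\<^sub>t p\<close> changes with \<open>t\<close> at the rate
  \<open>2 \<Sum> \<integral> \<partial>\<^sub>i P\<^sub>t (v\<^sub>i v\<^sub>j) \<partial>\<^sub>j P\<^sub>t g\<close>. It tends to \<open>0\<close> as \<open>t \<rightarrow> \<infinity>\<close> because \<open>p\<close> vanishes at infinity, and to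
  \<open>\<integral> g p\<close> as \<open>t \<rightarrow> 0\<close>. The space-time integral of such products is bounded by a bilinear embedding
  theorem (\<open>bilinear_embedding\<close>), proved with an explicit Bellman function, uniformly in all
  \<open>\<bar>g\<bar> \<le> 1 / (1 + \<bar>x\<bar>)\<close>. Letting \<open>g\<close> approximate \<open>sgn p / (1 + \<bar>x\<bar>)\<close> shows that \<open>p / (1 + \<bar>x\<bar>)\<close> is
  integrable.
\<close>

section \<open>Integration over Euclidean space\<close>

lemma nn_integral_lborel_affine:
  fixes f :: "'a::euclidean_space \<Rightarrow> ennreal"
  assumes [measurable]: "f \<in> borel_measurable borel" and c: "c \<noteq> 0"
  shows "(\<integral>\<^sup>+x. f x \<partial>lborel) = ennreal (\<bar>c\<bar> ^ DIM('a)) * (\<integral>\<^sup>+x. f (t + c *\<^sub>R x) \<partial>lborel)"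
  by (subst lborel_affine[OF c, of t]) (simp add: nn_integral_density nn_integral_distr nn_integral_cmult)

lemma lborel_integrable_affine:
  fixes f :: "'a::euclidean_space \<Rightarrow> real"
  assumes f: "integrable lborel f" and c: "c \<noteq> 0"
  shows "integrable lborel (\<lambda>x. f (t + c *\<^sub>R x))"
proof -
  have [measurable]: "f \<in> borel_measurable borel" using f by auto
  have "ennreal (\<bar>c\<bar> ^ DIM('a)) * (\<integral>\<^sup>+x. ennreal (norm (f (t + c *\<^sub>R x))) \<partial>lborel) < \<infinity>"
    using f nn_integral_lborel_affine[of "\<lambda>x. ennreal (norm (f x))" c t] c
    unfolding integrable_iff_bounded by auto
  moreover have "ennreal (\<bar>c\<bar> ^ DIM('a)) \<noteq> 0" using c by auto
  ultimately have "(\<integral>\<^sup>+x. ennreal (norm (f (t + c *\<^sub>R x))) \<partial>lborel) < \<infinity>"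
    by (auto simp: ennreal_mult_less_top)
  then show ?thesis unfolding integrable_iff_bounded by auto
qed

lemma lborel_integral_affine:
  fixes f :: "'a::euclidean_space \<Rightarrow> real"
  assumes [measurable]: "f \<in> borel_measurable borel" and c: "c \<noteq> 0"
  shows "(\<integral>x. f x \<partial>lborel) = \<bar>c\<bar> ^ DIM('a) * (\<integral>x. f (t + c *\<^sub>R x) \<partial>lborel)"
  by (subst lborel_affine[OF c, of t]) (simp add: integral_density integral_distr)

lemma lborel_integrable_translate:
  fixes f :: "'a::euclidean_space \<Rightarrow> real"
  shows "integrable lborel f \<Longrightarrow> integrable lborel (\<lambda>x. f (x + t))"
  using lborel_integrable_affine[of f 1 t] by (simp add: add.commute)

lemma lborel_integral_translate:
  fixes f :: "'a::euclidean_space \<Rightarrow> real"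
  shows "f \<in> borel_measurable borel \<Longrightarrow> (\<integral>x. f (x + t) \<partial>lborel) = (\<integral>x. f x \<partial>lborel)"
  using lborel_integral_affine[of f 1 t] by (simp add: add.commute)

lemma nn_integral_power_decay_line:
  assumes "1 < (q::real)"
  shows "(\<integral>\<^sup>+x. ennreal ((1 + \<bar>x\<bar>) powr - q) \<partial>lborel) < \<infinity>"
proof -
  have lim: "((\<lambda>x::real. - ((1 + x) powr (1 - q)) / (q - 1)) \<longlongrightarrow> 0) at_top"
    using assms by real_asymp
  have half: "(\<integral>\<^sup>+x. ennreal ((1 + x) powr - q) * indicator {0..} x \<partial>lborel) = ennreal (1 / (q - 1))"
    (is "?h = _")
  proof -
    have "((\<lambda>x. - ((1 + x) powr (1 - q)) / (q - 1)) has_real_derivative (1 + x) powr - q) (at x)"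
      if "0 \<le> x" for x :: real
      using that assms by (auto intro!: derivative_eq_intros simp: divide_simps) (simp add: powr_diff powr_minus field_simps)
    then show ?thesis
      using nn_integral_FTC_atLeast[where a=0 and f="\<lambda>x. (1 + x) powr - q", OF _ _ _ lim] by auto
  qed
  have "(\<integral>\<^sup>+x. ennreal ((1 + \<bar>x\<bar>) powr - q) \<partial>lborel)
      \<le> (\<integral>\<^sup>+x. ennreal ((1 + x) powr - q) * indicator {0..} x
          + ennreal ((1 + (0 + (-1) * x)) powr - q) * indicator {0..} (0 + (-1) * x) \<partial>lborel)"
    by (rule nn_integral_mono) (auto split: split_indicator)
  also have "\<dots> = ?h + (\<integral>\<^sup>+x. ennreal ((1 + (0 + (-1) * x)) powr - q) * indicator {0..} (0 + (-1) * x) \<partial>lborel)"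
    by (rule nn_integral_add) auto
  also have "(\<integral>\<^sup>+x. ennreal ((1 + (0 + (-1) * x)) powr - q) * indicator {0..} (0 + (-1) * x) \<partial>lborel) = ?h"
    using nn_integral_real_affine[of "\<lambda>x. ennreal ((1 + x) powr - q) * indicator {0..} x" "-1" 0] by simp
  also have "?h + ?h < \<infinity>" unfolding half by simp
  finally show ?thesis .
qed

text \<open>
  The norm dominates every coordinate, so the integrand is bounded by a product of functions of one
  variable, each with exponent above \<open>1\<close>. This is where the condition \<open>s' > N\<close> on the dual exponent
  enters.
\<close>

lemma integrable_power_decay:
  assumes r: "real DIM('a) < r"
  shows "integrable lborel (\<lambda>x::'a::euclidean_space. (1 + norm x) powr - r)"
proof -
  let ?n = "real DIM('a)"
  have n: "0 < ?n" by simp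
  have le: "(1 + norm x) powr - r \<le> (\<Prod>b\<in>Basis. (1 + \<bar>x \<bullet> b\<bar>) powr - (r / ?n))" for x :: 'a
  proof -
    have "(1 + norm x) powr - r = (\<Prod>b\<in>(Basis::'a set). (1 + norm x) powr - (r / ?n))"
    proof -
      have "0 < 1 + norm x" by (simp add: add_pos_nonneg)
      then have "((1 + norm x) powr - (r / ?n)) ^ DIM('a) = ((1 + norm x) powr - (r / ?n)) powr ?n"
        by (subst powr_realpow) auto
      then show ?thesis using n by (simp add: powr_powr)
    qed
    also have "\<dots> \<le> (\<Prod>b\<in>Basis. (1 + \<bar>x \<bullet> b\<bar>) powr - (r / ?n))"
    proof (rule prod_mono, intro conjI)
      fix b :: 'a assume "b \<in> Basis"
      then have "\<bar>x \<bullet> b\<bar> \<le> norm x" by (rule Basis_le_norm)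
      then show "(1 + norm x) powr - (r / ?n) \<le> (1 + \<bar>x \<bullet> b\<bar>) powr - (r / ?n)"
        using r n by (intro powr_mono2') auto
    qed auto
    finally show ?thesis .
  qed
  have "1 < r / ?n" using r n by (simp add: field_simps)
  note line = nn_integral_power_decay_line[OF this]
  have "(\<integral>\<^sup>+x. ennreal (norm ((1 + norm x) powr - r)) \<partial>(lborel :: 'a measure))
      \<le> (\<integral>\<^sup>+x. (\<Prod>b\<in>Basis. ennreal ((1 + \<bar>x \<bullet> b\<bar>) powr - (r / ?n))) \<partial>(lborel :: 'a measure))"
    by (rule nn_integral_mono) (use le in \<open>auto simp: prod_ennreal intro!: ennreal_leI\<close>)
  also have "\<dots> = (\<Prod>b\<in>(Basis::'a set). (\<integral>\<^sup>+x. ennreal ((1 + \<bar>x\<bar>) powr - (r / ?n)) \<partial>lborel))"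
    by (rule nn_integral_lborel_prod) auto
  also have "\<dots> < \<infinity>"
    using line by (simp add: power_less_top_ennreal)
  finally show ?thesis unfolding integrable_iff_bounded by auto
qed

lemma power_exp_le_gaussian:
  fixes u d k :: real
  assumes "0 < d"
  shows "exp (k * u) \<le> exp (k\<^sup>2 / (4 * d)) * exp (d * u\<^sup>2)"
proof -
  have "0 \<le> (2 * d * u - k)\<^sup>2" by simp
  then have "k * u \<le> k\<^sup>2 / (4 * d) + d * u\<^sup>2"
    using assms by (simp add: field_simps power2_eq_square)
  then show ?thesis by (simp add: exp_add[symmetric])
qed

lemma integrable_gaussian:
  assumes d: "0 < d"
  shows "integrable lborel (\<lambda>x::'a::euclidean_space. exp (- d * (norm x)\<^sup>2))"
proof -
  define r where "r = real DIM('a) + 1"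
  have le: "exp (- d * (norm x)\<^sup>2) \<le> exp (r\<^sup>2 / (4 * d)) * (1 + norm x) powr - r" for x :: 'a
  proof -
    have "(1 + norm x) powr r \<le> exp (norm x) powr r"
      unfolding r_def by (intro powr_mono2) auto
    also have "\<dots> = exp (r * norm x)" by (simp add: powr_def)
    also have "\<dots> \<le> exp (r\<^sup>2 / (4 * d)) * exp (d * (norm x)\<^sup>2)"
      by (rule power_exp_le_gaussian[OF d])
    finally have "(1 + norm x) powr r \<le> exp (r\<^sup>2 / (4 * d)) * exp (d * (norm x)\<^sup>2)" .
    moreover have "1 + norm x > 0" by (simp add: add_pos_nonneg)
    ultimately show ?thesis
      by (simp add: powr_minus exp_minus field_simps)
  qed
  show ?thesis
  proof (rule Bochner_Integration.integrable_bound)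
    show "integrable lborel (\<lambda>x::'a. exp (r\<^sup>2 / (4 * d)) * (1 + norm x) powr - r)"
      by (intro integrable_mult_right integrable_power_decay) (simp add: r_def)
    show "AE x::'a in lborel. norm (exp (- d * (norm x)\<^sup>2)) \<le> norm (exp (r\<^sup>2 / (4 * d)) * (1 + norm x) powr - r)"
      using le by (auto simp: abs_mult)
  qed auto
qed

text \<open>
  Lets one Gaussian dominate all kernels centred near a point, as differentiation under the integral
  and continuity in the centre require.
\<close>

lemma gaussian_shift_bound:
  fixes x x' y :: "'a::euclidean_space"
  assumes "0 \<le> d"
  shows "exp (- d * (norm (x' - y))\<^sup>2) \<le> exp (d * (norm (x' - x))\<^sup>2) * exp (- (d / 2) * (norm (x - y))\<^sup>2)"
proof -
  have "norm (x - y) \<le> norm (x' - x) + norm (x' - y)"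
    using norm_triangle_ineq4[of "x' - y" "x' - x"] by simp
  then have "(norm (x - y))\<^sup>2 \<le> (norm (x' - x) + norm (x' - y))\<^sup>2"
    by (intro power_mono) auto
  also have "\<dots> \<le> 2 * (norm (x' - x))\<^sup>2 + 2 * (norm (x' - y))\<^sup>2"
    using sum_squares_bound[of "norm (x' - x)" "norm (x' - y)"] by (simp add: power2_sum)
  finally have "d * (norm (x - y))\<^sup>2 \<le> d * (2 * (norm (x' - x))\<^sup>2 + 2 * (norm (x' - y))\<^sup>2)"
    using assms by (intro mult_left_mono)
  then show ?thesis by (simp add: exp_add[symmetric] algebra_simps)
qed

text \<open>
  Translation invariance makes the integral of every difference quotient of \<open>A\<close> zero; the bound on
  \<open>A'\<close> along segments of length \<open>1\<close> permits the passage to the limit.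
\<close>

lemma integral_directional_derivative_eq_0:
  fixes A A' D :: "'a::euclidean_space \<Rightarrow> real"
  assumes A: "integrable lborel A"
    and deriv: "\<And>x. ((\<lambda>h. A (x + h *\<^sub>R e)) has_real_derivative A' x) (at 0)"
    and D: "integrable lborel D"
    and bound: "\<And>x h. 0 \<le> h \<Longrightarrow> h \<le> 1 \<Longrightarrow> \<bar>A' (x + h *\<^sub>R e)\<bar> \<le> D x"
  shows "integrable lborel A'" and "(\<integral>x. A' x \<partial>lborel) = 0"
proof -
  have [measurable]: "A \<in> borel_measurable borel" "D \<in> borel_measurable borel" using A D by auto
  define s where "s n x = (A (x + (1 / real (Suc n)) *\<^sub>R e) - A x) * real (Suc n)" for n x
  have deriv_at: "((\<lambda>h. A (x + h *\<^sub>R e)) has_real_derivative A' (x + h *\<^sub>R e)) (at h)" for x h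
    using deriv[of "x + h *\<^sub>R e"] DERIV_shift[of "\<lambda>h. A (x + h *\<^sub>R e)" _ 0 h]
    by (simp add: scaleR_left_distrib add_ac)
  have lim: "(\<lambda>n. s n x) \<longlonglongrightarrow> A' x" for x
  proof -
    have "((\<lambda>h. (A (x + h *\<^sub>R e) - A x) / h) \<longlongrightarrow> A' x) (at 0)"
      using deriv[of x] by (simp add: DERIV_def)
    moreover have "filterlim (\<lambda>n. 1 / real (Suc n)) (at 0) sequentially"
      unfolding filterlim_at using LIMSEQ_inverse_real_of_nat by (auto simp: divide_inverse)
    ultimately have "(\<lambda>n. (A (x + (1 / real (Suc n)) *\<^sub>R e) - A x) / (1 / real (Suc n))) \<longlonglongrightarrow> A' x"
      by (rule filterlim_compose)
    then show ?thesis by (simp add: s_def)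
  qed
  have sD: "\<bar>s n x\<bar> \<le> D x" for n x
  proof -
    let ?h = "1 / real (Suc n)"
    obtain z where z: "0 < z" "z < ?h" "A (x + ?h *\<^sub>R e) - A (x + 0 *\<^sub>R e) = (?h - 0) * A' (x + z *\<^sub>R e)"
      using MVT2[of 0 ?h "\<lambda>h. A (x + h *\<^sub>R e)" "\<lambda>h. A' (x + h *\<^sub>R e)"] deriv_at by auto
    have "?h \<le> 1" by simp
    then have "z \<le> 1" using z by linarith
    moreover have "s n x = A' (x + z *\<^sub>R e)" using z(3) by (simp add: s_def)
    ultimately show ?thesis using bound[of z x] z by simp
  qed
  have meas: "s n \<in> borel_measurable lborel" for n unfolding s_def by measurable
  have A'm: "A' \<in> borel_measurable lborel"
    by (rule borel_measurable_LIMSEQ_real[of _ s]) (use lim meas in auto)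
  show "integrable lborel A'"
    by (rule integrable_dominated_convergence[where s=s and w=D]) (use A'm meas D lim sD in auto)
  have "(\<lambda>n. \<integral>x. s n x \<partial>lborel) \<longlonglongrightarrow> (\<integral>x. A' x \<partial>lborel)"
    by (rule integral_dominated_convergence[where s=s and w=D]) (use A'm meas D lim sD in auto)
  moreover have "(\<integral>x. s n x \<partial>lborel) = 0" for n
    unfolding s_def using A
    by (simp add: lborel_integrable_translate lborel_integral_translate)
  ultimately show "(\<integral>x. A' x \<partial>lborel) = 0"
    using LIMSEQ_unique by (metis (no_types, lifting) tendsto_const ext)
qed

lemma has_real_derivative_integral:
  fixes K K' :: "real \<Rightarrow> 'a \<Rightarrow> real"
  assumes d: "0 < d"
    and K: "\<And>s. integrable M (K s)"
    and deriv: "\<And>s y. \<bar>s - t\<bar> < d \<Longrightarrow> ((\<lambda>s. K s y) has_real_derivative K' s y) (at s)"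
    and D: "integrable M D"
    and bound: "\<And>s y. \<bar>s - t\<bar> < d \<Longrightarrow> \<bar>K' s y\<bar> \<le> D y"
  shows "((\<lambda>s. \<integral>y. K s y \<partial>M) has_real_derivative (\<integral>y. K' t y \<partial>M)) (at t)"
  unfolding DERIV_def
proof (subst tendsto_at_iff_sequentially, intro allI impI)
  fix X :: "nat \<Rightarrow> real"
  assume X: "\<forall>i. X i \<in> UNIV - {0}" "X \<longlonglongrightarrow> 0"
  obtain n0 where n0: "\<And>n. n \<ge> n0 \<Longrightarrow> \<bar>X n\<bar> < d"
    using LIMSEQ_D[OF X(2) d] by auto
  define s where "s n y = (K (t + X (n + n0)) y - K t y) / X (n + n0)" for n y
  have lim: "(\<lambda>n. s n y) \<longlonglongrightarrow> K' t y" for y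
  proof -
    have "((\<lambda>h. (K (t + h) y - K t y) / h) \<longlongrightarrow> K' t y) (at 0)"
      using deriv[of t y] d by (simp add: DERIV_def)
    then have "((\<lambda>h. (K (t + h) y - K t y) / h) \<circ> X) \<longlonglongrightarrow> K' t y"
      using X by (subst (asm) tendsto_at_iff_sequentially) auto
    from LIMSEQ_ignore_initial_segment[OF this, of n0] show ?thesis
      by (simp add: s_def o_def)
  qed
  have sD: "\<bar>s n y\<bar> \<le> D y" for n y
  proof -
    define h where "h = X (n + n0)"
    have h: "\<bar>h\<bar> < d" "h \<noteq> 0" using n0[of "n + n0"] X(1) by (auto simp: h_def)
    obtain z where z: "\<bar>z - t\<bar> < d" "K (t + h) y - K t y = h * K' z y"
    proof (cases "h > 0")
      case True
      then obtain z where "t < z" "z < t + h" "K (t + h) y - K t y = (t + h - t) * K' z y"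
        using MVT2[of t "t + h" "\<lambda>s. K s y" "\<lambda>s. K' s y"] deriv h by force
      with h True show ?thesis by (intro that[of z]) auto
    next
      case False
      then obtain z where "t + h < z" "z < t" "K t y - K (t + h) y = (t - (t + h)) * K' z y"
        using MVT2[of "t + h" t "\<lambda>s. K s y" "\<lambda>s. K' s y"] deriv h by force
      with h False show ?thesis by (intro that[of z]) auto
    qed
    then have "s n y = K' z y" using h by (simp add: s_def h_def[symmetric])
    then show ?thesis using bound[OF z(1)] by simp
  qed
  have meas: "s n \<in> borel_measurable M" for n unfolding s_def
    using K[THEN borel_measurable_integrable] by measurable
  have K'm: "K' t \<in> borel_measurable M"
    by (rule borel_measurable_LIMSEQ_real[of _ s]) (use lim meas in auto)
  have "(\<lambda>n. \<integral>y. s n y \<partial>M) \<longlonglongrightarrow> (\<integral>y. K' t y \<partial>M)"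
    by (rule integral_dominated_convergence[where s=s and w=D]) (use K'm meas D lim sD in auto)
  moreover have "(\<integral>y. s n y \<partial>M) = ((\<integral>y. K (t + X (n + n0)) y \<partial>M) - (\<integral>y. K t y \<partial>M)) / X (n + n0)" for n
    unfolding s_def using K by simp
  ultimately have "(\<lambda>n. ((\<integral>y. K (t + X (n + n0)) y \<partial>M) - (\<integral>y. K t y \<partial>M)) / X (n + n0)) \<longlonglongrightarrow> (\<integral>y. K' t y \<partial>M)"
    by simp
  then show "((\<lambda>h. ((\<integral>y. K (t + h) y \<partial>M) - (\<integral>y. K t y \<partial>M)) / h) \<circ> X) \<longlonglongrightarrow> (\<integral>y. K' t y \<partial>M)"
    unfolding o_def by (rule LIMSEQ_offset[where k=n0])
qed

section \<open>The heat kernel\<close>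

text \<open>
  The normalising integral equals \<open>(4\<pi>)\<^sup>N\<^sup>/\<^sup>2\<close>; as written it makes the total mass \<open>1\<close> by scaling
  alone.
\<close>

definition heat :: "real \<Rightarrow> 'a::euclidean_space \<Rightarrow> real" where
  "heat t z = t powr (- (real DIM('a) / 2)) * exp (- (norm z)\<^sup>2 / (4 * t))
     / (\<integral>x. exp (- (norm (x :: 'a))\<^sup>2 / 4) \<partial>lborel)"

text \<open>
  First and second spatial derivatives of the kernel in closed form. The coordinate factors stand to
  the left of the kernel so that the closure properties of \<open>gaussian_kernel\<close> apply to them directly.
\<close>

definition heat_d :: "'a::euclidean_space \<Rightarrow> real \<Rightarrow> 'a \<Rightarrow> real" where
  "heat_d i t z = - (1 / (2 * t)) * ((z \<bullet> i) * heat t z)"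

definition heat_dd :: "'a::euclidean_space \<Rightarrow> 'a \<Rightarrow> real \<Rightarrow> 'a \<Rightarrow> real" where
  "heat_dd i j t z = 1 / (4 * t\<^sup>2) * ((z \<bullet> i) * ((z \<bullet> j) * heat t z)) - (i \<bullet> j) / (2 * t) * heat t z"

text \<open>
  Kernels with Gaussian decay, locally uniformly in time: the class that contains the heat kernel and
  its derivatives and over which all differentiations of convolutions are justified at once.
\<close>

definition gaussian_kernel :: "(real \<Rightarrow> 'a::euclidean_space \<Rightarrow> real) \<Rightarrow> bool" where
  "gaussian_kernel \<kappa> \<longleftrightarrow> continuous_on ({0<..} \<times> UNIV) (\<lambda>(t, z). \<kappa> t z) \<and>
     (\<forall>a b. 0 < a \<longrightarrow> a \<le> b \<longrightarrow>
       (\<exists>M d. 0 < M \<and> 0 < d \<and> (\<forall>t\<in>{a..b}. \<forall>z. \<bar>\<kappa> t z\<bar> \<le> M * exp (- d * (norm z)\<^sup>2))))"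

text \<open>
  Functions in \<open>L\<^sup>1 + L\<^sup>\<infinity>\<close>. Both the products \<open>v\<^sub>i v\<^sub>j\<close> in \<open>L\<^sup>s\<close> and a pressure that is locally integrable
  and vanishes at infinity are of this kind.
\<close>

definition tame :: "('a::euclidean_space \<Rightarrow> real) \<Rightarrow> bool" where
  "tame f \<longleftrightarrow> f \<in> borel_measurable borel \<and> (\<exists>D. integrable lborel D \<and> (\<forall>x. \<bar>f x\<bar> \<le> D x + 1))"

definition conv :: "(real \<Rightarrow> 'a::euclidean_space \<Rightarrow> real) \<Rightarrow> ('a \<Rightarrow> real) \<Rightarrow> 'a \<Rightarrow> real \<Rightarrow> real" where
  "conv \<kappa> f x t = (\<integral>y. \<kappa> t (x - y) * f y \<partial>lborel)"

lemma integral_pos_of_pos: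
  fixes f :: "'a::euclidean_space \<Rightarrow> real"
  assumes f: "integrable lborel f" and pos: "\<And>x. 0 < f x"
  shows "0 < (\<integral>x. f x \<partial>lborel)"
proof -
  have "(\<integral>x. f x \<partial>lborel) \<noteq> 0"
  proof
    assume "(\<integral>x. f x \<partial>lborel) = 0"
    then have "AE x in lborel. f x = 0"
      using integral_nonneg_eq_0_iff_AE[OF f] pos by (auto simp: less_imp_le)
    then have "AE x in (lborel :: 'a measure). False"
      by eventually_elim (use pos in \<open>simp add: less_le\<close>)
    then have "emeasure (lborel :: 'a measure) UNIV = 0"
      by (simp add: AE_iff_measurable[of UNIV] )
    then show False by (simp add: emeasure_lborel_UNIV)
  qed
  moreover have "0 \<le> (\<integral>x. f x \<partial>lborel)" using pos by (intro Bochner_Integration.integral_nonneg) (auto simp: less_imp_le)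
  ultimately show ?thesis by linarith
qed

lemma gaussian_mass_pos: "0 < (\<integral>x. exp (- (norm (x :: 'a::euclidean_space))\<^sup>2 / 4) \<partial>lborel)"
  using integrable_gaussian[of "1/4", where 'a='a]
  by (intro integral_pos_of_pos) auto

lemma heat_pos: "0 < t \<Longrightarrow> 0 < heat t z"
  unfolding heat_def using gaussian_mass_pos[where 'a='a] by simp

lemma gaussian_kernelD_cont: "gaussian_kernel \<kappa> \<Longrightarrow> continuous_on ({0<..} \<times> UNIV) (\<lambda>(t, z). \<kappa> t z)"
  by (simp add: gaussian_kernel_def)

lemma gaussian_kernelE:
  assumes "gaussian_kernel \<kappa>" "0 < a" "a \<le> b"
  obtains M d where "0 < M" "0 < d" "\<And>t z. a \<le> t \<Longrightarrow> t \<le> b \<Longrightarrow> \<bar>\<kappa> t z\<bar> \<le> M * exp (- d * (norm z)\<^sup>2)"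
  using assms unfolding gaussian_kernel_def by (metis atLeastAtMost_iff)

lemma gaussian_kernel_heat: "gaussian_kernel (heat :: real \<Rightarrow> 'a::euclidean_space \<Rightarrow> real)"
  unfolding gaussian_kernel_def
proof (intro conjI allI impI)
  show "continuous_on ({0<..} \<times> UNIV) (\<lambda>(t, z::'a). heat t z)"
    unfolding heat_def case_prod_unfold using gaussian_mass_pos[where 'a='a]
    by (auto intro!: continuous_intros)
  fix a b :: real assume ab: "0 < a" "a \<le> b"
  define c where "c = (\<integral>x. exp (- (norm (x :: 'a))\<^sup>2 / 4) \<partial>lborel)"
  have c: "0 < c" unfolding c_def by (rule gaussian_mass_pos)
  show "\<exists>M d. 0 < M \<and> 0 < d \<and> (\<forall>t\<in>{a..b}. \<forall>z::'a. \<bar>heat t z\<bar> \<le> M * exp (- d * (norm z)\<^sup>2))"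
  proof (intro exI conjI ballI allI)
    show "0 < a powr (- (real DIM('a) / 2)) / c" using c ab by simp
    show "0 < 1 / (4 * b)" using ab by simp
    fix t and z :: 'a assume t: "t \<in> {a..b}"
    have "t powr (- (real DIM('a) / 2)) \<le> a powr (- (real DIM('a) / 2))"
      using t ab by (intro powr_mono2') auto
    moreover have "(norm z)\<^sup>2 / (4 * b) \<le> (norm z)\<^sup>2 / (4 * t)"
      using t ab by (intro divide_left_mono) auto
    ultimately have "t powr (- (real DIM('a) / 2)) * exp (- (norm z)\<^sup>2 / (4 * t))
        \<le> a powr (- (real DIM('a) / 2)) * exp (- (1 / (4 * b)) * (norm z)\<^sup>2)"
      by (intro mult_mono) auto
    then show "\<bar>heat t z\<bar> \<le> a powr (- (real DIM('a) / 2)) / c * exp (- (1 / (4 * b)) * (norm z)\<^sup>2)"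
      using c unfolding heat_def c_def[symmetric] by (simp add: abs_mult divide_right_mono)
  qed
qed

lemma gaussian_kernel_coord:
  assumes \<kappa>: "gaussian_kernel \<kappa>" and i: "i \<in> Basis"
  shows "gaussian_kernel (\<lambda>t z. (z \<bullet> i) * \<kappa> t z)"
  unfolding gaussian_kernel_def
proof (intro conjI allI impI)
  show "continuous_on ({0<..} \<times> UNIV) (\<lambda>(t, z). (z \<bullet> i) * \<kappa> t z)"
    using gaussian_kernelD_cont[OF \<kappa>] unfolding case_prod_unfold
    by (intro continuous_intros)
  fix a b :: real assume ab: "0 < a" "a \<le> b"
  obtain M d where M: "0 < M" "0 < d" "\<And>t z. a \<le> t \<Longrightarrow> t \<le> b \<Longrightarrow> \<bar>\<kappa> t z\<bar> \<le> M * exp (- d * (norm z)\<^sup>2)"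
    using gaussian_kernelE[OF \<kappa> ab] by blast
  show "\<exists>M d. 0 < M \<and> 0 < d \<and> (\<forall>t\<in>{a..b}. \<forall>z. \<bar>(z \<bullet> i) * \<kappa> t z\<bar> \<le> M * exp (- d * (norm z)\<^sup>2))"
  proof (intro exI conjI ballI allI)
    show "0 < exp (1\<^sup>2 / (4 * (d / 2))) * M" "0 < d / 2" using M by auto
    fix t z assume t: "t \<in> {a..b}"
    have "\<bar>z \<bullet> i\<bar> \<le> norm z" using i by (rule Basis_le_norm)
    also have "\<dots> \<le> exp (1 * norm z)" unfolding mult_1 using exp_ge_add_one_self[of "norm z"] by linarith
    also have "\<dots> \<le> exp (1\<^sup>2 / (4 * (d / 2))) * exp (d / 2 * (norm z)\<^sup>2)"
      using M by (intro power_exp_le_gaussian) auto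
    finally have "\<bar>z \<bullet> i\<bar> * \<bar>\<kappa> t z\<bar> \<le> (exp (1\<^sup>2 / (4 * (d / 2))) * exp (d / 2 * (norm z)\<^sup>2)) * (M * exp (- d * (norm z)\<^sup>2))"
      using M(3)[of t z] t by (intro mult_mono) auto
    also have "\<dots> = exp (1\<^sup>2 / (4 * (d / 2))) * M * exp (- (d / 2) * (norm z)\<^sup>2)"
    proof -
      have "exp (d / 2 * (norm z)\<^sup>2) * exp (- d * (norm z)\<^sup>2) = exp (- (d / 2) * (norm z)\<^sup>2)"
        by (simp add: exp_add[symmetric] field_simps)
      moreover have "(E * p) * (M * q) = E * M * (p * q)" for E p q :: real
        by simp
      ultimately show ?thesis by simp
    qed
    finally show "\<bar>(z \<bullet> i) * \<kappa> t z\<bar> \<le> exp (1\<^sup>2 / (4 * (d / 2))) * M * exp (- (d / 2) * (norm z)\<^sup>2)"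
      by (simp add: abs_mult)
  qed
qed

lemma gaussian_kernel_scale:
  fixes \<kappa> :: "real \<Rightarrow> 'a::euclidean_space \<Rightarrow> real"
  assumes \<kappa>: "gaussian_kernel \<kappa>" and c: "continuous_on {0<..} c"
  shows "gaussian_kernel (\<lambda>t z. c t * \<kappa> t z)"
  unfolding gaussian_kernel_def
proof (intro conjI allI impI)
  have "continuous_on ({0<..} \<times> (UNIV :: 'a set)) (\<lambda>x. c (fst x))"
    by (rule continuous_on_compose2[OF c]) (auto intro!: continuous_intros)
  then show "continuous_on ({0<..} \<times> UNIV) (\<lambda>(t, z). c t * \<kappa> t z)"
    using gaussian_kernelD_cont[OF \<kappa>] unfolding case_prod_unfold
    by (intro continuous_intros)
  fix a b :: real assume ab: "0 < a" "a \<le> b"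
  obtain M d where M: "0 < M" "0 < d" "\<And>t z. a \<le> t \<Longrightarrow> t \<le> b \<Longrightarrow> \<bar>\<kappa> t z\<bar> \<le> M * exp (- d * (norm z)\<^sup>2)"
    using gaussian_kernelE[OF \<kappa> ab] by blast
  have "compact (c ` {a..b})"
    using ab by (intro compact_continuous_image continuous_on_subset[OF c]) auto
  then obtain B where B: "0 < B" "\<And>t. t \<in> {a..b} \<Longrightarrow> \<bar>c t\<bar> \<le> B"
    unfolding bounded_pos by (metis bounded_pos compact_imp_bounded image_eqI real_norm_def)
  show "\<exists>M d. 0 < M \<and> 0 < d \<and> (\<forall>t\<in>{a..b}. \<forall>z. \<bar>c t * \<kappa> t z\<bar> \<le> M * exp (- d * (norm z)\<^sup>2))"
  proof (intro exI conjI ballI allI)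
    show "0 < B * M" "0 < d" using B M by auto
    fix t z assume t: "t \<in> {a..b}"
    have "\<bar>c t\<bar> * \<bar>\<kappa> t z\<bar> \<le> B * (M * exp (- d * (norm z)\<^sup>2))"
      using M(3)[of t z] t B(1) B(2)[of t] by (intro mult_mono) auto
    then show "\<bar>c t * \<kappa> t z\<bar> \<le> B * M * exp (- d * (norm z)\<^sup>2)" by (simp add: abs_mult mult.assoc)
  qed
qed

lemma gaussian_kernel_diff:
  fixes \<kappa> \<kappa>' :: "real \<Rightarrow> 'a::euclidean_space \<Rightarrow> real"
  assumes \<kappa>: "gaussian_kernel \<kappa>" and \<kappa>': "gaussian_kernel \<kappa>'"
  shows "gaussian_kernel (\<lambda>t z. \<kappa> t z - \<kappa>' t z)"
  unfolding gaussian_kernel_def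
proof (intro conjI allI impI)
  show "continuous_on ({0<..} \<times> UNIV) (\<lambda>(t, z). \<kappa> t z - \<kappa>' t z)"
    using gaussian_kernelD_cont[OF \<kappa>] gaussian_kernelD_cont[OF \<kappa>'] unfolding case_prod_unfold
    by (intro continuous_intros)
  fix a b :: real assume ab: "0 < a" "a \<le> b"
  obtain M d where M: "0 < M" "0 < d" "\<And>t z. a \<le> t \<Longrightarrow> t \<le> b \<Longrightarrow> \<bar>\<kappa> t z\<bar> \<le> M * exp (- d * (norm z)\<^sup>2)"
    using gaussian_kernelE[OF \<kappa> ab] by blast
  obtain M' d' where M': "0 < M'" "0 < d'" "\<And>t z. a \<le> t \<Longrightarrow> t \<le> b \<Longrightarrow> \<bar>\<kappa>' t z\<bar> \<le> M' * exp (- d' * (norm z)\<^sup>2)"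
    using gaussian_kernelE[OF \<kappa>' ab] by blast
  show "\<exists>M d. 0 < M \<and> 0 < d \<and> (\<forall>t\<in>{a..b}. \<forall>z. \<bar>\<kappa> t z - \<kappa>' t z\<bar> \<le> M * exp (- d * (norm z)\<^sup>2))"
  proof (intro exI conjI ballI allI)
    show "0 < M + M'" "0 < min d d'" using M M' by auto
    fix t and z :: 'a assume t: "t \<in> {a..b}"
    have "exp (- d * (norm z)\<^sup>2) \<le> exp (- min d d' * (norm z)\<^sup>2)" "exp (- d' * (norm z)\<^sup>2) \<le> exp (- min d d' * (norm z)\<^sup>2)"
      by (auto intro!: mult_right_mono)
    then have "M * exp (- d * (norm z)\<^sup>2) + M' * exp (- d' * (norm z)\<^sup>2) \<le> M * exp (- min d d' * (norm z)\<^sup>2) + M' * exp (- min d d' * (norm z)\<^sup>2)"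
      using M M' by (intro add_mono mult_left_mono) auto
    then show "\<bar>\<kappa> t z - \<kappa>' t z\<bar> \<le> (M + M') * exp (- min d d' * (norm z)\<^sup>2)"
      using M(3)[of t z] M'(3)[of t z] t abs_triangle_ineq4[of "\<kappa> t z" "\<kappa>' t z"]
      unfolding distrib_right atLeastAtMost_iff by linarith
  qed
qed

lemma gaussian_kernel_heat_d: "i \<in> Basis \<Longrightarrow> gaussian_kernel (heat_d i)"
  unfolding heat_d_def[abs_def]
  by (intro gaussian_kernel_scale gaussian_kernel_coord gaussian_kernel_heat) (auto intro!: continuous_intros)

lemma gaussian_kernel_heat_dd: "i \<in> Basis \<Longrightarrow> j \<in> Basis \<Longrightarrow> gaussian_kernel (heat_dd i j)"
  unfolding heat_dd_def[abs_def]
  by (intro gaussian_kernel_diff gaussian_kernel_scale gaussian_kernel_coord gaussian_kernel_heat)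
     (auto intro!: continuous_intros)

lemma gaussian_kernel_continuous:
  assumes "gaussian_kernel \<kappa>" "0 < t"
  shows "continuous_on UNIV (\<kappa> t)"
proof -
  have "continuous_on UNIV (\<lambda>z. (\<lambda>(t, z). \<kappa> t z) (t, z))"
    by (rule continuous_on_compose2[OF gaussian_kernelD_cont[OF assms(1)]])
       (use assms in \<open>auto intro!: continuous_intros\<close>)
  then show ?thesis by simp
qed

lemma gaussian_kernel_measurable: "gaussian_kernel \<kappa> \<Longrightarrow> 0 < t \<Longrightarrow> \<kappa> t \<in> borel_measurable borel"
  by (intro borel_measurable_continuous_onI gaussian_kernel_continuous)

lemma gaussian_kernel_integrable: 
  assumes "gaussian_kernel \<kappa>" "0 < t" shows "integrable lborel (\<kappa> t)"
proof -
  obtain M d where M: "0 < M" "0 < d" "\<And>s z. t \<le> s \<Longrightarrow> s \<le> t \<Longrightarrow> \<bar>\<kappa> s z\<bar> \<le> M * exp (- d * (norm z)\<^sup>2)"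
    using gaussian_kernelE[OF assms(1,2)] by blast
  show ?thesis
    by (rule Bochner_Integration.integrable_bound[where f="\<lambda>z. M * exp (- d * (norm z)\<^sup>2)"])
       (use M integrable_gaussian[OF M(2)] gaussian_kernel_measurable[OF assms] in \<open>auto simp: abs_mult\<close>)
qed

lemma tame_integrable_gaussian:
  assumes f: "tame f" and d: "0 < d"
  shows "integrable lborel (\<lambda>y. exp (- d * (norm (x - y))\<^sup>2) * f y)"
proof -
  obtain D where D: "integrable lborel D" "\<And>x. \<bar>f x\<bar> \<le> D x + 1" and [measurable]: "f \<in> borel_measurable borel"
    using f unfolding tame_def by auto
  have [measurable]: "D \<in> borel_measurable borel" using D by auto
  have "integrable lborel (\<lambda>y. exp (- d * (norm (x + (-1) *\<^sub>R y))\<^sup>2))"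
    by (rule lborel_integrable_affine[OF integrable_gaussian[OF d]]) simp
  then have g: "integrable lborel (\<lambda>y. exp (- d * (norm (x - y))\<^sup>2))" by simp
  show ?thesis
  proof (rule Bochner_Integration.integrable_bound)
    show "integrable lborel (\<lambda>y. \<bar>D y\<bar> + exp (- d * (norm (x - y))\<^sup>2))"
      using D g by auto
    show "AE y in lborel. norm (exp (- d * (norm (x - y))\<^sup>2) * f y) \<le> norm (\<bar>D y\<bar> + exp (- d * (norm (x - y))\<^sup>2))"
    proof (rule AE_I2)
      fix y
      have "exp (- d * (norm (x - y))\<^sup>2) * \<bar>f y\<bar> \<le> exp (- d * (norm (x - y))\<^sup>2) * (\<bar>D y\<bar> + 1)"
        using D(2)[of y] by (intro mult_left_mono) auto
      also have "\<dots> \<le> \<bar>D y\<bar> + exp (- d * (norm (x - y))\<^sup>2)"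
        using d mult_right_mono[of "exp (- d * (norm (x - y))\<^sup>2)" 1 "\<bar>D y\<bar>"] by (simp add: algebra_simps)
      finally show "norm (exp (- d * (norm (x - y))\<^sup>2) * f y) \<le> norm (\<bar>D y\<bar> + exp (- d * (norm (x - y))\<^sup>2))"
        by (simp add: abs_mult)
    qed
  qed auto
qed

text \<open>
  A majorant that does not depend on the time in a compact interval nor on the centre in a unit ball;
  every limit under a convolution integral below uses it.
\<close>

lemma gaussian_kernel_dominated:
  assumes \<kappa>: "gaussian_kernel \<kappa>" and f: "tame f" and ab: "0 < a" "a \<le> b"
  obtains D where "integrable lborel D"
    and "\<And>t x' y. a \<le> t \<Longrightarrow> t \<le> b \<Longrightarrow> norm (x' - x) \<le> 1 \<Longrightarrow> \<bar>\<kappa> t (x' - y) * f y\<bar> \<le> D y"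
proof -
  obtain M d where M: "0 < M" "0 < d" "\<And>t z. a \<le> t \<Longrightarrow> t \<le> b \<Longrightarrow> \<bar>\<kappa> t z\<bar> \<le> M * exp (- d * (norm z)\<^sup>2)"
    using gaussian_kernelE[OF \<kappa> ab] by blast
  define D where "D y = M * exp d * \<bar>exp (- (d / 2) * (norm (x - y))\<^sup>2) * f y\<bar>" for y
  have "integrable lborel D" unfolding D_def
    using tame_integrable_gaussian[OF f, of "d/2" x] M by auto
  moreover have "\<bar>\<kappa> t (x' - y) * f y\<bar> \<le> D y" if t: "a \<le> t" "t \<le> b" and x': "norm (x' - x) \<le> 1" for t x' y
  proof -
    have "exp (- d * (norm (x' - y))\<^sup>2) \<le> exp (d * (norm (x' - x))\<^sup>2) * exp (- (d / 2) * (norm (x - y))\<^sup>2)"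
      using M by (intro gaussian_shift_bound) auto
    also have "\<dots> \<le> exp d * exp (- (d / 2) * (norm (x - y))\<^sup>2)"
      using M x' by (intro mult_right_mono) (auto simp: power_le_one)
    finally have "\<bar>\<kappa> t (x' - y)\<bar> \<le> M * (exp d * exp (- (d / 2) * (norm (x - y))\<^sup>2))"
      using M(1) M(3)[OF t, of "x' - y"] by (meson mult_left_mono less_imp_le order_trans)
    then have "\<bar>\<kappa> t (x' - y)\<bar> * \<bar>f y\<bar> \<le> M * (exp d * exp (- (d / 2) * (norm (x - y))\<^sup>2)) * \<bar>f y\<bar>"
      by (rule mult_right_mono) auto
    then show ?thesis unfolding D_def by (simp add: abs_mult mult.assoc)
  qed
  ultimately show ?thesis using that by blast
qed

lemma conv_integrable:
  assumes \<kappa>: "gaussian_kernel \<kappa>" and f: "tame f" and t: "0 < t"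
  shows "integrable lborel (\<lambda>y. \<kappa> t (x - y) * f y)"
proof -
  have [measurable]: "f \<in> borel_measurable borel" "\<kappa> t \<in> borel_measurable borel"
    using f gaussian_kernel_measurable[OF \<kappa> t] by (auto simp: tame_def)
  obtain D where D: "integrable lborel D" "\<And>s x' y. t \<le> s \<Longrightarrow> s \<le> t \<Longrightarrow> norm (x' - x) \<le> 1 \<Longrightarrow> \<bar>\<kappa> s (x' - y) * f y\<bar> \<le> D y"
    using gaussian_kernel_dominated[OF \<kappa> f t order_refl, of x] by metis
  show ?thesis
    by (rule Bochner_Integration.integrable_bound[OF D(1)])
       (use D(2)[of t x] in \<open>auto intro!: AE_I2 order_trans[OF _ abs_ge_self]\<close>)
qed

lemma conv_continuous:
  assumes \<kappa>: "gaussian_kernel \<kappa>" and f: "tame f"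
  shows "continuous_on (UNIV \<times> {0<..}) (\<lambda>(x, t). conv \<kappa> f x t)"
  unfolding continuous_on_sequentially
proof (intro allI ballI impI, elim conjE)
  fix u :: "nat \<Rightarrow> 'a \<times> real" and p
  assume p: "p \<in> UNIV \<times> {0<..}" and u: "\<forall>n. u n \<in> UNIV \<times> {0<..}" and lim: "u \<longlonglongrightarrow> p"
  define x t where "x = fst p" and "t = snd p"
  have t: "0 < t" using p by (auto simp: t_def)
  have limx: "(\<lambda>n. fst (u n)) \<longlonglongrightarrow> x" and limt: "(\<lambda>n. snd (u n)) \<longlonglongrightarrow> t"
    unfolding x_def t_def using lim by (auto intro: tendsto_fst tendsto_snd)
  have [measurable]: "f \<in> borel_measurable borel" using f by (auto simp: tame_def)
  have [measurable]: "\<kappa> (snd (u n)) \<in> borel_measurable borel" for n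
    using u by (intro gaussian_kernel_measurable[OF \<kappa>]) (auto simp: mem_Times_iff)
  have [measurable]: "\<kappa> t \<in> borel_measurable borel" by (intro gaussian_kernel_measurable[OF \<kappa>] t)
  have half: "0 < t / 2" "t / 2 \<le> 2 * t" using t by auto
  obtain D where D: "integrable lborel D"
    "\<And>s x' y. t / 2 \<le> s \<Longrightarrow> s \<le> 2 * t \<Longrightarrow> norm (x' - x) \<le> 1 \<Longrightarrow> \<bar>\<kappa> s (x' - y) * f y\<bar> \<le> D y"
    using gaussian_kernel_dominated[OF \<kappa> f, of "t / 2" "2 * t" x] half by metis
  obtain n1 where n1: "\<And>n. n \<ge> n1 \<Longrightarrow> norm (fst (u n) - x) < 1" using LIMSEQ_D[OF limx, of 1] by auto
  obtain n2 where n2: "\<And>n. n \<ge> n2 \<Longrightarrow> norm (snd (u n) - t) < t / 2" using LIMSEQ_D[OF limt, of "t/2"] t by auto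
  define m where "m = max n1 n2"
  define s where "s n y = \<kappa> (snd (u (n + m))) (fst (u (n + m)) - y) * f y" for n y
  have "(\<lambda>n. \<integral>y. s n y \<partial>lborel) \<longlonglongrightarrow> (\<integral>y. \<kappa> t (x - y) * f y \<partial>lborel)"
  proof (rule integral_dominated_convergence[where w=D])
    show "AE y in lborel. norm (s n y) \<le> D y" for n
    proof (rule AE_I2)
      fix y
      have "norm (fst (u (n + m)) - x) < 1" "\<bar>snd (u (n + m)) - t\<bar> < t / 2"
        using n1[of "n+m"] n2[of "n+m"] by (auto simp: m_def)
      then show "norm (s n y) \<le> D y"
        unfolding s_def real_norm_def by (intro D(2)) (auto simp: abs_if split: if_splits)
    qed
    show "AE y in lborel. (\<lambda>n. s n y) \<longlonglongrightarrow> \<kappa> t (x - y) * f y"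
    proof (rule AE_I2)
      fix y
      have "(\<lambda>n. (snd (u n), fst (u n) - y)) \<longlonglongrightarrow> (t, x - y)"
        by (intro tendsto_intros limx limt)
      then have "((\<lambda>(t, z). \<kappa> t z) \<circ> (\<lambda>n. (snd (u n), fst (u n) - y))) \<longlonglongrightarrow> (\<lambda>(t, z). \<kappa> t z) (t, x - y)"
        using gaussian_kernelD_cont[OF \<kappa>] u t unfolding continuous_on_sequentially by (auto simp: mem_Times_iff)
      then have "(\<lambda>n. \<kappa> (snd (u n)) (fst (u n) - y) * f y) \<longlonglongrightarrow> \<kappa> t (x - y) * f y"
        by (intro tendsto_intros) (auto simp: o_def)
      from LIMSEQ_ignore_initial_segment[OF this, of m] show "(\<lambda>n. s n y) \<longlonglongrightarrow> \<kappa> t (x - y) * f y"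
        by (simp add: s_def)
    qed
    show "(\<lambda>y. \<kappa> t (x - y) * f y) \<in> borel_measurable lborel" by measurable
    show "s n \<in> borel_measurable lborel" for n unfolding s_def by measurable
  qed (use D in auto)
  then show "((\<lambda>(x, t). conv \<kappa> f x t) \<circ> u) \<longlonglongrightarrow> (\<lambda>(x, t). conv \<kappa> f x t) p"
    unfolding s_def conv_def x_def t_def case_prod_unfold o_def
    by (rule LIMSEQ_offset)
qed

lemma conv_has_derivative_space:
  assumes \<kappa>: "gaussian_kernel \<kappa>" and \<kappa>': "gaussian_kernel \<kappa>'" and f: "tame f" and t: "0 < t"
    and e: "norm e \<le> 1"
    and deriv: "\<And>z. ((\<lambda>h. \<kappa> t (z + h *\<^sub>R e)) has_real_derivative \<kappa>' t z) (at 0)"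
  shows "((\<lambda>h. conv \<kappa> f (x + h *\<^sub>R e) t) has_real_derivative conv \<kappa>' f x t) (at 0)"
proof -
  obtain D where D: "integrable lborel D" "\<And>s x' y. t \<le> s \<Longrightarrow> s \<le> t \<Longrightarrow> norm (x' - x) \<le> 1 \<Longrightarrow> \<bar>\<kappa>' s (x' - y) * f y\<bar> \<le> D y"
    using gaussian_kernel_dominated[OF \<kappa>' f t order_refl, of x] by metis
  have "((\<lambda>h. \<integral>y. \<kappa> t (x + h *\<^sub>R e - y) * f y \<partial>lborel) has_real_derivative (\<integral>y. \<kappa>' t (x + 0 *\<^sub>R e - y) * f y \<partial>lborel)) (at 0)"
  proof (rule has_real_derivative_integral[where d=1 and D=D])
    show "integrable lborel (\<lambda>y. \<kappa> t (x + h *\<^sub>R e - y) * f y)" for h by (rule conv_integrable[OF \<kappa> f t])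
    show "((\<lambda>h. \<kappa> t (x + h *\<^sub>R e - y) * f y) has_real_derivative \<kappa>' t (x + h *\<^sub>R e - y) * f y) (at h)" for h y
    proof -
      have "((\<lambda>k. \<kappa> t (x - y + (k + h) *\<^sub>R e)) has_real_derivative \<kappa>' t (x + h *\<^sub>R e - y)) (at 0)"
        using deriv[of "x + h *\<^sub>R e - y"] by (simp add: algebra_simps)
      then have "((\<lambda>k. \<kappa> t (x - y + k *\<^sub>R e)) has_real_derivative \<kappa>' t (x + h *\<^sub>R e - y)) (at h)"
        using DERIV_shift[of "\<lambda>k. \<kappa> t (x - y + k *\<^sub>R e)" _ 0 h] by simp
      then show ?thesis by (intro DERIV_cmult_right) (simp add: algebra_simps)
    qed
    show "\<bar>\<kappa>' t (x + h *\<^sub>R e - y) * f y\<bar> \<le> D y" if "\<bar>h - 0\<bar> < 1" for h y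
      using that e by (intro D(2)) (auto intro!: mult_le_one)
  qed (use D in auto)
  then show ?thesis by (simp add: conv_def)
qed

lemma conv_has_derivative_time:
  assumes \<kappa>: "gaussian_kernel \<kappa>" and \<kappa>': "gaussian_kernel \<kappa>'" and f: "tame f" and t: "0 < t"
    and deriv: "\<And>t z. 0 < t \<Longrightarrow> ((\<lambda>t. \<kappa> t z) has_real_derivative \<kappa>' t z) (at t)"
  shows "((\<lambda>t. conv \<kappa> f x t) has_real_derivative conv \<kappa>' f x t) (at t)"
proof -
  have half: "0 < t / 2" "t / 2 \<le> 2 * t" using t by auto
  obtain D where D: "integrable lborel D" "\<And>s x' y. t / 2 \<le> s \<Longrightarrow> s \<le> 2 * t \<Longrightarrow> norm (x' - x) \<le> 1 \<Longrightarrow> \<bar>\<kappa>' s (x' - y) * f y\<bar> \<le> D y"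
    using gaussian_kernel_dominated[OF \<kappa>' f, of "t / 2" "2 * t" x] half by metis
  define K where "K s y = (if 0 < s then \<kappa> s (x - y) * f y else 0)" for s y
  have "((\<lambda>s. \<integral>y. K s y \<partial>lborel) has_real_derivative (\<integral>y. \<kappa>' t (x - y) * f y \<partial>lborel)) (at t)"
  proof (rule has_real_derivative_integral[where d="t / 2" and D=D])
    show "integrable lborel (K s)" for s using conv_integrable[OF \<kappa> f, of s x] by (cases "0 < s") (auto simp: K_def[abs_def])
    fix s y assume s: "\<bar>s - t\<bar> < t / 2"
    then have s': "0 < s" "t / 2 \<le> s" "s \<le> 2 * t" by (auto simp: abs_if split: if_splits)
    have "((\<lambda>s. \<kappa> s (x - y) * f y) has_real_derivative \<kappa>' s (x - y) * f y) (at s)"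
      using deriv[OF s'(1)] by (rule DERIV_cmult_right)
    then show "((\<lambda>s. K s y) has_real_derivative \<kappa>' s (x - y) * f y) (at s)"
      by (rule has_field_derivative_transform_within_open[where S="{0<..}"]) (use s' in \<open>auto simp: K_def\<close>)
    show "\<bar>\<kappa>' s (x - y) * f y\<bar> \<le> D y" using s' by (intro D(2)) auto
  qed (use D t in auto)
  then have "((\<lambda>s. \<integral>y. K s y \<partial>lborel) has_real_derivative conv \<kappa>' f x t) (at t)" by (simp add: conv_def)
  then show ?thesis
    by (rule has_field_derivative_transform_within_open[where S="{0<..}"]) (use t in \<open>auto simp: K_def conv_def\<close>)
qed

lemma norm_sq_line:
  fixes z :: "'a::euclidean_space"
  assumes "i \<in> Basis"
  shows "(norm (z + h *\<^sub>R i))\<^sup>2 = (norm z)\<^sup>2 + 2 * h * (z \<bullet> i) + h\<^sup>2"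
  unfolding power2_norm_eq_inner using assms
  by (simp add: inner_simps inner_commute power2_eq_square algebra_simps)

lemma heat_has_derivative_space:
  fixes z :: "'a::euclidean_space"
  assumes t: "0 < t" and i: "i \<in> Basis"
  shows "((\<lambda>h. heat t (z + h *\<^sub>R i)) has_real_derivative heat_d i t z) (at 0)"
proof -
  note nrm = norm_sq_line[OF i]
  show ?thesis unfolding heat_def heat_d_def nrm using t gaussian_mass_pos[where 'a='a]
    by (auto intro!: derivative_eq_intros simp: field_simps)
qed

lemma heat_d_has_derivative_space:
  assumes t: "0 < t" and i: "i \<in> Basis" and j: "j \<in> Basis"
  shows "((\<lambda>h. heat_d i t (z + h *\<^sub>R j)) has_real_derivative heat_dd i j t z) (at 0)"
proof -
  have "((\<lambda>h. (z \<bullet> i + h * (j \<bullet> i)) * heat t (z + h *\<^sub>R j)) has_real_derivative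
      (j \<bullet> i) * heat t z + (z \<bullet> i) * heat_d j t z) (at 0)"
    by (auto intro!: derivative_eq_intros heat_has_derivative_space[OF t j])
  from DERIV_cmult[OF this, of "- (1 / (2 * t))"]
  have "((\<lambda>h. heat_d i t (z + h *\<^sub>R j)) has_real_derivative
      - (1 / (2 * t)) * ((j \<bullet> i) * heat t z + (z \<bullet> i) * heat_d j t z)) (at 0)"
    by (simp add: heat_d_def inner_simps)
  also have "- (1 / (2 * t)) * ((j \<bullet> i) * heat t z + (z \<bullet> i) * heat_d j t z) = heat_dd i j t z"
    using t by (simp add: heat_d_def heat_dd_def inner_commute field_simps power2_eq_square)
  finally show ?thesis .
qed

lemma sum_Basis_inner_sq: "(\<Sum>i\<in>Basis. (z \<bullet> i) * (z \<bullet> i)) = (norm z)\<^sup>2"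
  by (subst power2_norm_eq_inner, subst (3) euclidean_inner) simp

lemma heat_has_derivative_time:
  fixes z :: "'a::euclidean_space"
  assumes t: "0 < t"
  shows "((\<lambda>t. heat t z) has_real_derivative (\<Sum>i\<in>Basis. heat_dd i i t z)) (at t)"
proof -
  define c where "c = (\<integral>x. exp (- (norm (x :: 'a))\<^sup>2 / 4) \<partial>lborel)"
  have c: "c \<noteq> 0" unfolding c_def using gaussian_mass_pos[where 'a='a] by simp
  have "(\<Sum>i\<in>Basis. heat_dd i i t z) = (\<Sum>i\<in>Basis. heat t z / (4 * t\<^sup>2) * ((z \<bullet> i) * (z \<bullet> i)) - heat t z / (2 * t))"
    unfolding heat_dd_def by (intro sum.cong) auto
  also have "\<dots> = heat t z / (4 * t\<^sup>2) * (norm z)\<^sup>2 - real DIM('a) * (heat t z / (2 * t))"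
    by (simp only: sum_subtractf sum_distrib_left[symmetric] sum_Basis_inner_sq) simp
  finally have eq: "(\<Sum>i\<in>Basis. heat_dd i i t z) = ((norm z)\<^sup>2 / (4 * t\<^sup>2) - real DIM('a) / (2 * t)) * heat t z"
    by (simp add: field_simps)
  have "((\<lambda>t. t powr (- (real DIM('a) / 2)) * exp (- (norm z)\<^sup>2 / (4 * t)) / c) has_real_derivative
      ((norm z)\<^sup>2 / (4 * t\<^sup>2) - real DIM('a) / (2 * t)) * (t powr (- (real DIM('a) / 2)) * exp (- (norm z)\<^sup>2 / (4 * t)) / c)) (at t)"
    using t c by (auto intro!: derivative_eq_intros simp: powr_diff)
       (simp add: field_simps power2_eq_square)
  then show ?thesis unfolding eq heat_def c_def .
qed

lemma gaussian_kernel_sum: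
  fixes \<kappa> :: "'b \<Rightarrow> real \<Rightarrow> 'a::euclidean_space \<Rightarrow> real"
  assumes "finite I" "\<And>i. i \<in> I \<Longrightarrow> gaussian_kernel (\<kappa> i)"
  shows "gaussian_kernel (\<lambda>t z. \<Sum>i\<in>I. \<kappa> i t z)"
  using assms
proof (induction I rule: finite_induct)
  case empty
  have "gaussian_kernel (\<lambda>t z. 0 * heat t (z :: 'a))"
    by (intro gaussian_kernel_scale gaussian_kernel_heat continuous_intros)
  then show ?case by simp
next
  case (insert i I)
  have "gaussian_kernel (\<lambda>t z. \<kappa> i t z - (-1) * (\<Sum>i\<in>I. \<kappa> i t z))"
    using insert by (intro gaussian_kernel_diff gaussian_kernel_scale continuous_intros) auto
  then show ?case using insert by simp
qed

section \<open>Heat averages\<close>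

text \<open>
  The substitution \<open>z = \<surd>t x\<close> turns the integral into the normalising constant.
\<close>

lemma integral_heat:
  assumes t: "0 < t"
  shows "(\<integral>z. heat t (z :: 'a::euclidean_space) \<partial>lborel) = 1"
proof -
  define c where "c = (\<integral>x. exp (- (norm (x :: 'a))\<^sup>2 / 4) \<partial>lborel)"
  have c: "c \<noteq> 0" unfolding c_def using gaussian_mass_pos[where 'a='a] by simp
  have "c = \<bar>1 / sqrt t\<bar> ^ DIM('a) * (\<integral>x. exp (- (norm (0 + (1 / sqrt t) *\<^sub>R (x :: 'a)))\<^sup>2 / 4) \<partial>lborel)"
    unfolding c_def by (rule lborel_integral_affine) (use t in auto)
  also have "(\<lambda>x. exp (- (norm (0 + (1 / sqrt t) *\<^sub>R (x :: 'a)))\<^sup>2 / 4)) = (\<lambda>x. exp (- (norm x)\<^sup>2 / (4 * t)))"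
    using t by (simp add: power_mult_distrib power_divide field_simps)
  also have "\<bar>1 / sqrt t\<bar> ^ DIM('a) = t powr (- (real DIM('a) / 2))"
    using t by (simp add: powr_minus powr_realpow[symmetric] powr_half_sqrt[symmetric] powr_powr power_one_over field_simps)
  finally have "t powr (- (real DIM('a) / 2)) * (\<integral>x. exp (- (norm (x::'a))\<^sup>2 / (4 * t)) \<partial>lborel) / c = 1"
    using c by simp
  then show ?thesis unfolding heat_def c_def[symmetric]
    by (simp only: integral_divide_zero integral_mult_right_zero)
qed

lemma heat_symmetric: "heat t (- z) = heat t z" by (simp add: heat_def)

lemma integral_reflect_translate:
  fixes h :: "'a::euclidean_space \<Rightarrow> real"
  assumes "h \<in> borel_measurable borel"
  shows "(\<integral>y. h (x - y) \<partial>lborel) = (\<integral>z. h z \<partial>lborel)"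
  using lborel_integral_affine[OF assms, of "-1" x] by simp

lemma integrable_reflect_translate:
  fixes h :: "'a::euclidean_space \<Rightarrow> real"
  assumes "integrable lborel h"
  shows "integrable lborel (\<lambda>y. h (x - y))"
  using lborel_integrable_affine[OF assms, of "-1" x] by simp

lemma conv_heat_pos:
  assumes t: "0 < t" and f: "tame f" and pos: "\<And>x. 0 < f x"
  shows "0 < conv heat f x t"
  unfolding conv_def
  by (intro integral_pos_of_pos conv_integrable gaussian_kernel_heat f t mult_pos_pos heat_pos pos)

lemma conv_heat_affine:
  assumes t: "0 < t" and f: "tame f"
  shows "(\<integral>y. heat t (x - y) * (a * f y + b) \<partial>lborel) = a * conv heat f x t + b"
    and "integrable lborel (\<lambda>y. heat t (x - y) * (a * f y + b))"
proof -
  have i1: "integrable lborel (\<lambda>y. heat t (x - y) * f y)"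
    by (rule conv_integrable[OF gaussian_kernel_heat f t])
  have i2: "integrable lborel (\<lambda>y. heat t (x - y))"
    by (intro integrable_reflect_translate gaussian_kernel_integrable gaussian_kernel_heat t)
  have eq: "(\<lambda>y. heat t (x - y) * (a * f y + b)) = (\<lambda>y. a * (heat t (x - y) * f y) + b * heat t (x - y))"
    by (auto simp: algebra_simps)
  show "integrable lborel (\<lambda>y. heat t (x - y) * (a * f y + b))" unfolding eq using i1 i2 by auto
  have "(\<integral>y. heat t (x - y) \<partial>lborel) = 1"
    using integral_reflect_translate[OF gaussian_kernel_measurable[OF gaussian_kernel_heat t], of x]
    by (simp add: integral_heat[OF t])
  then show "(\<integral>y. heat t (x - y) * (a * f y + b) \<partial>lborel) = a * conv heat f x t + b"
    unfolding eq conv_def using i1 i2 by simp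
qed

text \<open>
  Jensen's inequality for the concave power, through the tangent line of \<open>u \<mapsto> u\<^sup>\<theta>\<close> at the average. It
  transports the pointwise constraint \<open>\<bar>g\<bar> \<le> f\<^sup>\<theta>\<close> to all later times, which keeps the pair of heat
  extensions in the domain of the Bellman function.
\<close>

lemma conv_heat_jensen_concave:
  assumes t: "0 < t" and th: "0 < th" "th < 1" and f: "tame f" "\<And>x. 0 < f x"
    and g: "tame g" "\<And>x. \<bar>g x\<bar> \<le> f x powr th"
  shows "\<bar>conv heat g x t\<bar> \<le> conv heat f x t powr th"
proof -
  define l where "l = conv heat f x t"
  have l: "0 < l" unfolding l_def by (rule conv_heat_pos[OF t f])
  have tangent: "\<bar>g y\<bar> \<le> th * l powr (th - 1) * f y + (1 - th) * l powr th" for y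
  proof -
    have "f y powr th * l powr (1 - th) \<le> th * f y + (1 - th) * l"
      using th f(2)[of y] l by (intro Youngs_inequality_0) auto
    then have "f y powr th * l powr (1 - th) * l powr (th - 1) \<le> (th * f y + (1 - th) * l) * l powr (th - 1)"
      by (intro mult_right_mono) auto
    moreover have "l powr (1 - th) * l powr (th - 1) = 1" using l by (simp add: powr_add[symmetric])
    moreover have "l * l powr (th - 1) = l powr th" using l by (simp add: powr_diff)
    moreover have "(th * f y + (1 - th) * l) * l powr (th - 1) = th * l powr (th - 1) * f y + (1 - th) * (l * l powr (th - 1))"
      by (simp add: algebra_simps)
    ultimately have "f y powr th \<le> th * l powr (th - 1) * f y + (1 - th) * l powr th"
      by (simp only: mult.assoc mult_1_right)
    then show ?thesis using g(2)[of y] by linarith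
  qed
  have "\<bar>conv heat g x t\<bar> \<le> (\<integral>y. \<bar>heat t (x - y) * g y\<bar> \<partial>lborel)"
    unfolding conv_def by (rule integral_abs_bound)
  also have "\<dots> \<le> (\<integral>y. heat t (x - y) * (th * l powr (th - 1) * f y + (1 - th) * l powr th) \<partial>lborel)"
  proof (intro integral_mono conv_heat_affine t f integrable_abs conv_integrable[OF gaussian_kernel_heat g(1) t])
    fix y
    show "\<bar>heat t (x - y) * g y\<bar> \<le> heat t (x - y) * (th * l powr (th - 1) * f y + (1 - th) * l powr th)"
      using tangent[of y] heat_pos[OF t, of "x - y"] by (auto simp: abs_mult intro!: mult_left_mono)
  qed
  also have "\<dots> = th * l powr (th - 1) * l + (1 - th) * l powr th"
    unfolding conv_heat_affine(1)[OF t f(1)] l_def ..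
  also have "\<dots> = l powr th" using l by (simp add: powr_diff algebra_simps)
  finally show ?thesis unfolding l_def .
qed

text \<open>
  The tangent line of the convex power at the average. It bounds the Bellman functional by the
  \<open>L\<^sup>s\<close> norm of the initial value.
\<close>

lemma conv_heat_jensen_convex:
  assumes t: "0 < t" and s: "1 < s" and f: "tame f" "\<And>x. 0 < f x"
    and fs: "tame (\<lambda>x. f x powr s)"
  shows "conv heat f x t powr s \<le> conv heat (\<lambda>x. f x powr s) x t"
proof -
  define l where "l = conv heat f x t"
  have l: "0 < l" unfolding l_def by (rule conv_heat_pos[OF t f])
  have tangent: "s * l powr (s - 1) * f y + (1 - s) * l powr s \<le> f y powr s" for y
  proof -
    have "(f y powr s) powr (1 / s) * (l powr s) powr (1 - 1 / s) \<le> 1 / s * f y powr s + (1 - 1 / s) * l powr s"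
      using s f(2)[of y] l by (intro Youngs_inequality_0) auto
    also have "(f y powr s) powr (1 / s) * (l powr s) powr (1 - 1 / s) = f y * l powr (s - 1)"
      using s f(2)[of y] by (simp add: powr_powr right_diff_distrib)
    finally have "s * (f y * l powr (s - 1)) \<le> s * (1 / s * f y powr s + (1 - 1 / s) * l powr s)"
      using s by (intro mult_left_mono) auto
    then show ?thesis using s by (simp add: algebra_simps)
  qed
  have "l powr s = s * l powr (s - 1) * l + (1 - s) * l powr s"
    using l by (simp add: powr_diff algebra_simps)
  also have "\<dots> = (\<integral>y. heat t (x - y) * (s * l powr (s - 1) * f y + (1 - s) * l powr s) \<partial>lborel)"
    unfolding conv_heat_affine(1)[OF t f(1)] l_def ..
  also have "\<dots> \<le> conv heat (\<lambda>x. f x powr s) x t"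
    unfolding conv_def using tangent less_imp_le[OF heat_pos[OF t]]
    by (intro integral_mono conv_heat_affine conv_integrable gaussian_kernel_heat t f fs) (auto intro!: mult_left_mono)
  finally show ?thesis unfolding l_def .
qed

lemma conv_measurable:
  assumes \<kappa>: "gaussian_kernel \<kappa>" and f: "tame f" and t: "0 < t"
  shows "(\<lambda>x. conv \<kappa> f x t) \<in> borel_measurable borel"
proof -
  have "continuous_on UNIV (\<lambda>x. (\<lambda>(x, t). conv \<kappa> f x t) (x, t))"
    by (rule continuous_on_compose2[OF conv_continuous[OF \<kappa> f]])
       (use t in \<open>auto intro!: continuous_intros\<close>)
  then show ?thesis by (intro borel_measurable_continuous_onI) simp
qed

lemma conv_heat_mass:
  fixes h :: "'a::euclidean_space \<Rightarrow> real"
  assumes t: "0 < t" and h: "integrable lborel h" and nonneg: "\<And>x. 0 \<le> h x"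
  shows "integrable lborel (\<lambda>x. conv heat h x t)" and "(\<integral>x. conv heat h x t \<partial>lborel) = (\<integral>x. h x \<partial>lborel)"
proof -
  have [measurable]: "h \<in> borel_measurable borel" using h by auto
  have [measurable]: "(heat t :: 'a \<Rightarrow> real) \<in> borel_measurable borel" by (rule gaussian_kernel_measurable[OF gaussian_kernel_heat t])
  have tame: "tame h" unfolding tame_def using h nonneg by (auto intro!: exI[of _ h])
  have nn: "0 \<le> conv heat h x t" for x
    unfolding conv_def
    by (intro Bochner_Integration.integral_nonneg mult_nonneg_nonneg nonneg less_imp_le[OF heat_pos[OF t]])
  have "(\<integral>\<^sup>+x. ennreal (conv heat h x t) \<partial>lborel) = (\<integral>\<^sup>+x. (\<integral>\<^sup>+y. ennreal (heat t (x - y) * h y) \<partial>lborel) \<partial>lborel)"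
    unfolding conv_def
    by (intro nn_integral_cong nn_integral_eq_integral[symmetric] conv_integrable[OF gaussian_kernel_heat tame t])
       (auto intro!: mult_nonneg_nonneg nonneg less_imp_le[OF heat_pos[OF t]])
  also have "\<dots> = (\<integral>\<^sup>+y. (\<integral>\<^sup>+x. ennreal (heat t (x - y) * h y) \<partial>lborel) \<partial>lborel)"
    by (intro lborel_pair.Fubini'[symmetric]) measurable
  also have "\<dots> = (\<integral>\<^sup>+y. ennreal (h y) \<partial>lborel)"
  proof (intro nn_integral_cong)
    fix y :: 'a
    have "integrable lborel (\<lambda>x. heat t (x + (- y)))"
      by (intro lborel_integrable_translate gaussian_kernel_integrable gaussian_kernel_heat t)
    moreover have "(\<integral>x. heat t (x + (- y)) \<partial>lborel) = 1"
      using integral_heat[OF t] by (subst lborel_integral_translate) auto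
    ultimately have "(\<integral>\<^sup>+x. ennreal (heat t (x - y)) \<partial>lborel) = 1"
      using less_imp_le[OF heat_pos[OF t]] by (subst nn_integral_eq_integral) auto
    then show "(\<integral>\<^sup>+x. ennreal (heat t (x - y) * h y) \<partial>lborel) = ennreal (h y)"
      by (simp add: ennreal_mult[OF less_imp_le[OF heat_pos[OF t]] nonneg] nn_integral_multc)
  qed
  also have "\<dots> = ennreal (\<integral>y. h y \<partial>lborel)" using h nonneg by (intro nn_integral_eq_integral) auto
  finally have eq: "(\<integral>\<^sup>+x. ennreal (conv heat h x t) \<partial>lborel) = ennreal (\<integral>y. h y \<partial>lborel)" .
  have m: "(\<lambda>x. conv heat h x t) \<in> borel_measurable lborel"
    using conv_measurable[OF gaussian_kernel_heat tame t] by simp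
  show "integrable lborel (\<lambda>x. conv heat h x t)"
    using eq m nn by (intro integrableI_nonneg) auto
  show "(\<integral>x. conv heat h x t \<partial>lborel) = (\<integral>x. h x \<partial>lborel)"
    using eq m nn nonneg by (subst integral_eq_nn_integral) (auto intro!: Bochner_Integration.integral_nonneg)
qed

section \<open>A smooth cutoff on balls\<close>

lemma max_power_has_derivative:
  "((\<lambda>u::real. (max 0 u) ^ Suc (Suc k)) has_real_derivative real (Suc (Suc k)) * (max 0 u) ^ Suc k) (at u)"
proof (cases u "0::real" rule: linorder_cases)
  case less
  show ?thesis
    by (rule has_field_derivative_transform_within_open[where S="{..<0}" and f="\<lambda>_. 0"]) (use less in auto)
next
  case greater
  have "((\<lambda>u::real. u ^ Suc (Suc k)) has_real_derivative real (Suc (Suc k)) * (max 0 u) ^ Suc k) (at u)"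
    using DERIV_pow[of "Suc (Suc k)" u] greater by (simp add: max_def)
  then show ?thesis
    by (rule has_field_derivative_transform_within_open[where S="{0<..}"]) (use greater in \<open>auto simp: max_def\<close>)
next
  case equal
  have "(\<lambda>h::real. (max 0 h) ^ Suc (Suc k) / h) \<midarrow>0\<rightarrow> 0"
  proof (rule Lim_null_comparison)
    show "\<forall>\<^sub>F h::real in at 0. norm ((max 0 h) ^ Suc (Suc k) / h) \<le> \<bar>h\<bar> ^ Suc k"
      by (rule always_eventually) (auto simp: max_def abs_mult power_abs mult_le_0_iff)
    show "((\<lambda>h::real. \<bar>h\<bar> ^ Suc k) \<longlongrightarrow> 0) (at 0)"
      by (rule tendsto_eq_intros refl tendsto_rabs | simp)+
  qed
  then show ?thesis using equal by (simp add: DERIV_def)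
qed

definition bump :: "real \<Rightarrow> 'a::euclidean_space \<Rightarrow> real" where
  "bump R x = max 0 (1 - (norm x)\<^sup>2 / R\<^sup>2)"

definition bump_d :: "'a::euclidean_space \<Rightarrow> real \<Rightarrow> 'a \<Rightarrow> real" where
  "bump_d i R x = 3 * (bump R x)\<^sup>2 * (- 2 * (x \<bullet> i) / R\<^sup>2)"

definition bump_dd :: "'a::euclidean_space \<Rightarrow> real \<Rightarrow> 'a \<Rightarrow> real" where
  "bump_dd i R x = 6 * bump R x * (2 * (x \<bullet> i) / R\<^sup>2)\<^sup>2 - 6 * (bump R x)\<^sup>2 / R\<^sup>2"

lemma bump_has_derivative:
  assumes R: "0 < R" and i: "i \<in> Basis"
  shows "((\<lambda>h. bump R (x + h *\<^sub>R i) ^ 3) has_real_derivative bump_d i R x) (at 0)"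
    and "((\<lambda>h. bump_d i R (x + h *\<^sub>R i)) has_real_derivative bump_dd i R x) (at 0)"
proof -
  note nrm = norm_sq_line[OF i]
  have u: "((\<lambda>h. 1 - (norm (x + h *\<^sub>R i))\<^sup>2 / R\<^sup>2) has_real_derivative - 2 * (x \<bullet> i) / R\<^sup>2) (at 0)"
    unfolding nrm using R by (auto intro!: derivative_eq_intros simp: field_simps)
  show 1: "((\<lambda>h. bump R (x + h *\<^sub>R i) ^ 3) has_real_derivative bump_d i R x) (at 0)"
    using DERIV_chain2[OF max_power_has_derivative[of 1] u]
    by (simp add: bump_def bump_d_def eval_nat_numeral)
  have 2: "((\<lambda>h. (bump R (x + h *\<^sub>R i))\<^sup>2) has_real_derivative 2 * bump R x * (- 2 * (x \<bullet> i) / R\<^sup>2)) (at 0)"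
    using DERIV_chain2[OF max_power_has_derivative[of 0] u]
    by (simp add: bump_def eval_nat_numeral)
  have 3: "((\<lambda>h. - 2 * ((x + h *\<^sub>R i) \<bullet> i) / R\<^sup>2) has_real_derivative - 2 / R\<^sup>2) (at 0)"
    using i R by (auto simp: inner_simps intro!: derivative_eq_intros) (simp add: power2_eq_square power4_eq_xxxx)
  show "((\<lambda>h. bump_d i R (x + h *\<^sub>R i)) has_real_derivative bump_dd i R x) (at 0)"
    unfolding bump_d_def
    by (rule DERIV_cong[OF DERIV_mult[OF DERIV_cmult[OF 2, of 3] 3]])
       (simp add: bump_dd_def power2_eq_square field_simps)
qed

lemma bump_outside: "0 < R \<Longrightarrow> R \<le> norm x \<Longrightarrow> bump R x = 0"
  by (auto simp: bump_def max_def divide_simps not_le abs_le_square_iff[symmetric])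
 
lemma bump_nonneg: "0 \<le> bump R x" and bump_le_1: "bump R x \<le> 1"
  by (auto simp: bump_def)

text \<open>
  After integration by parts the cutoff costs only its second derivatives, which are of order
  \<open>1 / R\<^sup>2\<close> and disappear as \<open>R \<rightarrow> \<infinity>\<close>. The cube of \<open>bump\<close> is used because it is twice continuously
  differentiable.
\<close>

lemma bump_dd_bound:
  assumes R: "0 < R" and i: "i \<in> Basis"
  shows "\<bar>bump_dd i R x\<bar> \<le> 30 / R\<^sup>2"
proof (cases "norm x < R")
  case True
  have "\<bar>x \<bullet> i\<bar> \<le> R" using Basis_le_norm[OF i, of x] True by simp
  then have "(x \<bullet> i)\<^sup>2 \<le> R\<^sup>2" using abs_le_square_iff[of "x \<bullet> i" R] R by simp
  then have "(2 * (x \<bullet> i) / R\<^sup>2)\<^sup>2 \<le> 4 / R\<^sup>2"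
    using R by (simp add: power_divide power_mult_distrib divide_simps power2_eq_square)
       (metis mult_left_mono mult.commute zero_le_square)?
  then have "6 * bump R x * (2 * (x \<bullet> i) / R\<^sup>2)\<^sup>2 \<le> 6 * 1 * (4 / R\<^sup>2)"
    using bump_nonneg[of R x] bump_le_1[of R x] by (intro mult_mono) auto
  moreover have "6 * (bump R x)\<^sup>2 / R\<^sup>2 \<le> 6 * 1 / R\<^sup>2"
    using bump_nonneg[of R x] bump_le_1[of R x] by (intro divide_right_mono mult_left_mono power_le_one) auto
  moreover have "0 \<le> 6 * bump R x * (2 * (x \<bullet> i) / R\<^sup>2)\<^sup>2" "0 \<le> 6 * (bump R x)\<^sup>2 / R\<^sup>2"
    using bump_nonneg[of R x] by auto
  moreover have "6 * 1 * (4 / R\<^sup>2) = 24 * (1 / R\<^sup>2)" "6 * 1 / R\<^sup>2 = 6 * (1 / R\<^sup>2)" "30 / R\<^sup>2 = 30 * (1 / R\<^sup>2)" "0 \<le> 1 / R\<^sup>2"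
    by auto
  ultimately show ?thesis unfolding bump_dd_def by linarith
next
  case False
  then show ?thesis using bump_outside[OF R, of x] by (simp add: bump_dd_def)
qed

lemma continuous_bump [continuous_intros]: "continuous_on A (bump R)"
  and continuous_bump_d: "continuous_on A (bump_d i R)"
  and continuous_bump_dd: "continuous_on A (bump_dd i R)"
proof -
  show 1: "continuous_on A (bump R)" for A :: "'a set" unfolding bump_def[abs_def] divide_inverse by (intro continuous_intros)
  show "continuous_on A (bump_d i R)" unfolding bump_d_def[abs_def] divide_inverse by (intro continuous_intros 1)
  show "continuous_on A (bump_dd i R)" unfolding bump_dd_def[abs_def] divide_inverse by (intro continuous_intros 1)
qed

lemma integral_directional_derivative_compact:
  fixes A A' :: "'a::euclidean_space \<Rightarrow> real"
  assumes A: "continuous_on UNIV A" and A': "continuous_on UNIV A'"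
    and deriv: "\<And>x. ((\<lambda>h. A (x + h *\<^sub>R e)) has_real_derivative A' x) (at 0)"
    and e: "norm e \<le> 1"
    and zero: "\<And>x. R \<le> norm x \<Longrightarrow> A x = 0" "\<And>x. R \<le> norm x \<Longrightarrow> A' x = 0"
  shows "(\<integral>x. A' x \<partial>lborel) = 0"
proof -
  have "bounded (A' ` cball 0 R)"
    by (intro compact_imp_bounded compact_continuous_image continuous_on_subset[OF A']) auto
  then obtain B where "0 < B" "\<forall>y\<in>A' ` cball 0 R. norm y \<le> B"
    unfolding bounded_pos by blast
  then have B: "\<And>x. norm x \<le> R \<Longrightarrow> \<bar>A' x\<bar> \<le> B" "0 < B" by auto
  have "integrable lborel (\<lambda>x. indicator (cball 0 R) x *\<^sub>R A x)"
    by (rule borel_integrable_compact) (auto intro: continuous_on_subset[OF A])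
  also have "(\<lambda>x. indicator (cball 0 R) x *\<^sub>R A x) = A"
    using zero by (auto simp: fun_eq_iff split: split_indicator)
  finally have iA: "integrable lborel A" .
  show ?thesis
  proof (rule integral_directional_derivative_eq_0(2)[OF iA deriv])
    have "integrable lborel (\<lambda>x. indicator (cball (0::'a) (R + 1)) x *\<^sub>R B)"
      by (rule borel_integrable_compact) (auto intro: continuous_intros)
    then show "integrable lborel (\<lambda>x. B * indicator (cball (0::'a) (R + 1)) x)" by (simp add: mult.commute)
    fix x and h :: real assume h: "0 \<le> h" "h \<le> 1"
    have "norm x \<le> norm (x + h *\<^sub>R e) + norm (h *\<^sub>R e)" using norm_triangle_ineq4[of "x + h *\<^sub>R e" "h *\<^sub>R e"] by simp
    moreover have "norm (h *\<^sub>R e) \<le> 1" using h e by (auto intro!: mult_le_one)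
    ultimately show "\<bar>A' (x + h *\<^sub>R e)\<bar> \<le> B * indicator (cball 0 (R + 1)) x"
      using B zero(2)[of "x + h *\<^sub>R e"] by (cases "R \<le> norm (x + h *\<^sub>R e)") (auto split: split_indicator)
  qed
qed

section \<open>A Bellman function\<close>

text \<open>
  Chosen so that \<open>A s (s - 1) = 9 + (2 - s) (s - 1)\<close> for \<open>A = bellman_const s\<close>. The second summand
  absorbs the negative part of the Hessian and the \<open>9\<close> leaves room for the mixed term.
\<close>

definition bellman_const :: "real \<Rightarrow> real" where
  "bellman_const s = (9 + (2 - s) * (s - 1)) / (s * (s - 1))"

definition bellman :: "real \<Rightarrow> real \<Rightarrow> real \<Rightarrow> real" where
  "bellman s F G = bellman_const s * F powr s + F powr (2 - s) * G\<^sup>2"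

text \<open>
  The partial derivatives of \<open>bellman s\<close> in its two arguments, followed by its Hessian as a quadratic form
  in \<open>(a, c)\<close>.
\<close>

definition bellman_F :: "real \<Rightarrow> real \<Rightarrow> real \<Rightarrow> real" where
  "bellman_F s F G = bellman_const s * s * F powr (s - 1) + (2 - s) * F powr (1 - s) * G\<^sup>2"

definition bellman_G :: "real \<Rightarrow> real \<Rightarrow> real \<Rightarrow> real" where
  "bellman_G s F G = 2 * F powr (2 - s) * G"

definition bellman_hess :: "real \<Rightarrow> real \<Rightarrow> real \<Rightarrow> real \<Rightarrow> real \<Rightarrow> real" where
  "bellman_hess s F G a c =
     (bellman_const s * s * (s - 1) * F powr (s - 2) - (2 - s) * (s - 1) * F powr (- s) * G\<^sup>2) * a\<^sup>2
     + 4 * (2 - s) * F powr (1 - s) * G * a * c + 2 * F powr (2 - s) * c\<^sup>2"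

lemma bellman_has_derivative:
  assumes "(F has_real_derivative F') (at x)" "(G has_real_derivative G') (at x)" "0 < F x"
  shows "((\<lambda>x. bellman s (F x) (G x)) has_real_derivative
    bellman_F s (F x) (G x) * F' + bellman_G s (F x) (G x) * G') (at x)"
  unfolding bellman_def bellman_F_def bellman_G_def
  using assms by (auto intro!: derivative_eq_intros simp: algebra_simps)

lemma bellman_d_has_derivative:
  assumes "(F has_real_derivative F1 x) (at x)" "(G has_real_derivative G1 x) (at x)" "0 < F x"
    and "(F1 has_real_derivative F2) (at x)" "(G1 has_real_derivative G2) (at x)"
  shows "((\<lambda>x. bellman_F s (F x) (G x) * F1 x + bellman_G s (F x) (G x) * G1 x) has_real_derivative
    bellman_hess s (F x) (G x) (F1 x) (G1 x) + bellman_F s (F x) (G x) * F2 + bellman_G s (F x) (G x) * G2) (at x)"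
  unfolding bellman_F_def bellman_G_def bellman_hess_def
  using assms by (auto intro!: derivative_eq_intros simp: algebra_simps power2_eq_square)

lemma powr_power2: "((F::real) powr a)\<^sup>2 = F powr (2 * a)"
  by (simp add: power2_eq_square powr_add[symmetric])

text \<open>
  On the region \<open>\<bar>G\<bar> \<le> F\<^sup>s\<^sup>-\<^sup>1\<close> the function is convex, with a Hessian whose size in the two directions is
  \<open>F\<^sup>s\<^sup>-\<^sup>2\<close> and \<open>F\<^sup>2\<^sup>-\<^sup>s\<close>. The product of these is \<open>1\<close>, so the geometric mean controls \<open>\<bar>a c\<bar>\<close> without any
  weight.
\<close>

lemma bellman_hess_lower:
  assumes s: "1 < s" "s < 2" and F: "0 < F" and G: "\<bar>G\<bar> \<le> F powr (s - 1)"
  shows "F powr (s - 2) * a\<^sup>2 + F powr (2 - s) * c\<^sup>2 \<le> bellman_hess s F G a c"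
proof -
  \<comment> \<open>In these normalised variables the Hessian is at least \<open>9 p\<^sup>2 - 4 p q + 2 q\<^sup>2\<close>.\<close>
  define p where "p = F powr (s / 2 - 1) * \<bar>a\<bar>"
  define q where "q = F powr (1 - s / 2) * \<bar>c\<bar>"
  have pq: "p * q = \<bar>a\<bar> * \<bar>c\<bar>"
  proof -
    have "p * q = (F powr (s / 2 - 1) * F powr (1 - s / 2)) * (\<bar>a\<bar> * \<bar>c\<bar>)" by (simp add: p_def q_def)
    also have "F powr (s / 2 - 1) * F powr (1 - s / 2) = 1" using F by (simp add: powr_add[symmetric])
    finally show ?thesis by simp
  qed
  have p2: "p\<^sup>2 = F powr (s - 2) * a\<^sup>2"
    unfolding p_def by (simp add: power_mult_distrib powr_power2)
  have q2: "q\<^sup>2 = F powr (2 - s) * c\<^sup>2"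
    unfolding q_def by (simp add: power_mult_distrib powr_power2)
  have "G\<^sup>2 \<le> (F powr (s - 1))\<^sup>2" using G by (metis abs_ge_zero power2_abs power_mono)
  also have "\<dots> = F powr (2 * s - 2)" by (simp add: powr_power2)
  finally have "F powr (- s) * G\<^sup>2 \<le> F powr (- s) * F powr (2 * s - 2)" by (intro mult_left_mono) auto
  also have "\<dots> = F powr (s - 2)" using F by (simp add: powr_add[symmetric])
  finally have G2: "F powr (- s) * G\<^sup>2 \<le> F powr (s - 2)" .
  have G1: "\<bar>F powr (1 - s) * G\<bar> \<le> 1"
  proof -
    have "\<bar>F powr (1 - s) * G\<bar> \<le> F powr (1 - s) * F powr (s - 1)"
      using G by (simp add: abs_mult mult_left_mono)
    also have "\<dots> = 1" using F by (simp add: powr_add[symmetric])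
    finally show ?thesis .
  qed
  have "(2 - s) * (s - 1) * (F powr (- s) * G\<^sup>2) \<le> (2 - s) * (s - 1) * F powr (s - 2)"
    using s G2 by (intro mult_left_mono) auto
  moreover have "bellman_const s * s * (s - 1) = 9 + (2 - s) * (s - 1)"
    using s by (simp add: bellman_const_def)
  then have "bellman_const s * s * (s - 1) * F powr (s - 2) = 9 * F powr (s - 2) + (2 - s) * (s - 1) * F powr (s - 2)"
    by (simp only: distrib_right)
  ultimately have "9 * F powr (s - 2) \<le> bellman_const s * s * (s - 1) * F powr (s - 2) - (2 - s) * (s - 1) * F powr (- s) * G\<^sup>2"
    by (simp add: mult.assoc)
  then have 1: "9 * F powr (s - 2) * a\<^sup>2 \<le> (bellman_const s * s * (s - 1) * F powr (s - 2) - (2 - s) * (s - 1) * F powr (- s) * G\<^sup>2) * a\<^sup>2"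
    by (rule mult_right_mono) simp
  have "\<bar>4 * (2 - s) * F powr (1 - s) * G * a * c\<bar> = 4 * (2 - s) * \<bar>F powr (1 - s) * G\<bar> * (\<bar>a\<bar> * \<bar>c\<bar>)"
    using s by (simp add: abs_mult)
  also have "\<dots> \<le> 4 * 1 * 1 * (\<bar>a\<bar> * \<bar>c\<bar>)"
    using s G1 by (intro mult_mono) auto
  finally have 2: "\<bar>4 * (2 - s) * F powr (1 - s) * G * a * c\<bar> \<le> 4 * (p * q)" using pq by simp
  have "0 \<le> (2 * p - q)\<^sup>2" by simp
  then have 3: "4 * (p * q) \<le> 4 * p\<^sup>2 + q\<^sup>2" by (simp add: power2_eq_square algebra_simps)
  have "p\<^sup>2 \<ge> 0" by simp
  then have "p\<^sup>2 + q\<^sup>2 \<le> 9 * p\<^sup>2 - 4 * (p * q) + 2 * q\<^sup>2" using 3 by linarith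
  moreover have "9 * p\<^sup>2 \<le> (bellman_const s * s * (s - 1) * F powr (s - 2) - (2 - s) * (s - 1) * F powr (- s) * G\<^sup>2) * a\<^sup>2"
    using 1 unfolding p2 by (simp only: mult.assoc)
  moreover have "2 * F powr (2 - s) * c\<^sup>2 = 2 * q\<^sup>2" by (simp only: q2 mult.assoc)
  ultimately show ?thesis unfolding bellman_hess_def p2[symmetric] q2[symmetric] using 2 by linarith
qed

lemma bellman_upper:
  assumes s: "1 < s" "s < 2" and F: "0 < F" and G: "\<bar>G\<bar> \<le> F powr (s - 1)"
  shows "bellman s F G \<le> (bellman_const s + 1) * F powr s" "0 \<le> bellman s F G"
proof -
  have "G\<^sup>2 \<le> (F powr (s - 1))\<^sup>2" using G by (metis abs_ge_zero power2_abs power_mono)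
  also have "\<dots> = F powr (2 * s - 2)" by (simp add: powr_power2)
  finally have "F powr (2 - s) * G\<^sup>2 \<le> F powr (2 - s) * F powr (2 * s - 2)" by (intro mult_left_mono) auto
  also have "\<dots> = F powr s" using F by (simp add: powr_add[symmetric])
  finally show "bellman s F G \<le> (bellman_const s + 1) * F powr s" unfolding bellman_def by (simp add: algebra_simps)
  have "0 \<le> bellman_const s" using s by (simp add: bellman_const_def)
  then show "0 \<le> bellman s F G" unfolding bellman_def by simp
qed

section \<open>The bilinear embedding\<close>

lemma power_le_power_plus_one:
  fixes u :: real
  assumes "0 \<le> u" "0 \<le> r" "r \<le> s"
  shows "u powr r \<le> u powr s + 1"
proof (cases "u \<le> 1")
  case True
  then have "u powr r \<le> 1" using assms by (intro powr_le1) auto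
  then show ?thesis by (simp add: add_increasing)
next
  case False
  then have "u powr r \<le> u powr s" using assms by (intro powr_mono) auto
  then show ?thesis by simp
qed

lemma tame_powr_integrable:
  assumes "f \<in> borel_measurable borel" "integrable lborel (\<lambda>x. \<bar>f x\<bar> powr s)" "1 \<le> s"
  shows "tame f"
  unfolding tame_def using assms power_le_power_plus_one[of "\<bar>f x\<bar>" 1 s for x]
  by (auto intro!: exI[of _ "\<lambda>x. \<bar>f x\<bar> powr s"])

text \<open>
  A short list of rules for continuity of expressions in the heat extensions. The full collection
  \<open>continuous_intros\<close> would also decompose the compositions with \<open>fst\<close> and \<open>snd\<close>, for which continuity is
  only known on positive times.
\<close>

lemmas cont_rules = continuous_on_add continuous_on_diff continuous_on_mult continuous_on_power
  continuous_on_const continuous_on_sum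

text \<open>
  A positive function in \<open>L\<^sup>s\<close> that dominates \<open>g\<close> in the sense dual to it. Both are extended to positive
  times by the heat flow.
\<close>

locale heat_pair =
  fixes f g :: "'a::euclidean_space \<Rightarrow> real" and s :: real
  assumes s: "1 < s" "s < 2"
    and f_meas [measurable]: "f \<in> borel_measurable borel" and f_pos: "\<And>x. 0 < f x"
    and f_int: "integrable lborel (\<lambda>x. f x powr s)"
    and g_meas [measurable]: "g \<in> borel_measurable borel" and g_le: "\<And>x. \<bar>g x\<bar> \<le> f x powr (s - 1)"
begin

lemma tame_fs: "tame (\<lambda>x. f x powr s)"
  unfolding tame_def using f_int by (auto intro!: exI[of _ "\<lambda>x. f x powr s"])

lemma tame_f: "tame f"
  unfolding tame_def using f_int power_le_power_plus_one[of "f x" 1 s for x] f_pos s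
  by (auto intro!: exI[of _ "\<lambda>x. f x powr s"] simp: less_imp_le abs_of_pos powr_one_gt_zero_iff)

lemma tame_g: "tame g"
proof -
  have "\<bar>g x\<bar> \<le> f x powr s + 1" for x
    using g_le[of x] power_le_power_plus_one[of "f x" "s - 1" s] f_pos[of x] s by simp
  then show ?thesis unfolding tame_def using f_int g_meas by blast
qed

definition "F x t = conv heat f x t"
definition "G x t = conv heat g x t"
definition "Fd i x t = conv (heat_d i) f x t"
definition "Gd i x t = conv (heat_d i) g x t"
definition "Fdd i x t = conv (heat_dd i i) f x t"
definition "Gdd i x t = conv (heat_dd i i) g x t"

lemma F_pos: "0 < t \<Longrightarrow> 0 < F x t"
  unfolding F_def by (rule conv_heat_pos[OF _ tame_f f_pos])

lemma G_le: "0 < t \<Longrightarrow> \<bar>G x t\<bar> \<le> F x t powr (s - 1)"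
  unfolding F_def G_def using s by (intro conv_heat_jensen_concave tame_f tame_g f_pos g_le) auto

lemma Fs_le: "0 < t \<Longrightarrow> F x t powr s \<le> conv heat (\<lambda>x. f x powr s) x t"
  unfolding F_def using s by (intro conv_heat_jensen_convex tame_f tame_fs f_pos) auto

lemma heat_dd_sum_kernel: "gaussian_kernel (\<lambda>t z. \<Sum>i\<in>Basis. heat_dd i i t (z :: 'a))"
  by (intro gaussian_kernel_sum gaussian_kernel_heat_dd) auto

lemma conv_heat_dd_sum:
  assumes "tame h" "0 < t"
  shows "conv (\<lambda>t z. \<Sum>i\<in>Basis. heat_dd i i t (z :: 'a)) h x t = (\<Sum>i\<in>Basis. conv (heat_dd i i) h x t)"
  unfolding conv_def sum_distrib_right
  by (intro Bochner_Integration.integral_sum conv_integrable gaussian_kernel_heat_dd assms)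

text \<open>
  Since \<open>F\<close> and \<open>G\<close> solve the heat equation, \<open>Phi\<close> is a subsolution: \<open>(\<partial>\<^sub>t - \<Delta>) Phi = - Q\<close>, where \<open>Q\<close>
  is the Hessian evaluated on the gradients of \<open>F\<close> and \<open>G\<close>.
\<close>

definition "Phi x t = bellman s (F x t) (G x t)"
definition "Phi_d i x t = bellman_F s (F x t) (G x t) * Fd i x t + bellman_G s (F x t) (G x t) * Gd i x t"
definition "Q x t = (\<Sum>i\<in>Basis. bellman_hess s (F x t) (G x t) (Fd i x t) (Gd i x t))"
definition "Phi_dd i x t = bellman_hess s (F x t) (G x t) (Fd i x t) (Gd i x t)
   + bellman_F s (F x t) (G x t) * Fdd i x t + bellman_G s (F x t) (G x t) * Gdd i x t"

lemma Phi_has_derivative_space: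
  assumes t: "0 < t" and i: "i \<in> Basis"
  shows "((\<lambda>h. Phi (x + h *\<^sub>R i) t) has_real_derivative Phi_d i x t) (at 0)"
    and "((\<lambda>h. Phi_d i (x + h *\<^sub>R i) t) has_real_derivative Phi_dd i x t) (at 0)"
proof -
  have ni: "norm i \<le> 1" using i by simp
  have F1: "((\<lambda>h. F (x + h *\<^sub>R i) t) has_real_derivative Fd i (x + 0 *\<^sub>R i) t) (at 0)"
    using conv_has_derivative_space[OF gaussian_kernel_heat gaussian_kernel_heat_d[OF i] tame_f t ni heat_has_derivative_space[OF t i], of x]
    by (simp add: F_def Fd_def)
  have G1: "((\<lambda>h. G (x + h *\<^sub>R i) t) has_real_derivative Gd i (x + 0 *\<^sub>R i) t) (at 0)"
    using conv_has_derivative_space[OF gaussian_kernel_heat gaussian_kernel_heat_d[OF i] tame_g t ni heat_has_derivative_space[OF t i], of x]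
    by (simp add: G_def Gd_def)
  have F2: "((\<lambda>h. Fd i (x + h *\<^sub>R i) t) has_real_derivative Fdd i x t) (at 0)"
    using conv_has_derivative_space[OF gaussian_kernel_heat_d[OF i] gaussian_kernel_heat_dd[OF i i] tame_f t ni heat_d_has_derivative_space[OF t i i], of x]
    by (simp add: Fd_def Fdd_def)
  have G2: "((\<lambda>h. Gd i (x + h *\<^sub>R i) t) has_real_derivative Gdd i x t) (at 0)"
    using conv_has_derivative_space[OF gaussian_kernel_heat_d[OF i] gaussian_kernel_heat_dd[OF i i] tame_g t ni heat_d_has_derivative_space[OF t i i], of x]
    by (simp add: Gd_def Gdd_def)
  show "((\<lambda>h. Phi (x + h *\<^sub>R i) t) has_real_derivative Phi_d i x t) (at 0)"
    using bellman_has_derivative[OF F1 G1, of s] F_pos[OF t] by (simp add: Phi_def Phi_d_def)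
  show "((\<lambda>h. Phi_d i (x + h *\<^sub>R i) t) has_real_derivative Phi_dd i x t) (at 0)"
    using bellman_d_has_derivative[OF F1 G1 _ F2 G2, of s] F_pos[OF t] by (simp add: Phi_d_def Phi_dd_def)
qed

lemma Phi_has_derivative_time:
  assumes t: "0 < t"
  shows "((\<lambda>t. Phi x t) has_real_derivative (\<Sum>i\<in>Basis. Phi_dd i x t) - Q x t) (at t)"
proof -
  have F1: "((\<lambda>t. F x t) has_real_derivative (\<Sum>i\<in>Basis. Fdd i x t)) (at t)"
    using conv_has_derivative_time[OF gaussian_kernel_heat heat_dd_sum_kernel tame_f t heat_has_derivative_time, of x]
    by (simp add: F_def Fdd_def conv_heat_dd_sum[OF tame_f t])
  have G1: "((\<lambda>t. G x t) has_real_derivative (\<Sum>i\<in>Basis. Gdd i x t)) (at t)"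
    using conv_has_derivative_time[OF gaussian_kernel_heat heat_dd_sum_kernel tame_g t heat_has_derivative_time, of x]
    by (simp add: G_def Gdd_def conv_heat_dd_sum[OF tame_g t])
  have "(\<Sum>i\<in>Basis. Phi_dd i x t) - Q x t = bellman_F s (F x t) (G x t) * (\<Sum>i\<in>Basis. Fdd i x t) + bellman_G s (F x t) (G x t) * (\<Sum>i\<in>Basis. Gdd i x t)"
    unfolding Phi_dd_def Q_def by (simp add: sum.distrib sum_distrib_left)
  then show ?thesis
    using bellman_has_derivative[OF F1 G1, of s] F_pos[OF t] by (simp add: Phi_def)
qed

lemma cont_F: "continuous_on (UNIV \<times> {0<..}) (\<lambda>z. F (fst z) (snd z))"
  and cont_G: "continuous_on (UNIV \<times> {0<..}) (\<lambda>z. G (fst z) (snd z))"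
  using conv_continuous[OF gaussian_kernel_heat tame_f] conv_continuous[OF gaussian_kernel_heat tame_g]
  by (simp_all add: F_def G_def case_prod_unfold)

lemma cont_Fd: "i \<in> Basis \<Longrightarrow> continuous_on (UNIV \<times> {0<..}) (\<lambda>z. Fd i (fst z) (snd z))"
  and cont_Gd: "i \<in> Basis \<Longrightarrow> continuous_on (UNIV \<times> {0<..}) (\<lambda>z. Gd i (fst z) (snd z))"
  using conv_continuous[OF gaussian_kernel_heat_d tame_f] conv_continuous[OF gaussian_kernel_heat_d tame_g]
  by (simp_all add: Fd_def Gd_def case_prod_unfold)

lemma cont_Fdd: "i \<in> Basis \<Longrightarrow> continuous_on (UNIV \<times> {0<..}) (\<lambda>z. Fdd i (fst z) (snd z))"
  and cont_Gdd: "i \<in> Basis \<Longrightarrow> continuous_on (UNIV \<times> {0<..}) (\<lambda>z. Gdd i (fst z) (snd z))"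
  using conv_continuous[OF gaussian_kernel_heat_dd tame_f] conv_continuous[OF gaussian_kernel_heat_dd tame_g]
  by (simp_all add: Fdd_def Gdd_def case_prod_unfold)

lemma cont_powr: "continuous_on (UNIV \<times> {0<..}) (\<lambda>z. F (fst z) (snd z) powr r)"
  by (intro continuous_on_powr cont_F continuous_on_const) (auto simp: F_pos[THEN less_imp_neq, symmetric])

lemma cont_Phi: "continuous_on (UNIV \<times> {0<..}) (\<lambda>z. Phi (fst z) (snd z))"
  unfolding Phi_def bellman_def by (intro cont_rules cont_powr cont_F cont_G)

lemma cont_Phi_d: "i \<in> Basis \<Longrightarrow> continuous_on (UNIV \<times> {0<..}) (\<lambda>z. Phi_d i (fst z) (snd z))"
  unfolding Phi_d_def bellman_F_def bellman_G_def by (intro cont_rules cont_powr cont_F cont_G cont_Fd cont_Gd)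

lemma cont_Phi_dd: "i \<in> Basis \<Longrightarrow> continuous_on (UNIV \<times> {0<..}) (\<lambda>z. Phi_dd i (fst z) (snd z))"
  unfolding Phi_dd_def bellman_F_def bellman_G_def bellman_hess_def
  by (intro cont_rules cont_powr cont_F cont_G cont_Fd cont_Gd cont_Fdd cont_Gdd)

lemma cont_Q: "continuous_on (UNIV \<times> {0<..}) (\<lambda>z. Q (fst z) (snd z))"
  unfolding Q_def bellman_hess_def
  by (intro cont_rules cont_powr cont_F cont_G cont_Fd cont_Gd)

lemma cont_slice:
  assumes "continuous_on (UNIV \<times> {0<..}) (\<lambda>z. h (fst z) (snd z))" "0 < t"
  shows "continuous_on UNIV (\<lambda>x. h x (t :: real))"
proof -
  have "continuous_on UNIV (\<lambda>x. (\<lambda>z. h (fst z) (snd z)) (x, t))"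
    by (rule continuous_on_compose2[OF assms(1)]) (use assms(2) in \<open>auto intro!: continuous_intros\<close>)
  then show ?thesis by simp
qed

lemma Phi_nonneg: "0 < t \<Longrightarrow> 0 \<le> Phi x t"
  unfolding Phi_def by (rule bellman_upper(2)[OF s F_pos G_le])

lemma Phi_le: "0 < t \<Longrightarrow> Phi x t \<le> (bellman_const s + 1) * conv heat (\<lambda>x. f x powr s) x t"
proof -
  assume t: "0 < t"
  have "Phi x t \<le> (bellman_const s + 1) * F x t powr s"
    unfolding Phi_def by (rule bellman_upper(1)[OF s F_pos[OF t] G_le[OF t]])
  also have "\<dots> \<le> (bellman_const s + 1) * conv heat (\<lambda>x. f x powr s) x t"
    using s by (intro mult_left_mono Fs_le[OF t]) (simp add: bellman_const_def)
  finally show ?thesis .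
qed

lemma Phi_integral:
  assumes t: "0 < t"
  shows "integrable lborel (\<lambda>x. Phi x t)"
    and "(\<integral>x. Phi x t \<partial>lborel) \<le> (bellman_const s + 1) * (\<integral>x. f x powr s \<partial>lborel)"
proof -
  have i: "integrable lborel (\<lambda>x. (bellman_const s + 1) * conv heat (\<lambda>x. f x powr s) x t)"
    by (intro integrable_mult_right conv_heat_mass(1)[OF t f_int]) auto
  have m: "(\<lambda>x. Phi x t) \<in> borel_measurable lborel"
    using cont_slice[OF cont_Phi t] by (simp add: borel_measurable_continuous_onI)
  show i2: "integrable lborel (\<lambda>x. Phi x t)"
    by (rule Bochner_Integration.integrable_bound[OF i m])
       (use Phi_le[OF t] Phi_nonneg[OF t] in \<open>auto intro!: AE_I2 order_trans[OF _ abs_ge_self]\<close>)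
  have "(\<integral>x. Phi x t \<partial>lborel) \<le> (\<integral>x. (bellman_const s + 1) * conv heat (\<lambda>x. f x powr s) x t \<partial>lborel)"
    by (intro integral_mono i i2 Phi_le[OF t])
  also have "\<dots> = (bellman_const s + 1) * (\<integral>x. f x powr s \<partial>lborel)"
    using conv_heat_mass(2)[OF t f_int] by simp
  finally show "(\<integral>x. Phi x t \<partial>lborel) \<le> (bellman_const s + 1) * (\<integral>x. f x powr s \<partial>lborel)" .
qed

text \<open>
  Two integrations by parts move both derivatives to the cutoff.
\<close>

lemma integral_bump_Phi_dd:
  assumes t: "0 < t" and i: "i \<in> Basis" and R: "0 < R"
  shows "(\<integral>x. bump R x ^ 3 * Phi_dd i x t \<partial>lborel) = (\<integral>x. bump_dd i R x * Phi x t \<partial>lborel)"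
proof -
  note c = cont_slice[OF cont_Phi t] cont_slice[OF cont_Phi_d[OF i] t] cont_slice[OF cont_Phi_dd[OF i] t]
  have ib: "integrable lborel (\<lambda>x. indicator (cball 0 R) x *\<^sub>R (bump R x ^ 3 * Phi_dd i x t))"
      "integrable lborel (\<lambda>x. indicator (cball 0 R) x *\<^sub>R (bump_dd i R x * Phi x t))"
    by (intro borel_integrable_compact continuous_intros continuous_on_subset[OF c(1)] continuous_on_subset[OF c(3)] continuous_bump_dd; simp)+
  have out: "\<And>x::'a. R < norm x \<Longrightarrow> bump R x = 0" by (rule bump_outside[OF R less_imp_le])
  have eqs: "(\<lambda>x. indicator (cball 0 R) x *\<^sub>R (bump R x ^ 3 * Phi_dd i x t)) = (\<lambda>x. bump R x ^ 3 * Phi_dd i x t)"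
     "(\<lambda>x. indicator (cball 0 R) x *\<^sub>R (bump_dd i R x * Phi x t)) = (\<lambda>x. bump_dd i R x * Phi x t)"
    using out by (auto simp: fun_eq_iff bump_dd_def not_le split: split_indicator)
  have "(\<integral>x. (bump R x ^ 3 * Phi_dd i x t - bump_dd i R x * Phi x t) \<partial>lborel) = 0"
  proof (rule integral_directional_derivative_compact[where e=i and R=R])
    show "continuous_on UNIV (\<lambda>x. bump R x ^ 3 * Phi_d i x t - bump_d i R x * Phi x t)"
      by (intro continuous_intros c continuous_bump_d)
    show "continuous_on UNIV (\<lambda>x. bump R x ^ 3 * Phi_dd i x t - bump_dd i R x * Phi x t)"
      by (intro continuous_intros c continuous_bump_dd)
    fix x
    show "((\<lambda>h. bump R (x + h *\<^sub>R i) ^ 3 * Phi_d i (x + h *\<^sub>R i) t - bump_d i R (x + h *\<^sub>R i) * Phi (x + h *\<^sub>R i) t)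
        has_real_derivative bump R x ^ 3 * Phi_dd i x t - bump_dd i R x * Phi x t) (at 0)"
      by (rule DERIV_cong[OF DERIV_diff[OF
            DERIV_mult[OF bump_has_derivative(1)[OF R i] Phi_has_derivative_space(2)[OF t i]]
            DERIV_mult[OF bump_has_derivative(2)[OF R i] Phi_has_derivative_space(1)[OF t i]]]])
         (simp add: algebra_simps)
    show "bump R x ^ 3 * Phi_d i x t - bump_d i R x * Phi x t = 0" if "R \<le> norm x"
      using bump_outside[OF R that] by (simp add: bump_d_def)
    show "bump R x ^ 3 * Phi_dd i x t - bump_dd i R x * Phi x t = 0" if "R \<le> norm x"
      using bump_outside[OF R that] by (simp add: bump_dd_def)
  qed (use i in simp)
  then show ?thesis using ib unfolding eqs by simp
qed

end

context heat_pair begin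

definition "K = (bellman_const s + 1) * (\<integral>x. f x powr s \<partial>lborel)"

lemma K_nonneg: "0 \<le> K"
  unfolding K_def using s by (intro mult_nonneg_nonneg Bochner_Integration.integral_nonneg) (auto simp: bellman_const_def)

text \<open>
  The lower bounds for the Hessian in different coordinate directions are added before the arithmetic
  and geometric means are compared, so that \<open>i\<close> and \<open>j\<close> may differ.
\<close>

lemma Q_lower:
  assumes t: "0 < t" and i: "i \<in> Basis" and j: "j \<in> Basis"
  shows "2 * \<bar>Fd i x t * Gd j x t\<bar> \<le> Q x t"
proof -
  define p where "p k = F x t powr (s - 2) * (Fd k x t)\<^sup>2" for k
  define q where "q k = F x t powr (2 - s) * (Gd k x t)\<^sup>2" for k
  have nonneg: "0 \<le> p k" "0 \<le> q k" for k by (auto simp: p_def q_def)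
  have "p i + q j \<le> (\<Sum>k\<in>Basis. p k) + (\<Sum>k\<in>Basis. q k)"
    using i j nonneg by (intro add_mono member_le_sum) auto
  also have "\<dots> = (\<Sum>k\<in>Basis. p k + q k)" by (simp add: sum.distrib)
  also have "\<dots> \<le> Q x t"
    unfolding Q_def p_def q_def by (intro sum_mono bellman_hess_lower[OF s F_pos[OF t] G_le[OF t]])
  finally have 1: "p i + q j \<le> Q x t" .
  define u where "u = F x t powr (s / 2 - 1) * \<bar>Fd i x t\<bar>"
  define v where "v = F x t powr (1 - s / 2) * \<bar>Gd j x t\<bar>"
  have "u * v = (F x t powr (s / 2 - 1) * F x t powr (1 - s / 2)) * (\<bar>Fd i x t\<bar> * \<bar>Gd j x t\<bar>)" by (simp add: u_def v_def)
  also have "F x t powr (s / 2 - 1) * F x t powr (1 - s / 2) = 1" using F_pos[OF t, of x] by (simp add: powr_add[symmetric])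
  finally have "u * v = \<bar>Fd i x t * Gd j x t\<bar>" by (simp add: abs_mult)
  moreover have "u\<^sup>2 = p i" "v\<^sup>2 = q j" by (auto simp: u_def v_def p_def q_def power_mult_distrib powr_power2)
  moreover have "2 * u * v \<le> u\<^sup>2 + v\<^sup>2" by (rule sum_squares_bound)
  ultimately show ?thesis using 1 by simp
qed

text \<open>
  Integrate \<open>Q = \<Delta> Phi - \<partial>\<^sub>t Phi\<close> against the cutoff over a time slab. The Laplacian contributes at most
  the error of the cutoff, and the time derivative at most the mass of \<open>Phi\<close> at the initial time, since
  \<open>Phi\<close> is nonnegative at the final one.
\<close>

lemma energy:
  assumes ab: "0 < a" "a \<le> b" and R: "0 < R"
  defines "q \<equiv> \<lambda>z. indicator {a..b} (snd z) * (bump R (fst z) ^ 3 * Q (fst z) (snd z))"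
  shows "integrable lborel q" and "(\<integral>z. q z \<partial>lborel) \<le> K + (b - a) * (real DIM('a) * (30 / R\<^sup>2) * K)"
proof -
  define S where "S = cball (0::'a) R \<times> {a..b}"
  define L where "L x t = (\<Sum>i\<in>Basis. Phi_dd i x t)" for x t
  define l where "l z = indicator {a..b} (snd z) * (bump R (fst z) ^ 3 * L (fst z) (snd z))" for z
  have S: "compact S" "S \<subseteq> UNIV \<times> {0<..}" unfolding S_def using ab by (auto intro!: compact_Times)
  have out: "\<And>x::'a. R < norm x \<Longrightarrow> bump R x = 0" by (rule bump_outside[OF R less_imp_le])
  have cont_L: "continuous_on (UNIV \<times> {0<..}) (\<lambda>z. L (fst z) (snd z))"
    unfolding L_def by (intro cont_rules cont_Phi_dd)
  have cb: "continuous_on S (\<lambda>z. bump R (fst z))"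
    by (rule continuous_on_compose2[OF continuous_bump[of UNIV]]) (auto intro!: continuous_intros)
  have "integrable lborel (\<lambda>z. indicator S z *\<^sub>R (bump R (fst z) ^ 3 * Q (fst z) (snd z)))"
    by (intro borel_integrable_compact S(1) cont_rules cb continuous_on_subset[OF cont_Q S(2)])
  also have "(\<lambda>z. indicator S z *\<^sub>R (bump R (fst z) ^ 3 * Q (fst z) (snd z))) = q"
    using out by (auto simp: fun_eq_iff q_def S_def not_le split: split_indicator)
  finally show iq: "integrable lborel q" .
  have "integrable lborel (\<lambda>z. indicator S z *\<^sub>R (bump R (fst z) ^ 3 * L (fst z) (snd z)))"
    by (intro borel_integrable_compact S(1) cont_rules cb continuous_on_subset[OF cont_L S(2)])
  also have "(\<lambda>z. indicator S z *\<^sub>R (bump R (fst z) ^ 3 * L (fst z) (snd z))) = l"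
    using out by (auto simp: fun_eq_iff l_def S_def not_le split: split_indicator)
  finally have il: "integrable lborel l" .
  have meas_bump: "bump R \<in> borel_measurable (borel :: 'a measure)"
    by (intro borel_measurable_continuous_onI continuous_bump)
  have b3: "0 \<le> bump R x ^ 3" "\<bar>bump R x ^ 3\<bar> \<le> 1" for x :: 'a
    using bump_nonneg[of R x] bump_le_1[of R x] by (auto intro: power_le_one)
  have iPhi: "integrable lborel (\<lambda>x. bump R x ^ 3 * Phi x t)" if "0 < t" for t
    by (rule Bochner_Integration.integrable_bound[OF Phi_integral(1)[OF that]])
       (use meas_bump borel_measurable_integrable[OF Phi_integral(1)[OF that]] Phi_nonneg[OF that] b3
         in \<open>auto intro!: AE_I2 borel_measurable_times mult_left_le_one_le simp: abs_mult\<close>)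
  have Phi_K: "(\<integral>x. Phi x t \<partial>lborel) \<le> K" if "0 < t" for t unfolding K_def by (rule Phi_integral(2)[OF that])
  note pair = lborel_prod[where 'a='a and 'b=real, symmetric]
  \<comment> \<open>The Laplacian part is integrated in space first, the time derivative part in time first.\<close>
  have "(\<integral>z. l z \<partial>lborel) = (\<integral>t. (\<integral>x. l (x, t) \<partial>lborel) \<partial>lborel)"
    using lborel_pair.integral_snd[of "\<lambda>x t. l (x, t)"] il by (simp add: pair case_prod_unfold)
  also have "\<dots> = (\<integral>t. indicator {a..b} t * (\<Sum>i\<in>Basis. \<integral>x. bump_dd i R x * Phi x t \<partial>lborel) \<partial>lborel)"
  proof (intro Bochner_Integration.integral_cong refl)
    fix t
    show "(\<integral>x. l (x, t) \<partial>lborel) = indicator {a..b} t * (\<Sum>i\<in>Basis. \<integral>x. bump_dd i R x * Phi x t \<partial>lborel)"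
    proof (cases "t \<in> {a..b}")
      case True
      then have t: "0 < t" using ab by auto
      have "(\<integral>x. l (x, t) \<partial>lborel) = (\<integral>x. (\<Sum>i\<in>Basis. bump R x ^ 3 * Phi_dd i x t) \<partial>lborel)"
        using True by (simp add: l_def L_def sum_distrib_left)
      also have "\<dots> = (\<Sum>i\<in>Basis. \<integral>x. bump R x ^ 3 * Phi_dd i x t \<partial>lborel)"
      proof (intro Bochner_Integration.integral_sum)
        fix i :: 'a assume i: "i \<in> Basis"
        have "integrable lborel (\<lambda>x. indicator (cball 0 R) x *\<^sub>R (bump R x ^ 3 * Phi_dd i x t))"
          by (intro borel_integrable_compact cont_rules continuous_on_subset[OF cont_slice[OF cont_Phi_dd[OF i] t]] continuous_bump; simp)
        also have "(\<lambda>x. indicator (cball 0 R) x *\<^sub>R (bump R x ^ 3 * Phi_dd i x t)) = (\<lambda>x. bump R x ^ 3 * Phi_dd i x t)"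
          using out by (auto simp: fun_eq_iff not_le split: split_indicator)
        finally show "integrable lborel (\<lambda>x. bump R x ^ 3 * Phi_dd i x t)" .
      qed
      finally show ?thesis using True by (simp add: integral_bump_Phi_dd[OF t _ R])
    qed (simp add: l_def)
  qed
  also have "\<dots> \<le> (\<integral>t. indicator {a..b} t * (real DIM('a) * (30 / R\<^sup>2) * K) \<partial>lborel)"
  proof (rule integral_mono_AE')
    show "integrable lborel (\<lambda>t. indicator {a..b} t * (real DIM('a) * (30 / R\<^sup>2) * K))"
      using ab by (intro integrable_mult_left integrable_real_indicator) auto
    show "AE t in lborel. 0 \<le> indicator {a..b} t * (real DIM('a) * (30 / R\<^sup>2) * K)" using K_nonneg by auto
    show "AE t in lborel. indicator {a..b} t * (\<Sum>i\<in>Basis. \<integral>x. bump_dd i R x * Phi x t \<partial>lborel)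
        \<le> indicator {a..b} t * (real DIM('a) * (30 / R\<^sup>2) * K)"
    proof (rule AE_I2, cases)
      fix t assume "t \<in> {a..b}"
      then have t: "0 < t" using ab by auto
      have "(\<integral>x. bump_dd i R x * Phi x t \<partial>lborel) \<le> 30 / R\<^sup>2 * K" if i: "i \<in> Basis" for i
      proof -
        have "(\<integral>x. bump_dd i R x * Phi x t \<partial>lborel) \<le> (\<integral>x. 30 / R\<^sup>2 * Phi x t \<partial>lborel)"
          using bump_dd_bound[OF R i] Phi_nonneg[OF t]
          by (intro integral_mono' integrable_mult_right Phi_integral(1)[OF t] mult_right_mono mult_nonneg_nonneg)
             (auto simp: abs_le_iff)
        also have "\<dots> \<le> 30 / R\<^sup>2 * K" using Phi_K[OF t] by (auto intro!: mult_left_mono divide_right_mono)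
        finally show ?thesis .
      qed
      then have "(\<Sum>i\<in>Basis. \<integral>x. bump_dd i R x * Phi x t \<partial>lborel) \<le> real DIM('a) * (30 / R\<^sup>2 * K)"
        by (rule sum_bounded_above)
      then show "indicator {a..b} t * (\<Sum>i\<in>Basis. \<integral>x. bump_dd i R x * Phi x t \<partial>lborel)
        \<le> indicator {a..b} t * (real DIM('a) * (30 / R\<^sup>2) * K)" by (auto split: split_indicator)
    qed auto
  qed
  also have "\<dots> = (b - a) * (real DIM('a) * (30 / R\<^sup>2) * K)" using ab by simp
  finally have lK: "(\<integral>z. l z \<partial>lborel) \<le> (b - a) * (real DIM('a) * (30 / R\<^sup>2) * K)" .
  have ilq: "integrable lborel (\<lambda>z. l z - q z)" using il iq by auto
  have "(\<integral>z. l z - q z \<partial>lborel) = (\<integral>x. (\<integral>t. l (x, t) - q (x, t) \<partial>lborel) \<partial>lborel)"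
    using lborel_pair.integral_fst[of "\<lambda>x t. l (x, t) - q (x, t)"] ilq by (simp add: pair case_prod_unfold)
  also have "\<dots> = (\<integral>x. bump R x ^ 3 * Phi x b - bump R x ^ 3 * Phi x a \<partial>lborel)"
  proof (intro Bochner_Integration.integral_cong refl)
    fix x :: 'a
    have "(\<integral>t. indicator {a..b} t *\<^sub>R (L x t - Q x t) \<partial>lborel) = Phi x b - Phi x a"
    proof (rule integral_FTC_atLeastAtMost[OF ab(2)])
      fix t assume "a \<le> t" "t \<le> b"
      then show "((\<lambda>t. Phi x t) has_vector_derivative L x t - Q x t) (at t within {a..b})"
        using Phi_has_derivative_time[of t x] ab
        by (auto simp: L_def has_real_derivative_iff_has_vector_derivative intro: has_vector_derivative_at_within)
    next
      have "continuous_on {a..b} (\<lambda>t. (\<lambda>z. L (fst z) (snd z) - Q (fst z) (snd z)) (x, t))"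
        by (rule continuous_on_compose2[OF continuous_on_diff[OF cont_L cont_Q]]) (use ab in \<open>auto intro!: continuous_intros\<close>)
      then show "continuous_on {a..b} (\<lambda>t. L x t - Q x t)" by simp
    qed
    moreover have "(\<lambda>t. l (x, t) - q (x, t)) = (\<lambda>t. bump R x ^ 3 * (indicator {a..b} t *\<^sub>R (L x t - Q x t)))"
      by (auto simp: l_def q_def algebra_simps fun_eq_iff)
    ultimately show "(\<integral>t. l (x, t) - q (x, t) \<partial>lborel) = bump R x ^ 3 * Phi x b - bump R x ^ 3 * Phi x a"
      by (simp only: integral_mult_right_zero right_diff_distrib)
  qed
  also have "\<dots> = (\<integral>x. bump R x ^ 3 * Phi x b \<partial>lborel) - (\<integral>x. bump R x ^ 3 * Phi x a \<partial>lborel)"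
    using ab by (intro Bochner_Integration.integral_diff iPhi) auto
  finally have eq: "(\<integral>z. l z - q z \<partial>lborel) = (\<integral>x. bump R x ^ 3 * Phi x b \<partial>lborel) - (\<integral>x. bump R x ^ 3 * Phi x a \<partial>lborel)" .
  have "0 - K \<le> (\<integral>x. bump R x ^ 3 * Phi x b \<partial>lborel) - (\<integral>x. bump R x ^ 3 * Phi x a \<partial>lborel)"
  proof (intro diff_mono)
    show "0 \<le> (\<integral>x. bump R x ^ 3 * Phi x b \<partial>lborel)"
      using ab by (intro Bochner_Integration.integral_nonneg mult_nonneg_nonneg b3 Phi_nonneg) auto
    have "(\<integral>x. bump R x ^ 3 * Phi x a \<partial>lborel) \<le> (\<integral>x. Phi x a \<partial>lborel)"
      using ab Phi_nonneg[OF ab(1)] b3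
      by (intro integral_mono iPhi Phi_integral(1)) (auto intro!: mult_left_le_one_le)
    also have "\<dots> \<le> K" by (rule Phi_K[OF ab(1)])
    finally show "(\<integral>x. bump R x ^ 3 * Phi x a \<partial>lborel) \<le> K" .
  qed
  then have "- K \<le> (\<integral>z. l z \<partial>lborel) - (\<integral>z. q z \<partial>lborel)"
    unfolding eq[symmetric] using il iq by simp
  then show "(\<integral>z. q z \<partial>lborel) \<le> K + (b - a) * (real DIM('a) * (30 / R\<^sup>2) * K)"
    using lK by linarith
qed

text \<open>
  The cutoff is removed by Fatou's lemma, the error in \<open>energy\<close> being of order \<open>1 / R\<^sup>2\<close> for fixed \<open>a\<close>
  and \<open>b\<close>. The resulting bound no longer depends on the time interval.
\<close>

lemma bilinear_bound:
  assumes ab: "0 < a" "a \<le> b" and i: "i \<in> Basis" and j: "j \<in> Basis"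
  shows "(\<integral>\<^sup>+z. ennreal (indicator {a..b} (snd z) * \<bar>Fd i (fst z) (snd z) * Gd j (fst z) (snd z)\<bar>) \<partial>lborel) \<le> ennreal K"
proof -
  define h where "h z = indicator {a..b} (snd z) * \<bar>Fd i (fst z) (snd z) * Gd j (fst z) (snd z)\<bar>" for z
  define u where "u n z = ennreal (bump (real (Suc n)) (fst z) ^ 3 * h z)" for n z
  have h0: "0 \<le> h z" for z by (auto simp: h_def)
  have [measurable]: "h \<in> borel_measurable borel"
  proof -
    have "(\<lambda>z. indicator (UNIV \<times> {a..b}) z *\<^sub>R \<bar>Fd i (fst z) (snd z) * Gd j (fst z) (snd z)\<bar>) \<in> borel_measurable borel"
      using ab by (intro borel_measurable_continuous_on_indicator continuous_on_rabs continuous_on_mult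
        continuous_on_subset[OF cont_Fd[OF i]] continuous_on_subset[OF cont_Gd[OF j]]) (auto intro!: borel_closed closed_Times)
    also have "(\<lambda>z. indicator (UNIV \<times> {a..b}) z *\<^sub>R \<bar>Fd i (fst z) (snd z) * Gd j (fst z) (snd z)\<bar>) = h"
      by (auto simp: h_def fun_eq_iff split: split_indicator)
    finally show ?thesis .
  qed
  have bm [measurable]: "(\<lambda>z :: 'a \<times> real. bump R (fst z)) \<in> borel_measurable borel" for R
    by (intro borel_measurable_continuous_onI continuous_on_compose2[OF continuous_bump[of UNIV]]) (auto intro!: continuous_intros)
  have um: "u n \<in> borel_measurable lborel" for n unfolding u_def by measurable
  have lim: "(\<lambda>n. u n z) \<longlonglongrightarrow> ennreal (h z)" for z
  proof -
    have "(\<lambda>n. (norm (fst z))\<^sup>2 / (real (Suc n))\<^sup>2) \<longlonglongrightarrow> 0" by real_asymp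
    then have "(\<lambda>n. max 0 (1 - (norm (fst z))\<^sup>2 / (real (Suc n))\<^sup>2) ^ 3 * h z) \<longlonglongrightarrow> max 0 (1 - 0) ^ 3 * h z"
      by (intro tendsto_intros)
    then show ?thesis unfolding u_def bump_def by (intro tendsto_ennrealI) simp
  qed
  define c where "c n = K + (b - a) * (real DIM('a) * (30 / (real (Suc n))\<^sup>2) * K)" for n
  have bound: "(\<integral>\<^sup>+z. u n z \<partial>lborel) \<le> ennreal (c n)" for n
  proof -
    note e = energy[OF ab, of "real (Suc n)"]
    let ?q = "\<lambda>z. indicator {a..b} (snd z) * (bump (real (Suc n)) (fst z) ^ 3 * Q (fst z) (snd z))"
    \<comment> \<open>The mixed products are dominated by the dissipation \<open>Q\<close> that the energy estimate controls.\<close>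
    have le: "bump (real (Suc n)) (fst z) ^ 3 * h z \<le> ?q z" for z
    proof (cases "snd z \<in> {a..b}")
      case True
      then have "0 < snd z" using ab by auto
      from Q_lower[OF this i j, of "fst z"] have "h z \<le> Q (fst z) (snd z)" using True by (simp add: h_def)
      then show ?thesis using True bump_nonneg[of "real (Suc n)" "fst z"] by (auto intro!: mult_left_mono)
    qed (simp add: h_def)
    have q0: "0 \<le> ?q z" for z using le[of z] h0[of z] bump_nonneg[of "real (Suc n)" "fst z"]
      by (meson mult_nonneg_nonneg order_trans zero_le_power)
    have "(\<integral>\<^sup>+z. u n z \<partial>lborel) \<le> (\<integral>\<^sup>+z. ennreal (?q z) \<partial>lborel)"
      unfolding u_def by (intro nn_integral_mono ennreal_leI le)
    also have "\<dots> = ennreal (\<integral>z. ?q z \<partial>lborel)"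
      using e(1) q0 by (intro nn_integral_eq_integral) auto
    also have "\<dots> \<le> ennreal (c n)" unfolding c_def using e(2) by (intro ennreal_leI) auto
    finally show ?thesis .
  qed
  have "c \<longlonglongrightarrow> K"
  proof -
    have "(\<lambda>n. K + (b - a) * (real DIM('a) * (30 / (real (Suc n))\<^sup>2) * K)) \<longlonglongrightarrow> K + (b - a) * (real DIM('a) * 0 * K)"
      by (intro tendsto_intros) real_asymp
    then show ?thesis by (simp add: c_def[abs_def])
  qed
  then have climit: "(\<lambda>n. ennreal (c n)) \<longlonglongrightarrow> ennreal K" by (rule tendsto_ennrealI)
  have "(\<integral>\<^sup>+z. ennreal (h z) \<partial>lborel) = (\<integral>\<^sup>+z. liminf (\<lambda>n. u n z) \<partial>lborel)"
    using lim_imp_Liminf[OF sequentially_bot lim] by simp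
  also have "\<dots> \<le> liminf (\<lambda>n. \<integral>\<^sup>+z. u n z \<partial>lborel)" by (rule nn_integral_liminf[OF um])
  also have "\<dots> \<le> liminf (\<lambda>n. ennreal (c n))" by (intro Liminf_mono always_eventually allI bound)
  also have "\<dots> = ennreal K" by (rule lim_imp_Liminf[OF sequentially_bot climit])
  finally show ?thesis unfolding h_def .
qed

end

lemma bilinear_embedding:
  fixes f g :: "'a::euclidean_space \<Rightarrow> real"
  assumes s: "1 < s" "s < 2"
    and f: "f \<in> borel_measurable borel" "\<And>x. 0 < f x" "integrable lborel (\<lambda>x. f x powr s)"
    and g: "g \<in> borel_measurable borel" "\<And>x. \<bar>g x\<bar> \<le> f x powr (s - 1)"
    and ab: "0 < a" "a \<le> b" and ij: "i \<in> Basis" "j \<in> Basis"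
  shows "(\<integral>\<^sup>+z. ennreal (indicator {a..b} (snd z) * \<bar>conv (heat_d i) f (fst z) (snd z) * conv (heat_d j) g (fst z) (snd z)\<bar>) \<partial>lborel)
     \<le> ennreal ((bellman_const s + 1) * (\<integral>x. f x powr s \<partial>lborel))"
proof -
  interpret heat_pair f g s by unfold_locales (use assms in auto)
  show ?thesis using bilinear_bound[OF ab ij] unfolding K_def Fd_def Gd_def .
qed

section \<open>Transferring derivatives between two heat kernels\<close>

lemma gaussian_kernel_integral_derivative:
  assumes \<kappa>: "gaussian_kernel \<kappa>" and \<kappa>': "gaussian_kernel \<kappa>'" and t: "0 < t" and e: "norm e \<le> 1"
    and deriv: "\<And>z. ((\<lambda>h. \<kappa> t (z + h *\<^sub>R e)) has_real_derivative \<kappa>' t z) (at 0)"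
  shows "(\<integral>z. \<kappa>' t z \<partial>lborel) = 0"
proof -
  obtain M d where M: "0 < M" "0 < d" "\<And>s z. t \<le> s \<Longrightarrow> s \<le> t \<Longrightarrow> \<bar>\<kappa>' s z\<bar> \<le> M * exp (- d * (norm z)\<^sup>2)"
    using gaussian_kernelE[OF \<kappa>' t order_refl] by blast
  show ?thesis
  proof (rule integral_directional_derivative_eq_0(2)[OF gaussian_kernel_integrable[OF \<kappa> t] deriv])
    show "integrable lborel (\<lambda>x. M * (exp d * exp (- (d / 2) * (norm (x - 0))\<^sup>2)))"
      using integrable_gaussian[of "d / 2"] M by (intro integrable_mult_right) auto
    fix x and h :: real assume h: "0 \<le> h" "h \<le> 1"
    have "norm (x + h *\<^sub>R e - x) \<le> 1" using h e by (auto intro!: mult_le_one)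
    then have n1: "(norm (x + h *\<^sub>R e - x))\<^sup>2 \<le> 1" by (intro power_le_one) auto
    have "exp (- d * (norm (x + h *\<^sub>R e - 0))\<^sup>2) \<le> exp (d * (norm (x + h *\<^sub>R e - x))\<^sup>2) * exp (- (d / 2) * (norm (x - 0))\<^sup>2)"
      using M by (intro gaussian_shift_bound) auto
    also have "\<dots> \<le> exp d * exp (- (d / 2) * (norm (x - 0))\<^sup>2)"
      using M n1 by (intro mult_right_mono) auto
    finally have "M * exp (- d * (norm (x + h *\<^sub>R e))\<^sup>2) \<le> M * (exp d * exp (- (d / 2) * (norm (x - 0))\<^sup>2))"
      using M by (intro mult_left_mono) auto
    then show "\<bar>\<kappa>' t (x + h *\<^sub>R e)\<bar> \<le> M * (exp d * exp (- (d / 2) * (norm (x - 0))\<^sup>2))"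
      using M(3)[of t "x + h *\<^sub>R e"] by simp
  qed
qed

lemma heat_moments:
  fixes i j :: "'a::euclidean_space"
  assumes t: "0 < t" and i: "i \<in> Basis" and j: "j \<in> Basis"
  shows "(\<integral>z. (z \<bullet> i) * heat t z \<partial>lborel) = 0"
    and "(\<integral>z. (z \<bullet> i) * ((z \<bullet> j) * heat t z) \<partial>lborel) = 2 * t * (i \<bullet> j)"
    and "integrable lborel (\<lambda>z. (z \<bullet> i) * heat t z)"
    and "integrable lborel (\<lambda>z. (z \<bullet> i) * ((z \<bullet> j) * heat t z))"
proof -
  have ni: "norm i \<le> 1" "norm j \<le> 1" using i j by auto
  have "(\<integral>z. heat_d i t z \<partial>lborel) = 0"
    by (rule gaussian_kernel_integral_derivative[OF gaussian_kernel_heat gaussian_kernel_heat_d[OF i] t ni(1) heat_has_derivative_space[OF t i]])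
  then show "(\<integral>z. (z \<bullet> i) * heat t z \<partial>lborel) = 0"
    unfolding heat_d_def using t by simp
  have "gaussian_kernel (\<lambda>t z::'a. (z \<bullet> i) * heat t z)"
    by (intro gaussian_kernel_coord gaussian_kernel_heat i)
  from gaussian_kernel_integrable[OF this t] show "integrable lborel (\<lambda>z. (z \<bullet> i) * heat t z)" .
  have "gaussian_kernel (\<lambda>t z::'a. (z \<bullet> i) * ((z \<bullet> j) * heat t z))"
    by (intro gaussian_kernel_coord gaussian_kernel_heat i j)
  from gaussian_kernel_integrable[OF this t] show i2: "integrable lborel (\<lambda>z. (z \<bullet> i) * ((z \<bullet> j) * heat t z))" .
  have i0: "integrable lborel (heat t :: 'a \<Rightarrow> real)" by (rule gaussian_kernel_integrable[OF gaussian_kernel_heat t])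
  have "(\<integral>z. heat_dd i j t z \<partial>lborel) = 0"
    by (rule gaussian_kernel_integral_derivative[OF gaussian_kernel_heat_d[OF i] gaussian_kernel_heat_dd[OF i j] t ni(2) heat_d_has_derivative_space[OF t i j]])
  then have "1 / (4 * t\<^sup>2) * (\<integral>z. (z \<bullet> i) * ((z \<bullet> j) * heat t z) \<partial>lborel) - (i \<bullet> j) / (2 * t) = 0"
    unfolding heat_dd_def using i2 i0 by (simp add: integral_heat[OF t])
  then show "(\<integral>z. (z \<bullet> i) * ((z \<bullet> j) * heat t z) \<partial>lborel) = 2 * t * (i \<bullet> j)"
    using t by (simp add: field_simps power2_eq_square)
qed

text \<open>
  The parallelogram law: the product of two Gaussians is a Gaussian about the midpoint of their
  centres.
\<close>

lemma heat_product:
  fixes x y z :: "'a::euclidean_space"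
  assumes t: "0 < t"
  shows "heat t (z - x) * heat t (z - y) = heat (2 * t) (y - x) * heat (t / 2) (z - (1 / 2) *\<^sub>R (x + y))"
proof -
  define c where "c = (\<integral>x. exp (- (norm (x :: 'a))\<^sup>2 / 4) \<partial>lborel)"
  have par: "(norm (z - x))\<^sup>2 + (norm (z - y))\<^sup>2 = 2 * (norm (z - (1 / 2) *\<^sub>R (x + y)))\<^sup>2 + (norm (y - x))\<^sup>2 / 2"
    unfolding power2_norm_eq_inner
    by (simp add: inner_simps inner_commute algebra_simps) (simp add: field_simps)
  have e: "- (norm (z - x))\<^sup>2 / (4 * t) + - (norm (z - y))\<^sup>2 / (4 * t)
      = - (norm (y - x))\<^sup>2 / (4 * (2 * t)) + - (norm (z - (1 / 2) *\<^sub>R (x + y)))\<^sup>2 / (4 * (t / 2))"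
  proof -
    have "- (norm (z - x))\<^sup>2 / (4 * t) + - (norm (z - y))\<^sup>2 / (4 * t) = - ((norm (z - x))\<^sup>2 + (norm (z - y))\<^sup>2) / (4 * t)"
      by (simp add: add_divide_distrib diff_divide_distrib)
    also have "\<dots> = - (norm (y - x))\<^sup>2 / (4 * (2 * t)) + - (norm (z - (1 / 2) *\<^sub>R (x + y)))\<^sup>2 / (4 * (t / 2))"
      unfolding par using t by (simp add: field_simps)
    finally show ?thesis .
  qed
  have p: "t powr (- (real DIM('a) / 2)) * t powr (- (real DIM('a) / 2)) = (2 * t) powr (- (real DIM('a) / 2)) * (t / 2) powr (- (real DIM('a) / 2))"
    using t by (simp add: powr_mult[symmetric])
  have "heat t (z - x) * heat t (z - y) =
      (t powr (- (real DIM('a) / 2)) * t powr (- (real DIM('a) / 2))) * exp (- (norm (z - x))\<^sup>2 / (4 * t) + - (norm (z - y))\<^sup>2 / (4 * t)) / (c * c)"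
    unfolding heat_def c_def[symmetric] exp_add by simp
  also have "\<dots> = heat (2 * t) (y - x) * heat (t / 2) (z - (1 / 2) *\<^sub>R (x + y))"
    unfolding heat_def c_def[symmetric] e p exp_add by simp
  finally show ?thesis .
qed

text \<open>
  The formula \<open>k\<^sub>2\<^sub>t = k\<^sub>t * k\<^sub>t\<close> with one derivative on each factor. It is computed from
  \<open>heat_product\<close> and the second moments of the Gaussian about the midpoint.
\<close>

lemma heat_dd_semigroup:
  fixes x y :: "'a::euclidean_space"
  assumes t: "0 < t" and i: "i \<in> Basis" and j: "j \<in> Basis"
  shows "(\<integral>z. heat_d i t (z - x) * heat_d j t (z - y) \<partial>lborel) = - heat_dd i j (2 * t) (y - x)"
proof -
  define m d where "m = (1 / 2) *\<^sub>R (x + y)" and "d = y - x"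
  define k where "k z = heat (t / 2) z" for z :: 'a
  have t2: "0 < t / 2" using t by simp
  have mx: "m + z - x = z + (1/2) *\<^sub>R d" "m + z - y = z - (1/2) *\<^sub>R d" for z
    by (auto simp: m_def d_def algebra_simps) (simp_all add: scaleR_2[symmetric] algebra_simps flip: scaleR_left_distrib)?
  have "(\<integral>z. heat_d i t (z - x) * heat_d j t (z - y) \<partial>lborel)
      = (\<integral>z. heat_d i t (m + z - x) * heat_d j t (m + z - y) \<partial>lborel)"
    using lborel_integral_affine[of "\<lambda>z. heat_d i t (z - x) * heat_d j t (z - y)" 1 m]
      gaussian_kernel_measurable[OF gaussian_kernel_heat_d[OF i] t] gaussian_kernel_measurable[OF gaussian_kernel_heat_d[OF j] t]
    by simp
  also have "\<dots> = (\<integral>z. 1 / (4 * t\<^sup>2) * heat (2 * t) d * ((z \<bullet> i) * ((z \<bullet> j) * k z) - (d \<bullet> j) / 2 * ((z \<bullet> i) * k z)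
      + (d \<bullet> i) / 2 * ((z \<bullet> j) * k z) - (d \<bullet> i) * (d \<bullet> j) / 4 * k z) \<partial>lborel)"
  proof (intro Bochner_Integration.integral_cong refl)
    fix z
    have "heat_d i t (m + z - x) * heat_d j t (m + z - y)
        = 1 / (4 * t\<^sup>2) * ((z \<bullet> i + (d \<bullet> i) / 2) * (z \<bullet> j - (d \<bullet> j) / 2)) * (heat t (m + z - x) * heat t (m + z - y))"
      unfolding heat_d_def by (simp add: mx inner_simps power2_eq_square)
    also have "heat t (m + z - x) * heat t (m + z - y) = heat (2 * t) d * k z"
      using heat_product[OF t, of "m + z" x y] by (simp add: m_def d_def k_def)
    finally show "heat_d i t (m + z - x) * heat_d j t (m + z - y) = 1 / (4 * t\<^sup>2) * heat (2 * t) d * ((z \<bullet> i) * ((z \<bullet> j) * k z) - (d \<bullet> j) / 2 * ((z \<bullet> i) * k z)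
      + (d \<bullet> i) / 2 * ((z \<bullet> j) * k z) - (d \<bullet> i) * (d \<bullet> j) / 4 * k z)"
      by (simp only:) (simp add: algebra_simps)
  qed
  also have "\<dots> = 1 / (4 * t\<^sup>2) * heat (2 * t) d * (t * (i \<bullet> j) - (d \<bullet> i) * (d \<bullet> j) / 4)"
  proof -
    note mo = heat_moments[OF t2 i j] heat_moments[OF t2 j i]
    have i0: "integrable lborel k" unfolding k_def by (rule gaussian_kernel_integrable[OF gaussian_kernel_heat t2])
    have k1: "integral\<^sup>L lborel k = 1" unfolding k_def by (rule integral_heat[OF t2])
    show ?thesis using mo i0 unfolding k_def[symmetric] by (simp add: k1)
  qed
  also have "\<dots> = - heat_dd i j (2 * t) d"
    unfolding heat_dd_def using t by (simp add: field_simps power2_eq_square)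
  finally show ?thesis unfolding d_def .
qed

lemma conv_abs_bounded:
  assumes \<kappa>: "gaussian_kernel \<kappa>" and f: "tame f" and t: "0 < t"
  obtains C where "0 < C" "\<And>x. (\<integral>y. \<bar>\<kappa> t (x - y) * f y\<bar> \<partial>lborel) \<le> C"
proof -
  obtain D where D: "integrable lborel D" "\<And>x. \<bar>f x\<bar> \<le> D x + 1" and [measurable]: "f \<in> borel_measurable borel"
    using f unfolding tame_def by auto
  obtain M d where M: "0 < M" "0 < d" "\<And>s z. t \<le> s \<Longrightarrow> s \<le> t \<Longrightarrow> \<bar>\<kappa> s z\<bar> \<le> M * exp (- d * (norm z)\<^sup>2)"
    using gaussian_kernelE[OF \<kappa> t order_refl] by blast
  note ik = gaussian_kernel_integrable[OF \<kappa> t]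
  have "(\<integral>y. \<bar>\<kappa> t (x - y) * f y\<bar> \<partial>lborel) \<le> M * (\<integral>y. \<bar>D y\<bar> \<partial>lborel) + (\<integral>y. \<bar>\<kappa> t y\<bar> \<partial>lborel)" for x
  proof -
    have ik2: "integrable lborel (\<lambda>y. \<bar>\<kappa> t (x - y)\<bar>)"
      by (intro integrable_abs integrable_reflect_translate ik)
    have "(\<integral>y. \<bar>\<kappa> t (x - y) * f y\<bar> \<partial>lborel) \<le> (\<integral>y. M * \<bar>D y\<bar> + \<bar>\<kappa> t (x - y)\<bar> \<partial>lborel)"
    proof (intro integral_mono)
      show "integrable lborel (\<lambda>y. \<bar>\<kappa> t (x - y) * f y\<bar>)" by (intro integrable_abs conv_integrable[OF \<kappa> f t])
      show "integrable lborel (\<lambda>y. M * \<bar>D y\<bar> + \<bar>\<kappa> t (x - y)\<bar>)" using D ik2 by auto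
      fix y
      have "M * exp (- d * (norm (x - y))\<^sup>2) \<le> M * 1" using M(1,2) by (intro mult_left_mono) auto
      then have "\<bar>\<kappa> t (x - y)\<bar> \<le> M"
        using M(3)[of t "x - y"] by simp
      have "\<bar>\<kappa> t (x - y) * f y\<bar> \<le> \<bar>\<kappa> t (x - y)\<bar> * (\<bar>D y\<bar> + 1)"
        using D(2)[of y] unfolding abs_mult by (intro mult_left_mono) auto
      also have "\<dots> \<le> M * \<bar>D y\<bar> + \<bar>\<kappa> t (x - y)\<bar>"
        using mult_right_mono[OF \<open>\<bar>\<kappa> t (x - y)\<bar> \<le> M\<close>, of "\<bar>D y\<bar>"] by (simp add: algebra_simps)
      finally show "\<bar>\<kappa> t (x - y) * f y\<bar> \<le> M * \<bar>D y\<bar> + \<bar>\<kappa> t (x - y)\<bar>" .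
    qed
    also have "\<dots> = M * (\<integral>y. \<bar>D y\<bar> \<partial>lborel) + (\<integral>y. \<bar>\<kappa> t y\<bar> \<partial>lborel)"
      using D(1) ik2 integral_reflect_translate[of "\<lambda>z. \<bar>\<kappa> t z\<bar>" x] gaussian_kernel_measurable[OF \<kappa> t] by simp
    finally show ?thesis .
  qed
  moreover have "0 < M * (\<integral>y. \<bar>D y\<bar> \<partial>lborel) + (\<integral>y. \<bar>\<kappa> t y\<bar> \<partial>lborel) + 1"
    using M by (intro add_nonneg_pos add_nonneg_nonneg mult_nonneg_nonneg Bochner_Integration.integral_nonneg) auto
  ultimately show ?thesis
    by (intro that[of "M * (\<integral>y. \<bar>D y\<bar> \<partial>lborel) + (\<integral>y. \<bar>\<kappa> t y\<bar> \<partial>lborel) + 1"]) (auto intro: add_increasing2)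
qed

lemma conv_swap:
  assumes \<kappa>: "gaussian_kernel \<kappa>" and f: "tame f" and t: "0 < t" and \<phi>: "integrable lborel \<phi>"
  shows "(\<integral>z. \<phi> z * conv \<kappa> f z t \<partial>lborel) = (\<integral>x. f x * (\<integral>z. \<kappa> t (z - x) * \<phi> z \<partial>lborel) \<partial>lborel)"
proof -
  obtain C where C: "0 < C" "\<And>x. (\<integral>y. \<bar>\<kappa> t (x - y) * f y\<bar> \<partial>lborel) \<le> C"
    using conv_abs_bounded[OF \<kappa> f t] by blast
  have [measurable]: "f \<in> borel_measurable borel" "\<phi> \<in> borel_measurable borel" "\<kappa> t \<in> borel_measurable borel"
    using f \<phi> gaussian_kernel_measurable[OF \<kappa> t] by (auto simp: tame_def)
  have ic: "integrable lborel (\<lambda>x. \<phi> z * (\<kappa> t (z - x) * f x))" for z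
    by (intro integrable_mult_right conv_integrable[OF \<kappa> f t])
  have int: "integrable (lborel \<Otimes>\<^sub>M lborel) (\<lambda>(z, x). \<phi> z * (\<kappa> t (z - x) * f x))"
  proof (rule lborel_pair.Fubini_integrable)
    show "(\<lambda>(z, x). \<phi> z * (\<kappa> t (z - x) * f x)) \<in> borel_measurable (lborel \<Otimes>\<^sub>M lborel)" by measurable
    show "AE z in lborel. integrable lborel (\<lambda>x. case (z, x) of (z, x) \<Rightarrow> \<phi> z * (\<kappa> t (z - x) * f x))"
      using ic by simp
    show "integrable lborel (\<lambda>z. \<integral>x. norm (case (z, x) of (z, x) \<Rightarrow> \<phi> z * (\<kappa> t (z - x) * f x)) \<partial>lborel)"
    proof (rule Bochner_Integration.integrable_bound)
      show "integrable lborel (\<lambda>z. C * \<phi> z)" using \<phi> by auto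
      show "(\<lambda>z. \<integral>x. norm (case (z, x) of (z, x) \<Rightarrow> \<phi> z * (\<kappa> t (z - x) * f x)) \<partial>lborel) \<in> borel_measurable lborel"
        by measurable
      show "AE z in lborel. norm (\<integral>x. norm (case (z, x) of (z, x) \<Rightarrow> \<phi> z * (\<kappa> t (z - x) * f x)) \<partial>lborel) \<le> norm (C * \<phi> z)"
      proof (rule AE_I2)
        fix z
        have "(\<integral>x. norm (\<phi> z * (\<kappa> t (z - x) * f x)) \<partial>lborel) = \<bar>\<phi> z\<bar> * (\<integral>x. \<bar>\<kappa> t (z - x) * f x\<bar> \<partial>lborel)"
          by (simp add: abs_mult)
        also have "\<dots> \<le> \<bar>\<phi> z\<bar> * C" by (intro mult_left_mono C) auto
        finally show "norm (\<integral>x. norm (case (z, x) of (z, x) \<Rightarrow> \<phi> z * (\<kappa> t (z - x) * f x)) \<partial>lborel) \<le> norm (C * \<phi> z)"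
          using C(1) by (simp add: abs_mult mult.commute)
      qed
    qed
  qed
  have "(\<integral>z. \<phi> z * conv \<kappa> f z t \<partial>lborel) = (\<integral>z. (\<integral>x. \<phi> z * (\<kappa> t (z - x) * f x) \<partial>lborel) \<partial>lborel)"
    by (simp add: conv_def)
  also have "\<dots> = (\<integral>x. (\<integral>z. \<phi> z * (\<kappa> t (z - x) * f x) \<partial>lborel) \<partial>lborel)"
    using lborel_pair.Fubini_integral[OF int] by simp
  also have "\<dots> = (\<integral>x. f x * (\<integral>z. \<kappa> t (z - x) * \<phi> z \<partial>lborel) \<partial>lborel)"
    by (intro Bochner_Integration.integral_cong refl) (simp add: mult_ac flip: integral_mult_right_zero)
  finally show ?thesis .
qed

lemma heat_d_odd: "heat_d i t (- z) = - heat_d i t z" by (simp add: heat_d_def heat_symmetric)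
lemma heat_dd_even: "heat_dd i j t (- z) = heat_dd i j t z" by (simp add: heat_dd_def heat_symmetric)

text \<open>
  Splits the two derivatives between \<open>f\<close> and \<open>g\<close>, each smoothed up to time \<open>t\<close>; this is the form in which
  the bilinear embedding applies.
\<close>

lemma integral_conv_heat_dd:
  assumes t: "0 < t" and i: "i \<in> Basis" and j: "j \<in> Basis" and f: "tame f"
    and g: "integrable lborel g" "tame g"
  shows "(\<integral>y. g y * conv (heat_dd i j) f y (2 * t) \<partial>lborel) = - (\<integral>z. conv (heat_d i) f z t * conv (heat_d j) g z t \<partial>lborel)"
proof -
  note ki = gaussian_kernel_heat_d[OF i] note kj = gaussian_kernel_heat_d[OF j]
  obtain C where C: "0 < C" "\<And>x. (\<integral>y. \<bar>heat_d i t (x - y) * f y\<bar> \<partial>lborel) \<le> C"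
    using conv_abs_bounded[OF ki f t] by blast
  define A where "A z = conv (heat_d i) f z t / C" for z
  have "\<bar>conv (heat_d i) f z t\<bar> \<le> C" for z
    unfolding conv_def by (rule order_trans[OF integral_abs_bound C(2)])
  then have A: "tame A" unfolding tame_def A_def using C(1) conv_measurable[OF ki f t]
    by (auto intro!: exI[of _ "\<lambda>_. 0"])
  have odd: "heat_d j t (y - z) = - heat_d j t (z - y)" for y z
    using heat_d_odd[of j t "z - y"] by simp
  have step2: "(\<integral>z. heat_d j t (y - z) * conv (heat_d i) f z t \<partial>lborel) = conv (heat_dd i j) f y (2 * t)" for y
  proof -
    have "(\<integral>z. heat_d j t (y - z) * conv (heat_d i) f z t \<partial>lborel) = (\<integral>x. f x * (\<integral>z. heat_d i t (z - x) * heat_d j t (y - z) \<partial>lborel) \<partial>lborel)"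
      by (intro conv_swap ki f t integrable_reflect_translate gaussian_kernel_integrable kj)
    also have "\<dots> = (\<integral>x. f x * (\<integral>z. - (heat_d i t (z - x) * heat_d j t (z - y)) \<partial>lborel) \<partial>lborel)"
      by (intro Bochner_Integration.integral_cong refl arg_cong2[where f="(*)"]) (simp add: odd[of y])
    also have "\<dots> = conv (heat_dd i j) f y (2 * t)"
      unfolding conv_def by (simp add: heat_dd_semigroup[OF t i j] mult.commute)
    finally show ?thesis .
  qed
  have "(\<integral>y. g y * conv (heat_dd i j) f y (2 * t) \<partial>lborel) = (\<integral>y. C * (g y * conv (heat_d j) A y t) \<partial>lborel)"
  proof (intro Bochner_Integration.integral_cong refl)
    fix y
    have "C * conv (heat_d j) A y t = conv (heat_dd i j) f y (2 * t)"
      unfolding step2[symmetric] using C(1) unfolding conv_def[of "heat_d j"] A_def by simp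
    then show "g y * conv (heat_dd i j) f y (2 * t) = C * (g y * conv (heat_d j) A y t)" by simp
  qed
  also have "\<dots> = C * (\<integral>y. g y * conv (heat_d j) A y t \<partial>lborel)" by simp
  also have "(\<integral>y. g y * conv (heat_d j) A y t \<partial>lborel) = (\<integral>x. A x * (\<integral>z. heat_d j t (z - x) * g z \<partial>lborel) \<partial>lborel)"
    by (rule conv_swap[OF kj A t g(1)])
  also have "\<dots> = (\<integral>x. A x * (\<integral>z. - (heat_d j t (x - z) * g z) \<partial>lborel) \<partial>lborel)"
  proof (intro Bochner_Integration.integral_cong refl arg_cong2[where f="(*)"])
    fix x z
    show "heat_d j t (z - x) * g z = - (heat_d j t (x - z) * g z)" using odd[of z x] by simp
  qed
  also have "\<dots> = - (\<integral>x. A x * conv (heat_d j) g x t \<partial>lborel)" by (simp add: conv_def)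
  also have "C * - (\<integral>x. A x * conv (heat_d j) g x t \<partial>lborel) = - (\<integral>x. C * (A x * conv (heat_d j) g x t) \<partial>lborel)" by simp
  also have "\<dots> = - (\<integral>z. conv (heat_d i) f z t * conv (heat_d j) g z t \<partial>lborel)"
    using C(1) by (simp add: A_def)
  finally show ?thesis .
qed

section \<open>Decay of the pressure along the heat flow\<close>

lemma powr_add_le:
  fixes u v s :: real
  assumes "0 \<le> u" "0 \<le> v" "0 \<le> s"
  shows "(u + v) powr s \<le> 2 powr s * (u powr s + v powr s)"
proof -
  have "(u + v) powr s \<le> (2 * max u v) powr s" using assms by (intro powr_mono2) auto
  also have "\<dots> = 2 powr s * (max u v) powr s" using assms by (simp add: powr_mult)
  also have "\<dots> \<le> 2 powr s * (u powr s + v powr s)" by (intro mult_left_mono) (auto simp: max_def)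
  finally show ?thesis .
qed

lemma conv_diff:
  assumes "gaussian_kernel \<kappa>" "tame f" "tame g" "0 < t"
  shows "conv \<kappa> (\<lambda>x. f x - g x) x t = conv \<kappa> f x t - conv \<kappa> g x t"
  unfolding conv_def using conv_integrable[OF assms(1,2,4), of x] conv_integrable[OF assms(1,3,4), of x]
  by (simp add: right_diff_distrib)

lemma conv_measurable_joint:
  assumes "gaussian_kernel \<kappa>" "tame f" "0 < a"
  shows "(\<lambda>z. indicator {a..b} (snd z) * conv \<kappa> f (fst z) (snd z)) \<in> borel_measurable borel"
proof -
  have "(\<lambda>z. indicator (UNIV \<times> {a..b}) z *\<^sub>R conv \<kappa> f (fst z) (snd z)) \<in> borel_measurable borel"
    using conv_continuous[OF assms(1,2)] assms(3)
    by (intro borel_measurable_continuous_on_indicator)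
       (auto intro!: borel_closed closed_Times elim!: continuous_on_subset simp: case_prod_unfold)
  also have "(\<lambda>z. indicator (UNIV \<times> {a..b}) z *\<^sub>R conv \<kappa> f (fst z) (snd z)) = (\<lambda>z. indicator {a..b} (snd z) * conv \<kappa> f (fst z) (snd z))"
    by (auto simp: fun_eq_iff split: split_indicator)
  finally show ?thesis .
qed

text \<open>
  The function \<open>F\<close> has a sign and need not dominate the weight. Both defects are repaired by adding
  \<open>h = (1 + \<bar>x\<bar>)\<^sup>-\<^sup>1\<^sup>/\<^sup>(\<^sup>s\<^sup>-\<^sup>1\<^sup>)\<close>, which is in \<open>L\<^sup>s\<close> because \<open>s / (s - 1)\<close> exceeds the dimension, to the
  positive and to the negative part of \<open>F\<close>: these sums are positive, have difference \<open>F\<close>, and dominate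
  every \<open>g\<close> below the weight.
\<close>

lemma bilinear_embedding_weight:
  fixes F :: "'a::euclidean_space \<Rightarrow> real"
  assumes s: "1 < s" "s < 2" "real DIM('a) < s / (s - 1)"
    and F [measurable]: "F \<in> borel_measurable borel" and Fs: "integrable lborel (\<lambda>x. \<bar>F x\<bar> powr s)"
    and ij: "i \<in> Basis" "j \<in> Basis"
  obtains C where "0 \<le> C" and "\<And>g a b. g \<in> borel_measurable borel \<Longrightarrow> (\<And>x. \<bar>g x\<bar> \<le> 1 / (1 + norm x)) \<Longrightarrow> 0 < a \<Longrightarrow> a \<le> b \<Longrightarrow>
    (\<integral>\<^sup>+z. ennreal (indicator {a..b} (snd z) * \<bar>conv (heat_d i) F (fst z) (snd z) * conv (heat_d j) g (fst z) (snd z)\<bar>) \<partial>lborel) \<le> ennreal C"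
proof -
  define h where "h x = (1 + norm x) powr - (1 / (s - 1))" for x :: 'a
  have n1: "0 < 1 + norm x" for x :: 'a by (simp add: add_pos_nonneg)
  have h0: "0 < h x" for x using n1[of x] unfolding h_def by simp
  have hs: "h x powr (s - 1) = 1 / (1 + norm x)" for x
  proof -
    have "h x powr (s - 1) = (1 + norm x) powr - 1" using s by (simp add: h_def powr_powr)
    also have "\<dots> = 1 / (1 + norm x)" using n1[of x] by (subst powr_minus_divide) simp
    finally show ?thesis .
  qed
  have [measurable]: "h \<in> borel_measurable borel" unfolding h_def by measurable
  have "h x powr s = (1 + norm x) powr - (s / (s - 1))" for x
    by (simp add: h_def powr_powr)
  then have ihs: "integrable lborel (\<lambda>x. h x powr s)"
    using integrable_power_decay[OF s(3)] by simp
  define f1 f2 where "f1 x = max 0 (F x) + h x" and "f2 x = max 0 (- F x) + h x" for x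
  have f_props: "f \<in> borel_measurable borel" "\<And>x. 0 < f x" "integrable lborel (\<lambda>x. f x powr s)" "tame f" "\<And>x. h x \<le> f x"
    if "f = f1 \<or> f = f2" for f
  proof -
    show fm [measurable]: "f \<in> borel_measurable borel" using that by (auto simp: f1_def[abs_def] f2_def[abs_def])
    show le: "h x \<le> f x" for x using that by (auto simp: f1_def f2_def)
    show pos: "0 < f x" for x using le[of x] h0[of x] by linarith
    have up: "f x \<le> \<bar>F x\<bar> + h x" for x using that by (auto simp: f1_def f2_def)
    show i: "integrable lborel (\<lambda>x. f x powr s)"
    proof (rule Bochner_Integration.integrable_bound)
      show "integrable lborel (\<lambda>x. 2 powr s * (\<bar>F x\<bar> powr s + h x powr s))" using Fs ihs by auto
      show "AE x in lborel. norm (f x powr s) \<le> norm (2 powr s * (\<bar>F x\<bar> powr s + h x powr s))"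
      proof (rule AE_I2)
        fix x
        have "f x powr s \<le> (\<bar>F x\<bar> + h x) powr s" using up pos[of x] s by (intro powr_mono2) auto
        also have "\<dots> \<le> 2 powr s * (\<bar>F x\<bar> powr s + h x powr s)" using h0[of x] s by (intro powr_add_le) auto
        finally show "norm (f x powr s) \<le> norm (2 powr s * (\<bar>F x\<bar> powr s + h x powr s))" by (simp add: abs_mult)
      qed
    qed measurable
    show "tame f" using i pos s by (intro tame_powr_integrable[where s=s]) (auto simp: abs_of_pos)
  qed
  note p1 = f_props[of f1, simplified] and p2 = f_props[of f2, simplified]
  define C where "C = (bellman_const s + 1) * (\<integral>x. f1 x powr s \<partial>lborel) + (bellman_const s + 1) * (\<integral>x. f2 x powr s \<partial>lborel)"
  have bc: "0 \<le> bellman_const s + 1" using s by (simp add: bellman_const_def)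
  have C0: "0 \<le> (bellman_const s + 1) * (\<integral>x. f1 x powr s \<partial>lborel)" "0 \<le> (bellman_const s + 1) * (\<integral>x. f2 x powr s \<partial>lborel)"
    using bc by (auto intro!: mult_nonneg_nonneg Bochner_Integration.integral_nonneg)
  show ?thesis
  proof (rule that[of C])
    show "0 \<le> C" using C0 by (simp add: C_def)
    fix g :: "'a \<Rightarrow> real" and a b :: real
    assume [measurable]: "g \<in> borel_measurable borel" and g: "\<And>x. \<bar>g x\<bar> \<le> 1 / (1 + norm x)" and ab: "0 < a" "a \<le> b"
    have gf: "\<bar>g x\<bar> \<le> f x powr (s - 1)" if "f = f1 \<or> f = f2" for f x
    proof -
      have "h x powr (s - 1) \<le> f x powr (s - 1)" using f_props(5)[OF that, of x] h0[of x] s by (intro powr_mono2) auto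
      then show ?thesis using g[of x] hs[of x] by simp
    qed
    have "tame g"
    proof -
      have "\<bar>g x\<bar> \<le> 0 + 1" for x
      proof -
        have "1 / (1 + norm x) \<le> 1" using n1[of x] by (subst divide_le_eq_1_pos) auto
        then show ?thesis using g[of x] by simp
      qed
      then show ?thesis unfolding tame_def by (auto intro!: exI[of _ "\<lambda>_. 0"])
    qed
    let ?I = "\<lambda>f z. indicator {a..b} (snd z) * \<bar>conv (heat_d i) f (fst z) (snd z) * conv (heat_d j) g (fst z) (snd z)\<bar>"
    have meas: "(\<lambda>z. ennreal (?I f z)) \<in> borel_measurable lborel" if "tame f" for f
    proof -
      have "(\<lambda>z. ennreal \<bar>(indicator {a..b} (snd z) * conv (heat_d i) f (fst z) (snd z)) * (indicator {a..b} (snd z) * conv (heat_d j) g (fst z) (snd z))\<bar>) \<in> borel_measurable lborel"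
        using conv_measurable_joint[OF gaussian_kernel_heat_d[OF ij(1)] that ab(1), of b]
          conv_measurable_joint[OF gaussian_kernel_heat_d[OF ij(2)] \<open>tame g\<close> ab(1), of b] by simp
      also have "(\<lambda>z. ennreal \<bar>(indicator {a..b} (snd z) * conv (heat_d i) f (fst z) (snd z)) * (indicator {a..b} (snd z) * conv (heat_d j) g (fst z) (snd z))\<bar>) = (\<lambda>z. ennreal (?I f z))"
        by (auto simp: fun_eq_iff split: split_indicator)
      finally show ?thesis .
    qed
    have le: "?I F z \<le> ?I f1 z + ?I f2 z" for z
    proof (cases "snd z \<in> {a..b}")
      case True
      then have "0 < snd z" using ab by auto
      moreover have "F = (\<lambda>x. f1 x - f2 x)" by (auto simp: f1_def f2_def fun_eq_iff max_def)
      ultimately have "conv (heat_d i) F (fst z) (snd z) = conv (heat_d i) f1 (fst z) (snd z) - conv (heat_d i) f2 (fst z) (snd z)"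
        using conv_diff[OF gaussian_kernel_heat_d[OF ij(1)] p1(4) p2(4), of "snd z" "fst z"] by simp
      then have "\<bar>conv (heat_d i) F (fst z) (snd z) * c\<bar> \<le> \<bar>conv (heat_d i) f1 (fst z) (snd z) * c\<bar> + \<bar>conv (heat_d i) f2 (fst z) (snd z) * c\<bar>" for c
        by (simp add: left_diff_distrib abs_triangle_ineq4)
      then show ?thesis using True by simp
    qed simp
    have "(\<integral>\<^sup>+z. ennreal (?I F z) \<partial>lborel) \<le> (\<integral>\<^sup>+z. ennreal (?I f1 z) + ennreal (?I f2 z) \<partial>lborel)"
      using le by (intro nn_integral_mono) (auto simp flip: ennreal_plus intro!: ennreal_leI)
    also have "\<dots> = (\<integral>\<^sup>+z. ennreal (?I f1 z) \<partial>lborel) + (\<integral>\<^sup>+z. ennreal (?I f2 z) \<partial>lborel)"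
      by (intro nn_integral_add meas p1 p2)
    also have "\<dots> \<le> ennreal ((bellman_const s + 1) * (\<integral>x. f1 x powr s \<partial>lborel)) + ennreal ((bellman_const s + 1) * (\<integral>x. f2 x powr s \<partial>lborel))"
      using s ij ab p1 p2 gf by (intro add_mono bilinear_embedding) auto
    also have "\<dots> = ennreal C" using C0 by (simp add: C_def flip: ennreal_plus)
    finally show "(\<integral>\<^sup>+z. ennreal (?I F z) \<partial>lborel) \<le> ennreal C" .
  qed
qed

lemma heat_flow_pairing:
  fixes f g :: "'a::euclidean_space \<Rightarrow> real"
  assumes g: "continuous_on UNIV g" and gR: "\<And>x. R \<le> norm x \<Longrightarrow> g x = 0"
    and g_tame: "tame g" and f: "tame f" and ij: "i \<in> Basis" "j \<in> Basis" and ab: "0 < a" "a \<le> b"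
    and C: "0 \<le> C" "(\<integral>\<^sup>+z. ennreal (indicator {a..b} (snd z) * \<bar>conv (heat_d i) f (fst z) (snd z) * conv (heat_d j) g (fst z) (snd z)\<bar>) \<partial>lborel) \<le> ennreal C"
  defines "H \<equiv> \<lambda>y t. indicator {a..b} t * (g y * conv (heat_dd i j) f y (2 * t))"
  shows "integrable lborel (\<lambda>z. H (fst z) (snd z))" and "\<bar>\<integral>z. H (fst z) (snd z) \<partial>lborel\<bar> \<le> C"
proof -
  note kij = gaussian_kernel_heat_dd[OF ij]
  define S where "S = cball (0::'a) R \<times> {a..b}"
  have S: "compact S" unfolding S_def by (auto intro!: compact_Times)
  have cg: "continuous_on S (\<lambda>z. g (fst z))"
    by (rule continuous_on_compose2[OF g]) (auto intro!: continuous_intros)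
  have cc: "continuous_on S (\<lambda>z. conv (heat_dd i j) f (fst z) (2 * snd z))"
  proof -
    have "continuous_on S (\<lambda>z. (\<lambda>(x, t). conv (heat_dd i j) f x t) (fst z, 2 * snd z))"
      by (rule continuous_on_compose2[OF conv_continuous[OF kij f]]) (use ab in \<open>auto intro!: continuous_intros simp: S_def\<close>)
    then show ?thesis by simp
  qed
  have "integrable lborel (\<lambda>z. indicator S z *\<^sub>R (g (fst z) * conv (heat_dd i j) f (fst z) (2 * snd z)))"
    by (intro borel_integrable_compact S cont_rules cg cc)
  also have "(\<lambda>z. indicator S z *\<^sub>R (g (fst z) * conv (heat_dd i j) f (fst z) (2 * snd z))) = (\<lambda>z. H (fst z) (snd z))"
    using gR by (auto simp: fun_eq_iff H_def S_def not_le less_imp_le split: split_indicator)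
  finally show iH: "integrable lborel (\<lambda>z. H (fst z) (snd z))" .
  have ig: "integrable lborel g"
  proof -
    have "integrable lborel (\<lambda>x. indicator (cball 0 R) x *\<^sub>R g x)"
      by (intro borel_integrable_compact continuous_on_subset[OF g]) auto
    also have "(\<lambda>x. indicator (cball 0 R) x *\<^sub>R g x) = g"
      using gR by (auto simp: fun_eq_iff not_le less_imp_le split: split_indicator)
    finally show ?thesis .
  qed
  note pair = lborel_prod[where 'a='a and 'b=real, symmetric]
  let ?X = "\<lambda>z t. indicator {a..b} t * (conv (heat_d i) f z t * conv (heat_d j) g z t)"
  have Ht: "(\<integral>y. H y t \<partial>lborel) = - (\<integral>z. ?X z t \<partial>lborel)" for t
  proof (cases "t \<in> {a..b}")
    case True
    then have "0 < t" using ab by auto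
    from integral_conv_heat_dd[OF this ij f ig g_tame] show ?thesis using True by (simp add: H_def)
  qed (simp add: H_def)
  have "integrable lborel (\<lambda>t. \<integral>y. H y t \<partial>lborel)"
    using lborel_pair.integrable_snd[of H] iH by (simp add: pair case_prod_unfold)
  have Xm: "(\<lambda>z. ?X (fst z) (snd z)) \<in> borel_measurable lborel"
  proof -
    have "(\<lambda>z. (indicator {a..b} (snd z) * conv (heat_d i) f (fst z) (snd z)) * (indicator {a..b} (snd z) * conv (heat_d j) g (fst z) (snd z))) \<in> borel_measurable lborel"
      using conv_measurable_joint[OF gaussian_kernel_heat_d[OF ij(1)] f ab(1), of b]
          conv_measurable_joint[OF gaussian_kernel_heat_d[OF ij(2)] g_tame ab(1), of b] by simp
    also have "(\<lambda>z. (indicator {a..b} (snd z) * conv (heat_d i) f (fst z) (snd z)) * (indicator {a..b} (snd z) * conv (heat_d j) g (fst z) (snd z))) = (\<lambda>z. ?X (fst z) (snd z))"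
      by (auto simp: fun_eq_iff split: split_indicator)
    finally show ?thesis .
  qed
  have iX: "integrable lborel (\<lambda>z. ?X (fst z) (snd z))"
    unfolding integrable_iff_bounded using Xm C(2) by (auto simp: abs_mult intro: le_less_trans)
  have "(\<integral>z. H (fst z) (snd z) \<partial>lborel) = (\<integral>t. (\<integral>y. H y t \<partial>lborel) \<partial>lborel)"
    using lborel_pair.integral_snd[of H] iH by (simp add: pair case_prod_unfold)
  also have "\<dots> = - (\<integral>t. (\<integral>z. ?X z t \<partial>lborel) \<partial>lborel)" unfolding Ht by simp
  also have "(\<integral>t. (\<integral>z. ?X z t \<partial>lborel) \<partial>lborel) = (\<integral>z. ?X (fst z) (snd z) \<partial>lborel)"
    using lborel_pair.integral_snd[of ?X] iX by (simp add: pair case_prod_unfold)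
  finally have eq: "(\<integral>z. H (fst z) (snd z) \<partial>lborel) = - (\<integral>z. ?X (fst z) (snd z) \<partial>lborel)" .
  have "ennreal \<bar>\<integral>z. ?X (fst z) (snd z) \<partial>lborel\<bar> \<le> (\<integral>\<^sup>+z. ennreal \<bar>?X (fst z) (snd z)\<bar> \<partial>lborel)"
    using integral_norm_bound_ennreal[OF iX] by simp
  also have "\<dots> \<le> ennreal C" using C(2) by (simp add: abs_mult)
  finally show "\<bar>\<integral>z. H (fst z) (snd z) \<partial>lborel\<bar> \<le> C" using C(1) unfolding eq by simp
qed

text \<open>
  The fundamental theorem of calculus in time, with \<open>\<Delta> P\<^sub>t p\<close> replaced by second derivatives of the
  smoothed \<open>F i j\<close>. The factor \<open>2\<close> comes from running the flow at time \<open>2 t\<close>, which leaves \<open>P\<^sub>t\<close> for each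
  of the two factors.
\<close>

lemma heat_flow_increment:
  fixes p g :: "'a::euclidean_space \<Rightarrow> real" and F :: "'a \<Rightarrow> 'a \<Rightarrow> 'a \<Rightarrow> real"
  assumes p: "tame p" and g: "continuous_on UNIV g" and gR: "\<And>x. R \<le> norm x \<Longrightarrow> g x = 0" and g_tame: "tame g"
    and F: "\<And>i j. i \<in> Basis \<Longrightarrow> j \<in> Basis \<Longrightarrow> tame (F i j)" and ab: "0 < a" "a \<le> b"
    and eq: "\<And>y t. 0 < t \<Longrightarrow> (\<Sum>i\<in>Basis. conv (heat_dd i i) p y t) = - (\<Sum>i\<in>Basis. \<Sum>j\<in>Basis. conv (heat_dd i j) (F i j) y t)"
    and C: "\<And>i j. i \<in> Basis \<Longrightarrow> j \<in> Basis \<Longrightarrow> 0 \<le> C i j"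
      "\<And>i j. i \<in> Basis \<Longrightarrow> j \<in> Basis \<Longrightarrow>
      (\<integral>\<^sup>+z. ennreal (indicator {a..b} (snd z) * \<bar>conv (heat_d i) (F i j) (fst z) (snd z) * conv (heat_d j) g (fst z) (snd z)\<bar>) \<partial>lborel) \<le> ennreal (C i j)"
  shows "\<bar>(\<integral>y. g y * (conv heat p y (2 * b) - conv heat p y (2 * a)) \<partial>lborel)\<bar> \<le> 2 * (\<Sum>i\<in>Basis. \<Sum>j\<in>Basis. C i j)"
proof -
  define H where "H i j y t = indicator {a..b} t * (g y * conv (heat_dd i j) (F i j) y (2 * t))" for i j y t
  note pairing = heat_flow_pairing[where R=R, OF g gR g_tame F _ _ ab C, folded H_def]
  have iH: "integrable lborel (\<lambda>z. H i j (fst z) (snd z))" if "i \<in> Basis" "j \<in> Basis" for i j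
    using pairing(1)[OF _ that that that that] by simp
  have bH: "\<bar>\<integral>z. H i j (fst z) (snd z) \<partial>lborel\<bar> \<le> C i j" if "i \<in> Basis" "j \<in> Basis" for i j
    using pairing(2)[OF _ that that that that] by simp
  define S where "S z = (\<Sum>i\<in>Basis. \<Sum>j\<in>Basis. H i j (fst z) (snd z))" for z
  have iS: "integrable lborel S" unfolding S_def[abs_def] by (intro Bochner_Integration.integrable_sum iH)
  note pair = lborel_prod[where 'a='a and 'b=real, symmetric]
  have inner: "g y * (conv heat p y (2 * b) - conv heat p y (2 * a)) = - 2 * (\<integral>t. S (y, t) \<partial>lborel)" for y
  proof -
    let ?D = "\<lambda>t. \<Sum>i\<in>Basis. \<Sum>j\<in>Basis. conv (heat_dd i j) (F i j) y (2 * t)"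
    have "(\<integral>t. indicator {a..b} t *\<^sub>R (- 2 * ?D t) \<partial>lborel) = conv heat p y (2 * b) - conv heat p y (2 * a)"
    proof (rule integral_FTC_atLeastAtMost[OF ab(2)])
      fix t assume "a \<le> t" "t \<le> b"
      then have t: "0 < 2 * t" using ab by auto
      have "((\<lambda>t. conv heat p y t) has_real_derivative conv (\<lambda>t z. \<Sum>i\<in>Basis. heat_dd i i t (z :: 'a)) p y (2 * t)) (at (2 * t))"
        by (intro conv_has_derivative_time gaussian_kernel_heat gaussian_kernel_sum gaussian_kernel_heat_dd p t heat_has_derivative_time) auto
      also have "conv (\<lambda>t z. \<Sum>i\<in>Basis. heat_dd i i t (z :: 'a)) p y (2 * t) = (\<Sum>i\<in>Basis. conv (heat_dd i i) p y (2 * t))"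
        unfolding conv_def sum_distrib_right
        by (intro Bochner_Integration.integral_sum conv_integrable gaussian_kernel_heat_dd p t)
      also have "\<dots> = - ?D t" by (rule eq[OF t])
      finally have "((\<lambda>t. conv heat p y (2 * t)) has_real_derivative - ?D t * 2) (at t)"
        by (rule DERIV_chain2) (auto intro!: derivative_eq_intros)
      then show "((\<lambda>t. conv heat p y (2 * t)) has_vector_derivative - 2 * ?D t) (at t within {a..b})"
        by (auto simp: has_real_derivative_iff_has_vector_derivative mult.commute intro: has_vector_derivative_at_within)
    next
      have "continuous_on {a..b} (\<lambda>t. (\<lambda>(x, t). conv (heat_dd i j) (F i j) x t) (y, 2 * t))" if "i \<in> Basis" "j \<in> Basis" for i j
        by (rule continuous_on_compose2[OF conv_continuous[OF gaussian_kernel_heat_dd[OF that] F[OF that]]])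
           (use ab in \<open>auto intro!: continuous_intros\<close>)
      then show "continuous_on {a..b} (\<lambda>t. - 2 * ?D t)" by (intro cont_rules) auto
    qed
    moreover have "(\<lambda>t. indicator {a..b} t *\<^sub>R (- 2 * ?D t)) = (\<lambda>t. - 2 * (indicator {a..b} t * ?D t))" by auto
    ultimately have 1: "conv heat p y (2 * b) - conv heat p y (2 * a) = - 2 * (\<integral>t. indicator {a..b} t * ?D t \<partial>lborel)"
      by (simp only: integral_mult_right_zero)
    have "(\<lambda>t. S (y, t)) = (\<lambda>t. g y * (indicator {a..b} t * ?D t))"
      unfolding S_def H_def sum_distrib_left fst_conv snd_conv
      by (intro ext sum.cong refl) (simp only: mult_ac)
    then have "(\<integral>t. S (y, t) \<partial>lborel) = g y * (\<integral>t. indicator {a..b} t * ?D t \<partial>lborel)"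
      by (simp only: integral_mult_right_zero)
    then show ?thesis unfolding 1 by simp
  qed
  have "(\<integral>y. g y * (conv heat p y (2 * b) - conv heat p y (2 * a)) \<partial>lborel) = - 2 * (\<integral>y. (\<integral>t. S (y, t) \<partial>lborel) \<partial>lborel)"
    unfolding inner by simp
  also have "(\<integral>y. (\<integral>t. S (y, t) \<partial>lborel) \<partial>lborel) = (\<integral>z. S z \<partial>lborel)"
    using lborel_pair.integral_fst[of "\<lambda>y t. S (y, t)"] iS by (simp add: pair case_prod_unfold)
  also have "\<dots> = (\<Sum>i\<in>Basis. \<Sum>j\<in>Basis. \<integral>z. H i j (fst z) (snd z) \<partial>lborel)"
    unfolding S_def using iH by (simp add: Bochner_Integration.integral_sum Bochner_Integration.integrable_sum)
  finally have "\<bar>(\<integral>y. g y * (conv heat p y (2 * b) - conv heat p y (2 * a)) \<partial>lborel)\<bar>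
      = 2 * \<bar>\<Sum>i\<in>Basis. \<Sum>j\<in>Basis. \<integral>z. H i j (fst z) (snd z) \<partial>lborel\<bar>" by (simp add: abs_mult)
  also have "\<dots> \<le> 2 * (\<Sum>i\<in>Basis. \<Sum>j\<in>Basis. C i j)"
    by (intro mult_left_mono order_trans[OF sum_abs] sum_mono bH) auto
  finally show ?thesis .
qed

text \<open>
  Outside a large ball \<open>p\<close> is small, and the heat kernel averages; inside, \<open>p\<close> is integrable and the
  kernel is bounded by a multiple of \<open>t\<^sup>-\<^sup>N\<^sup>/\<^sup>2\<close>.
\<close>

lemma heat_pairing_vanishes:
  fixes p g :: "'a::euclidean_space \<Rightarrow> real"
  assumes p: "tame p" and vanish: "\<And>e. 0 < e \<Longrightarrow> \<exists>R. \<forall>x. R \<le> norm x \<longrightarrow> \<bar>p x\<bar> \<le> e"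
    and g: "integrable lborel g"
  shows "((\<lambda>t. \<integral>y. g y * conv heat p y t \<partial>lborel) \<longlongrightarrow> 0) at_top"
proof (rule tendstoI)
  fix e :: real assume e: "0 < e"
  define G where "G = (\<integral>y. \<bar>g y\<bar> \<partial>lborel) + 1"
  have G: "0 < G" unfolding G_def by (intro add_nonneg_pos Bochner_Integration.integral_nonneg) auto
  define e' where "e' = e / (2 * G)"
  have e': "0 < e'" using e G by (simp add: e'_def)
  obtain R where R: "\<And>x. R \<le> norm x \<Longrightarrow> \<bar>p x\<bar> \<le> e'" using vanish[OF e'] by auto
  obtain D where D: "integrable lborel D" "\<And>x. \<bar>p x\<bar> \<le> D x + 1" and [measurable]: "p \<in> borel_measurable borel"
    using p unfolding tame_def by auto
  have [measurable]: "D \<in> borel_measurable borel" "cball (0::'a) R \<in> sets borel" using D(1) by auto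
  define q where "q x = indicator (cball 0 R) x * (\<bar>D x\<bar> + 1)" for x :: 'a
  have iq: "integrable lborel q"
  proof (rule Bochner_Integration.integrable_bound)
    show "integrable lborel (\<lambda>x. \<bar>D x\<bar> + indicator (cball 0 R) x)"
      using D(1) by (auto intro!: integrable_real_indicator emeasure_bounded_finite)
    show "q \<in> borel_measurable lborel" unfolding q_def by measurable
  qed (auto simp: q_def split: split_indicator)
  have q0: "0 \<le> q x" for x by (auto simp: q_def)
  have pq: "\<bar>p x\<bar> \<le> q x + e'" for x
    using R[of x] D(2)[of x] e' by (auto simp: q_def split: split_indicator)
  define c where "c = (\<integral>x. exp (- (norm (x :: 'a))\<^sup>2 / 4) \<partial>lborel)"
  have c: "0 < c" unfolding c_def by (rule gaussian_mass_pos)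
  have kb: "heat t z \<le> t powr (- (real DIM('a) / 2)) / c" if "0 < t" for t and z :: 'a
    unfolding heat_def c_def[symmetric] using c that by (intro divide_right_mono mult_left_le) auto
  define Iq where "Iq = (\<integral>x. q x \<partial>lborel)"
  have Iq: "0 \<le> Iq" unfolding Iq_def using q0 by (intro Bochner_Integration.integral_nonneg) auto
  have bound: "\<bar>conv heat p y t\<bar> \<le> t powr (- (real DIM('a) / 2)) / c * Iq + e'" if t: "0 < t" for y t
  proof -
    have ih: "integrable lborel (\<lambda>x. heat t (y - x))"
      by (intro integrable_reflect_translate gaussian_kernel_integrable gaussian_kernel_heat t)
    have "\<bar>conv heat p y t\<bar> \<le> (\<integral>x. \<bar>heat t (y - x) * p x\<bar> \<partial>lborel)"
      unfolding conv_def by (rule integral_abs_bound)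
    also have "\<dots> \<le> (\<integral>x. t powr (- (real DIM('a) / 2)) / c * q x + e' * heat t (y - x) \<partial>lborel)"
    proof (intro integral_mono integrable_abs conv_integrable[OF gaussian_kernel_heat p t] Bochner_Integration.integrable_add integrable_mult_right iq ih)
      fix x
      have h: "0 \<le> heat t (y - x)" using heat_pos[OF t] by (rule less_imp_le)
      have "\<bar>heat t (y - x) * p x\<bar> \<le> heat t (y - x) * (q x + e')"
        using h pq[of x] by (auto simp: abs_mult intro!: mult_left_mono)
      also have "\<dots> = heat t (y - x) * q x + e' * heat t (y - x)" by (simp add: algebra_simps)
      also have "\<dots> \<le> t powr (- (real DIM('a) / 2)) / c * q x + e' * heat t (y - x)"
        using mult_right_mono[OF kb[OF t, of "y - x"] q0[of x]] by simp
      finally show "\<bar>heat t (y - x) * p x\<bar> \<le> t powr (- (real DIM('a) / 2)) / c * q x + e' * heat t (y - x)" .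
    qed
    also have "\<dots> = t powr (- (real DIM('a) / 2)) / c * Iq + e' * (\<integral>x. heat t (y - x) \<partial>lborel)"
      using iq ih by (simp add: Iq_def)
    also have "(\<integral>x. heat t (y - x) \<partial>lborel) = 1"
      using integral_reflect_translate[OF gaussian_kernel_measurable[OF gaussian_kernel_heat t], of y]
      by (simp add: integral_heat[OF t])
    finally show ?thesis by simp
  qed
  have "((\<lambda>t. t powr (- (real DIM('a) / 2))) \<longlongrightarrow> 0) at_top"
    by (intro tendsto_neg_powr filterlim_ident) simp
  from tendsto_mult[OF this tendsto_const[of "Iq / c"]]
  have "((\<lambda>t. t powr (- (real DIM('a) / 2)) * (Iq / c)) \<longlongrightarrow> 0) at_top" by simp
  from tendstoD[OF this e'] have "\<forall>\<^sub>F t in at_top. \<bar>t powr (- (real DIM('a) / 2)) * (Iq / c)\<bar> < e'" by (simp add: dist_real_def)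
  with eventually_gt_at_top[of 0]
  show "\<forall>\<^sub>F t in at_top. dist (\<integral>y. g y * conv heat p y t \<partial>lborel) 0 < e"
  proof eventually_elim
    case (elim t)
    have "\<bar>\<integral>y. g y * conv heat p y t \<partial>lborel\<bar> \<le> (\<integral>y. \<bar>g y * conv heat p y t\<bar> \<partial>lborel)" by (rule integral_abs_bound)
    also have "\<dots> \<le> (\<integral>y. 2 * e' * \<bar>g y\<bar> \<partial>lborel)"
    proof (rule integral_mono')
      show "integrable lborel (\<lambda>y. 2 * e' * \<bar>g y\<bar>)" using g by auto
      fix y
      have "\<bar>conv heat p y t\<bar> \<le> 2 * e'" using bound[OF elim(1), of y] elim(2) by (simp add: abs_if split: if_splits)
      then show "\<bar>g y * conv heat p y t\<bar> \<le> 2 * e' * \<bar>g y\<bar>"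
        by (simp add: abs_mult) (metis abs_ge_zero mult.commute mult_left_mono)
      show "0 \<le> 2 * e' * \<bar>g y\<bar>" using e' by simp
    qed
    also have "\<dots> = 2 * e' * (G - 1)" by (simp add: G_def)
    also have "\<dots> < 2 * e' * G" using e' by simp
    also have "\<dots> = e" using G by (simp add: e'_def)
    finally show ?case by simp
  qed
qed

text \<open>
  After the substitution \<open>x = y + \<surd>t z\<close> the pairing is a Gaussian average of the correlations \<open>J\<close> of
  \<open>p\<close> with translates of \<open>g\<close>, and \<open>J\<close> is continuous at \<open>0\<close> because \<open>g\<close> is continuous and compactly
  supported.
\<close>

lemma heat_pairing_initial:
  fixes p g :: "'a::euclidean_space \<Rightarrow> real"
  assumes p: "tame p" and g: "continuous_on UNIV g" and gR: "\<And>x. R \<le> norm x \<Longrightarrow> g x = 0"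
    and g1: "\<And>x. \<bar>g x\<bar> \<le> 1"
  shows "(\<lambda>n. \<integral>y. g y * conv heat p y (1 / real (Suc n)) \<partial>lborel) \<longlonglongrightarrow> (\<integral>y. g y * p y \<partial>lborel)"
proof -
  obtain D where D: "integrable lborel D" "\<And>x. \<bar>p x\<bar> \<le> D x + 1" and [measurable]: "p \<in> borel_measurable borel"
    using p unfolding tame_def by auto
  have [measurable]: "g \<in> borel_measurable borel" using g by (rule borel_measurable_continuous_onI)
  have ig: "integrable lborel g"
  proof -
    have "integrable lborel (\<lambda>x. indicator (cball 0 R) x *\<^sub>R g x)"
      by (intro borel_integrable_compact continuous_on_subset[OF g]) auto
    also have "(\<lambda>x. indicator (cball 0 R) x *\<^sub>R g x) = g"
      using gR by (auto simp: fun_eq_iff not_le less_imp_le split: split_indicator)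
    finally show ?thesis .
  qed
  define J where "J v = (\<integral>x. p x * g (x + v) \<partial>lborel)" for v
  define B where "B = (\<integral>x. \<bar>D x\<bar> \<partial>lborel) + (\<integral>x. \<bar>g x\<bar> \<partial>lborel)"
  have le: "\<bar>p x * g (x + v)\<bar> \<le> \<bar>D x\<bar> + \<bar>g (x + v)\<bar>" for x v
  proof -
    have "\<bar>p x * g (x + v)\<bar> \<le> (\<bar>D x\<bar> + 1) * \<bar>g (x + v)\<bar>"
      using D(2)[of x] unfolding abs_mult by (intro mult_right_mono) auto
    also have "\<dots> \<le> \<bar>D x\<bar> + \<bar>g (x + v)\<bar>" using mult_left_le[OF g1[of "x + v"], of "\<bar>D x\<bar>"] by (simp add: algebra_simps)
    finally show ?thesis .
  qed
  have id: "integrable lborel (\<lambda>x. \<bar>D x\<bar> + \<bar>g (x + v)\<bar>)" for v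
    using D(1) ig by (auto intro!: integrable_abs lborel_integrable_translate)
  have iJ: "integrable lborel (\<lambda>x. p x * g (x + v))" for v
    by (rule Bochner_Integration.integrable_bound[OF id[of v]]) (use le in auto)
  have JB: "(\<integral>x. \<bar>p x * g (x + v)\<bar> \<partial>lborel) \<le> B" for v
  proof -
    have "(\<integral>x. \<bar>p x * g (x + v)\<bar> \<partial>lborel) \<le> (\<integral>x. \<bar>D x\<bar> + \<bar>g (x + v)\<bar> \<partial>lborel)"
      by (intro integral_mono le id integrable_abs iJ)
    also have "\<dots> = B" unfolding B_def using D(1) ig lborel_integral_translate[of "\<lambda>x. \<bar>g x\<bar>" v]
      by (subst Bochner_Integration.integral_add) (auto intro!: integrable_abs lborel_integrable_translate)
    finally show ?thesis .
  qed
  have [measurable]: "(heat 1 :: 'a \<Rightarrow> real) \<in> borel_measurable borel" by (rule gaussian_kernel_measurable[OF gaussian_kernel_heat]) simp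
  have ih: "integrable lborel (heat 1 :: 'a \<Rightarrow> real)" by (rule gaussian_kernel_integrable[OF gaussian_kernel_heat]) simp
  have key: "(\<integral>y. g y * conv heat p y t \<partial>lborel) = (\<integral>z. heat 1 z * J (sqrt t *\<^sub>R z) \<partial>lborel)" if t: "0 < t" for t
  proof -
    have [measurable]: "(heat t :: 'a \<Rightarrow> real) \<in> borel_measurable borel" by (rule gaussian_kernel_measurable[OF gaussian_kernel_heat t])
    have int: "integrable (lborel \<Otimes>\<^sub>M lborel) (\<lambda>(z, x). heat 1 z * (p x * g (x + sqrt t *\<^sub>R z)))"
    proof (rule lborel_pair.Fubini_integrable)
      show "(\<lambda>(z, x). heat 1 z * (p x * g (x + sqrt t *\<^sub>R z))) \<in> borel_measurable (lborel \<Otimes>\<^sub>M lborel)" by measurable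
      show "AE z in lborel. integrable lborel (\<lambda>x. case (z, x) of (z, x) \<Rightarrow> heat 1 z * (p x * g (x + sqrt t *\<^sub>R z)))"
        using iJ by simp
      show "integrable lborel (\<lambda>z. \<integral>x. norm (case (z, x) of (z, x) \<Rightarrow> heat 1 z * (p x * g (x + sqrt t *\<^sub>R z))) \<partial>lborel)"
      proof (rule Bochner_Integration.integrable_bound)
        show "integrable lborel (\<lambda>z::'a. B * heat 1 z)" using ih by auto
        show "AE z::'a in lborel. norm (\<integral>x. norm (case (z, x) of (z, x) \<Rightarrow> heat 1 z * (p x * g (x + sqrt t *\<^sub>R z))) \<partial>lborel) \<le> norm (B * heat 1 z)"
        proof (rule AE_I2)
          fix z :: 'a
          have h: "0 < heat 1 z" by (rule heat_pos) simp
          have "(\<integral>x. norm (heat 1 z * (p x * g (x + sqrt t *\<^sub>R z))) \<partial>lborel) = heat 1 z * (\<integral>x. \<bar>p x * g (x + sqrt t *\<^sub>R z)\<bar> \<partial>lborel)"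
            using h by (simp add: abs_mult)
          also have "\<dots> \<le> heat 1 z * B" using h by (intro mult_left_mono JB) auto
          finally show "norm (\<integral>x. norm (case (z, x) of (z, x) \<Rightarrow> heat 1 z * (p x * g (x + sqrt t *\<^sub>R z))) \<partial>lborel) \<le> norm (B * heat 1 z)"
            by (simp add: mult.commute)
        qed
      qed measurable
    qed
    have scale: "heat t (sqrt t *\<^sub>R z) * sqrt t ^ DIM('a) = heat 1 z" for z :: 'a
    proof -
      have "t powr (- (real DIM('a) / 2)) * sqrt t ^ DIM('a) = 1"
        using t by (simp add: powr_minus powr_realpow[symmetric] powr_half_sqrt[symmetric] powr_powr field_simps)
      moreover have "- (norm (sqrt t *\<^sub>R z))\<^sup>2 / (4 * t) = - (norm z)\<^sup>2 / 4"
        using t by (simp add: power_mult_distrib)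
      moreover have "heat t (sqrt t *\<^sub>R z) * sqrt t ^ DIM('a)
          = (t powr (- (real DIM('a) / 2)) * sqrt t ^ DIM('a)) * exp (- (norm (sqrt t *\<^sub>R z))\<^sup>2 / (4 * t)) / (\<integral>x. exp (- (norm (x :: 'a))\<^sup>2 / 4) \<partial>lborel)"
        unfolding heat_def by simp
      ultimately show ?thesis unfolding heat_def[of 1] by simp
    qed
    have "(\<integral>y. g y * conv heat p y t \<partial>lborel) = (\<integral>x. p x * (\<integral>y. heat t (y - x) * g y \<partial>lborel) \<partial>lborel)"
      by (rule conv_swap[OF gaussian_kernel_heat p t ig])
    also have "\<dots> = (\<integral>x. (\<integral>z. heat 1 z * (p x * g (x + sqrt t *\<^sub>R z)) \<partial>lborel) \<partial>lborel)"
    proof (intro Bochner_Integration.integral_cong refl)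
      fix x
      have "(\<integral>y. heat t (y - x) * g y \<partial>lborel) = \<bar>sqrt t\<bar> ^ DIM('a) * (\<integral>z. heat t (x + sqrt t *\<^sub>R z - x) * g (x + sqrt t *\<^sub>R z) \<partial>lborel)"
        by (rule lborel_integral_affine) (use t in auto)
      also have "\<dots> = (\<integral>z. (heat t (sqrt t *\<^sub>R z) * sqrt t ^ DIM('a)) * g (x + sqrt t *\<^sub>R z) \<partial>lborel)"
        using t by (simp add: mult_ac flip: integral_mult_right_zero)
      finally have eq: "(\<integral>y. heat t (y - x) * g y \<partial>lborel) = (\<integral>z. heat 1 z * g (x + sqrt t *\<^sub>R z) \<partial>lborel)" unfolding scale .
      have "(\<lambda>z. heat 1 z * (p x * g (x + sqrt t *\<^sub>R z))) = (\<lambda>z. p x * (heat 1 z * g (x + sqrt t *\<^sub>R z)))" by (simp only: mult_ac)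
      then show "p x * (\<integral>y. heat t (y - x) * g y \<partial>lborel) = (\<integral>z. heat 1 z * (p x * g (x + sqrt t *\<^sub>R z)) \<partial>lborel)"
        unfolding eq by (simp only: integral_mult_right_zero)
    qed
    also have "\<dots> = (\<integral>z. (\<integral>x. heat 1 z * (p x * g (x + sqrt t *\<^sub>R z)) \<partial>lborel) \<partial>lborel)"
      using lborel_pair.Fubini_integral[OF int] by simp
    also have "\<dots> = (\<integral>z. heat 1 z * J (sqrt t *\<^sub>R z) \<partial>lborel)" unfolding J_def by simp
    finally show ?thesis .
  qed
  have Jlim: "J \<midarrow>0\<rightarrow> J 0"
    unfolding tendsto_at_iff_sequentially
  proof (intro allI impI)
    fix X :: "nat \<Rightarrow> 'a" assume X: "\<forall>i. X i \<in> UNIV - {0}" "X \<longlonglongrightarrow> 0"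
    obtain n0 where n0: "\<And>n. n \<ge> n0 \<Longrightarrow> norm (X n) < 1" using LIMSEQ_D[OF X(2), of 1] by auto
    have "(\<lambda>n. \<integral>x. p x * g (x + X (n + n0)) \<partial>lborel) \<longlonglongrightarrow> (\<integral>x. p x * g (x + 0) \<partial>lborel)"
    proof (rule integral_dominated_convergence[where w="\<lambda>x. \<bar>D x\<bar> + indicator (cball 0 (\<bar>R\<bar> + 1)) x"])
      show "integrable lborel (\<lambda>x. \<bar>D x\<bar> + indicator (cball (0::'a) (\<bar>R\<bar> + 1)) x)"
        using D(1) by (auto intro!: integrable_real_indicator emeasure_bounded_finite)
      show "AE x in lborel. norm (p x * g (x + X (n + n0))) \<le> \<bar>D x\<bar> + indicator (cball 0 (\<bar>R\<bar> + 1)) x" for n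
      proof (rule AE_I2)
        fix x
        show "norm (p x * g (x + X (n + n0))) \<le> \<bar>D x\<bar> + indicator (cball 0 (\<bar>R\<bar> + 1)) x"
        proof (cases "R \<le> norm (x + X (n + n0))")
          case True then show ?thesis by (simp add: gR)
        next
          case False
          have "norm x \<le> norm (x + X (n + n0)) + norm (X (n + n0))" using norm_triangle_ineq4[of "x + X (n + n0)" "X (n + n0)"] by simp
          then have "norm x \<le> \<bar>R\<bar> + 1" using n0[of "n + n0"] False by simp
          then show ?thesis using le[of x "X (n + n0)"] g1[of "x + X (n + n0)"] by simp
        qed
      qed
      show "AE x in lborel. (\<lambda>n. p x * g (x + X (n + n0))) \<longlonglongrightarrow> p x * g (x + 0)"
      proof (rule AE_I2)
        fix x
        have "isCont g (x + 0)" using g by (simp add: continuous_on_eq_continuous_at)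
        moreover have "(\<lambda>n. x + X (n + n0)) \<longlonglongrightarrow> x + 0" by (intro tendsto_intros LIMSEQ_ignore_initial_segment X)
        ultimately have "(\<lambda>n. g (x + X (n + n0))) \<longlonglongrightarrow> g (x + 0)"
          by (rule isCont_tendsto_compose)
        then show "(\<lambda>n. p x * g (x + X (n + n0))) \<longlonglongrightarrow> p x * g (x + 0)"
          by (rule tendsto_mult_left)
      qed
    qed measurable
    then show "(J \<circ> X) \<longlonglongrightarrow> J 0" unfolding J_def o_def by (rule LIMSEQ_offset[where k=n0])
  qed
  have [measurable]: "J \<in> borel_measurable borel" unfolding J_def by measurable
  have "(\<lambda>n. \<integral>z. heat 1 z * J (sqrt (1 / real (Suc n)) *\<^sub>R z) \<partial>lborel) \<longlonglongrightarrow> (\<integral>z. heat 1 (z::'a) * J 0 \<partial>lborel)"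
  proof (rule integral_dominated_convergence[where w="\<lambda>z::'a. B * heat 1 z"])
    show "integrable lborel (\<lambda>z::'a. B * heat 1 z)" using ih by auto
    show "AE z::'a in lborel. norm (heat 1 z * J (sqrt (1 / real (Suc n)) *\<^sub>R z)) \<le> B * heat 1 z" for n
    proof (rule AE_I2)
      fix z :: 'a
      have h: "0 < heat 1 z" by (rule heat_pos) simp
      have "\<bar>J (sqrt (1 / real (Suc n)) *\<^sub>R z)\<bar> \<le> B" unfolding J_def by (rule order_trans[OF integral_abs_bound JB])
      then show "norm (heat 1 z * J (sqrt (1 / real (Suc n)) *\<^sub>R z)) \<le> B * heat 1 z"
        using h by (simp add: abs_mult mult.commute)
    qed
    show "AE z::'a in lborel. (\<lambda>n. heat 1 z * J (sqrt (1 / real (Suc n)) *\<^sub>R z)) \<longlonglongrightarrow> heat 1 z * J 0"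
    proof (rule AE_I2)
      fix z :: 'a
      have "(\<lambda>n. sqrt (1 / real (Suc n))) \<longlonglongrightarrow> 0" by real_asymp
      then have "(\<lambda>n. sqrt (1 / real (Suc n)) *\<^sub>R z) \<longlonglongrightarrow> 0 *\<^sub>R z" by (intro tendsto_intros)
      moreover have "isCont J 0" using Jlim by (simp add: isCont_def)
      ultimately have "(\<lambda>n. J (sqrt (1 / real (Suc n)) *\<^sub>R z)) \<longlonglongrightarrow> J 0"
        by (intro isCont_tendsto_compose[of _ J]) auto
      then show "(\<lambda>n. heat 1 z * J (sqrt (1 / real (Suc n)) *\<^sub>R z)) \<longlonglongrightarrow> heat 1 z * J 0"
        by (rule tendsto_mult_left)
    qed
  qed measurable
  moreover have "(\<integral>z. heat 1 (z::'a) * J 0 \<partial>lborel) = (\<integral>y. g y * p y \<partial>lborel)"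
    using integral_heat[of 1, where 'a='a] by (simp add: J_def mult.commute)
  moreover have "(\<integral>y. g y * conv heat p y (1 / real (Suc n)) \<partial>lborel) = (\<integral>z. heat 1 z * J (sqrt (1 / real (Suc n)) *\<^sub>R z) \<partial>lborel)" for n
    by (rule key) simp
  ultimately show ?thesis by simp
qed

text \<open>
  The pairing \<open>A(t) = \<integral> g P\<^sub>t p\<close> is \<open>0\<close> at \<open>t = \<infinity>\<close> and \<open>\<integral> g p\<close> at \<open>t = 0\<close>, and its oscillation is bounded
  by the bilinear embedding, with a constant that depends on \<open>g\<close> only through its majorant.
\<close>

lemma pressure_pairing_bound:
  fixes p :: "'a::euclidean_space \<Rightarrow> real" and F :: "'a \<Rightarrow> 'a \<Rightarrow> 'a \<Rightarrow> real"
  assumes s: "1 < s" "s < 2" "real DIM('a) < s / (s - 1)"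
    and p: "tame p" and vanish: "\<And>e. 0 < e \<Longrightarrow> \<exists>R. \<forall>x. R \<le> norm x \<longrightarrow> \<bar>p x\<bar> \<le> e"
    and F: "\<And>i j. i \<in> Basis \<Longrightarrow> j \<in> Basis \<Longrightarrow> F i j \<in> borel_measurable borel"
    and Fs: "\<And>i j. i \<in> Basis \<Longrightarrow> j \<in> Basis \<Longrightarrow> integrable lborel (\<lambda>x. \<bar>F i j x\<bar> powr s)"
    and eq: "\<And>y t. 0 < t \<Longrightarrow> (\<Sum>i\<in>Basis. conv (heat_dd i i) p y t) = - (\<Sum>i\<in>Basis. \<Sum>j\<in>Basis. conv (heat_dd i j) (F i j) y t)"
  obtains C where "\<And>g R. continuous_on UNIV g \<Longrightarrow> (\<And>x. \<bar>g x\<bar> \<le> 1 / (1 + norm x)) \<Longrightarrow> (\<And>x. R \<le> norm x \<Longrightarrow> g x = 0)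
    \<Longrightarrow> \<bar>\<integral>x. g x * p x \<partial>lborel\<bar> \<le> C"
proof -
  define P where "P i j C \<longleftrightarrow> 0 \<le> C \<and> (\<forall>g a b. g \<in> borel_measurable borel \<longrightarrow> (\<forall>x. \<bar>g x\<bar> \<le> 1 / (1 + norm x)) \<longrightarrow> 0 < a \<longrightarrow> a \<le> b \<longrightarrow>
      (\<integral>\<^sup>+z. ennreal (indicator {a..b} (snd z) * \<bar>conv (heat_d i) (F i j) (fst z) (snd z) * conv (heat_d j) g (fst z) (snd z)\<bar>) \<partial>lborel) \<le> ennreal C)" for i j C
  have ex: "\<exists>C. P i j C" if "i \<in> Basis" "j \<in> Basis" for i j
  proof -
    show ?thesis
    proof (rule bilinear_embedding_weight[OF s F[OF that] Fs[OF that] that])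
      fix C
      assume c: "0 \<le> C" "\<And>g a b. g \<in> borel_measurable borel \<Longrightarrow> (\<And>x. \<bar>g x\<bar> \<le> 1 / (1 + norm x)) \<Longrightarrow> 0 < a \<Longrightarrow> a \<le> b \<Longrightarrow>
        (\<integral>\<^sup>+z. ennreal (indicator {a..b} (snd z) * \<bar>conv (heat_d i) (F i j) (fst z) (snd z) * conv (heat_d j) g (fst z) (snd z)\<bar>) \<partial>lborel) \<le> ennreal C"
      show "\<exists>C. P i j C"
        unfolding P_def by (intro exI[of _ C] conjI allI impI c; (assumption | erule spec))
    qed
  qed
  have P: "P i j (SOME C. P i j C)" if "i \<in> Basis" "j \<in> Basis" for i j
    by (rule someI_ex[OF ex[OF that]])
  define C where "C i j = (SOME C. P i j C)" for i j
  have C: "0 \<le> C i j" "g \<in> borel_measurable borel \<Longrightarrow> (\<And>x. \<bar>g x\<bar> \<le> 1 / (1 + norm x)) \<Longrightarrow> 0 < a \<Longrightarrow> a \<le> b \<Longrightarrow>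
      (\<integral>\<^sup>+z. ennreal (indicator {a..b} (snd z) * \<bar>conv (heat_d i) (F i j) (fst z) (snd z) * conv (heat_d j) g (fst z) (snd z)\<bar>) \<partial>lborel) \<le> ennreal (C i j)"
    if "i \<in> Basis" "j \<in> Basis" for i j g a b
    subgoal by (rule conjunct1[OF P[OF that, folded C_def, unfolded P_def]])
    subgoal by (rule conjunct2[OF P[OF that, folded C_def, unfolded P_def], rule_format])
    done
  define K where "K = 2 * (\<Sum>i\<in>Basis. \<Sum>j\<in>Basis. C i j)"
  show ?thesis
  proof (rule that[of K])
    fix g :: "'a \<Rightarrow> real" and R
    assume g: "continuous_on UNIV g" and gw: "\<And>x. \<bar>g x\<bar> \<le> 1 / (1 + norm x)" and gR: "\<And>x. R \<le> norm x \<Longrightarrow> g x = 0"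
    have gm: "g \<in> borel_measurable borel" using g by (rule borel_measurable_continuous_onI)
    have g1: "\<bar>g x\<bar> \<le> 1" for x
    proof -
      have "1 / (1 + norm x) \<le> 1" by (subst divide_le_eq_1_pos) (auto simp: add_pos_nonneg)
      then show ?thesis using gw[of x] by simp
    qed
    have tg: "tame g" unfolding tame_def using g1 gm by (auto intro!: exI[of _ "\<lambda>_. 0"])
    have ig: "integrable lborel g"
    proof -
      have "integrable lborel (\<lambda>x. indicator (cball 0 R) x *\<^sub>R g x)"
        by (intro borel_integrable_compact continuous_on_subset[OF g]) auto
      also have "(\<lambda>x. indicator (cball 0 R) x *\<^sub>R g x) = g"
        using gR by (auto simp: fun_eq_iff not_le less_imp_le split: split_indicator)
      finally show ?thesis .
    qed
    have igp: "integrable lborel (\<lambda>y. g y * conv heat p y t)" if t: "0 < t" for t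
    proof -
      have c: "continuous_on UNIV (\<lambda>y. (\<lambda>(x, t). conv heat p x t) (y, t))"
        by (rule continuous_on_compose2[OF conv_continuous[OF gaussian_kernel_heat p]]) (use t in \<open>auto intro!: continuous_intros\<close>)
      have "integrable lborel (\<lambda>x. indicator (cball 0 R) x *\<^sub>R (g x * conv heat p x t))"
        using c by (intro borel_integrable_compact cont_rules continuous_on_subset[OF g]) (auto elim: continuous_on_subset)
      also have "(\<lambda>x. indicator (cball 0 R) x *\<^sub>R (g x * conv heat p x t)) = (\<lambda>y. g y * conv heat p y t)"
        using gR by (auto simp: fun_eq_iff not_le less_imp_le split: split_indicator)
      finally show ?thesis .
    qed
    define A where "A t = (\<integral>y. g y * conv heat p y t \<partial>lborel)" for t
    have diff: "\<bar>A (2 * b) - A (2 * a)\<bar> \<le> K" if ab: "0 < a" "a \<le> b" for a b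
    proof -
      have "A (2 * b) - A (2 * a) = (\<integral>y. g y * (conv heat p y (2 * b) - conv heat p y (2 * a)) \<partial>lborel)"
        unfolding A_def right_diff_distrib using ab by (intro Bochner_Integration.integral_diff[symmetric] igp) auto
      moreover have "\<bar>(\<integral>y. g y * (conv heat p y (2 * b) - conv heat p y (2 * a)) \<partial>lborel)\<bar> \<le> K"
        unfolding K_def
      proof (rule heat_flow_increment[where F=F and C=C and R=R, OF p g _ tg _ ab])
        show "g x = 0" if "R \<le> norm x" for x by (rule gR[OF that])
        show "tame (F i j)" if "i \<in> Basis" "j \<in> Basis" for i j
          using s by (intro tame_powr_integrable[OF F[OF that] Fs[OF that]]) auto
        show "0 \<le> C i j" if "i \<in> Basis" "j \<in> Basis" for i j by (rule C(1)[OF that])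
        show "(\<integral>\<^sup>+z. ennreal (indicator {a..b} (snd z) * \<bar>conv (heat_d i) (F i j) (fst z) (snd z) * conv (heat_d j) g (fst z) (snd z)\<bar>) \<partial>lborel) \<le> ennreal (C i j)"
          if "i \<in> Basis" "j \<in> Basis" for i j by (rule C(2)[OF that gm gw ab])
      qed (rule eq)
      ultimately show ?thesis by simp
    qed
    have large: "\<bar>A (2 * a)\<bar> \<le> K" if a: "0 < a" for a
    proof (rule tendsto_upperbound[where F=at_top and f="\<lambda>b. \<bar>A (2 * b) - A (2 * a)\<bar>"])
      have "(A \<longlongrightarrow> 0) at_top" unfolding A_def[abs_def] by (rule heat_pairing_vanishes[OF p vanish ig])
      moreover have "filterlim (\<lambda>b::real. 2 * b) at_top at_top" by real_asymp
      ultimately have "((\<lambda>b. A (2 * b)) \<longlongrightarrow> 0) at_top" by (rule filterlim_compose)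
      then have "((\<lambda>b. \<bar>A (2 * b) - A (2 * a)\<bar>) \<longlongrightarrow> \<bar>0 - A (2 * a)\<bar>) at_top" by (intro tendsto_intros)
      then show "((\<lambda>b. \<bar>A (2 * b) - A (2 * a)\<bar>) \<longlongrightarrow> \<bar>A (2 * a)\<bar>) at_top" by simp
      show "\<forall>\<^sub>F b in at_top. \<bar>A (2 * b) - A (2 * a)\<bar> \<le> K"
        using eventually_ge_at_top[of a] by eventually_elim (use diff[OF a] in simp)
    qed simp
    show "\<bar>\<integral>x. g x * p x \<partial>lborel\<bar> \<le> K"
    proof (rule tendsto_upperbound[where F=sequentially])
      have "(\<lambda>n. A (1 / real (Suc n))) \<longlonglongrightarrow> (\<integral>y. g y * p y \<partial>lborel)"
        unfolding A_def by (rule heat_pairing_initial[where R=R, OF p g gR g1])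
      then show "(\<lambda>n. \<bar>A (1 / real (Suc n))\<bar>) \<longlonglongrightarrow> \<bar>\<integral>y. g y * p y \<partial>lborel\<bar>" by (intro tendsto_intros)
      show "\<forall>\<^sub>F n in sequentially. \<bar>A (1 / real (Suc n))\<bar> \<le> K"
      proof (intro always_eventually allI)
        fix n
        have half: "2 * (q / 2) = q" for q :: real by simp
        show "\<bar>A (1 / real (Suc n))\<bar> \<le> K" using large[of "1 / real (Suc n) / 2"] unfolding half by simp
      qed
    qed simp
  qed
qed

text \<open>
  Duality: continuous functions converging almost everywhere to the sign of \<open>p\<close> are clamped to
  \<open>[-1, 1]\<close> and multiplied by a cutoff of the weight, and the cutoff is then removed by Fatou's lemma.
\<close>

lemma weighted_integrable_of_pairing_bound:
  fixes p :: "'a::euclidean_space \<Rightarrow> real"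
  assumes p: "tame p"
    and C: "\<And>g R. continuous_on UNIV g \<Longrightarrow> (\<And>x. \<bar>g x\<bar> \<le> 1 / (1 + norm x)) \<Longrightarrow> (\<And>x. R \<le> norm x \<Longrightarrow> g x = 0)
    \<Longrightarrow> \<bar>\<integral>x. g x * p x \<partial>lborel\<bar> \<le> C"
  shows "integrable lborel (\<lambda>x. p x / (1 + norm x))"
proof -
  obtain D where D: "integrable lborel D" "\<And>x. \<bar>p x\<bar> \<le> D x + 1" and [measurable]: "p \<in> borel_measurable borel"
    using p unfolding tame_def by auto
  have [measurable]: "cball (0::'a) R \<in> sets borel" for R by simp
  have n1: "0 < 1 + norm x" for x :: 'a by (simp add: add_pos_nonneg)
  have w1: "1 / (1 + norm x) \<le> 1" for x :: 'a by (subst divide_le_eq_1_pos) (auto simp: n1)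
  have "(\<lambda>x. sgn (p x)) \<in> borel_measurable lebesgue" by (intro measurable_completion) measurable
  then have "(\<lambda>x. sgn (p x)) measurable_on UNIV" by (intro lebesgue_measurable_imp_measurable_on) auto
  then obtain N G where N: "negligible N" and Gc: "\<And>n::nat. continuous_on UNIV (G n)"
    and Glim: "\<And>x. x \<notin> N \<Longrightarrow> (\<lambda>n. G n x) \<longlonglongrightarrow> sgn (p x)"
    unfolding measurable_on_def by auto
  have aeN: "AE x in lborel. x \<notin> N"
  proof -
    have "AE x in lebesgue. x \<notin> N" using N by (auto simp: negligible_iff_null_sets intro: AE_not_in)
    then show ?thesis by (simp add: AE_completion_iff)
  qed
  have bound: "(\<integral>\<^sup>+x. ennreal (\<bar>p x\<bar> / (1 + norm x) * bump (real (Suc m)) x) \<partial>lborel) \<le> ennreal C" for m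
  proof -
    let ?R = "real (Suc m)"
    define g where "g n x = max (- 1) (min 1 (G n x)) * (bump ?R x / (1 + norm x))" for n x
    have R: "0 < ?R" by simp
    have gc: "continuous_on UNIV (g n)" for n
      unfolding g_def[abs_def] by (intro continuous_intros Gc continuous_bump) (metis n1 less_irrefl)
    have bw: "0 \<le> bump ?R x / (1 + norm x)" "bump ?R x / (1 + norm x) \<le> 1 / (1 + norm x)" for x :: 'a
      using n1[of x] bump_nonneg[of ?R x] bump_le_1[of ?R x] by (auto intro: divide_right_mono)
    have clamp: "\<bar>max (- 1) (min 1 u)\<bar> \<le> 1" for u :: real by auto
    have gw: "\<bar>g n x\<bar> \<le> 1 / (1 + norm x)" for n x
    proof -
      have "\<bar>g n x\<bar> = \<bar>max (- 1) (min 1 (G n x))\<bar> * (bump ?R x / (1 + norm x))" by (simp only: g_def abs_mult abs_of_nonneg[OF bw(1)])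
      also have "\<dots> \<le> 1 * (1 / (1 + norm x))" using bw[of x] clamp[of "G n x"] by (intro mult_mono) auto
      finally show ?thesis by simp
    qed
    have gz: "g n x = 0" if "?R \<le> norm x" for n x unfolding g_def using bump_outside[OF R that] by simp
    have le: "\<bar>\<integral>x. g n x * p x \<partial>lborel\<bar> \<le> C" for n by (rule C[OF gc gw gz])
    have [measurable]: "g n \<in> borel_measurable borel" for n by (intro borel_measurable_continuous_onI gc)
    have [measurable]: "bump ?R \<in> borel_measurable (borel :: 'a measure)" by (intro borel_measurable_continuous_onI continuous_bump)
    define W where "W x = indicator (cball 0 ?R) x * (\<bar>D x\<bar> + 1)" for x :: 'a
    have iW: "integrable lborel W"
    proof (rule Bochner_Integration.integrable_bound)
      show "integrable lborel (\<lambda>x. \<bar>D x\<bar> + indicator (cball 0 ?R) x)"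
        using D(1) by (auto intro!: integrable_real_indicator emeasure_bounded_finite)
      show "W \<in> borel_measurable lborel" unfolding W_def using D(1) by measurable
    qed (auto simp: W_def split: split_indicator)
    let ?f = "\<lambda>x. sgn (p x) * (bump ?R x / (1 + norm x)) * p x"
    have conv: "integrable lborel ?f \<and> (\<lambda>n. \<integral>x. g n x * p x \<partial>lborel) \<longlonglongrightarrow> (\<integral>x. ?f x \<partial>lborel)"
    proof -
      have b: "norm (g n x * p x) \<le> W x" for n x
      proof (cases "?R \<le> norm x")
        case True then show ?thesis using gz[OF True] by (auto simp: W_def)
      next
        case False
        have "\<bar>g n x\<bar> * \<bar>p x\<bar> \<le> 1 * (\<bar>D x\<bar> + 1)" using gw[of n x] w1[of x] D(2)[of x] by (intro mult_mono) auto
        then show ?thesis using False by (simp add: W_def abs_mult)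
      qed
      have m1: "?f \<in> borel_measurable lborel" and m2: "\<And>n. (\<lambda>x. g n x * p x) \<in> borel_measurable lborel"
        by measurable
      have l: "AE x in lborel. (\<lambda>n. g n x * p x) \<longlonglongrightarrow> ?f x"
        using aeN
      proof eventually_elim
        case (elim x)
        have "(\<lambda>n. max (- 1) (min 1 (G n x))) \<longlonglongrightarrow> max (- 1) (min 1 (sgn (p x)))"
          by (intro tendsto_intros Glim elim)
        moreover have "max (- 1) (min 1 (sgn (p x))) = sgn (p x)" by (auto simp: sgn_if)
        ultimately have "(\<lambda>n. max (- 1) (min 1 (G n x))) \<longlonglongrightarrow> sgn (p x)" by simp
        then show ?case unfolding g_def by (intro tendsto_intros)
      qed
      show ?thesis
        by (intro conjI integrable_dominated_convergence[OF m1 m2 iW l] integral_dominated_convergence[OF m1 m2 iW l] AE_I2 b)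
    qed
    have feq: "?f x = \<bar>p x\<bar> / (1 + norm x) * bump ?R x" for x by (simp add: sgn_if)
    have "(\<integral>x. ?f x \<partial>lborel) \<le> C"
      using conv le by (intro tendsto_upperbound[OF conjunct2[OF conv]] always_eventually) (auto simp: abs_le_iff)
    moreover have "(\<integral>\<^sup>+x. ennreal (?f x) \<partial>lborel) = ennreal (\<integral>x. ?f x \<partial>lborel)"
      using conv n1 bump_nonneg unfolding feq by (intro nn_integral_eq_integral) (auto intro!: AE_I2 mult_nonneg_nonneg divide_nonneg_pos)
    ultimately show ?thesis unfolding feq by (simp add: ennreal_leI)
  qed
  have [measurable]: "bump R \<in> borel_measurable (borel :: 'a measure)" for R by (intro borel_measurable_continuous_onI continuous_bump)
  have lim: "(\<lambda>m. ennreal (\<bar>p x\<bar> / (1 + norm x) * bump (real (Suc m)) x)) \<longlonglongrightarrow> ennreal (\<bar>p x\<bar> / (1 + norm x))" for x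
  proof -
    have "(\<lambda>n. (norm x)\<^sup>2 / (real (Suc n))\<^sup>2) \<longlonglongrightarrow> 0" by real_asymp
    then have "(\<lambda>n. \<bar>p x\<bar> / (1 + norm x) * max 0 (1 - (norm x)\<^sup>2 / (real (Suc n))\<^sup>2)) \<longlonglongrightarrow> \<bar>p x\<bar> / (1 + norm x) * max 0 (1 - 0)"
      by (intro tendsto_intros)
    then show ?thesis unfolding bump_def by (intro tendsto_ennrealI) simp
  qed
  have "(\<integral>\<^sup>+x. ennreal (norm (p x / (1 + norm x))) \<partial>lborel) = (\<integral>\<^sup>+x. liminf (\<lambda>m. ennreal (\<bar>p x\<bar> / (1 + norm x) * bump (real (Suc m)) x)) \<partial>lborel)"
    using lim_imp_Liminf[OF sequentially_bot lim] n1 by (simp add: abs_of_pos)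
  also have "\<dots> \<le> liminf (\<lambda>m. \<integral>\<^sup>+x. ennreal (\<bar>p x\<bar> / (1 + norm x) * bump (real (Suc m)) x) \<partial>lborel)"
    by (rule nn_integral_liminf) measurable
  also have "\<dots> \<le> liminf (\<lambda>m::nat. ennreal C)" by (intro Liminf_mono always_eventually allI bound)
  also have "\<dots> = ennreal C" by (simp add: Liminf_const)
  also have "\<dots> < \<infinity>" by simp
  finally show ?thesis unfolding integrable_iff_bounded by simp
qed

section \<open>Radial gradient fields as test functions\<close>

lemma k_times_differentiable_continuous: "k_times_differentiable k g \<Longrightarrow> continuous_on UNIV g"
  by (cases k) (auto simp: continuous_on_eq_continuous_at differentiable_imp_continuous_within)

lemma k_times_differentiable_Suc_D: "k_times_differentiable (Suc k) g \<Longrightarrow> k_times_differentiable k g"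
proof (induction k arbitrary: g)
  case 0
  then show ?case using k_times_differentiable_continuous[of "Suc 0" g] by simp
next
  case (Suc k)
  then show ?case by (metis k_times_differentiable.simps(2))
qed

lemma k_times_differentiable_SucI:
  assumes "\<And>x. (g has_derivative g' x) (at x)" "\<And>d. k_times_differentiable k (\<lambda>x. g' x d)"
  shows "k_times_differentiable (Suc k) g"
proof -
  have "frechet_derivative g (at x) = g' x" for x
    using assms(1)[of x] by (rule frechet_derivative_at[symmetric])
  then show ?thesis using assms by (auto simp: differentiable_def)
qed

lemma k_times_differentiable_SucE:
  assumes "k_times_differentiable (Suc k) g"
  obtains g' where "\<And>x. (g has_derivative g' x) (at x)" "\<And>d. k_times_differentiable k (\<lambda>x. g' x d)"
  using assms frechet_derivative_works by (intro that[of "\<lambda>x. frechet_derivative g (at x)"]) auto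

lemma k_times_differentiable_const: "k_times_differentiable k (\<lambda>x. c)"
proof (induction k arbitrary: c)
  case (Suc k)
  show ?case by (rule k_times_differentiable_SucI[where g'="\<lambda>x d. 0"]) (auto intro: Suc)
qed simp

lemma k_times_differentiable_bounded_linear:
  assumes "bounded_linear f" shows "k_times_differentiable k f"
proof (cases k)
  case 0 then show ?thesis using assms by (simp add: linear_continuous_on)
next
  case (Suc m)
  show ?thesis unfolding Suc
    by (rule k_times_differentiable_SucI[where g'="\<lambda>x. f"])
       (auto intro: bounded_linear_imp_has_derivative assms k_times_differentiable_const)
qed

lemma k_times_differentiable_add:
  "k_times_differentiable k f \<Longrightarrow> k_times_differentiable k g \<Longrightarrow> k_times_differentiable k (\<lambda>x. f x + g x)"
proof (induction k arbitrary: f g)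
  case 0 then show ?case by (auto intro: continuous_intros)
next
  case (Suc k)
  obtain f' where f': "\<And>x. (f has_derivative f' x) (at x)" "\<And>d. k_times_differentiable k (\<lambda>x. f' x d)"
    using k_times_differentiable_SucE[OF Suc.prems(1)] by blast
  obtain g' where g': "\<And>x. (g has_derivative g' x) (at x)" "\<And>d. k_times_differentiable k (\<lambda>x. g' x d)"
    using k_times_differentiable_SucE[OF Suc.prems(2)] by blast
  show ?case
    by (rule k_times_differentiable_SucI[where g'="\<lambda>x d. f' x d + g' x d"])
       (auto intro: has_derivative_add f' g' Suc.IH)
qed

lemma k_times_differentiable_bilinear:
  assumes "bounded_bilinear B"
  shows "k_times_differentiable k f \<Longrightarrow> k_times_differentiable k g \<Longrightarrow> k_times_differentiable k (\<lambda>x. B (f x) (g x))"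
proof (induction k arbitrary: f g)
  case 0 then show ?case using bounded_bilinear.continuous_on[OF assms] by auto
next
  case (Suc k)
  obtain f' where f': "\<And>x. (f has_derivative f' x) (at x)" "\<And>d. k_times_differentiable k (\<lambda>x. f' x d)"
    using k_times_differentiable_SucE[OF Suc.prems(1)] by blast
  obtain g' where g': "\<And>x. (g has_derivative g' x) (at x)" "\<And>d. k_times_differentiable k (\<lambda>x. g' x d)"
    using k_times_differentiable_SucE[OF Suc.prems(2)] by blast
  note fg = k_times_differentiable_Suc_D[OF Suc.prems(1)] k_times_differentiable_Suc_D[OF Suc.prems(2)]
  show ?case
    by (rule k_times_differentiable_SucI[where g'="\<lambda>x d. B (f x) (g' x d) + B (f' x d) (g x)"])
       (intro bounded_bilinear.FDERIV[OF assms] f' g' k_times_differentiable_add Suc.IH fg)+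
qed

text \<open>
  A smooth function of one variable that vanishes beyond \<open>a\<close>, carried together with all its
  derivatives: \<open>h m\<close> is the \<open>m\<close>-th one. Composed with \<open>\<bar>x - y\<bar>\<^sup>2\<close> it gives a radial test function whose
  derivatives are again explicit in \<open>h\<close>.
\<close>

definition profile :: "(nat \<Rightarrow> real \<Rightarrow> real) \<Rightarrow> real \<Rightarrow> bool" where
  "profile h a \<longleftrightarrow> (\<forall>m s. (h m has_real_derivative h (Suc m) s) (at s)) \<and> (\<forall>m s. a \<le> s \<longrightarrow> h m s = 0)"

lemma profileD: "profile h a \<Longrightarrow> (h m has_real_derivative h (Suc m) s) (at s)"
  and profile_zero: "profile h a \<Longrightarrow> a \<le> s \<Longrightarrow> h m s = 0"
  by (auto simp: profile_def)

lemma profile_continuous: "profile h a \<Longrightarrow> continuous_on A (h m)"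
  by (rule continuous_at_imp_continuous_on) (auto intro: DERIV_isCont profileD)

text \<open>
  Induction on \<open>k\<close> for all \<open>m\<close> at once, since each derivative raises \<open>m\<close>.
\<close>

lemma k_times_differentiable_profile:
  assumes h: "profile h a" and q: "\<And>k. k_times_differentiable k q"
  shows "k_times_differentiable k (\<lambda>x. h m (q x))"
proof (induction k arbitrary: m)
  case 0
  show ?case using k_times_differentiable_continuous[OF q]
    by (auto intro: continuous_on_compose2[OF profile_continuous[OF h]])
next
  case (Suc k)
  obtain q' where q': "\<And>x. (q has_derivative q' x) (at x)" "\<And>d. k_times_differentiable k (\<lambda>x. q' x d)"
    using k_times_differentiable_SucE[OF q[of "Suc k"]] by blast
  show ?case
  proof (rule k_times_differentiable_SucI[where g'="\<lambda>x d. h (Suc m) (q x) * q' x d"])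
    show "((\<lambda>x. h m (q x)) has_derivative (\<lambda>d. h (Suc m) (q x) * q' x d)) (at x)" for x
      using has_derivative_compose[OF q'(1) profileD[OF h, of m "q x", unfolded has_field_derivative_def]] by (simp add: mult.commute)
    show "k_times_differentiable k (\<lambda>x. h (Suc m) (q x) * q' x d)" for d
      by (rule k_times_differentiable_bilinear[OF bounded_bilinear_mult Suc.IH q'(2)])
  qed
qed

lemma k_times_differentiable_diff_const: "k_times_differentiable k (\<lambda>x. x - y)"
  using k_times_differentiable_add[OF k_times_differentiable_bounded_linear[OF bounded_linear_ident] k_times_differentiable_const[of k "- y"]]
  by simp

definition radial :: "(nat \<Rightarrow> real \<Rightarrow> real) \<Rightarrow> real ^ 'n \<Rightarrow> real ^ 'n \<Rightarrow> real" where
  "radial h y x = h 0 ((x - y) \<bullet> (x - y))"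

definition radial_grad :: "(nat \<Rightarrow> real \<Rightarrow> real) \<Rightarrow> real ^ 'n \<Rightarrow> real ^ 'n \<Rightarrow> real ^ 'n" where
  "radial_grad h y x = (2 * h 1 ((x - y) \<bullet> (x - y))) *\<^sub>R (x - y)"

lemma compact_support_ball:
  fixes g :: "'a::euclidean_space \<Rightarrow> 'b::zero"
  assumes "\<And>x. a \<le> (x - y) \<bullet> (x - y) \<Longrightarrow> g x = 0"
  shows "compact_support_in UNIV g"
proof -
  have "{x \<in> UNIV. g x \<noteq> 0} \<subseteq> cball y (sqrt \<bar>a\<bar>)"
  proof
    fix x assume "x \<in> {x \<in> UNIV. g x \<noteq> 0}"
    then have "(x - y) \<bullet> (x - y) \<le> \<bar>a\<bar>" using assms[of x] by (cases "a \<le> (x - y) \<bullet> (x - y)") auto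
    then have "norm (x - y) \<le> sqrt \<bar>a\<bar>" unfolding norm_eq_sqrt_inner by (rule real_sqrt_le_mono)
    then show "x \<in> cball y (sqrt \<bar>a\<bar>)" by (simp add: dist_norm norm_minus_commute)
  qed
  then have "bounded {x \<in> UNIV. g x \<noteq> 0}" by (rule bounded_subset[OF bounded_cball])
  then show ?thesis unfolding compact_support_in_def by simp
qed

lemma k_times_differentiable_sq: "k_times_differentiable k (\<lambda>x::'a::real_inner. (x - y) \<bullet> (x - y))"
  by (intro k_times_differentiable_bilinear[OF bounded_bilinear_inner] k_times_differentiable_diff_const)

lemma radial_test:
  assumes h: "profile h a" shows "radial h y \<in> space_test_functions"
proof -
  have "k_times_differentiable k (radial h y)" for k
    unfolding radial_def[abs_def] by (rule k_times_differentiable_profile[OF h k_times_differentiable_sq])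
  moreover have "compact_support_in UNIV (radial h y)"
    by (rule compact_support_ball[of a y]) (simp add: radial_def profile_zero[OF h])
  ultimately show ?thesis by (simp add: space_test_functions_def smooth_def)
qed

lemma radial_grad_test:
  assumes h: "profile h a" shows "radial_grad h y \<in> space_test_functions"
proof -
  have "k_times_differentiable k (radial_grad h y)" for k
    unfolding radial_grad_def[abs_def]
    by (rule k_times_differentiable_bilinear[OF bounded_bilinear_scaleR
          k_times_differentiable_bilinear[OF bounded_bilinear_mult k_times_differentiable_const
            k_times_differentiable_profile[OF h k_times_differentiable_sq]] k_times_differentiable_diff_const])
  moreover have "compact_support_in UNIV (radial_grad h y)"
    by (rule compact_support_ball[of a y]) (simp add: radial_grad_def profile_zero[OF h])
  ultimately show ?thesis by (simp add: space_test_functions_def smooth_def)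
qed

lemma profile_sq_has_derivative:
  assumes "profile h a"
  shows "((\<lambda>x::'a::real_inner. h m ((x - y) \<bullet> (x - y))) has_derivative (\<lambda>d. 2 * h (Suc m) ((x - y) \<bullet> (x - y)) * ((x - y) \<bullet> d))) (at x)"
proof -
  have q: "((\<lambda>x. (x - y) \<bullet> (x - y)) has_derivative (\<lambda>d. 2 * ((x - y) \<bullet> d))) (at x)"
    by (auto intro!: derivative_eq_intros simp: inner_commute)
  show ?thesis
    using has_derivative_compose[OF q profileD[OF assms, of m, unfolded has_field_derivative_def]] by (simp add: mult_ac)
qed

lemma partial_derivI: "(g has_derivative g') (at x) \<Longrightarrow> partial_deriv i g x = g' (axis i 1)"
  unfolding partial_deriv_def by (simp add: frechet_derivative_at[symmetric])

lemma gradient_radial: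
  assumes "profile h a" shows "gradient (radial h y) = radial_grad h y"
proof (rule ext)
  fix x
  have "partial_deriv i (radial h y) x = radial_grad h y x $ i" for i
    unfolding radial_def[abs_def]
    by (subst partial_derivI[OF profile_sq_has_derivative[OF assms]]) (simp add: radial_grad_def inner_axis)
  then show "gradient (radial h y) x = radial_grad h y x" by (simp add: gradient_def vec_eq_iff)
qed

lemma radial_grad_has_derivative:
  assumes h: "profile h a"
  shows "(radial_grad h y has_derivative (\<lambda>d. (2 * h 1 ((x - y) \<bullet> (x - y))) *\<^sub>R d
     + (4 * h 2 ((x - y) \<bullet> (x - y)) * ((x - y) \<bullet> d)) *\<^sub>R (x - y))) (at x)"
  unfolding radial_grad_def[abs_def]
  by (rule has_derivative_eq_rhs[OF has_derivative_scaleR[OF has_derivative_mult_right[OF profile_sq_has_derivative[OF h]]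
        has_derivative_diff[OF has_derivative_ident has_derivative_const]]])
     (simp add: fun_eq_iff numeral_2_eq_2 mult_ac)

lemma axis_nth_if: "axis j (1::real) $ i = (if i = j then 1 else 0)"
  by (simp add: axis_def)

lemma vector_gradient_radial:
  assumes h: "profile h a"
  shows "vector_gradient (radial_grad h y) x $ i $ j =
    (if i = j then 2 * h 1 ((x - y) \<bullet> (x - y)) else 0) + 4 * h 2 ((x - y) \<bullet> (x - y)) * (x - y) $ i * (x - y) $ j"
proof -
  have "((\<lambda>x. radial_grad h y x $ i) has_derivative (\<lambda>d. ((2 * h 1 ((x - y) \<bullet> (x - y))) *\<^sub>R d
     + (4 * h 2 ((x - y) \<bullet> (x - y)) * ((x - y) \<bullet> d)) *\<^sub>R (x - y)) $ i)) (at x)"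
    by (rule bounded_linear.has_derivative[OF bounded_linear_vec_nth radial_grad_has_derivative[OF h]])
  from partial_derivI[OF this, of j] show ?thesis
    by (simp add: vector_gradient_def inner_axis axis_nth_if)
qed

lemma contraction_radial:
  assumes h: "profile h a"
  shows "contraction (outer_product u u) (vector_gradient (radial_grad h y) x)
    = 2 * h 1 ((x - y) \<bullet> (x - y)) * (u \<bullet> u) + 4 * h 2 ((x - y) \<bullet> (x - y)) * (u \<bullet> (x - y))\<^sup>2"
proof -
  let ?z = "x - y"
  have "contraction (outer_product u u) (vector_gradient (radial_grad h y) x)
     = (\<Sum>i\<in>UNIV. \<Sum>j\<in>UNIV. (if i = j then 2 * h 1 (?z \<bullet> ?z) * (u $ i * u $ j) else 0) + 4 * h 2 (?z \<bullet> ?z) * ((u $ i * ?z $ i) * (u $ j * ?z $ j)))"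
    unfolding contraction_def outer_product_def vector_gradient_radial[OF h]
    by (intro sum.cong refl) (auto simp: algebra_simps)
  also have "\<dots> = (\<Sum>i\<in>UNIV. 2 * h 1 (?z \<bullet> ?z) * (u $ i * u $ i)) + (\<Sum>i\<in>UNIV. \<Sum>j\<in>UNIV. 4 * h 2 (?z \<bullet> ?z) * ((u $ i * ?z $ i) * (u $ j * ?z $ j)))"
    by (simp add: sum.distrib)
  also have "\<dots> = 2 * h 1 (?z \<bullet> ?z) * (\<Sum>i\<in>UNIV. u $ i * u $ i) + 4 * h 2 (?z \<bullet> ?z) * ((\<Sum>i\<in>UNIV. u $ i * ?z $ i) * (\<Sum>j\<in>UNIV. u $ j * ?z $ j))"
    by (simp only: sum_product) (simp only: sum_distrib_left)
  finally show ?thesis by (simp add: inner_vec_def power2_eq_square)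
qed

lemma divergence_radial:
  fixes x y :: "real ^ 'n"
  assumes h: "profile h a"
  shows "divergence (radial_grad h y) x = 2 * real CARD('n) * h 1 ((x - y) \<bullet> (x - y)) + 4 * h 2 ((x - y) \<bullet> (x - y)) * ((x - y) \<bullet> (x - y))"
proof -
  let ?z = "x - y"
  have "divergence (radial_grad h y) x = (\<Sum>i\<in>UNIV. vector_gradient (radial_grad h y) x $ i $ i)"
    by (simp add: divergence_def vector_gradient_def)
  also have "\<dots> = (\<Sum>i\<in>UNIV. 2 * h 1 (?z \<bullet> ?z) + 4 * h 2 (?z \<bullet> ?z) * (?z $ i * ?z $ i))"
    unfolding vector_gradient_radial[OF h] by (intro sum.cong refl) simp
  also have "\<dots> = 2 * real CARD('n) * h 1 (?z \<bullet> ?z) + 4 * h 2 (?z \<bullet> ?z) * (\<Sum>i\<in>UNIV. ?z $ i * ?z $ i)"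
    by (simp add: sum.distrib sum_distrib_left)
  finally show ?thesis by (simp add: inner_vec_def)
qed

text \<open>
  The Laplacian of \<open>h 0 (\<bar>x\<bar>\<^sup>2)\<close> in dimension \<open>n\<close> is \<open>2 n h' + 4 s h''\<close> at \<open>s = \<bar>x\<bar>\<^sup>2\<close>; this is its
  \<open>m\<close>-th derivative in \<open>s\<close>.
\<close>

definition lap_profile :: "real \<Rightarrow> (nat \<Rightarrow> real \<Rightarrow> real) \<Rightarrow> nat \<Rightarrow> real \<Rightarrow> real" where
  "lap_profile n h m s = (2 * n + 4 * real m) * h (Suc m) s + 4 * s * h (Suc (Suc m)) s"

lemma profile_lap_profile: "profile h a \<Longrightarrow> profile (lap_profile n h) a"
  unfolding profile_def
proof (intro conjI allI impI)
  assume h: "(\<forall>m s. (h m has_real_derivative h (Suc m) s) (at s)) \<and> (\<forall>m s. a \<le> s \<longrightarrow> h m s = 0)"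
  fix m s
  show "(lap_profile n h m has_real_derivative lap_profile n h (Suc m) s) (at s)"
    unfolding lap_profile_def[abs_def]
    by (rule derivative_eq_intros refl h[THEN conjunct1, rule_format] | simp)+ (simp add: algebra_simps)
  show "a \<le> s \<Longrightarrow> lap_profile n h m s = 0" using h by (simp add: lap_profile_def)
qed

text \<open>
  The Laplacian of a gradient is the gradient of the Laplacian, so it integrates to zero against
  divergence free fields. This is why the viscous term disappears for every value of the viscosity.
\<close>

lemma laplacian_radial:
  fixes y :: "real ^ 'n"
  assumes h: "profile h a"
  shows "laplacian (radial_grad h y) = gradient (radial (lap_profile (real CARD('n)) h) y)"
proof (rule ext)
  fix x
  let ?z = "\<lambda>x. x - y"
  let ?q = "(x - y) \<bullet> (x - y)"
  have 1: "partial_deriv i (radial_grad h y) = (\<lambda>x. (2 * h 1 (?z x \<bullet> ?z x)) *\<^sub>R axis i 1 + (4 * h 2 (?z x \<bullet> ?z x) * (?z x $ i)) *\<^sub>R ?z x)" for i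
    by (rule ext, subst partial_derivI[OF radial_grad_has_derivative[OF h]]) (simp add: inner_axis)
  have 2: "((\<lambda>x. (2 * h 1 (?z x \<bullet> ?z x)) *\<^sub>R axis i 1 + (4 * h 2 (?z x \<bullet> ?z x) * (?z x $ i)) *\<^sub>R ?z x) has_derivative
     (\<lambda>d. (4 * h 2 ?q * (?z x \<bullet> d)) *\<^sub>R axis i 1 + ((4 * h 2 ?q * ?z x $ i) *\<^sub>R d + (4 * h 2 ?q * d $ i + 8 * h 3 ?q * (?z x \<bullet> d) * ?z x $ i) *\<^sub>R ?z x))) (at x)" for i
  proof -
    have c: "((\<lambda>x. ?z x $ i) has_derivative (\<lambda>d. d $ i)) (at x)"
      by (rule bounded_linear.has_derivative[OF bounded_linear_vec_nth, THEN has_derivative_eq_rhs]) (auto intro!: derivative_eq_intros)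
    have a: "((\<lambda>x. (2 * h 1 (?z x \<bullet> ?z x)) *\<^sub>R axis i (1::real)) has_derivative (\<lambda>d. (4 * h 2 ?q * (?z x \<bullet> d)) *\<^sub>R axis i 1)) (at x)"
      by (rule has_derivative_eq_rhs[OF has_derivative_scaleR_left[OF has_derivative_mult_right[OF profile_sq_has_derivative[OF h]]]])
         (simp add: fun_eq_iff numeral_2_eq_2)
    have b: "((\<lambda>x. (4 * h 2 (?z x \<bullet> ?z x) * (?z x $ i)) *\<^sub>R ?z x) has_derivative
      (\<lambda>d. (4 * h 2 ?q * ?z x $ i) *\<^sub>R d + (4 * h 2 ?q * d $ i + 8 * h 3 ?q * (?z x \<bullet> d) * ?z x $ i) *\<^sub>R ?z x)) (at x)"
      by (rule has_derivative_eq_rhs[OF has_derivative_scaleR[OF has_derivative_mult[OF has_derivative_mult_right[OF profile_sq_has_derivative[OF h]] c]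
        has_derivative_diff[OF has_derivative_ident has_derivative_const]]])
         (simp add: fun_eq_iff eval_nat_numeral algebra_simps)
    show ?thesis by (rule has_derivative_add[OF a b])
  qed
  have "partial_deriv i (partial_deriv i (radial_grad h y)) x = (8 * h 2 ?q * ?z x $ i) *\<^sub>R axis i 1 + (4 * h 2 ?q + 8 * h 3 ?q * (?z x $ i * ?z x $ i)) *\<^sub>R ?z x" for i
    unfolding 1 by (subst partial_derivI[OF 2]) (simp add: inner_axis vec_eq_iff axis_nth_if algebra_simps)
  then have "laplacian (radial_grad h y) x = (\<Sum>i\<in>UNIV. (8 * h 2 ?q * ?z x $ i) *\<^sub>R axis i 1 + (4 * h 2 ?q + 8 * h 3 ?q * (?z x $ i * ?z x $ i)) *\<^sub>R ?z x)"
    by (simp add: laplacian_def)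
  also have "\<dots> = (8 * h 2 ?q) *\<^sub>R (\<Sum>i\<in>UNIV. ?z x $ i *\<^sub>R axis i 1) + (\<Sum>i\<in>(UNIV :: 'n set). 4 * h 2 ?q + 8 * h 3 ?q * (?z x $ i * ?z x $ i)) *\<^sub>R ?z x"
    by (subst sum.distrib) (simp add: scaleR_sum_right scaleR_sum_left)
  also have "(\<Sum>i\<in>UNIV. ?z x $ i *\<^sub>R axis i 1) = ?z x"
    using basis_expansion[of "?z x"] by (simp add: scalar_mult_eq_scaleR)
  also have "(\<Sum>i\<in>(UNIV :: 'n set). 4 * h 2 ?q + 8 * h 3 ?q * (?z x $ i * ?z x $ i)) = 4 * real CARD('n) * h 2 ?q + 8 * h 3 ?q * ?q"
    unfolding sum.distrib sum_distrib_left[symmetric] by (simp add: inner_vec_def)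
  also have "(8 * h 2 ?q) *\<^sub>R ?z x + (4 * real CARD('n) * h 2 ?q + 8 * h 3 ?q * ?q) *\<^sub>R ?z x = radial_grad (lap_profile (real CARD('n)) h) y x"
    unfolding radial_grad_def lap_profile_def scaleR_add_left[symmetric] by (simp add: eval_nat_numeral algebra_simps)
  finally show "laplacian (radial_grad h y) x = gradient (radial (lap_profile (real CARD('n)) h) y) x"
    by (simp add: gradient_radial[OF profile_lap_profile[OF h]])
qed

section \<open>Smooth profiles approximating a truncated parabola\<close>

text \<open>
  The derivatives of \<open>exp (- 1 / s)\<close> are polynomials in \<open>1 / s\<close> times the function itself; differentiating
  \<open>P (1 / s) exp (- 1 / s)\<close> turns \<open>P\<close> into \<open>X\<^sup>2 (P - P')\<close>.
\<close>

primrec expinv_poly :: "nat \<Rightarrow> real poly" where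
  "expinv_poly 0 = 1"
| "expinv_poly (Suc m) = [:0, 0, 1:] * (expinv_poly m - pderiv (expinv_poly m))"

definition expinv :: "nat \<Rightarrow> real \<Rightarrow> real" where
  "expinv m s = (if 0 < s then poly (expinv_poly m) (1 / s) * exp (- (1 / s)) else 0)"

lemma poly_exp_tendsto_0: "((\<lambda>x::real. poly P x * exp (- x)) \<longlongrightarrow> 0) at_top"
proof -
  have "((\<lambda>x. \<Sum>i\<le>degree P. coeff P i * (x ^ i / exp x)) \<longlongrightarrow> (\<Sum>i\<le>degree P. coeff P i * 0)) at_top"
    by (intro tendsto_sum tendsto_mult tendsto_const tendsto_power_div_exp_0)
  then show ?thesis by (simp add: poly_altdef exp_minus sum_distrib_right divide_inverse mult.assoc)
qed

lemma expinv_has_derivative: "(expinv m has_real_derivative expinv (Suc m) s) (at s)"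
proof (cases s "0::real" rule: linorder_cases)
  case less
  show ?thesis
    by (rule has_field_derivative_transform_within_open[where S="{..<0}" and f="\<lambda>_. 0"]) (use less in \<open>auto simp: expinv_def\<close>)
next
  case greater
  have "((\<lambda>s. poly (expinv_poly m) (1 / s) * exp (- (1 / s))) has_real_derivative expinv (Suc m) s) (at s)"
  proof -
    have i: "((\<lambda>s. 1 / s) has_real_derivative - (1 / s\<^sup>2)) (at s)"
      using greater by (auto intro!: derivative_eq_intros simp: power2_eq_square)
    have "((\<lambda>s. poly (expinv_poly m) (1 / s)) has_real_derivative poly (pderiv (expinv_poly m)) (1 / s) * - (1 / s\<^sup>2)) (at s)"
      by (rule DERIV_chain2[OF poly_DERIV i])
    moreover have "((\<lambda>s. exp (- (1 / s))) has_real_derivative exp (- (1 / s)) * (1 / s\<^sup>2)) (at s)"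
      using DERIV_chain2[OF DERIV_exp DERIV_minus[OF i]] by simp
    ultimately have "((\<lambda>s. poly (expinv_poly m) (1 / s) * exp (- (1 / s))) has_real_derivative
      poly (pderiv (expinv_poly m)) (1 / s) * - (1 / s\<^sup>2) * exp (- (1 / s)) + exp (- (1 / s)) * (1 / s\<^sup>2) * poly (expinv_poly m) (1 / s)) (at s)"
      by (rule DERIV_mult)
    then show ?thesis by (rule DERIV_cong) (use greater in \<open>simp add: expinv_def power2_eq_square algebra_simps\<close>)
  qed
  then show ?thesis
    by (rule has_field_derivative_transform_within_open[where S="{0<..}"]) (use greater in \<open>auto simp: expinv_def\<close>)
next
  case equal
  have "(\<lambda>h. expinv m h / h) \<midarrow>0\<rightarrow> 0"
  proof (rule filterlim_split_at)
    show "((\<lambda>h. expinv m h / h) \<longlongrightarrow> 0) (at_left 0)"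
      by (rule tendsto_eventually) (auto simp: eventually_at_filter expinv_def)
    have "((\<lambda>h. poly ([:0, 1:] * expinv_poly m) (inverse h) * exp (- inverse h)) \<longlongrightarrow> 0) (at_right 0)"
      by (rule filterlim_compose[OF poly_exp_tendsto_0 filterlim_inverse_at_top_right])
    then show "((\<lambda>h. expinv m h / h) \<longlongrightarrow> 0) (at_right 0)"
      by (rule Lim_transform_eventually) (auto simp: eventually_at_filter expinv_def field_simps)
  qed
  then show ?thesis using equal by (simp add: DERIV_def) (simp add: expinv_def)
qed

lemma antiderivative_vanishing:
  fixes e :: "real \<Rightarrow> real"
  assumes "\<And>s. isCont e s" "\<And>s. s \<le> 0 \<Longrightarrow> e s = 0"
  obtains E where "\<And>s. (E has_real_derivative e s) (at s)" "\<And>s. s \<le> 0 \<Longrightarrow> E s = 0"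
proof -
  obtain F where F: "\<And>x. (F has_vector_derivative e x) (at x)"
    using einterval_antiderivative[of "- \<infinity>" "\<infinity>" e] assms(1) by auto
  have F': "(F has_real_derivative e x) (at x)" for x
    using F by (simp add: has_real_derivative_iff_has_vector_derivative)
  show ?thesis
  proof (rule that[of "\<lambda>s. F s - F 0"])
    show "((\<lambda>s. F s - F 0) has_real_derivative e s) (at s)" for s
      using F'[of s] by (auto intro!: derivative_eq_intros)
    show "F s - F 0 = 0" if "s \<le> 0" for s
    proof (cases "s = 0")
      case False
      then have "s < 0" using that by simp
      then obtain z where "s < z" "z < 0" "F 0 - F s = (0 - s) * e z"
        using MVT2[of s 0 F e] F' by blast
      then show ?thesis using assms(2)[of z] by simp
    qed simp
  qed
qed

lemma expinv_0_bounds: "0 \<le> expinv 0 s" "expinv 0 s \<le> 1" "0 < s \<Longrightarrow> 1 - 1 / s \<le> expinv 0 s"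
  using exp_ge_add_one_self[of "- (1 / s)"] by (auto simp: expinv_def)

text \<open>
  Let \<open>E\<close> be the second antiderivative of \<open>exp (- 1 / s)\<close>, extended by \<open>0\<close> to the negative axis. As
  \<open>n \<rightarrow> \<infinity>\<close>, the rescaled functions \<open>E (n (a - s)) / n\<^sup>2\<close> approach \<open>(a - s)\<^sub>+\<^sup>2 / 2\<close>; the first and second
  derivatives converge pointwise with bounds independent of \<open>n\<close>.
\<close>

lemma exists_profiles:
  obtains h :: "real \<Rightarrow> nat \<Rightarrow> nat \<Rightarrow> real \<Rightarrow> real" where
    "\<And>a n. profile (h a n) a"
    "\<And>n m. continuous_on UNIV (\<lambda>(a, s). h a n m s)"
    "\<And>a n s. \<bar>h a n 2 s\<bar> \<le> 1" "\<And>a n s. \<bar>h a n 1 s\<bar> \<le> max 0 (a - s)"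
    "\<And>a s. (\<lambda>n. h a n 2 s) \<longlonglongrightarrow> (if s < a then 1 else 0)"
    "\<And>a s. (\<lambda>n. h a n 1 s) \<longlonglongrightarrow> - max 0 (a - s)"
proof -
  have c0: "isCont (expinv 0) s" for s by (rule DERIV_isCont[OF expinv_has_derivative])
  obtain E1 where E1: "\<And>s. (E1 has_real_derivative expinv 0 s) (at s)" "\<And>s. s \<le> 0 \<Longrightarrow> E1 s = 0"
    by (rule antiderivative_vanishing[OF c0]) (auto simp: expinv_def)
  have c1: "isCont E1 s" for s by (rule DERIV_isCont[OF E1(1)])
  obtain E2 where E2: "\<And>s. (E2 has_real_derivative E1 s) (at s)" "\<And>s. s \<le> 0 \<Longrightarrow> E2 s = 0"
    by (rule antiderivative_vanishing[OF c1 E1(2)], assumption, rule that)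
  define B where "B m = (case m of 0 \<Rightarrow> E2 | Suc 0 \<Rightarrow> E1 | Suc (Suc k) \<Rightarrow> expinv k)" for m
  have B: "(B m has_real_derivative B (Suc m) s) (at s)" for m s
    using E1(1) E2(1) expinv_has_derivative by (auto simp: B_def split: nat.split)
  have B0: "B m s = 0" if "s \<le> 0" for m s
    using E1(2)[OF that] E2(2)[OF that] that by (auto simp: B_def expinv_def split: nat.split)
  have Bc: "continuous_on UNIV (B m)" for m by (intro continuous_at_imp_continuous_on ballI DERIV_isCont[OF B])
  have E1_bounds: "0 \<le> E1 s" "E1 s \<le> max 0 s" for s
  proof -
    have "0 \<le> E1 s \<and> E1 s \<le> max 0 s"
    proof (cases "0 < s")
      case True
      then obtain z where "E1 s - E1 0 = (s - 0) * expinv 0 z" using MVT2[of 0 s E1 "expinv 0"] E1(1) by blast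
      then show ?thesis using True E1(2)[of 0] expinv_0_bounds(1,2)[of z] by (auto simp: mult_left_le)
    qed (use E1(2)[of s] in auto)
    then show "0 \<le> E1 s" "E1 s \<le> max 0 s" by auto
  qed
  \<comment> \<open>From \<open>exp (- 1 / s) \<ge> 1 - 1 / s\<close>; the logarithm is negligible after division by \<open>n\<close>.\<close>
  have E1_lower: "s - 1 - ln s \<le> E1 s" if s: "1 \<le> s" for s
  proof -
    have "E1 1 - (1 - 1 - ln 1) \<le> E1 s - (s - 1 - ln s)"
    proof (rule DERIV_nonneg_imp_nondecreasing[OF s])
      fix x :: real assume "1 \<le> x" "x \<le> s"
      then have "((\<lambda>x. E1 x - (x - 1 - ln x)) has_real_derivative expinv 0 x - (1 - 1 / x)) (at x)"
        by (auto intro!: derivative_eq_intros E1(1) simp: field_simps)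
      moreover have "0 \<le> expinv 0 x - (1 - 1 / x)" using expinv_0_bounds(3)[of x] \<open>1 \<le> x\<close> by simp
      ultimately show "\<exists>y. ((\<lambda>x. E1 x - (x - 1 - ln x)) has_real_derivative y) (at x) \<and> 0 \<le> y" by blast
    qed
    then show ?thesis using E1_bounds(1)[of 1] by simp
  qed
  \<comment> \<open>The scaling parameter is \<open>n + 1\<close>, hence never zero.\<close>
  define l where "l n = real (Suc n)" for n
  have l: "0 < l n" for n by (simp add: l_def)
  define h where "h a n m s = (- l n) ^ m / (l n)\<^sup>2 * B m (l n * (a - s))" for a n m s
  have h1: "h a n 1 s = - (E1 (l n * (a - s)) / l n)" for a n s
    using l[of n] by (simp add: h_def B_def power2_eq_square)
  have h2: "h a n 2 s = expinv 0 (l n * (a - s))" for a n s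
    using l[of n] by (simp add: h_def B_def numeral_2_eq_2)
  show ?thesis
  proof (rule that[of h])
    fix a n s
    show "profile (h a n) a" unfolding profile_def
    proof (intro conjI allI impI)
      fix m s
      have "((\<lambda>s. B m (l n * (a - s))) has_real_derivative B (Suc m) (l n * (a - s)) * - l n) (at s)"
        by (rule DERIV_chain2[OF B]) (auto intro!: derivative_eq_intros)
      from DERIV_cmult[OF this, of "(- l n) ^ m / (l n)\<^sup>2"]
      show "(h a n m has_real_derivative h a n (Suc m) s) (at s)" unfolding h_def[abs_def] by (simp add: mult_ac)
      show "a \<le> s \<Longrightarrow> h a n m s = 0" using l[of n] by (simp add: h_def B0 mult_nonneg_nonpos)
    qed
    show "\<bar>h a n 2 s\<bar> \<le> 1" unfolding h2 using expinv_0_bounds by simp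
    show "\<bar>h a n 1 s\<bar> \<le> max 0 (a - s)"
      unfolding h1 using E1_bounds[of "l n * (a - s)"] l[of n]
      by (auto simp: abs_of_nonneg pos_divide_le_eq max_def mult.commute zero_le_mult_iff split: if_splits)
  next
    fix n m
    show "continuous_on UNIV (\<lambda>(a, s). h a n m s)" unfolding h_def case_prod_unfold
      by (intro continuous_intros continuous_on_compose2[OF Bc]) auto
  next
    fix a s
    show "(\<lambda>n. h a n 2 s) \<longlonglongrightarrow> (if s < a then 1 else 0)"
    proof (cases "s < a")
      case True
      define d where "d = a - s"
      have d: "0 < d" using True by (simp add: d_def)
      have "(\<lambda>n. exp (- (1 / (real (Suc n) * d)))) \<longlonglongrightarrow> 1" using d by real_asymp
      moreover have "h a n 2 s = exp (- (1 / (real (Suc n) * d)))" for n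
        using d unfolding h2 l_def d_def[symmetric] by (simp add: expinv_def zero_less_mult_iff)
      ultimately show ?thesis using True by simp
    next
      case False
      then have "h a n 2 s = 0" for n unfolding h2 using l[of n] by (auto simp: expinv_def zero_less_mult_iff)
      then show ?thesis using False by simp
    qed
    show "(\<lambda>n. h a n 1 s) \<longlonglongrightarrow> - max 0 (a - s)"
    proof (cases "s < a")
      case True
      define d where "d = a - s"
      have d: "0 < d" using True by (simp add: d_def)
      have "(\<lambda>n. E1 (l n * d) / l n) \<longlonglongrightarrow> d"
      proof (rule tendsto_sandwich)
        show "(\<lambda>n. (real (Suc n) * d - 1 - ln (real (Suc n) * d)) / real (Suc n)) \<longlonglongrightarrow> d" using d by real_asymp
        show "(\<lambda>n. d) \<longlonglongrightarrow> d" by simp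
        show "\<forall>\<^sub>F n in sequentially. E1 (l n * d) / l n \<le> d"
          using E1_bounds(2)[of "l n * d" for n] l d by (intro always_eventually allI) (simp add: pos_divide_le_eq mult.commute)
        have "filterlim (\<lambda>n. real (Suc n) * d) at_top sequentially" using d by real_asymp
        then have "\<forall>\<^sub>F n in sequentially. 1 \<le> real (Suc n) * d" by (simp add: filterlim_at_top)
        then show "\<forall>\<^sub>F n in sequentially. (real (Suc n) * d - 1 - ln (real (Suc n) * d)) / real (Suc n) \<le> E1 (l n * d) / l n"
          by eventually_elim (use E1_lower in \<open>auto simp: l_def intro!: divide_right_mono\<close>)
      qed
      then have "(\<lambda>n. - (E1 (l n * (a - s)) / l n)) \<longlonglongrightarrow> - (a - s)"
        unfolding d_def by (rule tendsto_minus)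
      moreover have "max 0 (a - s) = a - s" using True by simp
      ultimately show ?thesis unfolding h1 by simp
    next
      case False
      then have "h a n 1 s = 0" for n unfolding h1 using l[of n] E1(2)[of "l n * (a - s)"] by (simp add: mult_nonneg_nonpos)
      then show ?thesis using False by simp
    qed
  qed
qed

section \<open>The stationary identity on balls\<close>

text \<open>
  Two signed measures on the line with the same distribution function agree: half-lines are stable
  under intersection, and the sets of agreement form a Dynkin system. The measures are given as
  images of densities on two possibly different spaces.
\<close>

lemma integral_eq_of_half_lines_sets:
  fixes c1 :: "'a \<Rightarrow> real" and c2 :: "'b \<Rightarrow> real"
  assumes c1: "integrable M1 c1" and r1 [measurable]: "r1 \<in> borel_measurable M1"
    and c2: "integrable M2 c2" and r2 [measurable]: "r2 \<in> borel_measurable M2"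
    and eq: "\<And>a::real. (\<integral>x. indicator {..<a} (r1 x) * c1 x \<partial>M1) = (\<integral>x. indicator {..<a} (r2 x) * c2 x \<partial>M2)"
    and B: "B \<in> sets borel"
  shows "(\<integral>x. indicator B (r1 x) * c1 x \<partial>M1) = (\<integral>x. indicator B (r2 x) * c2 x \<partial>M2)"
proof -
  have int: "integrable M (\<lambda>x. indicator B (r x) * c x)"
    if c: "integrable M c" and r [measurable]: "r \<in> borel_measurable M" and B [measurable]: "B \<in> sets borel"
    for M :: "'c measure" and c :: "'c \<Rightarrow> real" and r :: "'c \<Rightarrow> real" and B
  proof (rule Bochner_Integration.integrable_bound[OF c])
    have [measurable]: "c \<in> borel_measurable M" using c by auto
    show "(\<lambda>x. indicator B (r x) * c x) \<in> borel_measurable M" by measurable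
  qed (auto split: split_indicator)
  have lim: "(\<lambda>n. \<integral>x. indicator (A n) (r x) * c x \<partial>M) \<longlonglongrightarrow> (\<integral>x. indicator A' (r x) * c x \<partial>M)"
    if c: "integrable M c" and r [measurable]: "r \<in> borel_measurable M"
      and A [measurable]: "\<And>n::nat. A n \<in> sets borel" and A' [measurable]: "A' \<in> sets borel"
      and l: "\<And>s. (\<lambda>n. indicator (A n) s :: real) \<longlonglongrightarrow> indicator A' s"
    for M :: "'c measure" and c :: "'c \<Rightarrow> real" and r :: "'c \<Rightarrow> real" and A A'
  proof (rule integral_dominated_convergence[where w="\<lambda>x. \<bar>c x\<bar>"])
    have [measurable]: "c \<in> borel_measurable M" using c by auto
    show "(\<lambda>x. indicator A' (r x) * c x) \<in> borel_measurable M" "(\<lambda>x. indicator (A n) (r x) * c x) \<in> borel_measurable M" for n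
      by measurable
    show "AE x in M. (\<lambda>n. indicator (A n) (r x) * c x) \<longlonglongrightarrow> indicator A' (r x) * c x"
      by (intro AE_I2 tendsto_intros l)
  qed (use c in \<open>auto split: split_indicator\<close>)
  have total: "(\<integral>x. c1 x \<partial>M1) = (\<integral>x. c2 x \<partial>M2)"
  proof -
    have l: "(\<lambda>n. indicator {..<real n} s :: real) \<longlonglongrightarrow> indicator UNIV s" for s
    proof (rule tendsto_eventually)
      obtain m where "s < real m" using reals_Archimedean2 by blast
      then show "\<forall>\<^sub>F n in sequentially. (indicator {..<real n} s :: real) = indicator UNIV s"
        by (intro eventually_sequentiallyI[of m]) (auto split: split_indicator)
    qed
    have "(\<lambda>n. \<integral>x. indicator {..<real n} (r1 x) * c1 x \<partial>M1) \<longlonglongrightarrow> (\<integral>x. indicator UNIV (r1 x) * c1 x \<partial>M1)"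
      by (rule lim[OF c1 r1 _ _ l]) auto
    moreover have "(\<lambda>n. \<integral>x. indicator {..<real n} (r2 x) * c2 x \<partial>M2) \<longlonglongrightarrow> (\<integral>x. indicator UNIV (r2 x) * c2 x \<partial>M2)"
      by (rule lim[OF c2 r2 _ _ l]) auto
    ultimately show ?thesis unfolding eq by (simp add: LIMSEQ_unique)
  qed
  have sets_eq: "sets (borel :: real measure) = sigma_sets UNIV (range lessThan)"
    by (subst borel_Iio) (simp add: sets_measure_of)
  have gen: "B \<in> sigma_sets UNIV (range lessThan)"
    using B unfolding sets_eq .
  have stable: "Int_stable (range (lessThan :: real \<Rightarrow> _))"
  proof (rule Int_stableI)
    fix A B :: "real set" assume "A \<in> range lessThan" "B \<in> range lessThan"
    then obtain a b where "A = {..<a}" "B = {..<b}" by auto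
    then have "A \<inter> B = {..<min a b}" by auto
    then show "A \<inter> B \<in> range lessThan" by simp
  qed
  have sb: "A \<in> sets borel" if "A \<in> sigma_sets UNIV (range (lessThan :: real \<Rightarrow> _))" for A
    using that unfolding sets_eq .
  have PU: "range (lessThan :: real \<Rightarrow> _) \<subseteq> Pow UNIV" by simp
  from stable PU gen show ?thesis
  proof (induction B rule: sigma_sets_induct_disjoint)
    case (basic A) then show ?case using eq by auto
  next
    case empty show ?case by simp
  next
    case (compl A)
    have [simp]: "(indicator (UNIV - A) s :: real) = 1 - indicator A s" for s by (auto split: split_indicator)
    have A: "A \<in> sets borel" by (rule sb[OF compl.hyps])
    show ?case using compl.IH total int[OF c1 r1 A] int[OF c2 r2 A] c1 c2 by (simp add: left_diff_distrib)
  next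
    case (union A)
    have A: "\<And>n. A n \<in> sets borel" using union.hyps by (intro sb) auto
    define U where "U n = (\<Union>i<n. A i)" for n :: nat
    have U: "\<And>n. U n \<in> sets borel" unfolding U_def using A by auto
    have AU: "(\<Union>i. A i) \<in> sets borel" using A by auto
    have l: "(\<lambda>n. indicator (U n) s :: real) \<longlonglongrightarrow> indicator (\<Union>i. A i) s" for s
      unfolding U_def by (rule LIMSEQ_indicator_UN)
    have sum: "(indicator (U n) s :: real) = (\<Sum>i<n. indicator (A i) s)" for n s
      unfolding U_def using union.hyps(1) by (intro indicator_UN_disjoint) (auto simp: disjoint_family_on_def)
    have "(\<integral>x. indicator (U n) (r1 x) * c1 x \<partial>M1) = (\<Sum>i<n. \<integral>x. indicator (A i) (r1 x) * c1 x \<partial>M1)" for n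
      unfolding sum sum_distrib_right using int[OF c1 r1 A] by (intro Bochner_Integration.integral_sum) auto
    moreover have "(\<integral>x. indicator (U n) (r2 x) * c2 x \<partial>M2) = (\<Sum>i<n. \<integral>x. indicator (A i) (r2 x) * c2 x \<partial>M2)" for n
      unfolding sum sum_distrib_right using int[OF c2 r2 A] by (intro Bochner_Integration.integral_sum) auto
    ultimately have "(\<integral>x. indicator (U n) (r1 x) * c1 x \<partial>M1) = (\<integral>x. indicator (U n) (r2 x) * c2 x \<partial>M2)" for n
      using union.IH by simp
    then show ?case using lim[OF c1 r1 U AU l] lim[OF c2 r2 U AU l] by (simp add: LIMSEQ_unique)
  qed
qed

text \<open>
  From sets to bounded functions through uniform approximation by the step functions
  \<open>\<lfloor>n \<beta>\<rfloor> / n\<close>.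
\<close>

lemma integral_eq_of_half_lines:
  fixes c1 :: "'a \<Rightarrow> real" and c2 :: "'b \<Rightarrow> real" and \<beta> :: "real \<Rightarrow> real"
  assumes c1: "integrable M1 c1" and r1 [measurable]: "r1 \<in> borel_measurable M1"
    and c2: "integrable M2 c2" and r2 [measurable]: "r2 \<in> borel_measurable M2"
    and eq: "\<And>a::real. (\<integral>x. indicator {..<a} (r1 x) * c1 x \<partial>M1) = (\<integral>x. indicator {..<a} (r2 x) * c2 x \<partial>M2)"
    and \<beta> [measurable]: "\<beta> \<in> borel_measurable borel" and bound: "\<And>s. \<bar>\<beta> s\<bar> \<le> B"
  shows "(\<integral>x. \<beta> (r1 x) * c1 x \<partial>M1) = (\<integral>x. \<beta> (r2 x) * c2 x \<partial>M2)"
proof -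
  define b where "b n s = real_of_int \<lfloor>real (Suc n) * \<beta> s\<rfloor> / real (Suc n)" for n s
  have bm [measurable]: "b n \<in> borel_measurable borel" for n unfolding b_def by measurable
  have close: "\<bar>\<beta> s - b n s\<bar> \<le> 1 / real (Suc n)" for n s
  proof -
    have "\<bar>real (Suc n) * \<beta> s - real_of_int \<lfloor>real (Suc n) * \<beta> s\<rfloor>\<bar> \<le> 1" by linarith
    moreover have "real (Suc n) * (\<beta> s - b n s) = real (Suc n) * \<beta> s - real_of_int \<lfloor>real (Suc n) * \<beta> s\<rfloor>"
      by (simp add: b_def right_diff_distrib)
    ultimately have "real (Suc n) * \<bar>\<beta> s - b n s\<bar> \<le> 1" by (metis abs_mult abs_of_nat)
    then show ?thesis by (simp add: field_simps)
  qed
  have bB: "\<bar>b n s\<bar> \<le> B + 1" for n s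
  proof -
    have "1 / real (Suc n) \<le> 1" by simp
    then show ?thesis using close[of s n] bound[of s] by linarith
  qed
  have blim: "(\<lambda>n. b n s) \<longlonglongrightarrow> \<beta> s" for s
  proof (rule LIM_zero_cancel, rule Lim_null_comparison)
    show "\<forall>\<^sub>F n in sequentially. norm (b n s - \<beta> s) \<le> 1 / real (Suc n)"
      using close[of s] by (intro always_eventually allI) (simp add: abs_minus_commute)
    show "(\<lambda>n. 1 / real (Suc n)) \<longlonglongrightarrow> 0" by real_asymp
  qed
  define S where "S n = {- \<lceil>real (Suc n) * B\<rceil> - 1..\<lceil>real (Suc n) * B\<rceil> + 1}" for n
  have inS: "\<lfloor>real (Suc n) * \<beta> s\<rfloor> \<in> S n" for n s
  proof -
    have "\<bar>real (Suc n) * \<beta> s\<bar> \<le> real (Suc n) * B" using bound[of s] by (simp add: abs_mult del: of_nat_Suc)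
    then show ?thesis unfolding S_def atLeastAtMost_iff by (intro conjI) linarith+
  qed
  define A where "A n k = {s. \<lfloor>real (Suc n) * \<beta> s\<rfloor> = k}" for n k
  have A [measurable]: "A n k \<in> sets borel" for n k unfolding A_def by measurable
  have bsum: "b n s = (\<Sum>k\<in>S n. real_of_int k / real (Suc n) * indicator (A n k) s)" for n s
  proof -
    have "(\<Sum>k\<in>S n. real_of_int k / real (Suc n) * indicator (A n k) s) = (\<Sum>k\<in>S n. if k = \<lfloor>real (Suc n) * \<beta> s\<rfloor> then real_of_int k / real (Suc n) else 0)"
      by (intro sum.cong refl) (auto simp: A_def)
    also have "\<dots> = b n s" using inS[of n s] by (subst sum.delta) (auto simp: S_def b_def)
    finally show ?thesis by simp
  qed
  have int: "(\<integral>x. b n (r x) * c x \<partial>M) = (\<Sum>k\<in>S n. real_of_int k / real (Suc n) * (\<integral>x. indicator (A n k) (r x) * c x \<partial>M))"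
    if c: "integrable M c" and r [measurable]: "r \<in> borel_measurable M" for M :: "'c measure" and c :: "'c \<Rightarrow> real" and r n
  proof -
    have [measurable]: "c \<in> borel_measurable M" using c by auto
    have i: "integrable M (\<lambda>x. indicator (A n k) (r x) * c x)" for k
      by (rule Bochner_Integration.integrable_bound[OF c]) (auto split: split_indicator)
    have "(\<integral>x. b n (r x) * c x \<partial>M) = (\<integral>x. (\<Sum>k\<in>S n. real_of_int k / real (Suc n) * (indicator (A n k) (r x) * c x)) \<partial>M)"
      unfolding bsum sum_distrib_right by (simp only: mult.assoc)
    also have "\<dots> = (\<Sum>k\<in>S n. \<integral>x. real_of_int k / real (Suc n) * (indicator (A n k) (r x) * c x) \<partial>M)"
      by (intro Bochner_Integration.integral_sum integrable_mult_right i)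
    finally show ?thesis by (simp only: integral_mult_right_zero)
  qed
  have lim: "(\<lambda>n. \<integral>x. b n (r x) * c x \<partial>M) \<longlonglongrightarrow> (\<integral>x. \<beta> (r x) * c x \<partial>M)"
    if c: "integrable M c" and r [measurable]: "r \<in> borel_measurable M" for M :: "'c measure" and c :: "'c \<Rightarrow> real" and r
  proof (rule integral_dominated_convergence[where w="\<lambda>x. (B + 1) * \<bar>c x\<bar>"])
    have [measurable]: "c \<in> borel_measurable M" using c by auto
    show "(\<lambda>x. \<beta> (r x) * c x) \<in> borel_measurable M" "(\<lambda>x. b n (r x) * c x) \<in> borel_measurable M" for n by measurable
    show "AE x in M. norm (b n (r x) * c x) \<le> (B + 1) * \<bar>c x\<bar>" for n
      using bB by (intro AE_I2) (auto simp: abs_mult intro!: mult_right_mono)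
    show "AE x in M. (\<lambda>n. b n (r x) * c x) \<longlonglongrightarrow> \<beta> (r x) * c x" by (intro AE_I2 tendsto_intros blim)
  qed (use c in auto)
  have "(\<integral>x. b n (r1 x) * c1 x \<partial>M1) = (\<integral>x. b n (r2 x) * c2 x \<partial>M2)" for n
    unfolding int[OF c1 r1] int[OF c2 r2] using integral_eq_of_half_lines_sets[OF c1 r1 c2 r2 eq A] by simp
  then show ?thesis using lim[OF c1 r1] lim[OF c2 r2] by (simp add: LIMSEQ_unique)
qed

text \<open>
  First the centre and the radius are extended from a countable set, on which the identity is known at
  a common time, to all values, by continuity of the profiles. Then \<open>n \<rightarrow> \<infinity>\<close> replaces the profiles by
  \<open>(a - s)\<^sub>+\<^sup>2 / 2\<close> with \<open>s = \<bar>x - y\<bar>\<^sup>2\<close>, whose second derivative is the indicator of a ball.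
\<close>

lemma radial_identity_of_smooth:
  fixes u :: "'a::euclidean_space \<Rightarrow> 'a" and p :: "'a \<Rightarrow> real" and h :: "real \<Rightarrow> nat \<Rightarrow> nat \<Rightarrow> real \<Rightarrow> real"
  defines "Q \<equiv> \<lambda>y x. (u x \<bullet> (x - y))\<^sup>2 + p x * (norm (x - y))\<^sup>2"
    and "S \<equiv> \<lambda>x. (norm (u x))\<^sup>2 + real DIM('a) * p x"
  assumes [measurable]: "u \<in> borel_measurable borel" "p \<in> borel_measurable borel"
    and loc: "\<And>R. integrable lborel (\<lambda>x. indicator (cball 0 R) x * ((norm (u x))\<^sup>2 + \<bar>p x\<bar>))"
    and h: "\<And>a n. profile (h a n) a" "\<And>n m. continuous_on UNIV (\<lambda>(a, s). h a n m s)"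
      "\<And>a n s. \<bar>h a n 2 s\<bar> \<le> 1" "\<And>a n s. \<bar>h a n 1 s\<bar> \<le> max 0 (a - s)"
      "\<And>a s. (\<lambda>n. h a n 2 s) \<longlonglongrightarrow> (if s < a then 1 else 0)"
      "\<And>a s. (\<lambda>n. h a n 1 s) \<longlonglongrightarrow> - max 0 (a - s)"
    and Y: "closure Y = UNIV"
    and smooth: "\<And>y a n. y \<in> Y \<Longrightarrow> a \<in> \<rat> \<Longrightarrow>
      (\<integral>x. 2 * h a n 1 ((norm (x - y))\<^sup>2) * S x + 4 * h a n 2 ((norm (x - y))\<^sup>2) * Q y x \<partial>lborel) = 0"
  shows "(\<integral>x. indicator {..<a} ((norm (x - y))\<^sup>2) * (2 * Q y x) \<partial>lborel) = (\<integral>x. max 0 (a - (norm (x - y))\<^sup>2) * S x \<partial>lborel)"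
    and "integrable lborel (\<lambda>x. indicator {..<a} ((norm (x - y))\<^sup>2) * (2 * Q y x))"
    and "integrable lborel (\<lambda>x. max 0 (a - (norm (x - y))\<^sup>2) * S x)"
    and "integrable lborel (\<lambda>x. indicator {..<a} ((norm (x - y))\<^sup>2) * S x)"
proof -
  define N where "N = real DIM('a)"
  define U where "U x = (norm (u x))\<^sup>2 + \<bar>p x\<bar>" for x
  define T where "T y a n x = 2 * h a n 1 ((norm (x - y))\<^sup>2) * S x + 4 * h a n 2 ((norm (x - y))\<^sup>2) * Q y x" for y a n x
  have U0: "0 \<le> U x" for x by (simp add: U_def)
  have N0: "0 \<le> N" by (simp add: N_def)
  have SU: "\<bar>S x\<bar> \<le> (1 + N) * U x" for x
  proof -
    have "\<bar>S x\<bar> \<le> (norm (u x))\<^sup>2 + N * \<bar>p x\<bar>" unfolding S_def N_def by (rule order_trans[OF abs_triangle_ineq]) (simp add: abs_mult)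
    also have "\<dots> \<le> (1 + N) * U x" using N0 by (simp add: U_def algebra_simps)
    finally show ?thesis .
  qed
  have QU: "\<bar>Q y x\<bar> \<le> (norm (x - y))\<^sup>2 * U x" for x y
  proof -
    have "\<bar>u x \<bullet> (x - y)\<bar> \<le> norm (u x) * norm (x - y)" by (rule Cauchy_Schwarz_ineq2)
    then have "(u x \<bullet> (x - y))\<^sup>2 \<le> (norm (u x) * norm (x - y))\<^sup>2" by (metis abs_ge_zero power2_abs power_mono)
    then have "\<bar>Q y x\<bar> \<le> (norm (u x) * norm (x - y))\<^sup>2 + \<bar>p x\<bar> * (norm (x - y))\<^sup>2"
      unfolding Q_def by (intro order_trans[OF abs_triangle_ineq] add_mono) (auto simp: abs_mult)
    also have "\<dots> = (norm (x - y))\<^sup>2 * U x" by (simp add: U_def power_mult_distrib algebra_simps)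
    finally show ?thesis .
  qed
  have [measurable]: "Q y \<in> borel_measurable borel" "S \<in> borel_measurable borel" for y unfolding Q_def S_def by measurable
  have hc: "continuous_on UNIV (h a n m)" for a n m by (rule profile_continuous[OF h(1)])
  have [measurable]: "h a n m \<in> borel_measurable borel" for a n m by (rule borel_measurable_continuous_onI[OF hc])
  have Tm [measurable]: "T y a n \<in> borel_measurable borel" for y a n unfolding T_def by measurable
  \<comment> \<open>A majorant that serves all centres in a ball of radius \<open>B\<close> and all \<open>a \<le> A\<close>.\<close>
  define M where "M A B x = ((2 * A * (1 + N) + 4 * A) * (indicator (cball 0 (sqrt A + B)) x * U x) :: real)" for A B x
  have iM: "integrable lborel (M A B)" for A B unfolding M_def U_def by (intro integrable_mult_right loc)
  have bound: "c1 * \<bar>S x\<bar> + c2 * \<bar>Q y x\<bar> \<le> M A B x"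
    if "0 \<le> A" "a \<le> A" "norm y \<le> B" and c1: "c1 \<le> 2 * max 0 (a - (norm (x - y))\<^sup>2)" "0 \<le> c1"
      and c2: "c2 \<le> 4" "0 \<le> c2" "a \<le> (norm (x - y))\<^sup>2 \<Longrightarrow> c2 = 0" for A B a y x c1 c2
  proof (cases "a \<le> (norm (x - y))\<^sup>2")
    case True
    then have "c1 = 0" "c2 = 0" using c1 c2(3) by auto
    then show ?thesis using that(1) U0[of x] N0 by (simp add: M_def)
  next
    case False
    then have q: "(norm (x - y))\<^sup>2 \<le> A" using that by simp
    then have "norm (x - y) \<le> sqrt A" by (simp add: real_le_rsqrt)
    then have x: "x \<in> cball 0 (sqrt A + B)" using norm_triangle_ineq[of "x - y" y] that(3) by simp
    have "a - (norm (x - y))\<^sup>2 \<le> A" using that(2) by (simp add: add_increasing2 diff_le_eq)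
    then have "max 0 (a - (norm (x - y))\<^sup>2) \<le> A" using that(1) by simp
    then have "c1 \<le> 2 * A" by (intro order_trans[OF c1(1)] mult_left_mono) auto
    then have "c1 * \<bar>S x\<bar> \<le> (2 * A) * ((1 + N) * U x)"
      using c1(2) SU[of x] that(1) by (intro mult_mono) auto
    moreover have "c2 * \<bar>Q y x\<bar> \<le> 4 * (A * U x)"
      using c2 QU[of y x] q U0[of x] that(1) by (intro mult_mono order_trans[OF QU] mult_right_mono) auto
    ultimately show ?thesis using x by (simp add: M_def algebra_simps)
  qed
  have Tbound: "\<bar>T y a n x\<bar> \<le> M A B x" if "0 \<le> A" "a \<le> A" "norm y \<le> B" for A B a y n x
  proof -
    have "\<bar>T y a n x\<bar> \<le> 2 * \<bar>h a n 1 ((norm (x - y))\<^sup>2)\<bar> * \<bar>S x\<bar> + 4 * \<bar>h a n 2 ((norm (x - y))\<^sup>2)\<bar> * \<bar>Q y x\<bar>"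
      unfolding T_def by (rule order_trans[OF abs_triangle_ineq]) (simp add: abs_mult)
    also have "\<dots> \<le> M A B x"
      using h(3,4)[of a n "(norm (x - y))\<^sup>2"] profile_zero[OF h(1)] by (intro bound[OF that]) auto
    finally show ?thesis .
  qed
  have zero: "(\<integral>x. T y a n x \<partial>lborel) = 0" for y a n
  proof -
    \<comment> \<open>Rational radii from above and centres in \<open>Y\<close>, both converging.\<close>
    obtain Z where Z: "\<And>k. Z k \<in> Y" "Z \<longlonglongrightarrow> y"
      using Y closure_sequential[of y Y] by auto
    have "\<forall>k. \<exists>q\<in>\<rat>. a < q \<and> q < a + 1 / real (Suc k)" by (intro allI Rats_dense_in_real) simp
    then obtain b where b: "\<And>k. b k \<in> \<rat>" "\<And>k. a < b k" "\<And>k. b k < a + 1 / real (Suc k)" by metis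
    have blim: "b \<longlonglongrightarrow> a"
    proof (rule tendsto_sandwich[where f="\<lambda>_. a"])
      show "(\<lambda>k. a + 1 / real (Suc k)) \<longlonglongrightarrow> a" by real_asymp
      show "\<forall>\<^sub>F k in sequentially. a \<le> b k" "\<forall>\<^sub>F k in sequentially. b k \<le> a + 1 / real (Suc k)"
        by (intro always_eventually allI less_imp_le b)+
    qed simp
    have "Bseq Z" using Z(2) by (intro convergent_imp_Bseq convergentI)
    then obtain B where B: "\<And>k. norm (Z k) \<le> B" unfolding Bseq_def by blast
    define A where "A = \<bar>a\<bar> + 1"
    have A: "0 \<le> A" "b k \<le> A" for k
    proof -
      have "1 / real (Suc k) \<le> 1" by simp
      then show "b k \<le> A" using b(3)[of k] unfolding A_def by linarith
    qed (simp add: A_def)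
    have "(\<lambda>k. \<integral>x. T (Z k) (b k) n x \<partial>lborel) \<longlonglongrightarrow> (\<integral>x. T y a n x \<partial>lborel)"
    proof (rule integral_dominated_convergence[where w="M A B"])
      show "AE x in lborel. norm (T (Z k) (b k) n x) \<le> M A B x" for k using Tbound[OF A B] by auto
      show "AE x in lborel. (\<lambda>k. T (Z k) (b k) n x) \<longlonglongrightarrow> T y a n x"
      proof (rule AE_I2)
        fix x
        have q: "(\<lambda>k. (norm (x - Z k))\<^sup>2) \<longlonglongrightarrow> (norm (x - y))\<^sup>2" by (intro tendsto_intros Z)
        have hl: "(\<lambda>k. h (b k) n m ((norm (x - Z k))\<^sup>2)) \<longlonglongrightarrow> h a n m ((norm (x - y))\<^sup>2)" for m
        proof -
          have "isCont (\<lambda>(a, s). h a n m s) (a, (norm (x - y))\<^sup>2)" using h(2)[of n m] by (simp add: continuous_on_eq_continuous_at)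
          from isCont_tendsto_compose[OF this tendsto_Pair[OF blim q]] show ?thesis by simp
        qed
        show "(\<lambda>k. T (Z k) (b k) n x) \<longlonglongrightarrow> T y a n x"
          unfolding T_def Q_def by (intro tendsto_intros hl Z)
      qed
    qed (use iM in auto)
    moreover have "(\<integral>x. T (Z k) (b k) n x \<partial>lborel) = 0" for k unfolding T_def by (rule smooth[OF Z(1) b(1)])
    ultimately show ?thesis by (simp add: LIMSEQ_unique)
  qed
  define q where "q x = (norm (x - y))\<^sup>2" for x
  define A where "A = \<bar>a\<bar>"
  have A: "0 \<le> A" "a \<le> A" by (auto simp: A_def)
  have [measurable]: "q \<in> borel_measurable borel" unfolding q_def by measurable
  have bd: "\<bar>c1\<bar> * \<bar>S x\<bar> + \<bar>c2\<bar> * \<bar>Q y x\<bar> \<le> M A (norm y) x"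
    if "\<bar>c1\<bar> \<le> 2 * max 0 (a - q x)" "\<bar>c2\<bar> \<le> 4" "a \<le> q x \<Longrightarrow> c2 = 0" for c1 c2 x
    using that unfolding q_def by (intro bound[OF A order_refl]) auto
  have i1: "integrable lborel (\<lambda>x. indicator {..<a} (q x) * (2 * Q y x))"
  proof (rule Bochner_Integration.integrable_bound[OF iM[of A "norm y"]])
    show "AE x in lborel. norm (indicator {..<a} (q x) * (2 * Q y x)) \<le> norm (M A (norm y) x)"
    proof (rule AE_I2)
      fix x
      have "\<bar>2 * indicator {..<a} (q x)\<bar> * \<bar>Q y x\<bar> \<le> M A (norm y) x"
        using bd[of 0 x "2 * indicator {..<a} (q x)"] by (auto split: split_indicator)
      then show "norm (indicator {..<a} (q x) * (2 * Q y x)) \<le> norm (M A (norm y) x)"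
        by (auto intro: order_trans[OF _ abs_ge_self] simp: abs_mult mult_ac)
    qed
  qed measurable
  have i2: "integrable lborel (\<lambda>x. max 0 (a - q x) * S x)"
  proof (rule Bochner_Integration.integrable_bound[OF iM[of A "norm y"]])
    show "AE x in lborel. norm (max 0 (a - q x) * S x) \<le> norm (M A (norm y) x)"
    proof (rule AE_I2)
      fix x
      have "\<bar>max 0 (a - q x)\<bar> \<le> 2 * max 0 (a - q x)" by (simp add: max_def)
      from bd[OF this, of 0] show "norm (max 0 (a - q x) * S x) \<le> norm (M A (norm y) x)"
        by (auto intro: order_trans[OF _ abs_ge_self] simp: abs_mult)
    qed
  qed measurable
  have i3: "integrable lborel (\<lambda>x. indicator {..<a} (q x) * S x)"
  proof (rule Bochner_Integration.integrable_bound)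
    show "integrable lborel (\<lambda>x. (1 + N) * (indicator (cball 0 (sqrt A + norm y)) x * U x))"
      unfolding U_def by (intro integrable_mult_right loc)
    show "AE x in lborel. norm (indicator {..<a} (q x) * S x) \<le> norm ((1 + N) * (indicator (cball 0 (sqrt A + norm y)) x * U x))"
    proof (rule AE_I2)
      fix x
      show "norm (indicator {..<a} (q x) * S x) \<le> norm ((1 + N) * (indicator (cball 0 (sqrt A + norm y)) x * U x))"
      proof (cases "q x < a")
        case True
        then have "norm (x - y) \<le> sqrt A" using A unfolding q_def by (intro real_le_rsqrt) simp
        then have "x \<in> cball 0 (sqrt A + norm y)" using norm_triangle_ineq[of "x - y" y] by simp
        then show ?thesis using SU[of x] U0[of x] N0 True by (simp add: abs_mult)
      qed simp
    qed
  qed measurable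
  have "(\<lambda>n. \<integral>x. T y a n x \<partial>lborel) \<longlonglongrightarrow> (\<integral>x. 2 * (indicator {..<a} (q x) * (2 * Q y x)) - 2 * (max 0 (a - q x) * S x) \<partial>lborel)"
  proof (rule integral_dominated_convergence[where w="M A (norm y)"])
    show "AE x in lborel. norm (T y a n x) \<le> M A (norm y) x" for n using Tbound[OF A order_refl] by auto
    show "AE x in lborel. (\<lambda>n. T y a n x) \<longlonglongrightarrow> 2 * (indicator {..<a} (q x) * (2 * Q y x)) - 2 * (max 0 (a - q x) * S x)"
    proof (rule AE_I2)
      fix x
      have "(\<lambda>n. T y a n x) \<longlonglongrightarrow> 2 * (- max 0 (a - q x)) * S x + 4 * (if q x < a then 1 else 0) * Q y x"
        unfolding T_def q_def by (intro tendsto_intros h(5,6))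
      also have "2 * (- max 0 (a - q x)) * S x + 4 * (if q x < a then 1 else 0) * Q y x = 2 * (indicator {..<a} (q x) * (2 * Q y x)) - 2 * (max 0 (a - q x) * S x)"
        by (auto split: split_indicator)
      finally show "(\<lambda>n. T y a n x) \<longlonglongrightarrow> 2 * (indicator {..<a} (q x) * (2 * Q y x)) - 2 * (max 0 (a - q x) * S x)" .
    qed
  qed (use iM in auto)
  then have "(\<integral>x. 2 * (indicator {..<a} (q x) * (2 * Q y x)) - 2 * (max 0 (a - q x) * S x) \<partial>lborel) = 0"
    unfolding zero by (simp add: LIMSEQ_const_iff)
  moreover have "(\<integral>x. 2 * (indicator {..<a} (q x) * (2 * Q y x)) - 2 * (max 0 (a - q x) * S x) \<partial>lborel)
      = 2 * (\<integral>x. indicator {..<a} (q x) * (2 * Q y x) \<partial>lborel) - 2 * (\<integral>x. max 0 (a - q x) * S x \<partial>lborel)"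
    unfolding Bochner_Integration.integral_diff[OF integrable_mult_right[OF i1] integrable_mult_right[OF i2]]
    by (simp only: integral_mult_right_zero)
  ultimately have "(\<integral>x. indicator {..<a} (q x) * (2 * Q y x) \<partial>lborel) = (\<integral>x. max 0 (a - q x) * S x \<partial>lborel)"
    by linarith
  then show "(\<integral>x. indicator {..<a} ((norm (x - y))\<^sup>2) * (2 * Q y x) \<partial>lborel) = (\<integral>x. max 0 (a - (norm (x - y))\<^sup>2) * S x \<partial>lborel)"
    unfolding q_def .
  show "integrable lborel (\<lambda>x. indicator {..<a} ((norm (x - y))\<^sup>2) * (2 * Q y x))"
    "integrable lborel (\<lambda>x. max 0 (a - (norm (x - y))\<^sup>2) * S x)"
    "integrable lborel (\<lambda>x. indicator {..<a} ((norm (x - y))\<^sup>2) * S x)" using i1 i2 i3 unfolding q_def .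
qed

section \<open>The stationary identity for general radial profiles\<close>

text \<open>
  The two combinations of velocity and pressure that a radial field sees: \<open>Q y\<close> arises from the
  second derivative of the profile and \<open>S\<close> from the first.
\<close>

locale radial_identity =
  fixes u :: "'a::euclidean_space \<Rightarrow> 'a" and p :: "'a \<Rightarrow> real"
  assumes u_meas [measurable]: "u \<in> borel_measurable borel" and p_meas [measurable]: "p \<in> borel_measurable borel"
begin

definition "Q y x = (u x \<bullet> (x - y))\<^sup>2 + p x * (norm (x - y))\<^sup>2"
definition "S x = (norm (u x))\<^sup>2 + real DIM('a) * p x"
definition "U x = (norm (u x))\<^sup>2 + \<bar>p x\<bar>"

lemma Q_meas [measurable]: "Q y \<in> borel_measurable borel" and S_meas [measurable]: "S \<in> borel_measurable borel"
  and U_meas [measurable]: "U \<in> borel_measurable borel"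
  unfolding Q_def[abs_def] S_def[abs_def] U_def[abs_def] by measurable

lemma U_nonneg: "0 \<le> U x" by (simp add: U_def)

lemma S_le: "\<bar>S x\<bar> \<le> (1 + real DIM('a)) * U x"
proof -
  have "\<bar>S x\<bar> \<le> (norm (u x))\<^sup>2 + real DIM('a) * \<bar>p x\<bar>" unfolding S_def by (rule order_trans[OF abs_triangle_ineq]) (simp add: abs_mult)
  also have "\<dots> \<le> (1 + real DIM('a)) * U x" by (simp add: U_def algebra_simps)
  finally show ?thesis .
qed

lemma Q_le: "\<bar>Q y x\<bar> \<le> (norm (x - y))\<^sup>2 * U x"
proof -
  have "\<bar>u x \<bullet> (x - y)\<bar> \<le> norm (u x) * norm (x - y)" by (rule Cauchy_Schwarz_ineq2)
  then have "(u x \<bullet> (x - y))\<^sup>2 \<le> (norm (u x) * norm (x - y))\<^sup>2" by (metis abs_ge_zero power2_abs power_mono)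
  then have "\<bar>Q y x\<bar> \<le> (norm (u x) * norm (x - y))\<^sup>2 + \<bar>p x\<bar> * (norm (x - y))\<^sup>2"
    unfolding Q_def by (intro order_trans[OF abs_triangle_ineq] add_mono) (auto simp: abs_mult)
  also have "\<dots> = (norm (x - y))\<^sup>2 * U x" by (simp add: U_def power_mult_distrib algebra_simps)
  finally show ?thesis .
qed

end

text \<open>
  The stationary identity tested with the gradient of
  \<open>(a - \<bar>x - y\<bar>\<^sup>2)\<^sub>+\<^sup>2 / 2\<close>, for all centres and radii. This is all that is kept of the equation at a fixed
  time.
\<close>

locale pressure_identity = radial_identity +
  assumes ident: "\<And>y a. (\<integral>x. indicator {..<a} ((norm (x - y))\<^sup>2) * (2 * Q y x) \<partial>lborel) = (\<integral>x. max 0 (a - (norm (x - y))\<^sup>2) * S x \<partial>lborel)"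
    and ident_int: "\<And>y a. integrable lborel (\<lambda>x. indicator {..<a} ((norm (x - y))\<^sup>2) * (2 * Q y x))"
      "\<And>y a. integrable lborel (\<lambda>x. indicator {..<a} ((norm (x - y))\<^sup>2) * S x)"
begin

text \<open>
  The identity for an arbitrary bounded Borel second derivative \<open>\<beta>\<close> of the profile; the inner integral
  on the right is minus its first derivative. Writing \<open>(a - s)\<^sub>+\<close> as a length turns \<open>ident\<close> into an equality of
  distribution functions.
\<close>

lemma integral_profile:
  fixes \<beta> :: "real \<Rightarrow> real"
  assumes \<beta> [measurable]: "\<beta> \<in> borel_measurable borel" and bound: "\<And>s. \<bar>\<beta> s\<bar> \<le> B"
  shows "(\<integral>x. \<beta> ((norm (x - y))\<^sup>2) * (indicator {..<A} ((norm (x - y))\<^sup>2) * (2 * Q y x)) \<partial>lborel)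
    = (\<integral>x. S x * (\<integral>s. indicator {(norm (x - y))\<^sup>2<..<A} s * \<beta> s \<partial>lborel) \<partial>lborel)"
proof -
  define q where "q x = (norm (x - y))\<^sup>2" for x
  have [measurable]: "q \<in> borel_measurable borel" unfolding q_def by measurable
  have q0: "0 \<le> q x" for x by (simp add: q_def)
  define c1 where "c1 x = indicator {..<A} (q x) * (2 * Q y x)" for x
  define m where "m s = (\<integral>x. indicator {..<s} (q x) * S x \<partial>lborel)" for s
  define c2 where "c2 s = indicator {0..<A} s * m s" for s
  have c1: "integrable lborel c1" unfolding c1_def q_def by (rule ident_int)
  have iS: "integrable lborel (\<lambda>x. indicator {..<s} (q x) * S x)" for s unfolding q_def by (rule ident_int)
  have Fub: "integrable lborel (\<lambda>s. \<gamma> s * c2 s) \<and> (\<integral>s. \<gamma> s * c2 s \<partial>lborel) = (\<integral>x. S x * (\<integral>s. indicator {q x<..<A} s * \<gamma> s \<partial>lborel) \<partial>lborel)"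
    if \<gamma> [measurable]: "\<gamma> \<in> borel_measurable borel" and b: "\<And>s. \<bar>\<gamma> s\<bar> \<le> K" for \<gamma> :: "real \<Rightarrow> real" and K
  proof -
    let ?f = "\<lambda>(s, x). \<gamma> s * indicator {0..<A} s * (indicator {..<s} (q x) * S x)"
    have fm: "?f \<in> borel_measurable (lborel \<Otimes>\<^sub>M lborel)"
    proof -
      have [measurable]: "Measurable.pred (borel \<Otimes>\<^sub>M borel) (\<lambda>z. q (snd z) < (fst z :: real))" by measurable
      have "(\<lambda>z. \<gamma> (fst z) * indicator {0..<A} (fst z) * ((if q (snd z) < fst z then 1 else 0) * S (snd z))) \<in> borel_measurable (lborel \<Otimes>\<^sub>M lborel)"
        by measurable
      also have "(\<lambda>z. \<gamma> (fst z) * indicator {0..<A} (fst z) * ((if q (snd z) < fst z then 1 else 0) * S (snd z))) = ?f"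
        by (auto simp: fun_eq_iff split: split_indicator)
      finally show ?thesis .
    qed
    have int: "integrable (lborel \<Otimes>\<^sub>M lborel) ?f"
    proof (rule lborel_pair.Fubini_integrable[OF fm])
      show "AE s in lborel. integrable lborel (\<lambda>x. ?f (s, x))" using iS by (auto intro!: AE_I2 integrable_mult_right)
      show "integrable lborel (\<lambda>s. \<integral>x. norm (?f (s, x)) \<partial>lborel)"
      proof (rule Bochner_Integration.integrable_bound)
        show "integrable lborel (\<lambda>s. indicator {0..A} s * (K * (\<integral>x. \<bar>indicator {..<A} (q x) * S x\<bar> \<partial>lborel)))"
          by (intro integrable_mult_left integrable_real_indicator) (auto simp: emeasure_lborel_Icc_eq)
        show "(\<lambda>s. \<integral>x. norm (?f (s, x)) \<partial>lborel) \<in> borel_measurable lborel"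
          using fm by (intro lborel.borel_measurable_lebesgue_integral) simp
        show "AE s in lborel. norm (\<integral>x. norm (?f (s, x)) \<partial>lborel) \<le> norm (indicator {0..A} s * (K * (\<integral>x. \<bar>indicator {..<A} (q x) * S x\<bar> \<partial>lborel)))"
        proof (rule AE_I2)
          fix s
          have K0: "0 \<le> K" using b[of 0] by (auto intro: order_trans[OF abs_ge_zero])
          show "norm (\<integral>x. norm (?f (s, x)) \<partial>lborel) \<le> norm (indicator {0..A} s * (K * (\<integral>x. \<bar>indicator {..<A} (q x) * S x\<bar> \<partial>lborel)))"
          proof (cases "s \<in> {0..<A}")
            case True
            have "(\<integral>x. norm (?f (s, x)) \<partial>lborel) = \<bar>\<gamma> s\<bar> * (\<integral>x. \<bar>indicator {..<s} (q x) * S x\<bar> \<partial>lborel)"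
              using True by (simp add: abs_mult)
            also have "\<dots> \<le> K * (\<integral>x. \<bar>indicator {..<A} (q x) * S x\<bar> \<partial>lborel)"
              using True iS b K0 by (intro mult_mono integral_mono integrable_abs Bochner_Integration.integral_nonneg) (auto split: split_indicator)
            finally show ?thesis using True K0 by (simp add: abs_mult)
          qed auto
        qed
      qed
    qed
    have inner1: "(\<integral>x. ?f (s, x) \<partial>lborel) = \<gamma> s * c2 s" for s by (simp add: c2_def m_def mult.assoc)
    have inner2: "(\<integral>s. ?f (s, x) \<partial>lborel) = S x * (\<integral>s. indicator {q x<..<A} s * \<gamma> s \<partial>lborel)" for x
    proof -
      have "(\<lambda>s. ?f (s, x)) = (\<lambda>s. S x * (indicator {q x<..<A} s * \<gamma> s))"
        using q0[of x] by (auto simp: fun_eq_iff split: split_indicator)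
      then show ?thesis by (simp only: integral_mult_right_zero)
    qed
    have "integrable lborel (\<lambda>s. \<integral>x. ?f (s, x) \<partial>lborel)" using lborel_pair.integrable_fst[of "\<lambda>s x. ?f (s, x)"] int by simp
    moreover have "(\<integral>s. (\<integral>x. ?f (s, x) \<partial>lborel) \<partial>lborel) = (\<integral>x. (\<integral>s. ?f (s, x) \<partial>lborel) \<partial>lborel)"
      using lborel_pair.Fubini_integral[of "\<lambda>s x. ?f (s, x)"] int by simp
    ultimately show ?thesis unfolding inner1 inner2 by simp
  qed
  have c2: "integrable lborel c2" using Fub[of "\<lambda>_. 1" 1] by simp
  have eq: "(\<integral>x. indicator {..<a} (q x) * c1 x \<partial>lborel) = (\<integral>s. indicator {..<a} s * c2 s \<partial>lborel)" for a
  proof -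
    have "(\<lambda>x. indicator {..<a} (q x) * c1 x) = (\<lambda>x. indicator {..<min a A} (q x) * (2 * Q y x))"
      by (auto simp: c1_def fun_eq_iff split: split_indicator)
    then have "(\<integral>x. indicator {..<a} (q x) * c1 x \<partial>lborel) = (\<integral>x. max 0 (min a A - q x) * S x \<partial>lborel)"
      using ident[of "min a A" y] by (simp add: q_def)
    also have "\<dots> = (\<integral>x. S x * (\<integral>s. indicator {q x<..<A} s * indicator {..<a} s \<partial>lborel) \<partial>lborel)"
    proof (intro Bochner_Integration.integral_cong refl)
      fix x
      have "(\<lambda>s. indicator {q x<..<A} s * indicator {..<a} s :: real) = indicator {q x<..<min a A}"
        by (auto simp: fun_eq_iff split: split_indicator)
      then have "(\<integral>s. indicator {q x<..<A} s * indicator {..<a} s \<partial>lborel) = measure lborel {q x<..<min a A}" by simp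
      also have "\<dots> = max 0 (min a A - q x)" by (cases "q x \<le> min a A") (auto simp: max_def)
      finally show "max 0 (min a A - q x) * S x = S x * (\<integral>s. indicator {q x<..<A} s * indicator {..<a} s \<partial>lborel)" by simp
    qed
    also have "\<dots> = (\<integral>s. indicator {..<a} s * c2 s \<partial>lborel)"
      using Fub[of "indicator {..<a}" 1] by (auto split: split_indicator)
    finally show ?thesis .
  qed
  have "(\<integral>x. \<beta> (q x) * c1 x \<partial>lborel) = (\<integral>s. \<beta> s * c2 s \<partial>lborel)"
    by (rule integral_eq_of_half_lines[where ?r1.0 = q and ?r2.0 = "\<lambda>s. s" and B = B, OF c1 _ c2 _ eq \<beta> bound]) auto
  also have "\<dots> = (\<integral>x. S x * (\<integral>s. indicator {q x<..<A} s * \<beta> s \<partial>lborel) \<partial>lborel)"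
    using Fub[OF \<beta> bound] by simp
  finally show ?thesis unfolding c1_def q_def .
qed

text \<open>
  The profile \<open>exp (- s / c)\<close> is not compactly supported; it is truncated at \<open>A\<close>, and \<open>A \<rightarrow> \<infinity>\<close> uses that
  \<open>U\<close> grows less than any Gaussian decays.
\<close>

lemma gaussian_identity:
  assumes tame: "tame (\<lambda>x. U x / 2)" and c: "0 < c"
  shows "(\<integral>x. exp (- (norm (x - y))\<^sup>2 / c) * (2 * Q y x) \<partial>lborel) = c * (\<integral>x. exp (- (norm (x - y))\<^sup>2 / c) * S x \<partial>lborel)"
    and "integrable lborel (\<lambda>x. exp (- (norm (x - y))\<^sup>2 / c) * (2 * Q y x))"
    and "integrable lborel (\<lambda>x. exp (- (norm (x - y))\<^sup>2 / c) * S x)"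
proof -
  define q where "q x = (norm (x - y))\<^sup>2" for x
  have [measurable]: "q \<in> borel_measurable borel" unfolding q_def by measurable
  have q0: "0 \<le> q x" for x by (simp add: q_def)
  have iU: "integrable lborel (\<lambda>x. exp (- d * q x) * U x)" if "0 < d" for d
    using integrable_mult_right[OF tame_integrable_gaussian[OF tame that, of y], of 2] by (simp add: q_def norm_minus_commute)
  have "integrable lborel (\<lambda>x. (2 * (2 * c)) * (exp (- (1 / (2 * c)) * q x) * U x))"
    using c by (intro integrable_mult_right iU) simp
  moreover have le1: "\<bar>exp (- q x / c) * (2 * Q y x)\<bar> \<le> (2 * (2 * c)) * (exp (- (1 / (2 * c)) * q x) * U x)" for x
  proof -
    have "q x / (2 * c) \<le> exp (q x / (2 * c))" using exp_ge_add_one_self[of "q x / (2 * c)"] by linarith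
    then have "q x \<le> 2 * c * exp (q x / (2 * c))" using c by (simp add: field_simps)
    then have "exp (- q x / c) * (2 * (q x * U x)) \<le> exp (- q x / c) * (2 * ((2 * c * exp (q x / (2 * c))) * U x))"
      using U_nonneg[of x] by (intro mult_left_mono mult_right_mono) auto
    also have "\<dots> = (2 * (2 * c)) * ((exp (- q x / c) * exp (q x / (2 * c))) * U x)" by simp
    also have "exp (- q x / c) * exp (q x / (2 * c)) = exp (- (1 / (2 * c)) * q x)"
      using c by (simp add: exp_add[symmetric] field_simps)
    finally have "exp (- q x / c) * (2 * (q x * U x)) \<le> (2 * (2 * c)) * (exp (- (1 / (2 * c)) * q x) * U x)" .
    moreover have "\<bar>exp (- q x / c) * (2 * Q y x)\<bar> \<le> exp (- q x / c) * (2 * (q x * U x))"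
      using Q_le[of y x] by (simp add: abs_mult q_def)
    ultimately show ?thesis by linarith
  qed
  ultimately have i1: "integrable lborel (\<lambda>x. (2 * (2 * c)) * (exp (- (1 / (2 * c)) * q x) * U x))" by simp
  have i2: "integrable lborel (\<lambda>x. c * ((1 + real DIM('a)) * (exp (- (1 / c) * q x) * U x)))"
    using c by (intro integrable_mult_right iU) simp
  have le2: "\<bar>exp (- q x / c) * S x\<bar> \<le> (1 + real DIM('a)) * (exp (- (1 / c) * q x) * U x)" for x
    using mult_left_mono[OF S_le[of x], of "exp (- q x / c)"] by (simp add: abs_mult mult_ac)
  show g1: "integrable lborel (\<lambda>x. exp (- (norm (x - y))\<^sup>2 / c) * (2 * Q y x))"
    by (rule Bochner_Integration.integrable_bound[OF i1])
       (use le1 in \<open>auto simp: q_def[symmetric] intro!: AE_I2 order_trans[OF _ abs_ge_self]\<close>)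
  have "integrable lborel (\<lambda>x. (1 + real DIM('a)) * (exp (- (1 / c) * q x) * U x))"
    using c by (intro integrable_mult_right iU) simp
  then show g2: "integrable lborel (\<lambda>x. exp (- (norm (x - y))\<^sup>2 / c) * S x)"
    by (rule Bochner_Integration.integrable_bound)
       (use le2 in \<open>auto simp: q_def[symmetric] intro!: AE_I2 order_trans[OF _ abs_ge_self]\<close>)
  define \<beta> where "\<beta> s = exp (- max 0 s / c)" for s
  have \<beta>m: "\<beta> \<in> borel_measurable borel" unfolding \<beta>_def by measurable
  have \<beta>b: "\<bar>\<beta> s\<bar> \<le> 1" for s using c by (simp add: \<beta>_def)
  have \<beta>I: "(\<integral>s. indicator {q x<..<A} s * \<beta> s \<partial>lborel) = (if q x < A then c * (exp (- q x / c) - exp (- A / c)) else 0)" for x A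
  proof (cases "q x < A")
    case True
    have "(\<integral>s. indicator {q x<..<A} s * \<beta> s \<partial>lborel) = (\<integral>s. indicator {q x..A} s *\<^sub>R exp (- s / c) \<partial>lborel)"
    proof (rule integral_cong_AE)
      show "AE s in lborel. indicator {q x<..<A} s * \<beta> s = indicator {q x..A} s *\<^sub>R exp (- s / c)"
        using AE_lborel_singleton[of "q x"] AE_lborel_singleton[of A]
        by eventually_elim (use q0[of x] in \<open>auto simp: \<beta>_def max_def split: split_indicator\<close>)
    qed (use \<beta>m in measurable)
    also have "\<dots> = (- c * exp (- A / c)) - (- c * exp (- q x / c))"
    proof (rule integral_FTC_atLeastAtMost)
      fix s
      have "((\<lambda>s. - c * exp (- s / c)) has_real_derivative exp (- s / c)) (at s)"
        using c by (auto intro!: derivative_eq_intros)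
      then show "((\<lambda>s. - c * exp (- s / c)) has_vector_derivative exp (- s / c)) (at s within {q x..A})"
        by (auto simp: has_real_derivative_iff_has_vector_derivative intro: has_vector_derivative_at_within)
    qed (use True c in \<open>auto intro!: continuous_intros\<close>)
    finally show ?thesis using True by (simp add: algebra_simps)
  next
    case False
    then have "{q x<..<A} = {}" by auto
    then show ?thesis using False by simp
  qed
  have step: "(\<integral>x. indicator {..<A} (q x) * (exp (- q x / c) * (2 * Q y x)) \<partial>lborel)
      = (\<integral>x. indicator {..<A} (q x) * (c * ((exp (- q x / c) - exp (- A / c)) * S x)) \<partial>lborel)" for A
  proof -
    have "(\<integral>x. \<beta> (q x) * (indicator {..<A} (q x) * (2 * Q y x)) \<partial>lborel) = (\<integral>x. S x * (\<integral>s. indicator {q x<..<A} s * \<beta> s \<partial>lborel) \<partial>lborel)"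
      using integral_profile[OF \<beta>m \<beta>b, of y A] unfolding q_def .
    moreover have "\<beta> (q x) * (indicator {..<A} (q x) * (2 * Q y x)) = indicator {..<A} (q x) * (exp (- q x / c) * (2 * Q y x))" for x
      using q0[of x] by (simp add: \<beta>_def max_def)
    moreover have "S x * (\<integral>s. indicator {q x<..<A} s * \<beta> s \<partial>lborel) = indicator {..<A} (q x) * (c * ((exp (- q x / c) - exp (- A / c)) * S x))" for x
      unfolding \<beta>I by simp
    ultimately show ?thesis by simp
  qed
  have ind: "(\<lambda>n. indicator {..<real n} (q x) :: real) \<longlonglongrightarrow> 1" for x
  proof (rule tendsto_eventually)
    obtain m where "q x < real m" using reals_Archimedean2 by blast
    then show "\<forall>\<^sub>F n in sequentially. (indicator {..<real n} (q x) :: real) = 1"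
      by (intro eventually_sequentiallyI[of m]) (auto split: split_indicator)
  qed
  have "(\<lambda>n. \<integral>x. indicator {..<real n} (q x) * (exp (- q x / c) * (2 * Q y x)) \<partial>lborel) \<longlonglongrightarrow> (\<integral>x. 1 * (exp (- q x / c) * (2 * Q y x)) \<partial>lborel)"
  proof (rule integral_dominated_convergence[OF _ _ i1])
    show "AE x in lborel. (\<lambda>n. indicator {..<real n} (q x) * (exp (- q x / c) * (2 * Q y x))) \<longlonglongrightarrow> 1 * (exp (- q x / c) * (2 * Q y x))"
      by (intro AE_I2 tendsto_intros ind)
    show "AE x in lborel. norm (indicator {..<real n} (q x) * (exp (- q x / c) * (2 * Q y x))) \<le> 2 * (2 * c) * (exp (- (1 / (2 * c)) * q x) * U x)" for n
    proof (rule AE_I2)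
      fix x
      show "norm (indicator {..<real n} (q x) * (exp (- q x / c) * (2 * Q y x))) \<le> 2 * (2 * c) * (exp (- (1 / (2 * c)) * q x) * U x)"
        using le1[of x] order_trans[OF abs_ge_zero le1[of x]] by (auto split: split_indicator)
    qed
  qed measurable
  moreover have "(\<lambda>n. \<integral>x. indicator {..<real n} (q x) * (c * ((exp (- q x / c) - exp (- real n / c)) * S x)) \<partial>lborel) \<longlonglongrightarrow> (\<integral>x. 1 * (c * ((exp (- q x / c) - 0) * S x)) \<partial>lborel)"
  proof (rule integral_dominated_convergence[OF _ _ i2])
    have "(\<lambda>n. exp (- real n / c)) \<longlonglongrightarrow> 0" using c by real_asymp
    then show "AE x in lborel. (\<lambda>n. indicator {..<real n} (q x) * (c * ((exp (- q x / c) - exp (- real n / c)) * S x))) \<longlonglongrightarrow> 1 * (c * ((exp (- q x / c) - 0) * S x))"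
      by (intro AE_I2 tendsto_intros ind)
    show "AE x in lborel. norm (indicator {..<real n} (q x) * (c * ((exp (- q x / c) - exp (- real n / c)) * S x))) \<le> c * ((1 + real DIM('a)) * (exp (- (1 / c) * q x) * U x))" for n
    proof (rule AE_I2)
      fix x
      have r0: "0 \<le> c * ((1 + real DIM('a)) * (exp (- (1 / c) * q x) * U x))" using U_nonneg[of x] c by simp
      show "norm (indicator {..<real n} (q x) * (c * ((exp (- q x / c) - exp (- real n / c)) * S x))) \<le> c * ((1 + real DIM('a)) * (exp (- (1 / c) * q x) * U x))"
      proof (cases "q x < real n")
        case True
        then have "exp (- real n / c) \<le> exp (- q x / c)" using c by (simp add: divide_right_mono)
        then have "\<bar>exp (- q x / c) - exp (- real n / c)\<bar> \<le> exp (- q x / c)" by simp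
        then have "\<bar>(exp (- q x / c) - exp (- real n / c)) * S x\<bar> \<le> \<bar>exp (- q x / c) * S x\<bar>" by (auto simp: abs_mult intro!: mult_right_mono)
        also note le2[of x]
        finally show ?thesis using True c by (simp add: abs_mult)
      qed (use r0 in simp)
    qed
  qed measurable
  ultimately have "(\<integral>x. 1 * (exp (- q x / c) * (2 * Q y x)) \<partial>lborel) = (\<integral>x. 1 * (c * ((exp (- q x / c) - 0) * S x)) \<partial>lborel)"
    unfolding step by (rule LIMSEQ_unique)
  then show "(\<integral>x. exp (- (norm (x - y))\<^sup>2 / c) * (2 * Q y x) \<partial>lborel) = c * (\<integral>x. exp (- (norm (x - y))\<^sup>2 / c) * S x \<partial>lborel)"
    by (simp add: q_def)
qed

text \<open>
  The distributional equation \<open>\<Delta> p = - \<Sum> \<partial>\<^sub>i \<partial>\<^sub>j (u\<^sub>i u\<^sub>j)\<close> smoothed by the heat kernel. Applying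
  \<open>gaussian_identity\<close> with \<open>c = 4 t\<close> is the same as testing with the kernel itself.
\<close>

lemma heat_identity:
  assumes tame_u: "tame (\<lambda>x. (norm (u x))\<^sup>2)" and tame_p: "tame p" and t: "0 < t"
  shows "(\<Sum>i\<in>Basis. conv (heat_dd i i) p y t) = - (\<Sum>i\<in>Basis. \<Sum>j\<in>Basis. conv (heat_dd i j) (\<lambda>x. (u x \<bullet> i) * (u x \<bullet> j)) y t)"
proof -
  have tU: "tame (\<lambda>x. U x / 2)"
  proof -
    obtain D D' where D: "integrable lborel D" "\<And>x. \<bar>(norm (u x))\<^sup>2\<bar> \<le> D x + 1" "integrable lborel D'" "\<And>x. \<bar>p x\<bar> \<le> D' x + 1"
      using tame_u tame_p unfolding tame_def by auto
    have "U x \<le> D x + D' x + 2" for x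
      using D(2)[of x] D(4)[of x] by (simp add: U_def)
    then have "\<bar>U x / 2\<bar> \<le> (D x + D' x) / 2 + 1" for x
      using U_nonneg[of x] by (simp add: field_simps)
    then show ?thesis unfolding tame_def using D(1,3) by (intro conjI exI[of _ "\<lambda>x. (D x + D' x) / 2"] allI) auto
  qed
  have "tame (\<lambda>x. (u x \<bullet> i) * (u x \<bullet> j))" if "i \<in> Basis" "j \<in> Basis" for i j
  proof -
    obtain D where D: "integrable lborel D" "\<And>x. \<bar>(norm (u x))\<^sup>2\<bar> \<le> D x + 1" using tame_u unfolding tame_def by auto
    have "\<bar>(u x \<bullet> i) * (u x \<bullet> j)\<bar> \<le> D x + 1" for x
    proof -
      have "\<bar>u x \<bullet> i\<bar> * \<bar>u x \<bullet> j\<bar> \<le> norm (u x) * norm (u x)" using that by (intro mult_mono Basis_le_norm) auto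
      then show ?thesis using D(2)[of x] by (simp add: abs_mult power2_eq_square)
    qed
    then show ?thesis unfolding tame_def using D(1) by (auto intro!: exI[of _ D])
  qed
  note tF = this
  have sym: "heat_dd i j t (y - x) = heat_dd i j t (x - y)" for i j x using heat_dd_even[of i j t "x - y"] by simp
  have nF: "(\<Sum>i\<in>Basis. \<Sum>j\<in>Basis. heat_dd i j t z * ((v \<bullet> i) * (v \<bullet> j))) = heat t z * ((v \<bullet> z)\<^sup>2 / (4 * t\<^sup>2) - (norm v)\<^sup>2 / (2 * t))" for z v :: 'a
  proof -
    have "(\<Sum>i\<in>Basis. \<Sum>j\<in>Basis. heat_dd i j t z * ((v \<bullet> i) * (v \<bullet> j)))
       = (\<Sum>i\<in>Basis. \<Sum>j\<in>Basis. heat t z / (4 * t\<^sup>2) * (((v \<bullet> i) * (z \<bullet> i)) * ((v \<bullet> j) * (z \<bullet> j))) - (if j = i then heat t z / (2 * t) * ((v \<bullet> i) * (v \<bullet> i)) else 0))"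
      unfolding heat_dd_def by (intro sum.cong refl) (auto simp: inner_Basis field_simps)
    also have "\<dots> = heat t z / (4 * t\<^sup>2) * ((\<Sum>i\<in>Basis. (v \<bullet> i) * (z \<bullet> i)) * (\<Sum>j\<in>Basis. (v \<bullet> j) * (z \<bullet> j))) - heat t z / (2 * t) * (\<Sum>i\<in>Basis. (v \<bullet> i) * (v \<bullet> i))"
    proof -
      have 1: "(\<Sum>i\<in>Basis. \<Sum>j\<in>Basis. if j = i then heat t z / (2 * t) * ((v \<bullet> i) * (v \<bullet> i)) else 0)
          = (\<Sum>i\<in>Basis. heat t z / (2 * t) * ((v \<bullet> i) * (v \<bullet> i)))"
        by (intro sum.cong refl) simp
      show ?thesis unfolding sum_subtractf 1 by (simp only: sum_product) (simp only: sum_distrib_left)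
    qed
    also have "(\<Sum>i\<in>Basis. (v \<bullet> i) * (z \<bullet> i)) = v \<bullet> z" by (rule euclidean_inner[symmetric])
    also have "(\<Sum>i\<in>Basis. (v \<bullet> i) * (v \<bullet> i)) = (norm v)\<^sup>2" by (rule sum_Basis_inner_sq)
    finally show ?thesis by (simp add: power2_eq_square algebra_simps)
  qed
  have np: "(\<Sum>i\<in>Basis. heat_dd i i t z) = heat t z * ((norm z)\<^sup>2 / (4 * t\<^sup>2) - real DIM('a) / (2 * t))" for z :: 'a
  proof -
    have "(\<Sum>i\<in>Basis. heat_dd i i t z) = (\<Sum>i\<in>Basis. heat t z / (4 * t\<^sup>2) * ((z \<bullet> i) * (z \<bullet> i)) - heat t z / (2 * t))"
      unfolding heat_dd_def by (intro sum.cong refl) simp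
    also have "\<dots> = heat t z / (4 * t\<^sup>2) * (norm z)\<^sup>2 - real DIM('a) * (heat t z / (2 * t))"
      by (simp only: sum_subtractf sum_distrib_left[symmetric] sum_Basis_inner_sq) simp
    finally show ?thesis by (simp add: algebra_simps)
  qed
  have ip: "integrable lborel (\<lambda>x. heat_dd i i t (x - y) * p x)" if "i \<in> Basis" for i
    using conv_integrable[OF gaussian_kernel_heat_dd[OF that that] tame_p t, of y] unfolding sym .
  have iF: "integrable lborel (\<lambda>x. heat_dd i j t (x - y) * ((u x \<bullet> i) * (u x \<bullet> j)))" if "i \<in> Basis" "j \<in> Basis" for i j
    using conv_integrable[OF gaussian_kernel_heat_dd[OF that] tF[OF that] t, of y] unfolding sym .
  have "(\<Sum>i\<in>Basis. conv (heat_dd i i) p y t) + (\<Sum>i\<in>Basis. \<Sum>j\<in>Basis. conv (heat_dd i j) (\<lambda>x. (u x \<bullet> i) * (u x \<bullet> j)) y t)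
    = (\<integral>x. (\<Sum>i\<in>Basis. heat_dd i i t (x - y) * p x) + (\<Sum>i\<in>Basis. \<Sum>j\<in>Basis. heat_dd i j t (x - y) * ((u x \<bullet> i) * (u x \<bullet> j))) \<partial>lborel)"
    unfolding conv_def sym using ip iF by (simp add: Bochner_Integration.integral_sum Bochner_Integration.integrable_sum)
  also have "\<dots> = (\<integral>x. t powr (- (real DIM('a) / 2)) / (\<integral>x. exp (- (norm (x :: 'a))\<^sup>2 / 4) \<partial>lborel) / (8 * t\<^sup>2)
      * (exp (- (norm (x - y))\<^sup>2 / (4 * t)) * (2 * Q y x) - (4 * t) * (exp (- (norm (x - y))\<^sup>2 / (4 * t)) * S x)) \<partial>lborel)"
  proof (intro Bochner_Integration.integral_cong refl)
    fix x
    have "(\<Sum>i\<in>Basis. heat_dd i i t (x - y) * p x) + (\<Sum>i\<in>Basis. \<Sum>j\<in>Basis. heat_dd i j t (x - y) * ((u x \<bullet> i) * (u x \<bullet> j)))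
       = heat t (x - y) / (8 * t\<^sup>2) * (2 * Q y x - 4 * t * S x)"
      unfolding nF sum_distrib_right[symmetric] np Q_def S_def using t
      by (simp add: field_simps power2_eq_square)
    then show "(\<Sum>i\<in>Basis. heat_dd i i t (x - y) * p x) + (\<Sum>i\<in>Basis. \<Sum>j\<in>Basis. heat_dd i j t (x - y) * ((u x \<bullet> i) * (u x \<bullet> j)))
      = t powr (- (real DIM('a) / 2)) / (\<integral>x. exp (- (norm (x :: 'a))\<^sup>2 / 4) \<partial>lborel) / (8 * t\<^sup>2)
      * (exp (- (norm (x - y))\<^sup>2 / (4 * t)) * (2 * Q y x) - (4 * t) * (exp (- (norm (x - y))\<^sup>2 / (4 * t)) * S x))"
      unfolding heat_def by (simp add: field_simps)
  qed
  also have "\<dots> = 0"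
  proof -
    have t4: "0 < 4 * t" using t by simp
    note g = gaussian_identity[OF tU t4, of y]
    show ?thesis
      unfolding integral_mult_right_zero Bochner_Integration.integral_diff[OF g(2) integrable_mult_right[OF g(3)]] g(1) by simp
  qed
  finally show ?thesis by linarith
qed

end

section \<open>The field of the weight\<close>

locale radial_weight =
  fixes w :: "real \<Rightarrow> real" and C :: real
  assumes w_meas [measurable]: "w \<in> borel_measurable borel"
    and w_nonneg: "\<And>s. 0 \<le> w s" and w_le: "\<And>s. 0 \<le> s \<Longrightarrow> w s \<le> C / (1 + s)"
    and w_int: "integrable lborel w"
begin

text \<open>
  The limiting field is \<open>V(x) = W(r) x / r = k(r\<^sup>2) x\<close>, so that \<open>k / 2\<close> is the derivative of its profile
  as a function of \<open>s = r\<^sup>2\<close>. All coefficients of \<open>\<nabla>V\<close> are bounded by \<open>K / (1 + r)\<close>.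
\<close>

definition "W r = (\<integral>s. indicator {0..r} s * w s \<partial>lborel)"
definition "k s = W (sqrt s) / sqrt s"
definition "K = C + (\<integral>s. w s \<partial>lborel)"

lemma C_nonneg: "0 \<le> C" using w_nonneg[of 0] w_le[of 0] by simp

lemma w_set_int: "A \<in> sets borel \<Longrightarrow> integrable lborel (\<lambda>s. indicator A s * w s)"
  by (rule Bochner_Integration.integrable_bound[OF w_int]) (auto split: split_indicator)

lemma W_meas [measurable]: "W \<in> borel_measurable borel"
proof -
  have [measurable]: "(\<lambda>z. (if 0 \<le> snd z \<and> snd z \<le> fst z then 1 else 0) * w (snd z)) \<in> borel_measurable (borel \<Otimes>\<^sub>M lborel)"
    by measurable
  have "(\<lambda>r. \<integral>s. (if 0 \<le> s \<and> s \<le> r then 1 else 0) * w s \<partial>lborel) \<in> borel_measurable borel"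
    by (rule lborel.borel_measurable_lebesgue_integral) (simp add: case_prod_unfold)
  moreover have "(if 0 \<le> s \<and> s \<le> r then 1 else 0) = (indicator {0..r} s :: real)" for s r :: real
    by (auto split: split_indicator)
  ultimately show ?thesis unfolding W_def[abs_def] by simp
qed

lemma k_meas [measurable]: "k \<in> borel_measurable borel" unfolding k_def[abs_def] by measurable

lemma W_nonneg: "0 \<le> W r" unfolding W_def using w_nonneg by (intro Bochner_Integration.integral_nonneg) auto

lemma W_le_mass: "W r \<le> (\<integral>s. w s \<partial>lborel)"
  unfolding W_def using w_nonneg by (intro integral_mono w_set_int w_int) (auto split: split_indicator)

lemma W_le_linear: assumes "0 \<le> r" shows "W r \<le> C * r"
proof -
  have "W r \<le> (\<integral>s. indicator {0..r} s * C \<partial>lborel)"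
    unfolding W_def
  proof (rule integral_mono[OF w_set_int])
    show "integrable lborel (\<lambda>s. indicator {0..r} s * C)" using assms by (intro integrable_mult_left integrable_real_indicator) auto
    fix s
    have "C / (1 + s) \<le> C" if "0 \<le> s" using that C_nonneg by (simp add: divide_le_eq mult_le_cancel_left1)
    then show "indicator {0..r} s * w s \<le> indicator {0..r} s * C" using w_le[of s] by (auto split: split_indicator)
  qed auto
  also have "\<dots> = C * r" using assms by simp
  finally show ?thesis .
qed

lemma ratio_le: assumes "0 < r" shows "W r / r \<le> K / (1 + r)"
proof -
  have "W r * (1 + r) \<le> C * r + (\<integral>s. w s \<partial>lborel) * r"
    using add_mono[OF W_le_linear[of r] mult_right_mono[OF W_le_mass[of r], of r]] assms
    by (simp add: distrib_left)
  then show ?thesis using assms by (simp add: K_def field_simps)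
qed

lemma K_nonneg: "0 \<le> K" unfolding K_def using C_nonneg w_nonneg by (intro add_nonneg_nonneg Bochner_Integration.integral_nonneg) auto

lemma k_nonneg: "0 \<le> s \<Longrightarrow> 0 \<le> k s" unfolding k_def using W_nonneg by simp

lemma k_le: assumes "0 < s" shows "k s \<le> K / (1 + sqrt s)"
  unfolding k_def by (rule ratio_le) (use assms in simp)

lemma K_ge_C: "C \<le> K" unfolding K_def using w_nonneg by (simp add: Bochner_Integration.integral_nonneg)

text \<open>
  Fubini's theorem for the region \<open>s \<le> r\<close>. It replaces differentiation of \<open>W / r\<close>, which is available
  only almost everywhere because \<open>w\<close> is merely integrable.
\<close>

lemma ratio_increment:
  assumes ab: "0 < a" "a \<le> b"
  shows "(\<integral>r. indicator {a..b} r * (W r / r\<^sup>2 - w r / r) \<partial>lborel) = W a / a - W b / b"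
proof -
  have b: "0 < b" using ab by simp
  let ?f = "\<lambda>(s, r). w s * (indicator {0..r} s * (indicator {a..b} r / r\<^sup>2))"
  have fm: "?f \<in> borel_measurable (lborel \<Otimes>\<^sub>M lborel)"
  proof -
    have "(\<lambda>z. w (fst z) * ((if 0 \<le> fst z \<and> fst z \<le> snd z then 1 else 0) * (indicator {a..b} (snd z) / (snd z)\<^sup>2))) \<in> borel_measurable (lborel \<Otimes>\<^sub>M lborel)"
      by measurable
    also have "(\<lambda>z. w (fst z) * ((if 0 \<le> fst z \<and> fst z \<le> snd z then 1 else 0) * (indicator {a..b} (snd z) / (snd z)\<^sup>2))) = ?f"
      by (auto simp: fun_eq_iff split: split_indicator)
    finally show ?thesis .
  qed
  have ir: "integrable lborel (\<lambda>r. indicator {a..b} r / r\<^sup>2 :: real)"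
  proof -
    have "integrable lborel (\<lambda>r. indicator {a..b} r *\<^sub>R (1 / r\<^sup>2))"
      using ab by (intro borel_integrable_compact continuous_intros) auto
    then show ?thesis by simp
  qed
  have absint: "(\<integral>r. \<bar>c * v r\<bar> \<partial>lborel) = \<bar>c\<bar> * (\<integral>r. \<bar>v r\<bar> \<partial>lborel)" for c and v :: "real \<Rightarrow> real"
    by (simp only: abs_mult integral_mult_right_zero)
  have int: "integrable (lborel \<Otimes>\<^sub>M lborel) ?f"
  proof (rule Bochner_Integration.integrable_bound)
    show "integrable (lborel \<Otimes>\<^sub>M lborel) (\<lambda>(s, r). w s * (indicator {a..b} r / r\<^sup>2))"
    proof (rule lborel_pair.Fubini_integrable)
      have "integrable lborel (\<lambda>s. \<bar>w s\<bar> * (\<integral>r. \<bar>indicator {a..b} r / r\<^sup>2\<bar> \<partial>lborel))"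
        using w_int by (intro integrable_mult_left integrable_abs)
      then show "integrable lborel (\<lambda>s. \<integral>r. norm (case (s, r) of (s, r) \<Rightarrow> w s * (indicator {a..b} r / r\<^sup>2)) \<partial>lborel)"
        by (simp only: prod.case real_norm_def absint)
      show "AE s in lborel. integrable lborel (\<lambda>r. case (s, r) of (s, r) \<Rightarrow> w s * (indicator {a..b} r / r\<^sup>2))"
        unfolding prod.case by (intro AE_I2 integrable_mult_right ir)
    qed measurable
    show "AE z in lborel \<Otimes>\<^sub>M lborel. norm (?f z) \<le> norm (case z of (s, r) \<Rightarrow> w s * (indicator {a..b} r / r\<^sup>2))"
      by (intro AE_I2) (auto simp: case_prod_unfold abs_mult split: split_indicator)
  qed (rule fm)
  have inner_r: "(\<integral>s. ?f (s, r) \<partial>lborel) = indicator {a..b} r * (W r / r\<^sup>2)" for r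
  proof -
    have "(\<lambda>s. ?f (s, r)) = (\<lambda>s. (indicator {a..b} r / r\<^sup>2) * (indicator {0..r} s * w s))" by (auto simp: fun_eq_iff)
    then show ?thesis by (simp only: integral_mult_right_zero W_def[symmetric]) simp
  qed
  have inner_s: "(\<integral>r. ?f (s, r) \<partial>lborel) = (indicator {0..a} s * w s) * (1 / a) + indicator {a<..b} s * (w s / s) - (1 / b) * (indicator {0..b} s * w s)" for s
  proof (cases "s \<in> {0..b}")
    case True
    define c where "c = max a s"
    have c: "0 < c" "c \<le> b" using True ab by (auto simp: c_def)
    have "(\<lambda>r. ?f (s, r)) = (\<lambda>r. w s * (indicator {c..b} r *\<^sub>R (1 / r\<^sup>2)))"
      using True by (auto simp: fun_eq_iff c_def split: split_indicator)
    moreover have "(\<integral>r. indicator {c..b} r *\<^sub>R (1 / r\<^sup>2) \<partial>lborel) = - (1 / b) - (- (1 / c))"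
    proof (rule integral_FTC_atLeastAtMost[OF c(2)])
      fix r assume "c \<le> r" "r \<le> b"
      then have "((\<lambda>r. - (1 / r)) has_real_derivative 1 / r\<^sup>2) (at r)"
        using c by (auto intro!: derivative_eq_intros simp: power2_eq_square)
      then show "((\<lambda>r. - (1 / r)) has_vector_derivative 1 / r\<^sup>2) (at r within {c..b})"
        by (auto simp: has_real_derivative_iff_has_vector_derivative intro: has_vector_derivative_at_within)
    qed (use c in \<open>auto intro!: continuous_intros\<close>)
    ultimately have "(\<integral>r. ?f (s, r) \<partial>lborel) = w s * (1 / c - 1 / b)" by (simp only: integral_mult_right_zero) simp
    then show ?thesis using True ab by (auto simp: c_def max_def right_diff_distrib split: split_indicator)
  next
    case False
    then have "?f (s, r) = 0" for r by (auto split: split_indicator)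
    then have "(\<integral>r. ?f (s, r) \<partial>lborel) = 0" by (simp only: Bochner_Integration.integral_zero)
    then show ?thesis using False ab by (auto simp only: indicator_simps atLeastAtMost_iff greaterThanAtMost_iff split: split_indicator)
  qed
  have i1: "integrable lborel (\<lambda>s. indicator {a<..b} s * (w s / s))"
  proof (rule Bochner_Integration.integrable_bound)
    show "integrable lborel (\<lambda>s. (1 / a) * w s)" by (intro integrable_mult_right w_int)
    show "AE s in lborel. norm (indicator {a<..b} s * (w s / s)) \<le> norm ((1 / a) * w s)"
      using ab w_nonneg by (intro AE_I2) (auto split: split_indicator intro!: divide_left_mono)
  qed measurable
  have "(\<integral>r. indicator {a..b} r * (W r / r\<^sup>2) \<partial>lborel) = (\<integral>s. (indicator {0..a} s * w s) * (1 / a) + indicator {a<..b} s * (w s / s) - (1 / b) * (indicator {0..b} s * w s) \<partial>lborel)"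
    using lborel_pair.Fubini_integral[of "\<lambda>s r. ?f (s, r)"] int unfolding inner_r inner_s by simp
  also have "\<dots> = W a * (1 / a) + (\<integral>s. indicator {a<..b} s * (w s / s) \<partial>lborel) - (1 / b) * W b"
    using w_set_int[of "{0..a}"] w_set_int[of "{0..b}"] i1 unfolding W_def by simp
  finally have eq: "(\<integral>r. indicator {a..b} r * (W r / r\<^sup>2) \<partial>lborel) = W a * (1 / a) + (\<integral>s. indicator {a<..b} s * (w s / s) \<partial>lborel) - (1 / b) * W b" .
  have i2: "integrable lborel (\<lambda>r. indicator {a..b} r * (W r / r\<^sup>2))"
    using lborel_pair.integrable_snd[of "\<lambda>s r. ?f (s, r)"] int unfolding inner_r by simp
  have i3: "(\<integral>r. indicator {a..b} r * (w r / r) \<partial>lborel) = (\<integral>s. indicator {a<..b} s * (w s / s) \<partial>lborel)"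
    "integrable lborel (\<lambda>r. indicator {a..b} r * (w r / r))"
  proof -
    have ae: "AE r in lborel. indicator {a<..b} r * (w r / r) = indicator {a..b} r * (w r / r)"
      using AE_lborel_singleton[of a] by eventually_elim (auto split: split_indicator)
    show "integrable lborel (\<lambda>r. indicator {a..b} r * (w r / r))"
      by (rule integrable_cong_AE_imp[OF i1 _ ae]) measurable
    show "(\<integral>r. indicator {a..b} r * (w r / r) \<partial>lborel) = (\<integral>s. indicator {a<..b} s * (w s / s) \<partial>lborel)"
      by (rule integral_cong_AE[symmetric, OF _ _ ae]) measurable
  qed
  have "(\<integral>r. indicator {a..b} r * (W r / r\<^sup>2 - w r / r) \<partial>lborel) = (\<integral>r. indicator {a..b} r * (W r / r\<^sup>2) \<partial>lborel) - (\<integral>r. indicator {a..b} r * (w r / r) \<partial>lborel)"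
    unfolding right_diff_distrib by (rule Bochner_Integration.integral_diff[OF i2 i3(2)])
  then show ?thesis unfolding eq i3(1) by simp
qed

text \<open>
  Minus the derivative of \<open>k\<close>, cut off near the origin, where it is singular, and at infinity.
\<close>

definition "slope d A s = indicator {d..A} s * ((k s - w (sqrt s)) / (2 * s))"

lemma slope_meas [measurable]: "slope d A \<in> borel_measurable borel" unfolding slope_def[abs_def] by measurable

lemma slope_core: assumes "0 < s" shows "\<bar>k s - w (sqrt s)\<bar> \<le> K / (1 + sqrt s)"
proof -
  have "w (sqrt s) \<le> C / (1 + sqrt s)" using assms by (intro w_le) simp
  also have "\<dots> \<le> K / (1 + sqrt s)" using assms by (intro divide_right_mono K_ge_C) simp
  finally show ?thesis using k_le[OF assms] k_nonneg[of s] w_nonneg[of "sqrt s"] assms by simp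
qed

lemma slope_bounded: assumes "0 < d" shows "\<bar>slope d A s\<bar> \<le> K / (2 * d)"
proof (cases "s \<in> {d..A}")
  case True
  then have s: "0 < s" "d \<le> s" using assms by auto
  have "\<bar>k s - w (sqrt s)\<bar> \<le> K"
  proof -
    have "K / (1 + sqrt s) \<le> K / 1" using K_nonneg s by (intro divide_left_mono) (auto intro: add_pos_nonneg)
    then show ?thesis using slope_core[OF s(1)] by simp
  qed
  then have "\<bar>k s - w (sqrt s)\<bar> / (2 * s) \<le> K / (2 * d)" using s assms by (intro frac_le) auto
  then show ?thesis using True s by (simp add: slope_def)
qed (use assms K_nonneg in \<open>simp add: slope_def\<close>)

text \<open>
  The substitution \<open>s = r\<^sup>2\<close> reduces this to \<open>ratio_increment\<close>.
\<close>

lemma slope_integral: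
  assumes d: "0 < d" and x: "0 \<le> x" "x < A" "d \<le> A"
  shows "(\<integral>s. indicator {x<..<A} s * slope d A s \<partial>lborel) = k (max x d) - k A"
proof -
  define c where "c = max x d"
  have c: "0 < c" "c \<le> A" using d x by (auto simp: c_def)
  let ?h = "\<lambda>s. (k s - w (sqrt s)) / (2 * s)"
  have hm: "?h \<in> borel_measurable borel" by measurable
  have "(\<integral>s. indicator {x<..<A} s * slope d A s \<partial>lborel) = (\<integral>s. ?h s * indicator {(sqrt c)\<^sup>2..(sqrt A)\<^sup>2} s \<partial>lborel)"
  proof (rule integral_cong_AE)
    show "AE s in lborel. indicator {x<..<A} s * slope d A s = ?h s * indicator {(sqrt c)\<^sup>2..(sqrt A)\<^sup>2} s"
      using AE_lborel_singleton[of x] AE_lborel_singleton[of A]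
      by eventually_elim (use c in \<open>auto simp: slope_def c_def max_def split: split_indicator\<close>)
  qed measurable
  also have "\<dots> = (\<integral>r. ?h (r\<^sup>2) * (2 * r) * indicator {sqrt c..sqrt A} r \<partial>lborel)"
  proof (rule integral_substitution(2))
    have "integrable lborel (\<lambda>s. indicator {c..A} s * ?h s)"
    proof (rule Bochner_Integration.integrable_bound)
      show "integrable lborel (\<lambda>s. indicator {c..A} s * (K / (2 * c)))"
        using c by (intro integrable_mult_left integrable_real_indicator) auto
      show "AE s in lborel. norm (indicator {c..A} s * ?h s) \<le> norm (indicator {c..A} s * (K / (2 * c)))"
      proof (rule AE_I2)
        fix s
        show "norm (indicator {c..A} s * ?h s) \<le> norm (indicator {c..A} s * (K / (2 * c)))"
          using slope_bounded[OF c(1), of A s] K_nonneg c by (auto simp: slope_def split: split_indicator)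
      qed
    qed (use hm in measurable)
    then show "set_integrable lborel {(sqrt c)\<^sup>2..(sqrt A)\<^sup>2} ?h" unfolding set_integrable_def using c by simp
  next
    fix r assume "r \<in> {sqrt c..sqrt A}"
    moreover have "0 < sqrt c" using c by simp
    ultimately show "0 \<le> 2 * r" unfolding atLeastAtMost_iff by linarith
  qed (use c in \<open>auto intro!: derivative_eq_intros continuous_intros\<close>)
  also have "\<dots> = (\<integral>r. indicator {sqrt c..sqrt A} r * (W r / r\<^sup>2 - w r / r) \<partial>lborel)"
  proof (intro Bochner_Integration.integral_cong refl)
    fix r
    show "?h (r\<^sup>2) * (2 * r) * indicator {sqrt c..sqrt A} r = indicator {sqrt c..sqrt A} r * (W r / r\<^sup>2 - w r / r)"
    proof (cases "r \<in> {sqrt c..sqrt A}")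
      case True
      moreover have "0 < sqrt c" using c by simp
      ultimately have "0 < r" unfolding atLeastAtMost_iff by linarith
      then show ?thesis using True by (simp add: k_def field_simps power2_eq_square)
    qed simp
  qed
  also have "\<dots> = W (sqrt c) / sqrt c - W (sqrt A) / sqrt A"
    using c by (intro ratio_increment) auto
  finally show ?thesis by (simp add: k_def c_def)
qed

end

text \<open>
  The integrability of \<open>U / (1 + \<bar>x\<bar>)\<close> is exactly what pairing with \<open>\<nabla>V\<close> needs.
\<close>

locale weighted_pressure = pressure_identity u p + radial_weight w C
  for u :: "'a::euclidean_space \<Rightarrow> 'a" and p w C +
  assumes decay: "integrable lborel (\<lambda>x. U x / (1 + norm x))"
begin

lemma norm_AE: "AE x in (lborel :: 'a measure). 0 < norm x"
  using AE_lborel_singleton[of 0] by eventually_elim simp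

text \<open>
  Let the cutoffs of \<open>slope\<close> tend to the origin and to infinity in \<open>integral_profile\<close>. Here \<open>R\<close> is the
  radial part of \<open>u \<otimes> u + p I\<close> and \<open>S - R\<close> its tangential part, so the integrand is
  \<open>u \<otimes> u : \<nabla>V + p div V\<close>.
\<close>

lemma weighted_identity:
  defines "R \<equiv> \<lambda>x. Q 0 x / (norm x)\<^sup>2"
  shows "integrable lborel (\<lambda>x. w (norm x) * R x + W (norm x) / norm x * (S x - R x))"
    and "(\<integral>x. w (norm x) * R x + W (norm x) / norm x * (S x - R x) \<partial>lborel) = 0"
proof -
  define q where "q x = (norm (x - 0))\<^sup>2" for x :: 'a
  have [measurable]: "q \<in> borel_measurable borel" unfolding q_def by measurable
  have sq: "sqrt (q x) = norm x" for x by (simp add: q_def)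
  have q0: "0 < q x" if "0 < norm x" for x using that by (simp add: q_def)
  define d where "d n = 1 / real (Suc n)" for n
  define A where "A n = real (Suc n)" for n
  have dA': "0 < d n" "d n \<le> 1" "1 \<le> A n" for n
    by (auto simp: d_def A_def)
  have dA: "0 < d n" "d n \<le> A n" "d n \<le> 1" "1 \<le> A n" for n
    using dA'[of n] by auto
  have step: "(\<integral>x. slope (d n) (A n) (q x) * (indicator {..<A n} (q x) * (2 * Q 0 x)) \<partial>lborel)
    = (\<integral>x. indicator {..<A n} (q x) * ((k (max (q x) (d n)) - k (A n)) * S x) \<partial>lborel)" for n
  proof -
    have "(\<integral>x. slope (d n) (A n) (q x) * (indicator {..<A n} (q x) * (2 * Q 0 x)) \<partial>lborel)
      = (\<integral>x. S x * (\<integral>s. indicator {q x<..<A n} s * slope (d n) (A n) s \<partial>lborel) \<partial>lborel)"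
      unfolding q_def
      by (rule integral_profile[where \<beta>="slope (d n) (A n)" and B="K / (2 * d n)", OF slope_meas slope_bounded[OF dA(1)]])
    also have "\<dots> = (\<integral>x. indicator {..<A n} (q x) * ((k (max (q x) (d n)) - k (A n)) * S x) \<partial>lborel)"
    proof (intro Bochner_Integration.integral_cong refl)
      fix x
      show "S x * (\<integral>s. indicator {q x<..<A n} s * slope (d n) (A n) s \<partial>lborel) = indicator {..<A n} (q x) * ((k (max (q x) (d n)) - k (A n)) * S x)"
      proof (cases "q x < A n")
        case True
        then show ?thesis using slope_integral[OF dA(1) _ True dA(2)] by (simp add: q_def)
      next
        case False
        then have "{q x<..<A n} = {}" by auto
        then show ?thesis using False by simp
      qed
    qed
    finally show ?thesis .
  qed
  have Rle: "\<bar>R x\<bar> \<le> U x" for x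
  proof (cases "x = 0")
    case False
    then show ?thesis using Q_le[of 0 x] by (simp add: R_def abs_divide pos_divide_le_eq mult.commute)
  qed (simp add: R_def Q_def U_nonneg)
  have n1: "0 < 1 + norm x" for x :: 'a by (simp add: add_pos_nonneg)
  have i1: "integrable lborel (\<lambda>x. K * (U x / (1 + norm x)))" by (intro integrable_mult_right decay)
  have i2: "integrable lborel (\<lambda>x. (2 * K * (1 + real DIM('a))) * (U x / (1 + norm x)))" by (intro integrable_mult_right decay)
  have Uw: "0 \<le> U x / (1 + norm x)" for x using U_nonneg[of x] n1[of x] by simp
  have [measurable]: "R \<in> borel_measurable borel" unfolding R_def by measurable
  let ?l = "\<lambda>x. (k (q x) - w (norm x)) * R x"
  let ?r = "\<lambda>x. k (q x) * S x"
  have b1: "\<bar>?l x\<bar> \<le> K * (U x / (1 + norm x))" if "0 < norm x" for x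
  proof -
    have "\<bar>k (q x) - w (norm x)\<bar> \<le> K / (1 + norm x)" using slope_core[OF q0[OF that]] by (simp add: sq)
    then have "\<bar>?l x\<bar> \<le> K / (1 + norm x) * U x" unfolding abs_mult using Rle[of x] K_nonneg n1[of x] by (intro mult_mono) auto
    then show ?thesis by simp
  qed
  have kq: "k s \<le> K / (1 + norm x)" if "q x \<le> s" "0 < s" for s x
  proof -
    have "norm x \<le> sqrt s" using real_sqrt_le_mono[OF that(1)] by (simp add: sq)
    then have "K / (1 + sqrt s) \<le> K / (1 + norm x)" using K_nonneg n1[of x] by (intro divide_left_mono) (auto intro!: mult_pos_pos add_pos_nonneg)
    then show ?thesis using k_le[OF that(2)] by linarith
  qed
  have ind: "(\<lambda>n. indicator {..<A n} (q x) :: real) \<longlonglongrightarrow> 1" for x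
  proof (rule tendsto_eventually)
    obtain m where "q x < real m" using reals_Archimedean2 by blast
    then show "\<forall>\<^sub>F n in sequentially. (indicator {..<A n} (q x) :: real) = 1"
      by (intro eventually_sequentiallyI[of m]) (auto simp: A_def split: split_indicator)
  qed
  have dlim: "d \<longlonglongrightarrow> 0" unfolding d_def by real_asymp
  have "(\<lambda>n. \<integral>x. slope (d n) (A n) (q x) * (indicator {..<A n} (q x) * (2 * Q 0 x)) \<partial>lborel) \<longlonglongrightarrow> (\<integral>x. ?l x \<partial>lborel)"
  proof (rule integral_dominated_convergence[OF _ _ i1])
    have form: "slope (d n) (A n) (q x) * (indicator {..<A n} (q x) * (2 * Q 0 x)) = indicator {d n..<A n} (q x) * ?l x" if x: "0 < norm x" for n x
      using q0[OF x] x by (auto simp: slope_def R_def sq q_def split: split_indicator)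
    show "AE x in lborel. norm (slope (d n) (A n) (q x) * (indicator {..<A n} (q x) * (2 * Q 0 x))) \<le> K * (U x / (1 + norm x))" for n
      using norm_AE
    proof eventually_elim
      case (elim x)
      show ?case unfolding form[OF elim] using b1[OF elim] K_nonneg Uw[of x] by (auto split: split_indicator)
    qed
    show "AE x in lborel. (\<lambda>n. slope (d n) (A n) (q x) * (indicator {..<A n} (q x) * (2 * Q 0 x))) \<longlonglongrightarrow> ?l x"
      using norm_AE
    proof eventually_elim
      case (elim x)
      have "(\<lambda>n. indicator {d n..<A n} (q x) :: real) \<longlonglongrightarrow> 1"
      proof (rule tendsto_eventually)
        obtain m where m: "q x < real m" using reals_Archimedean2 by blast
        from order_tendstoD(2)[OF dlim q0[OF elim]] eventually_ge_at_top[of m]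
        show "\<forall>\<^sub>F n in sequentially. (indicator {d n..<A n} (q x) :: real) = 1"
          by eventually_elim (use m in \<open>auto simp: A_def split: split_indicator\<close>)
      qed
      then have "(\<lambda>n. indicator {d n..<A n} (q x) * ?l x) \<longlonglongrightarrow> 1 * ?l x" by (intro tendsto_intros)
      then show ?case unfolding form[OF elim] by simp
    qed
  qed measurable
  moreover have "(\<lambda>n. \<integral>x. indicator {..<A n} (q x) * ((k (max (q x) (d n)) - k (A n)) * S x) \<partial>lborel) \<longlonglongrightarrow> (\<integral>x. ?r x \<partial>lborel)"
  proof (rule integral_dominated_convergence[OF _ _ i2])
    show "AE x in lborel. norm (indicator {..<A n} (q x) * ((k (max (q x) (d n)) - k (A n)) * S x)) \<le> (2 * K * (1 + real DIM('a))) * (U x / (1 + norm x))" for n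
    proof (rule AE_I2)
      fix x
      have r0: "0 \<le> (2 * K * (1 + real DIM('a))) * (U x / (1 + norm x))" using K_nonneg Uw[of x] by (intro mult_nonneg_nonneg) auto
      show "norm (indicator {..<A n} (q x) * ((k (max (q x) (d n)) - k (A n)) * S x)) \<le> (2 * K * (1 + real DIM('a))) * (U x / (1 + norm x))"
      proof (cases "q x < A n")
        case True
        have p: "0 < max (q x) (d n)" "0 < A n" using dA(1)[of n] dA(4)[of n] by auto
        have "\<bar>k (max (q x) (d n)) - k (A n)\<bar> \<le> k (max (q x) (d n)) + k (A n)"
          using k_nonneg[of "max (q x) (d n)"] k_nonneg[of "A n"] p by auto
        also have "\<dots> \<le> 2 * K / (1 + norm x)"
          using kq[of x "max (q x) (d n)"] kq[of x "A n"] p True by simp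
        finally have "\<bar>(k (max (q x) (d n)) - k (A n)) * S x\<bar> \<le> 2 * K / (1 + norm x) * ((1 + real DIM('a)) * U x)"
          unfolding abs_mult using S_le[of x] K_nonneg n1[of x] by (intro mult_mono) auto
        then show ?thesis using True by (simp add: mult_ac)
      qed (use r0 in simp)
    qed
    show "AE x in lborel. (\<lambda>n. indicator {..<A n} (q x) * ((k (max (q x) (d n)) - k (A n)) * S x)) \<longlonglongrightarrow> ?r x"
      using norm_AE
    proof eventually_elim
      case (elim x)
      have "(\<lambda>n. k (max (q x) (d n))) \<longlonglongrightarrow> k (q x)"
      proof (rule tendsto_eventually)
        from order_tendstoD(2)[OF dlim q0[OF elim]]
        show "\<forall>\<^sub>F n in sequentially. k (max (q x) (d n)) = k (q x)" by eventually_elim (simp add: max_def)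
      qed
      moreover have "(\<lambda>n. k (A n)) \<longlonglongrightarrow> 0"
      proof (rule tendsto_sandwich[where f="\<lambda>_. 0"])
        show "\<forall>\<^sub>F n in sequentially. 0 \<le> k (A n)" using k_nonneg dA(4) by (intro always_eventually allI k_nonneg) (meson order_trans zero_le_one)
        show "\<forall>\<^sub>F n in sequentially. k (A n) \<le> K / (1 + sqrt (A n))" using dA(4) by (intro always_eventually allI k_le) (meson less_le_trans zero_less_one)
        have "(\<lambda>n. 1 / (1 + sqrt (real (Suc n)))) \<longlonglongrightarrow> 0" by real_asymp
        from tendsto_mult_right[OF this, of K]
        show "(\<lambda>n. K / (1 + sqrt (A n))) \<longlonglongrightarrow> 0" by (simp add: A_def)
      qed simp
      ultimately have "(\<lambda>n. indicator {..<A n} (q x) * ((k (max (q x) (d n)) - k (A n)) * S x)) \<longlonglongrightarrow> 1 * ((k (q x) - 0) * S x)"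
        by (intro tendsto_intros ind)
      then show ?case by simp
    qed
  qed measurable
  ultimately have eq: "(\<integral>x. ?l x \<partial>lborel) = (\<integral>x. ?r x \<partial>lborel)" unfolding step by (rule LIMSEQ_unique)
  have il: "integrable lborel ?l"
  proof (rule Bochner_Integration.integrable_bound[OF i1])
    show "AE x in lborel. norm (?l x) \<le> norm (K * (U x / (1 + norm x)))"
      using norm_AE
    proof eventually_elim
      case (elim x)
      from b1[OF elim] show ?case unfolding real_norm_def by (rule order_trans[OF _ abs_ge_self])
    qed
  qed measurable
  have ir: "integrable lborel ?r"
  proof (rule Bochner_Integration.integrable_bound[OF i2])
    show "AE x in lborel. norm (?r x) \<le> norm ((2 * K * (1 + real DIM('a))) * (U x / (1 + norm x)))"
      using norm_AE
    proof eventually_elim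
      case (elim x)
      have "\<bar>?r x\<bar> \<le> K / (1 + norm x) * ((1 + real DIM('a)) * U x)"
        unfolding abs_mult using kq[OF order_refl q0[OF elim]] k_nonneg[of "q x"] q0[OF elim] S_le[of x] K_nonneg n1[of x] by (intro mult_mono) auto
      also have "\<dots> = (K * (1 + real DIM('a))) * (U x / (1 + norm x))" by simp
      also have "\<dots> \<le> (2 * K * (1 + real DIM('a))) * (U x / (1 + norm x))" using K_nonneg Uw[of x] by (intro mult_right_mono) auto
      finally show ?case unfolding real_norm_def by (rule order_trans[OF _ abs_ge_self])
    qed
  qed measurable
  have form: "(\<lambda>x. w (norm x) * R x + W (norm x) / norm x * (S x - R x)) = (\<lambda>x. ?r x - ?l x)"
    by (rule ext) (simp add: k_def sq algebra_simps diff_divide_distrib)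
  show "integrable lborel (\<lambda>x. w (norm x) * R x + W (norm x) / norm x * (S x - R x))"
    unfolding form using il ir by auto
  show "(\<integral>x. w (norm x) * R x + W (norm x) / norm x * (S x - R x) \<partial>lborel) = 0"
    unfolding form using il ir eq by simp
qed

lemma pressure_weight_integrable:
  "integrable lborel (\<lambda>x. p x * (w (norm x) + (real DIM('a) - 1) / norm x * W (norm x)))"
proof (rule Bochner_Integration.integrable_bound)
  show "integrable lborel (\<lambda>x. (K + real DIM('a) * K) * (U x / (1 + norm x)))" by (intro integrable_mult_right decay)
  show "AE x in lborel. norm (p x * (w (norm x) + (real DIM('a) - 1) / norm x * W (norm x))) \<le> norm ((K + real DIM('a) * K) * (U x / (1 + norm x)))"
    using norm_AE
  proof eventually_elim
    case (elim x)
    have n1: "0 < 1 + norm x" by (simp add: add_pos_nonneg)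
    have "w (norm x) \<le> C / (1 + norm x)" by (rule w_le) simp
    also have "\<dots> \<le> K / (1 + norm x)" using n1 by (intro divide_right_mono K_ge_C) simp
    finally have 1: "w (norm x) \<le> K / (1 + norm x)" .
    have D1: "0 \<le> real DIM('a) - 1" using DIM_positive[where 'a='a] by simp
    have "(real DIM('a) - 1) * (W (norm x) / norm x) \<le> real DIM('a) * (K / (1 + norm x))"
      using ratio_le[OF elim] W_nonneg[of "norm x"] elim D1 by (intro mult_mono) auto
    then have "w (norm x) + (real DIM('a) - 1) / norm x * W (norm x) \<le> (K + real DIM('a) * K) / (1 + norm x)"
      using 1 by (simp add: add_divide_distrib)
    moreover have "0 \<le> w (norm x) + (real DIM('a) - 1) / norm x * W (norm x)"
      using w_nonneg W_nonneg D1 elim by (intro add_nonneg_nonneg mult_nonneg_nonneg) auto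
    moreover have "\<bar>p x\<bar> \<le> U x" by (simp add: U_def)
    ultimately have "\<bar>p x\<bar> * \<bar>w (norm x) + (real DIM('a) - 1) / norm x * W (norm x)\<bar> \<le> U x * ((K + real DIM('a) * K) / (1 + norm x))"
      by (intro mult_mono U_nonneg) auto
    then have "norm (p x * (w (norm x) + (real DIM('a) - 1) / norm x * W (norm x))) \<le> (K + real DIM('a) * K) * (U x / (1 + norm x))"
      unfolding real_norm_def abs_mult by (simp add: mult_ac)
    then show ?case unfolding real_norm_def by (rule order_trans[OF _ abs_ge_self])
  qed
qed measurable

text \<open>
  Subtracting the pressure integral from \<open>weighted_identity\<close> leaves an integral of a nonnegative
  function \<open>E\<close> that is at most \<open>0\<close>. Both components of \<open>u\<close>, radial and tangential, enter \<open>E\<close> with a positive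
  coefficient.
\<close>

lemma velocity_vanishes:
  assumes w_pos: "AE x in (lborel :: 'a measure). 0 < w (norm x)" and W_pos: "\<And>r. 0 < r \<Longrightarrow> 0 < W r"
    and pressure: "0 \<le> (\<integral>x. p x * (w (norm x) + (real DIM('a) - 1) / norm x * W (norm x)) \<partial>lborel)"
  shows "AE x in lborel. u x = 0"
proof -
  define E where "E x = w (norm x) * ((u x \<bullet> x)\<^sup>2 / (norm x)\<^sup>2) + W (norm x) / norm x * ((norm (u x))\<^sup>2 - (u x \<bullet> x)\<^sup>2 / (norm x)\<^sup>2)" for x
  let ?P = "\<lambda>x. p x * (w (norm x) + (real DIM('a) - 1) / norm x * W (norm x))"
  let ?Z = "\<lambda>x. w (norm x) * (Q 0 x / (norm x)\<^sup>2) + W (norm x) / norm x * (S x - Q 0 x / (norm x)\<^sup>2)"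
  have Em [measurable]: "E \<in> borel_measurable borel" unfolding E_def by measurable
  have eq: "E x = ?Z x - ?P x" if "0 < norm x" for x
  proof -
    define a where "a = (u x \<bullet> x)\<^sup>2 / (norm x)\<^sup>2"
    have 1: "Q 0 x / (norm x)\<^sup>2 = a + p x" using that by (simp add: Q_def a_def add_divide_distrib)
    show ?thesis unfolding E_def 1 S_def a_def[symmetric] by (simp add: divide_inverse algebra_simps)
  qed
  have iE: "integrable lborel E"
  proof (rule integrable_cong_AE_imp)
    show "integrable lborel (\<lambda>x. ?Z x - ?P x)" using weighted_identity(1) pressure_weight_integrable by auto
    show "AE x in lborel. ?Z x - ?P x = E x" using norm_AE by eventually_elim (use eq in simp)
  qed measurable
  have "(\<integral>x. E x \<partial>lborel) = (\<integral>x. ?Z x - ?P x \<partial>lborel)"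
    by (rule integral_cong_AE) (use norm_AE eq in \<open>auto elim!: eventually_mono\<close>)
  also have "\<dots> = 0 - (\<integral>x. ?P x \<partial>lborel)"
    using weighted_identity pressure_weight_integrable by simp
  finally have le: "(\<integral>x. E x \<partial>lborel) \<le> 0" using pressure by simp
  have cs: "(u x \<bullet> x)\<^sup>2 / (norm x)\<^sup>2 \<le> (norm (u x))\<^sup>2" if "0 < norm x" for x
  proof -
    have "(u x \<bullet> x)\<^sup>2 \<le> (norm (u x) * norm x)\<^sup>2" using Cauchy_Schwarz_ineq2[of "u x" x] by (metis abs_ge_zero power2_abs power_mono)
    then show ?thesis using that by (simp add: pos_divide_le_eq power_mult_distrib)
  qed
  have E0: "AE x in lborel. 0 \<le> E x"
    using norm_AE
  proof eventually_elim
    case (elim x)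
    then show ?case unfolding E_def using cs[OF elim] w_nonneg W_nonneg by (intro add_nonneg_nonneg mult_nonneg_nonneg) auto
  qed
  have "(\<integral>x. E x \<partial>lborel) = 0" using le integral_nonneg_AE[OF E0] by simp
  then have "AE x in lborel. E x = 0" using integral_nonneg_eq_0_iff_AE[OF iE E0] by simp
  with norm_AE w_pos show ?thesis
  proof eventually_elim
    case (elim x)
    define a b where "a = (u x \<bullet> x)\<^sup>2 / (norm x)\<^sup>2" and "b = (norm (u x))\<^sup>2 - a"
    have ab: "0 \<le> a" "0 \<le> b" using cs[OF elim(1)] by (auto simp: a_def b_def)
    have W: "0 < W (norm x) / norm x" using W_pos[OF elim(1)] elim(1) by simp
    have "w (norm x) * a + W (norm x) / norm x * b = 0" using elim(3) by (simp add: E_def a_def b_def)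
    moreover have "0 \<le> w (norm x) * a" "0 \<le> W (norm x) / norm x * b" 
      by (rule mult_nonneg_nonneg[OF less_imp_le[OF elim(2)] ab(1)], rule mult_nonneg_nonneg[OF less_imp_le[OF W] ab(2)])
    ultimately have "w (norm x) * a = 0" "W (norm x) / norm x * b = 0" by linarith+
    then have "a = 0" "b = 0" using W elim(2) by auto
    then show ?case by (simp add: b_def)
  qed
qed

end

section \<open>Integrability of the pressure from decay at infinity\<close>

text \<open>
  Young's inequality with constants \<open>1\<close>: either \<open>b \<le> a\<^sup>s\<^sup>-\<^sup>1\<close>, and the first term suffices, or the
  second does.
\<close>

lemma mult_le_powr_plus_powr:
  fixes a b s :: real
  assumes s: "1 < s" and a: "0 \<le> a" and b: "0 < b"
  shows "a * b \<le> a powr s + b powr (s / (s - 1))"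
proof (cases "b \<le> a powr (s - 1)")
  case True
  then have "a \<noteq> 0" using b by auto
  then have "a * b \<le> a powr 1 * a powr (s - 1)" using True a by (simp add: mult_left_mono)
  also have "\<dots> = a powr (1 + (s - 1))" by (simp only: powr_add)
  also have "1 + (s - 1) = s" by simp
  finally show ?thesis by (simp add: add_increasing2)
next
  case False
  have "a \<le> b powr (1 / (s - 1))"
  proof (cases "a = 0")
    case False': False
    have "a = (a powr (s - 1)) powr (1 / (s - 1))" using s False' a by (simp add: powr_powr)
    also have "\<dots> \<le> b powr (1 / (s - 1))" using False s by (intro powr_mono2) auto
    finally show ?thesis .
  qed simp
  then have "a * b \<le> b powr (1 / (s - 1)) * b powr 1" using b by (simp add: mult_right_mono)
  also have "\<dots> = b powr (1 / (s - 1) + 1)" by (simp only: powr_add)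
  also have "1 / (s - 1) + 1 = s / (s - 1)" using s by (simp add: field_simps)
  finally show ?thesis by (simp add: add_increasing)
qed

lemma power2_powr: "(norm z)\<^sup>2 powr s = norm z powr (2 * s)"
  by (cases "norm z = 0") (auto simp: powr_powr simp flip: powr_numeral)

context pressure_identity begin

text \<open>
  The pressure is handled by the heat flow and duality, the velocity by Young's inequality against
  the weight.
\<close>

lemma decay_of_powr_integrable:
  assumes s: "1 < s" "s < 2" "real DIM('a) < s / (s - 1)"
    and us: "integrable lborel (\<lambda>x. norm (u x) powr (2 * s))"
    and p_loc: "\<And>R. integrable lborel (\<lambda>x. indicator (cball 0 R) x * p x)"
    and vanish: "\<And>e. 0 < e \<Longrightarrow> \<exists>R. \<forall>x. R \<le> norm x \<longrightarrow> \<bar>p x\<bar> \<le> e"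
  shows "integrable lborel (\<lambda>x. U x / (1 + norm x))"
proof -
  have n1: "0 < 1 + norm x" for x :: 'a by (simp add: add_pos_nonneg)
  have us': "integrable lborel (\<lambda>x. \<bar>(norm (u x))\<^sup>2\<bar> powr s)" using us by (simp add: power2_powr)
  have tu: "tame (\<lambda>x. (norm (u x))\<^sup>2)" by (rule tame_powr_integrable[OF _ us']) (use s in auto)
  have tp: "tame p"
  proof -
    obtain R where R: "\<And>x. R \<le> norm x \<Longrightarrow> \<bar>p x\<bar> \<le> 1" using vanish[of 1] by auto
    have "\<bar>p x\<bar> \<le> \<bar>indicator (cball 0 R) x * p x\<bar> + 1" for x
      using R[of x] by (cases "R \<le> norm x") (auto simp: add_increasing)
    then show ?thesis unfolding tame_def using integrable_abs[OF p_loc[of R]] p_meas by blast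
  qed
  obtain C where C: "\<And>g R. continuous_on UNIV g \<Longrightarrow> (\<And>x. \<bar>g x\<bar> \<le> 1 / (1 + norm x)) \<Longrightarrow> (\<And>x. R \<le> norm x \<Longrightarrow> g x = 0)
    \<Longrightarrow> \<bar>\<integral>x. g x * p x \<partial>lborel\<bar> \<le> C"
  proof (rule pressure_pairing_bound[OF s tp vanish, where F="\<lambda>i j x. (u x \<bullet> i) * (u x \<bullet> j)"])
    fix i j :: 'a assume ij: "i \<in> Basis" "j \<in> Basis"
    show "integrable lborel (\<lambda>x. \<bar>(u x \<bullet> i) * (u x \<bullet> j)\<bar> powr s)"
    proof (rule Bochner_Integration.integrable_bound[OF us'])
      have "\<bar>(u x \<bullet> i) * (u x \<bullet> j)\<bar> powr s \<le> \<bar>(norm (u x))\<^sup>2\<bar> powr s" for x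
        using Basis_le_norm[OF ij(1), of "u x"] Basis_le_norm[OF ij(2), of "u x"] s
        by (intro powr_mono2) (auto simp: abs_mult power2_eq_square intro!: mult_mono)
      then show "AE x in lborel. norm (\<bar>(u x \<bullet> i) * (u x \<bullet> j)\<bar> powr s) \<le> norm (\<bar>(norm (u x))\<^sup>2\<bar> powr s)"
        by (intro AE_I2) simp
    qed measurable
  next
    fix y :: 'a and t :: real assume "0 < t"
    then show "(\<Sum>i\<in>Basis. conv (heat_dd i i) p y t) = - (\<Sum>i\<in>Basis. \<Sum>j\<in>Basis. conv (heat_dd i j) (\<lambda>x. (u x \<bullet> i) * (u x \<bullet> j)) y t)"
      by (rule heat_identity[OF tu tp])
  qed auto
  have ip: "integrable lborel (\<lambda>x. p x / (1 + norm x))"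
    by (rule weighted_integrable_of_pairing_bound[OF tp C])
  have iu: "integrable lborel (\<lambda>x. (norm (u x))\<^sup>2 / (1 + norm x))"
  proof (rule Bochner_Integration.integrable_bound)
    show "integrable lborel (\<lambda>x. norm (u x) powr (2 * s) + (1 + norm x) powr - (s / (s - 1)))"
      by (intro Bochner_Integration.integrable_add us integrable_power_decay s)
    have "(norm (u x))\<^sup>2 / (1 + norm x) \<le> norm (u x) powr (2 * s) + (1 + norm x) powr - (s / (s - 1))" for x
      using mult_le_powr_plus_powr[OF s(1), of "(norm (u x))\<^sup>2" "1 / (1 + norm x)"] n1[of x]
      by (simp add: power2_powr powr_divide powr_minus_divide)
    moreover have "0 \<le> (norm (u x))\<^sup>2 / (1 + norm x)" for x using n1[of x] by simp
    ultimately show "AE x in lborel. norm ((norm (u x))\<^sup>2 / (1 + norm x)) \<le> norm (norm (u x) powr (2 * s) + (1 + norm x) powr - (s / (s - 1)))"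
      by (intro AE_I2) (simp add: order_trans[OF _ abs_ge_self])
  qed measurable
  have "U x / (1 + norm x) = (norm (u x))\<^sup>2 / (1 + norm x) + \<bar>p x / (1 + norm x)\<bar>" for x
    using n1[of x] by (simp add: U_def add_divide_distrib abs_divide)
  then show ?thesis using iu integrable_abs[OF ip] by simp
qed

end

text \<open>
  A null set of radii is a null set of points. Instead of polar coordinates the proof scales: by
  Tonelli, for almost every \<open>l\<close> in \<open>[1, 2]\<close> the points \<open>x\<close> with \<open>l \<bar>x\<bar>\<close> in the null set form a null set, and
  a single such \<open>l\<close> is enough, since a dilation preserves null sets.
\<close>

lemma AE_norm:
  assumes N: "AE r in lborel. 0 < r \<longrightarrow> P (r::real)"
  shows "AE x in (lborel :: 'a::euclidean_space measure). P (norm x)"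
proof -
  obtain M where M: "{r. \<not> (0 < r \<longrightarrow> P r)} \<subseteq> M" "M \<in> sets borel" "emeasure lborel M = 0"
    using N by (auto elim!: AE_E)
  have [measurable]: "M \<in> sets borel" by (rule M)
  let ?f = "\<lambda>(l, x::'a). indicator {1..2} l * indicator M (l * norm x) :: ennreal"
  have fm: "?f \<in> borel_measurable (lborel \<Otimes>\<^sub>M lborel)" by measurable
  have sc: "(\<integral>\<^sup>+l. indicator M (l * r) \<partial>lborel) = 0" if r: "0 < r" for r
  proof -
    have "(\<integral>\<^sup>+l. indicator M l \<partial>lborel) = ennreal \<bar>r\<bar> * (\<integral>\<^sup>+l. indicator M (0 + r * l) \<partial>lborel)"
      by (rule nn_integral_real_affine) (use r in auto)
    then show ?thesis using M(3) r by (simp add: mult.commute)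
  qed
  have "(\<integral>\<^sup>+l. \<integral>\<^sup>+x. ?f (l, x) \<partial>lborel \<partial>lborel) = (\<integral>\<^sup>+x. \<integral>\<^sup>+l. ?f (l, x) \<partial>lborel \<partial>lborel)"
    by (rule lborel_pair.Fubini'[of "\<lambda>l x. ?f (l, x)", symmetric]) (use fm in simp)
  also have "\<dots> = (\<integral>\<^sup>+x. 0 \<partial>(lborel :: 'a measure))"
  proof (rule nn_integral_cong_AE)
    show "AE x in lborel. (\<integral>\<^sup>+l. ?f (l, x) \<partial>lborel) = 0"
      using AE_lborel_singleton[of 0]
    proof eventually_elim
      case (elim x)
      have "(\<integral>\<^sup>+l. ?f (l, x) \<partial>lborel) \<le> (\<integral>\<^sup>+l. indicator M (l * norm x) \<partial>lborel)"
        by (intro nn_integral_mono) (auto split: split_indicator)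
      then show ?case using sc[of "norm x"] elim by simp
    qed
  qed
  finally have z: "(\<integral>\<^sup>+l. \<integral>\<^sup>+x. ?f (l, x) \<partial>(lborel :: 'a measure) \<partial>lborel) = 0" by simp
  have "(\<lambda>l. \<integral>\<^sup>+x. ?f (l, x) \<partial>(lborel :: 'a measure)) \<in> borel_measurable lborel"
    by (rule lborel.borel_measurable_nn_integral) (use fm in simp)
  from nn_integral_0_iff_AE[OF this] z have "AE l in lborel. (\<integral>\<^sup>+x. ?f (l, x) \<partial>(lborel :: 'a measure)) = 0" by blast
  then have "AE l in lborel. l \<in> {1..2} \<longrightarrow> (\<integral>\<^sup>+x. indicator M (l * norm x) \<partial>(lborel :: 'a measure)) = 0"
    by eventually_elim auto
  then have "\<exists>l. l \<in> {1..2} \<and> (\<integral>\<^sup>+x. indicator M (l * norm x) \<partial>(lborel :: 'a measure)) = 0"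
  proof (rule contrapos_pp)
    assume no: "\<not> (\<exists>l. l \<in> {1..2} \<and> (\<integral>\<^sup>+x. indicator M (l * norm x) \<partial>(lborel :: 'a measure)) = 0)"
    show "\<not> (AE l in lborel. l \<in> {1..2} \<longrightarrow> (\<integral>\<^sup>+x. indicator M (l * norm x) \<partial>(lborel :: 'a measure)) = 0)"
    proof
      assume "AE l in lborel. l \<in> {1..2} \<longrightarrow> (\<integral>\<^sup>+x. indicator M (l * norm x) \<partial>(lborel :: 'a measure)) = 0"
      then have "AE l in lborel. l \<notin> {1..2::real}" by eventually_elim (use no in blast)
      then have "{1..2::real} \<in> null_sets lborel" by (subst AE_iff_null_sets) auto
      then show False by (simp add: null_sets_def)
    qed
  qed
  then obtain l where l: "l \<in> {1..2}" "(\<integral>\<^sup>+x. indicator M (l * norm x) \<partial>(lborel :: 'a measure)) = 0" by blast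
  have l0: "0 < l" using l(1) by simp
  have ae: "AE x in (lborel :: 'a measure). l * norm x \<notin> M"
    using l(2) by (subst (asm) nn_integral_0_iff_AE) (auto simp: indicator_eq_0_iff)
  have "AE x in (lborel :: 'a measure). norm x \<notin> M"
  proof (subst lborel_affine[of l 0])
    have "AE x in distr lborel borel (\<lambda>x::'a. 0 + l *\<^sub>R x). norm x \<notin> M"
      using ae l0 by (subst AE_distr_iff) auto
    then show "AE x in density (distr lborel borel (\<lambda>x::'a. 0 + l *\<^sub>R x)) (\<lambda>_. ennreal (\<bar>l\<bar> ^ DIM('a))). norm x \<notin> M"
      by (subst AE_density) auto
  qed (use l0 in simp)
  then show ?thesis using AE_lborel_singleton[of 0] 
  proof eventually_elim
    case (elim x)
    then show ?case using subsetD[OF M(1), of "norm x"] by auto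
  qed
qed

section \<open>Borel representatives and slices in time\<close>

lemma AE_lebesgue_on_iff:
  assumes "S \<in> sets borel"
  shows "(AE x in lebesgue_on S. P x) \<longleftrightarrow> (AE x in lborel. x \<in> S \<longrightarrow> P x)"
  using assms by (subst AE_restrict_space_iff) (auto simp: AE_completion_iff)

text \<open>
  Lebesgue measurable functions are replaced by Borel functions throughout, because the sections of a
  Lebesgue measurable function of space and time need not be measurable.
\<close>

lemma borel_representative:
  fixes u :: "'a::euclidean_space \<Rightarrow> 'b::euclidean_space"
  assumes u: "u \<in> borel_measurable (lebesgue_on S)" and S [measurable]: "S \<in> sets borel"
  obtains u' where "u' \<in> borel_measurable borel" "AE x in lborel. x \<in> S \<longrightarrow> u' x = u x" "\<And>x. x \<notin> S \<Longrightarrow> u' x = 0"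
proof -
  define g where "g x = indicator S x *\<^sub>R u x" for x
  have "g \<in> borel_measurable lebesgue"
    unfolding g_def using u by (subst (asm) borel_measurable_restrict_space_iff) auto
  then have "\<exists>g'\<in>borel_measurable lborel. AE x in lborel. g x \<bullet> b = g' x" for b
    by (intro completion_ex_borel_measurable_real borel_measurable_inner borel_measurable_const)
  then obtain G where G: "\<And>b. G b \<in> borel_measurable lborel" "\<And>b. AE x in lborel. g x \<bullet> b = G b x" by metis
  have [measurable]: "G b \<in> borel_measurable borel" for b using G(1) by simp
  define u' where "u' x = indicator S x *\<^sub>R (\<Sum>b\<in>Basis. G b x *\<^sub>R b)" for x
  show thesis
  proof (rule that[of u'])
    show "u' \<in> borel_measurable borel" unfolding u'_def by measurable
    have "AE x in lborel. \<forall>b\<in>Basis. g x \<bullet> b = G b x" by (rule AE_finite_allI) (auto intro: G(2))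
    then show "AE x in lborel. x \<in> S \<longrightarrow> u' x = u x"
    proof eventually_elim
      case (elim x)
      have "(\<Sum>b\<in>Basis. G b x *\<^sub>R b) = (\<Sum>b\<in>Basis. (g x \<bullet> b) *\<^sub>R b)" using elim by (intro sum.cong) auto
      also have "\<dots> = g x" by (rule euclidean_representation)
      finally show ?case by (simp add: u'_def g_def)
    qed
  qed (simp add: u'_def)
qed

lemma
  fixes f f' :: "'a::euclidean_space \<Rightarrow> 'b::euclidean_space"
  assumes f' [measurable]: "f' \<in> borel_measurable borel" and S [measurable]: "S \<in> sets borel"
    and eq: "AE x in lborel. x \<in> S \<longrightarrow> f x = f' x"
  shows lebesgue_on_integral_eq: "(LINT x|lebesgue_on S. f x) = (\<integral>x. indicator S x *\<^sub>R f' x \<partial>lborel)"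
    and lebesgue_on_integrable_eq: "integrable (lebesgue_on S) f \<longleftrightarrow> integrable lborel (\<lambda>x. indicator S x *\<^sub>R f' x)"
    and lebesgue_on_measurable: "f \<in> borel_measurable (lebesgue_on S)"
proof -
  have m': "(\<lambda>x. indicator S x *\<^sub>R f' x) \<in> borel_measurable lborel" by measurable
  then have m'': "(\<lambda>x. indicator S x *\<^sub>R f' x) \<in> borel_measurable lebesgue" by (rule measurable_completion)
  have ae: "AE x in lebesgue. indicator S x *\<^sub>R f' x = indicator S x *\<^sub>R f x"
    unfolding AE_completion_iff using eq by eventually_elim (auto split: split_indicator)
  have ae2: "AE x in lebesgue. indicator S x *\<^sub>R f x = indicator S x *\<^sub>R f' x"
    using ae by eventually_elim (rule sym)
  have m: "(\<lambda>x. indicator S x *\<^sub>R f x) \<in> borel_measurable lebesgue" by (rule borel_measurable_AE[OF m'' ae])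
  have "(LINT x|lebesgue_on S. f x) = (LINT x|lebesgue. indicator S x *\<^sub>R f x)"
    by (rule integral_restrict_space) simp
  also have "\<dots> = (LINT x|lebesgue. indicator S x *\<^sub>R f' x)"
    by (rule integral_cong_AE[OF m m'' ae2])
  also have "\<dots> = (\<integral>x. indicator S x *\<^sub>R f' x \<partial>lborel)" by (rule integral_completion[OF m'])
  finally show "(LINT x|lebesgue_on S. f x) = (\<integral>x. indicator S x *\<^sub>R f' x \<partial>lborel)" .
  have "integrable (lebesgue_on S) f \<longleftrightarrow> integrable lebesgue (\<lambda>x. indicator S x *\<^sub>R f x)"
    by (rule integrable_restrict_space) simp
  also have "\<dots> \<longleftrightarrow> integrable lebesgue (\<lambda>x. indicator S x *\<^sub>R f' x)"
    by (rule integrable_cong_AE[OF m m'' ae2])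
  also have "\<dots> \<longleftrightarrow> integrable lborel (\<lambda>x. indicator S x *\<^sub>R f' x)" by (rule integrable_completion[OF m'])
  finally show "integrable (lebesgue_on S) f \<longleftrightarrow> integrable lborel (\<lambda>x. indicator S x *\<^sub>R f' x)" .
  show "f \<in> borel_measurable (lebesgue_on S)"
    using m by (subst borel_measurable_restrict_space_iff) auto
qed

lemma lebesgue_integral_eq:
  fixes f f' :: "'a::euclidean_space \<Rightarrow> 'b::euclidean_space"
  assumes "f' \<in> borel_measurable borel" "AE x in lborel. f x = f' x"
  shows "(LINT x|lebesgue. f x) = (\<integral>x. f' x \<partial>lborel)"
  using lebesgue_on_integral_eq[OF assms(1), of UNIV f] assms(2) by (simp add: lebesgue_on_UNIV_eq)

lemma section_measurable [measurable]:
  fixes F :: "'a::euclidean_space \<times> real \<Rightarrow> 'b::euclidean_space"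
  assumes "F \<in> borel_measurable borel"
  shows "(\<lambda>x. F (x, t)) \<in> borel_measurable borel"
  by (rule measurable_compose[OF _ assms]) (simp add: borel_prod[symmetric])

lemma section_integral_measurable [measurable]:
  fixes F :: "'a::euclidean_space \<times> real \<Rightarrow> 'b::euclidean_space"
  assumes "F \<in> borel_measurable borel"
  shows "(\<lambda>t. \<integral>x. F (x, t) \<partial>lborel) \<in> borel_measurable borel"
proof -
  have "(\<lambda>z. F (snd z, fst z)) \<in> borel_measurable (borel \<Otimes>\<^sub>M lborel)"
    by (rule measurable_compose[OF _ assms]) (simp add: borel_prod[symmetric])
  then show ?thesis by (intro lborel.borel_measurable_lebesgue_integral) (simp add: case_prod_unfold)
qed

lemma space_time_integral_eq:
  fixes F :: "real ^ 'n \<Rightarrow> real \<Rightarrow> real"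
  assumes F' [measurable]: "F' \<in> borel_measurable borel"
    and eq: "AE t in lborel. t \<in> {0<..<T} \<longrightarrow> (AE x in lborel. F x t = F' (x, t))"
  shows "space_time_integral T F = (\<integral>t. indicator {0<..<T} t * (\<integral>x. F' (x, t) \<partial>lborel) \<partial>lborel)"
proof -
  have "AE t in lborel. t \<in> {0<..<T} \<longrightarrow> (LINT x|lebesgue. F x t) = (\<integral>x. F' (x, t) \<partial>lborel)"
    using eq by eventually_elim (auto intro: lebesgue_integral_eq)
  from lebesgue_on_integral_eq[OF section_integral_measurable[OF F'] _ this]
  show ?thesis by (simp add: space_time_integral_def)
qed

text \<open>
  The seminorms are integrated in time, so by Tonelli the Borel representative is jointly integrable
  over cylinders with a bounded spatial base.
\<close>

lemma time_Lr_representative: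
  fixes u :: "'a::euclidean_space \<Rightarrow> real \<Rightarrow> 'b::euclidean_space"
  assumes u: "u \<in> time_Lr r T X (Lq_loc_seminorms r)" and X: "X \<subseteq> Lq_loc r" and r: "0 < r"
  obtains u' where "u' \<in> borel_measurable borel"
    "AE t in lborel. t \<in> {0<..<T} \<longrightarrow> (AE x in lborel. u x t = u' (x, t))"
    "\<And>R. integrable lborel (\<lambda>z. indicator (cball 0 R) (fst z) * norm (u' z) powr r)"
    "\<And>x t. t \<notin> {0<..<T} \<Longrightarrow> u' (x, t) = 0"
    "AE z in lborel. z \<in> UNIV \<times> {0<..<T} \<longrightarrow> u' z = u (fst z) (snd z)"
proof -
  let ?S = "UNIV \<times> {0<..<T} :: ('a \<times> real) set"
  have S: "?S \<in> sets borel" by (intro borel_open open_Times) auto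
  obtain u' where u' [measurable]: "u' \<in> borel_measurable borel"
    and ae: "AE z in lborel. z \<in> ?S \<longrightarrow> u' z = (case z of (x, t) \<Rightarrow> u x t)" and z: "\<And>z. z \<notin> ?S \<Longrightarrow> u' z = 0"
    by (rule borel_representative[OF _ S]) (use u in \<open>auto simp: time_Lr_def\<close>)
  have X': "AE t in lborel. t \<in> {0<..<T} \<longrightarrow> (\<lambda>x. u x t) \<in> X"
    using u by (simp add: time_Lr_def AE_lebesgue_on_iff)
  have ae': "AE t in lborel. t \<in> {0<..<T} \<longrightarrow> (AE x in lborel. u x t = u' (x, t))"
  proof -
    obtain N where N: "{z. \<not> (z \<in> ?S \<longrightarrow> u' z = (case z of (x, t) \<Rightarrow> u x t))} \<subseteq> N" "N \<in> sets borel" "emeasure lborel N = 0"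
      using ae by (auto elim!: AE_E)
    have "AE z in (lborel :: ('a \<times> real) measure). z \<notin> N" using N(2,3) by (intro AE_not_in) (auto simp: null_sets_def)
    then have "AE x in (lborel :: 'a measure). AE t in lborel. (x, t) \<notin> N"
      by (rule lborel_pair.AE_pair[of "\<lambda>z. z \<notin> N", unfolded lborel_prod])
    then have "AE t in lborel. AE x in (lborel :: 'a measure). (x, t) \<notin> N"
    proof (subst (asm) lborel_pair.AE_commute)
      have "{z \<in> space ((lborel :: 'a measure) \<Otimes>\<^sub>M (lborel :: real measure)). (fst z, snd z) \<notin> N} = - N"
        by (auto simp: space_pair_measure)
      then show "{z \<in> space ((lborel :: 'a measure) \<Otimes>\<^sub>M (lborel :: real measure)). (fst z, snd z) \<notin> N} \<in> sets (lborel \<Otimes>\<^sub>M lborel)"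
        unfolding lborel_prod using N(2) by simp
    qed
    then show ?thesis
    proof eventually_elim
      case (elim t)
      show ?case
      proof
        assume t: "t \<in> {0<..<T}"
        show "AE x in lborel. u x t = u' (x, t)" using elim
        proof eventually_elim
          case (elim x)
          then have "u' (x, t) = u x t" using subsetD[OF N(1), of "(x, t)"] t by auto
          then show ?case by (rule sym)
        qed
      qed
    qed
  qed
  show thesis
  proof (rule that[OF u' ae'])
    show "u' (x, t) = 0" if "t \<notin> {0<..<T}" for x t using that by (intro z) auto
    show "AE z in lborel. z \<in> ?S \<longrightarrow> u' z = u (fst z) (snd z)" using ae by (simp add: case_prod_unfold)
    fix R
    define N where "N t = Lq_norm r (cball 0 R) (\<lambda>x. u x t) powr r" for t
    define g where "g z = indicator (cball 0 R) (fst z) * norm (u' z) powr r" for z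
    have [measurable]: "cball (0::'a) R \<in> sets borel" by simp
    have [measurable]: "fst \<in> borel_measurable (borel :: ('a \<times> real) measure)" by (intro borel_measurable_continuous_onI continuous_intros)
    have gm [measurable]: "g \<in> borel_measurable borel" unfolding g_def by measurable
    have "Lq_norm r (cball (0::'a) R) \<in> (Lq_loc_seminorms r :: (('a \<Rightarrow> 'b) \<Rightarrow> real) set)" unfolding Lq_loc_seminorms_def by auto
    then have N: "integrable (lebesgue_on {0<..<T}) N"
      using u unfolding time_Lr_def N_def by blast
    have inner: "AE t in lborel. (\<integral>\<^sup>+x. ennreal (g (x, t)) \<partial>lborel) = ennreal (N t) * indicator {0<..<T} t"
      using X' ae'
    proof eventually_elim
      case (elim t)
      show ?case
      proof (cases "t \<in> {0<..<T}")
        case True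
        have ae2: "AE x in lborel. x \<in> cball 0 R \<longrightarrow> norm (u x t) powr r = norm (u' (x, t)) powr r"
          using elim(2) True by (auto elim!: eventually_mono)
        have "(\<lambda>x. u x t) \<in> Lq_space r (cball 0 R)" using elim(1) True X by (auto simp: Lq_loc_def)
        then have "integrable (lebesgue_on (cball 0 R)) (\<lambda>x. norm (u x t) powr r)" by (simp add: Lq_space_def)
        then have ig: "integrable lborel (\<lambda>x. g (x, t))"
          using lebesgue_on_integrable_eq[OF _ _ ae2] by (simp add: g_def)
        have "(LINT x|lebesgue_on (cball 0 R). norm (u x t) powr r) = (\<integral>x. g (x, t) \<partial>lborel)"
          using lebesgue_on_integral_eq[OF _ _ ae2] by (simp add: g_def)
        then have "N t = (\<integral>x. g (x, t) \<partial>lborel)"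
          using r by (simp add: N_def Lq_norm_def powr_powr g_def)
        then show ?thesis using True ig by (subst nn_integral_eq_integral) (auto simp: g_def)
      next
        case False
        then have "g (x, t) = 0" for x using z[of "(x, t)"] by (auto simp: g_def)
        then show ?thesis using False by simp
      qed
    qed
    have "(\<integral>\<^sup>+z. ennreal (g z) \<partial>lborel) = (\<integral>\<^sup>+t. \<integral>\<^sup>+x. ennreal (g (x, t)) \<partial>lborel \<partial>lborel)"
      using lborel_pair.nn_integral_snd[of "\<lambda>z. ennreal (g z)"] by (simp add: lborel_prod)
    also have "\<dots> = (\<integral>\<^sup>+t. ennreal (N t) * indicator {0<..<T} t \<partial>lborel)" by (rule nn_integral_cong_AE[OF inner])
    also have "\<dots> = (\<integral>\<^sup>+t. ennreal (N t) \<partial>lebesgue_on {0<..<T})"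
      by (simp add: nn_integral_restrict_space nn_integral_completion)
    also have "\<dots> < \<infinity>" using N by (auto simp: integrable_iff_bounded N_def)
    finally have "(\<integral>\<^sup>+z. ennreal (g z) \<partial>lborel) < \<infinity>" .
    then show "integrable lborel (\<lambda>z. indicator (cball 0 R) (fst z) * norm (u' z) powr r)"
      unfolding g_def[symmetric] by (intro integrableI_bounded) (auto simp: g_def)
  qed
qed

text \<open>
  The smooth step functions \<open>expinv 0\<close>, rescaled by \<open>n\<close> and moved inwards by \<open>1 / n\<close> at both ends, have
  support in \<open>[1 / n, m - 1 / n]\<close>, where \<open>n\<close> stands for \<open>Suc n\<close>. For the open interval \<open>(0, T)\<close> this shift is needed: the support must
  be a compact subset of it.
\<close>

lemma time_bump:
  assumes m: "m \<le> T"
  defines "\<xi> \<equiv> \<lambda>n t. expinv 0 (real (Suc n) * t - 1) * expinv 0 (real (Suc n) * (m - t) - 1)"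
  shows "\<xi> n \<in> time_test_functions T" and "continuous_on UNIV (\<xi> n)" and "0 \<le> \<xi> n t" and "\<xi> n t \<le> 1"
    and "(\<lambda>n. \<xi> n t) \<longlonglongrightarrow> indicator {0<..<m} t"
proof -
  define N where "N = real (Suc n)"
  have N: "0 < N" by (simp add: N_def)
  have ch: "((\<lambda>t. expinv k (c * t + d)) has_real_derivative expinv (Suc k) (c * t + d) * c) (at t)" for k c d t
    by (rule DERIV_chain2[OF expinv_has_derivative]) (auto intro!: derivative_eq_intros)
  have ct: "continuous_on UNIV (\<lambda>t. expinv k (c * t + d))" for k c d
    by (intro continuous_at_imp_continuous_on ballI DERIV_isCont[OF ch])
  have form: "\<xi> n = (\<lambda>t. expinv 0 (N * t + - 1) * expinv 0 (- N * t + (N * m - 1)))"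
    by (simp add: \<xi>_def N_def fun_eq_iff algebra_simps)
  show "continuous_on UNIV (\<xi> n)" unfolding form by (intro continuous_on_mult ct)
  show "0 \<le> \<xi> n t" "\<xi> n t \<le> 1" unfolding \<xi>_def by (auto intro!: mult_nonneg_nonneg mult_le_one expinv_0_bounds)
  define D where "D t = (expinv 1 (N * t + - 1) * N) * expinv 0 (- N * t + (N * m - 1))
    + (expinv 1 (- N * t + (N * m - 1)) * - N) * expinv 0 (N * t + - 1)" for t
  have der: "(\<xi> n has_real_derivative D t) (at t)" for t
    unfolding form D_def using DERIV_mult[OF ch[of 0 N "- 1" t] ch[of 0 "- N" "N * m - 1" t]] by simp
  have "continuous_on {0<..<T} D" unfolding D_def
    by (intro continuous_on_add continuous_on_mult continuous_on_const continuous_on_subset[OF ct] subset_UNIV)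
  then have C1: "\<xi> n C1_differentiable_on {0<..<T}"
    unfolding C1_differentiable_on_def using der by (auto simp: has_real_derivative_iff_has_vector_derivative)
  have sub: "{x \<in> {0<..<T}. \<xi> n x \<noteq> 0} \<subseteq> {1 / N..m - 1 / N}"
  proof
    fix x assume "x \<in> {x \<in> {0<..<T}. \<xi> n x \<noteq> 0}"
    then have "expinv 0 (N * x - 1) \<noteq> 0" "expinv 0 (N * (m - x) - 1) \<noteq> 0" by (auto simp: \<xi>_def N_def)
    then have "0 < N * x - 1" "0 < N * (m - x) - 1" by (auto simp: expinv_def split: if_splits)
    then show "x \<in> {1 / N..m - 1 / N}" using N by (auto simp: field_simps)
  qed
  then have cl: "closure {x \<in> {0<..<T}. \<xi> n x \<noteq> 0} \<subseteq> {1 / N..m - 1 / N}" by (rule closure_minimal) simp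
  have "compact (closure {x \<in> {0<..<T}. \<xi> n x \<noteq> 0})"
    unfolding compact_closure by (rule bounded_subset[OF bounded_closed_interval sub])
  moreover have "{1 / N..m - 1 / N} \<subseteq> {0<..<T}"
  proof
    fix x assume "x \<in> {1 / N..m - 1 / N}"
    moreover have "0 < 1 / N" using N by simp
    ultimately show "x \<in> {0<..<T}" using m by (auto simp del: zero_less_divide_1_iff)
  qed
  ultimately show "\<xi> n \<in> time_test_functions T"
    unfolding time_test_functions_def compact_support_in_def using C1 cl by blast
  show "(\<lambda>n. \<xi> n t) \<longlonglongrightarrow> indicator {0<..<m} t"
  proof (cases "t \<in> {0<..<m}")
    case True
    have lim: "(\<lambda>n. expinv 0 (real (Suc n) * c - 1)) \<longlonglongrightarrow> 1" if c: "0 < c" for c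
    proof (rule tendsto_sandwich)
      have top: "filterlim (\<lambda>n. real (Suc n) * c - 1) at_top sequentially" using c by real_asymp
      show "\<forall>\<^sub>F n in sequentially. 1 - 1 / (real (Suc n) * c - 1) \<le> expinv 0 (real (Suc n) * c - 1)"
        using top[unfolded filterlim_at_top_dense, rule_format, of 0] by eventually_elim (rule expinv_0_bounds(3))
      show "\<forall>\<^sub>F n in sequentially. expinv 0 (real (Suc n) * c - 1) \<le> 1" by (simp add: expinv_0_bounds)
      show "(\<lambda>n. 1 - 1 / (real (Suc n) * c - 1)) \<longlonglongrightarrow> 1" using c by real_asymp
    qed simp
    have "(\<lambda>n. \<xi> n t) \<longlonglongrightarrow> 1 * 1" unfolding \<xi>_def using True by (intro tendsto_mult lim) auto
    then show ?thesis using True by simp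
  next
    case False
    then have "\<xi> n t = 0" for n
    proof (cases "t \<le> 0")
      case True
      then have "real (Suc n) * t \<le> 0" by (intro mult_nonneg_nonpos) auto
      then have "real (Suc n) * t - 1 \<le> 0" by linarith
      then show ?thesis by (simp add: \<xi>_def expinv_def)
    next
      case False': False
      have "real (Suc n) * (m - t) \<le> 0" using False False' by (intro mult_nonneg_nonpos) auto
      then have "real (Suc n) * (m - t) - 1 \<le> 0" by linarith
      then show ?thesis by (simp add: \<xi>_def expinv_def)
    qed
    then show ?thesis using False by simp
  qed
qed

text \<open>
  The test functions approximate the indicators of \<open>(0, min a T)\<close>, and half-lines determine the integral
  against \<open>sgn g\<close>, which is that of \<open>\<bar>g\<bar>\<close>.
\<close>

lemma AE_zero_of_time_test_functions:
  fixes g :: "real \<Rightarrow> real"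
  assumes g: "integrable lborel g"
    and test: "\<And>\<xi>. \<xi> \<in> time_test_functions T \<Longrightarrow> continuous_on UNIV \<xi> \<Longrightarrow> (\<And>t. 0 \<le> \<xi> t) \<Longrightarrow> (\<And>t. \<xi> t \<le> 1)
      \<Longrightarrow> (\<integral>t. indicator {0<..<T} t * (\<xi> t * g t) \<partial>lborel) = 0"
  shows "AE t in lborel. t \<in> {0<..<T} \<longrightarrow> g t = 0"
proof -
  have [measurable]: "g \<in> borel_measurable borel" using g by auto
  define c where "c t = indicator {0<..<T} t * g t" for t
  have c: "integrable lborel c" unfolding c_def by (rule Bochner_Integration.integrable_bound[OF g]) (auto split: split_indicator)
  have half: "(\<integral>t. indicator {..<a} t * c t \<partial>lborel) = 0" for a
  proof -
    define \<xi> where "\<xi> n t = expinv 0 (real (Suc n) * t - 1) * expinv 0 (real (Suc n) * (min a T - t) - 1)" for n t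
    note b' = time_bump[of "min a T" T, folded \<xi>_def, OF min.cobounded2]
    have [measurable]: "\<xi> n \<in> borel_measurable borel" for n by (rule borel_measurable_continuous_onI[OF b'(2)])
    have "(\<lambda>n. \<integral>t. indicator {0<..<T} t * (\<xi> n t * g t) \<partial>lborel) \<longlonglongrightarrow> (\<integral>t. indicator {..<a} t * c t \<partial>lborel)"
    proof (rule integral_dominated_convergence[where w="\<lambda>t. \<bar>g t\<bar>"])
      show "AE t in lborel. norm (indicator {0<..<T} t * (\<xi> n t * g t)) \<le> \<bar>g t\<bar>" for n
        using b'(3,4)[of n] by (intro AE_I2) (auto simp: abs_mult mult_left_le_one_le split: split_indicator)
      show "AE t in lborel. (\<lambda>n. indicator {0<..<T} t * (\<xi> n t * g t)) \<longlonglongrightarrow> indicator {..<a} t * c t"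
      proof (rule AE_I2)
        fix t
        have "(\<lambda>n. indicator {0<..<T} t * (\<xi> n t * g t)) \<longlonglongrightarrow> indicator {0<..<T} t * (indicator {0<..<min a T} t * g t)"
          by (intro tendsto_intros b')
        moreover have "indicator {0<..<T} t * (indicator {0<..<min a T} t * g t) = indicator {..<a} t * c t"
          by (auto simp: c_def split: split_indicator)
        ultimately show "(\<lambda>n. indicator {0<..<T} t * (\<xi> n t * g t)) \<longlonglongrightarrow> indicator {..<a} t * c t" by simp
      qed
    qed (use g c in \<open>auto simp: c_def\<close>)
    moreover have "(\<integral>t. indicator {0<..<T} t * (\<xi> n t * g t) \<partial>lborel) = 0" for n by (rule test) (rule b')+
    ultimately show ?thesis by (simp add: LIMSEQ_const_iff)
  qed
  have "(\<integral>t. sgn (g t) * c t \<partial>lborel) = (\<integral>t. sgn (g t) * 0 \<partial>(lborel :: real measure))"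
    by (rule integral_eq_of_half_lines[where ?r1.0 = "\<lambda>t. t" and ?r2.0 = "\<lambda>t. t" and B = 1, OF c]) (auto simp: half sgn_if)
  moreover have "sgn (g t) * c t = \<bar>c t\<bar>" for t by (auto simp: c_def sgn_if split: split_indicator)
  ultimately have "(\<integral>t. \<bar>c t\<bar> \<partial>lborel) = 0" by simp
  then have "AE t in lborel. \<bar>c t\<bar> = 0" by (subst (asm) integral_nonneg_eq_0_iff_AE) (use c in auto)
  then show ?thesis by eventually_elim (auto simp: c_def)
qed

section \<open>The equation tested with radial gradient fields\<close>

lemma space_time_integral_zero:
  fixes F :: "real ^ 'n \<Rightarrow> real \<Rightarrow> real"
  assumes "AE t in lborel. t \<in> {0<..<T} \<longrightarrow> (LINT x|lebesgue. F x t) = 0"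
  shows "space_time_integral T F = 0"
  unfolding space_time_integral_def
  by (rule integral_eq_zero_AE) (use assms in \<open>simp add: AE_lebesgue_on_iff\<close>)

lemma space_time_integral_gradient:
  fixes u :: "real ^ 'n \<Rightarrow> real \<Rightarrow> real ^ 'n"
  assumes u: "u \<in> time_Lr r T (Lq_loc_sigma q) P" and \<psi>: "\<psi> \<in> space_test_functions"
  shows "space_time_integral T (\<lambda>x t. (u x t \<bullet> gradient \<psi> x) * \<eta> t) = 0"
proof (rule space_time_integral_zero)
  have "AE t in lborel. t \<in> {0<..<T} \<longrightarrow> (\<lambda>x. u x t) \<in> Lq_loc_sigma q"
    using u by (simp add: time_Lr_def AE_lebesgue_on_iff)
  then show "AE t in lborel. t \<in> {0<..<T} \<longrightarrow> (LINT x|lebesgue. (u x t \<bullet> gradient \<psi> x) * \<eta> t) = 0"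
    by eventually_elim (use \<psi> in \<open>auto simp: Lq_loc_sigma_def weakly_divergence_free_def\<close>)
qed

text \<open>
  The field \<open>radial_grad h y\<close> and its Laplacian are gradients, so the terms with the time derivative, the
  viscosity and the force vanish for each test function in time. The two remaining ones combine to the
  function of time in the conclusion.
\<close>

lemma weak_form_radial:
  fixes v :: "real ^ 'n \<Rightarrow> real \<Rightarrow> real ^ 'n" and v' :: "(real ^ 'n) \<times> real \<Rightarrow> real ^ 'n"
    and p :: "real ^ 'n \<Rightarrow> real \<Rightarrow> real" and p' :: "(real ^ 'n) \<times> real \<Rightarrow> real" and y :: "real ^ 'n"
  assumes weak: "weak_solution_NS \<nu> T f v p"
    and v' [measurable]: "v' \<in> borel_measurable borel" and p' [measurable]: "p' \<in> borel_measurable borel"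
    and v_eq: "AE t in lborel. t \<in> {0<..<T} \<longrightarrow> (AE x in lborel. v x t = v' (x, t))"
    and p_eq: "AE t in lborel. t \<in> {0<..<T} \<longrightarrow> (AE x in lborel. p x t = p' (x, t))"
    and loc: "\<And>R. integrable lborel (\<lambda>z. indicator (cball 0 R) (fst z) * ((norm (v' z))\<^sup>2 + \<bar>p' z\<bar>))"
    and h: "profile h a" and B: "\<And>s. 0 \<le> s \<Longrightarrow> \<bar>h 1 s\<bar> \<le> B" "\<And>s. 0 \<le> s \<Longrightarrow> \<bar>h 2 s\<bar> \<le> B"
  defines "S \<equiv> \<lambda>z. (norm (v' z))\<^sup>2 + real CARD('n) * p' z"
    and "Q \<equiv> \<lambda>z. (v' z \<bullet> (fst z - y))\<^sup>2 + p' z * (norm (fst z - y))\<^sup>2"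
  shows "AE t in lborel. t \<in> {0<..<T} \<longrightarrow>
    (\<integral>x. 2 * h 1 ((norm (x - y))\<^sup>2) * S (x, t) + 4 * h 2 ((norm (x - y))\<^sup>2) * Q (x, t) \<partial>lborel) = 0"
proof -
  let ?\<phi> = "radial_grad h y"
  define q where "q x = (norm (x - y))\<^sup>2" for x :: "real ^ 'n"
  have q0: "0 \<le> q x" for x by (simp add: q_def)
  have qd: "(x - y) \<bullet> (x - y) = q x" for x by (simp add: q_def power2_norm_eq_inner)
  have [measurable]: "h m \<in> borel_measurable borel" for m by (rule borel_measurable_continuous_onI[OF profile_continuous[OF h]])
  have [measurable]: "fst \<in> borel_measurable (borel :: ((real ^ 'n) \<times> real) measure)"
    by (intro borel_measurable_continuous_onI continuous_intros)
  have [measurable]: "q \<in> borel_measurable borel" unfolding q_def by measurable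
  define con where "con z = 2 * h 1 (q (fst z)) * (norm (v' z))\<^sup>2 + 4 * h 2 (q (fst z)) * (v' z \<bullet> (fst z - y))\<^sup>2" for z
  define dv where "dv z = p' z * (2 * real CARD('n) * h 1 (q (fst z)) + 4 * h 2 (q (fst z)) * q (fst z))" for z
  have con_eq: "contraction (outer_product (v' (x, t)) (v' (x, t))) (vector_gradient ?\<phi> x) = con (x, t)" for x t
    by (simp add: contraction_radial[OF h] qd con_def power2_norm_eq_inner)
  have dv_eq: "p' (x, t) * divergence ?\<phi> x = dv (x, t)" for x t
    by (simp add: divergence_radial[OF h] qd dv_def)
  have sum: "con (x, t) + dv (x, t) = 2 * h 1 ((norm (x - y))\<^sup>2) * S (x, t) + 4 * h 2 ((norm (x - y))\<^sup>2) * Q (x, t)" for x t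
    by (simp add: con_def dv_def S_def Q_def q_def algebra_simps)
  have [measurable]: "con \<in> borel_measurable borel" "dv \<in> borel_measurable borel" unfolding con_def dv_def by measurable
  define R where "R = norm y + (\<bar>a\<bar> + 1)"
  have out: "q x < a \<Longrightarrow> x \<in> cball 0 R" for x
  proof -
    assume "q x < a"
    moreover have "(\<bar>a\<bar> + 1)\<^sup>2 = \<bar>a\<bar>\<^sup>2 + 2 * \<bar>a\<bar> + 1" by (simp only: power2_sum) simp
    ultimately have "(norm (x - y))\<^sup>2 \<le> (\<bar>a\<bar> + 1)\<^sup>2"
      using zero_le_power2[of "\<bar>a\<bar>"] abs_ge_self[of a] unfolding q_def by linarith
    then have "norm (x - y) \<le> \<bar>a\<bar> + 1" by (rule power2_le_imp_le) simp
    then show "x \<in> cball 0 R" using norm_triangle_sub[of x y] by (simp add: R_def)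
  qed
  have B0: "0 \<le> B" using B(1)[of 0] by simp
  define c where "c = 2 * B * (1 + real CARD('n)) + 4 * B * \<bar>a\<bar>"
  define U where "U z = indicator (cball 0 R) (fst z) * ((norm (v' z))\<^sup>2 + \<bar>p' z\<bar>)" for z
  have U: "integrable lborel (\<lambda>z. c * U z)" unfolding U_def by (intro integrable_mult_right loc)
  have bounds: "\<bar>con z\<bar> \<le> c * U z \<and> \<bar>dv z\<bar> \<le> c * U z" for z
  proof (cases "q (fst z) < a")
    case True
    let ?s = "q (fst z)"
    have a: "?s \<le> \<bar>a\<bar>" using True by simp
    have ind: "indicator (cball 0 R) (fst z) = (1::real)" using out[OF True] by simp
    have "(v' z \<bullet> (fst z - y))\<^sup>2 \<le> (norm (v' z) * norm (fst z - y))\<^sup>2"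
      using Cauchy_Schwarz_ineq2[of "v' z" "fst z - y"] by (metis abs_ge_zero power2_abs power_mono)
    also have "\<dots> = (norm (v' z))\<^sup>2 * ?s" by (simp add: q_def power_mult_distrib)
    also have "\<dots> \<le> (norm (v' z))\<^sup>2 * \<bar>a\<bar>" by (intro mult_left_mono a) simp
    finally have cs: "(v' z \<bullet> (fst z - y))\<^sup>2 \<le> (norm (v' z))\<^sup>2 * \<bar>a\<bar>" .
    have "\<bar>con z\<bar> \<le> \<bar>h 1 ?s\<bar> * (2 * (norm (v' z))\<^sup>2) + \<bar>h 2 ?s\<bar> * (4 * (v' z \<bullet> (fst z - y))\<^sup>2)"
      unfolding con_def by (rule order_trans[OF abs_triangle_ineq]) (simp add: abs_mult)
    also have "\<dots> \<le> B * (2 * (norm (v' z))\<^sup>2) + B * (4 * ((norm (v' z))\<^sup>2 * \<bar>a\<bar>))"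
      using B[OF q0] cs B0 by (intro add_mono mult_mono) auto
    also have "\<dots> = (2 * B + 4 * B * \<bar>a\<bar>) * (norm (v' z))\<^sup>2" by (simp add: algebra_simps)
    also have "\<dots> \<le> c * (norm (v' z))\<^sup>2"
      using B0 by (intro mult_right_mono) (simp_all add: c_def algebra_simps)
    also have "\<dots> \<le> c * U z" using B0 by (intro mult_left_mono) (simp_all add: c_def U_def ind)
    finally have 1: "\<bar>con z\<bar> \<le> c * U z" .
    have "\<bar>2 * real CARD('n) * h 1 ?s + 4 * h 2 ?s * ?s\<bar> \<le> \<bar>h 1 ?s\<bar> * (2 * real CARD('n)) + \<bar>h 2 ?s\<bar> * (4 * ?s)"
      using q0[of "fst z"] by (intro order_trans[OF abs_triangle_ineq]) (simp add: abs_mult)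
    also have "\<dots> \<le> B * (2 * real CARD('n)) + B * (4 * \<bar>a\<bar>)"
      using B[OF q0] a B0 q0[of "fst z"] by (intro add_mono mult_mono) auto
    also have "\<dots> \<le> c" using B0 by (simp add: c_def algebra_simps)
    finally have "\<bar>dv z\<bar> \<le> \<bar>p' z\<bar> * c" unfolding dv_def abs_mult by (intro mult_left_mono) auto
    also have "\<dots> \<le> ((norm (v' z))\<^sup>2 + \<bar>p' z\<bar>) * c" using B0 by (intro mult_right_mono) (auto simp: c_def)
    also have "\<dots> = c * U z" by (simp add: U_def ind mult.commute)
    finally show ?thesis using 1 by simp
  next
    case False
    then have "con z = 0" "dv z = 0" using profile_zero[OF h] by (auto simp: con_def dv_def)
    moreover have "0 \<le> c * U z" using B0 by (auto simp: c_def U_def)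
    ultimately show ?thesis by simp
  qed
  have ic: "integrable (lborel \<Otimes>\<^sub>M lborel) con" and id: "integrable (lborel \<Otimes>\<^sub>M lborel) dv"
    unfolding lborel_prod
  proof -
    have "norm (con z) \<le> norm (c * U z)" "norm (dv z) \<le> norm (c * U z)" for z
      unfolding real_norm_def using bounds[of z] abs_ge_self[of "c * U z"] by linarith+
    then show "integrable lborel con" "integrable lborel dv"
      by (auto intro!: Bochner_Integration.integrable_bound[OF U] AE_I2 simp del: split_paired_All)
  qed
  define ac where "ac t = (\<integral>x. con (x, t) \<partial>lborel)" for t
  define ad where "ad t = (\<integral>x. dv (x, t) \<partial>lborel)" for t
  have iac: "integrable lborel ac" and iad: "integrable lborel ad"
    unfolding ac_def ad_def
    using lborel_pair.integrable_snd[of "\<lambda>x t. con (x, t)"] lborel_pair.integrable_snd[of "\<lambda>x t. dv (x, t)"] ic id by simp_all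
  have ae_c: "AE t in lborel. integrable lborel (\<lambda>x. con (x, t))"
    using lborel_pair.AE_integrable_snd[of "\<lambda>x t. con (x, t)"] ic by simp
  have ae_d: "AE t in lborel. integrable lborel (\<lambda>x. dv (x, t))"
    using lborel_pair.AE_integrable_snd[of "\<lambda>x t. dv (x, t)"] id by simp
  have "AE t in lborel. t \<in> {0<..<T} \<longrightarrow> ac t + ad t = 0"
  proof (rule AE_zero_of_time_test_functions)
    show "integrable lborel (\<lambda>t. ac t + ad t)" using iac iad by simp
    fix \<xi> assume \<xi>: "\<xi> \<in> time_test_functions T" "continuous_on UNIV \<xi>" "\<And>t. 0 \<le> \<xi> t" "\<And>t. \<xi> t \<le> 1"
    have [measurable]: "\<xi> \<in> borel_measurable borel" by (rule borel_measurable_continuous_onI[OF \<xi>(2)])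
    have "snd \<in> borel_measurable (borel :: ((real ^ 'n) \<times> real) measure)"
      by (intro borel_measurable_continuous_onI continuous_intros)
    then have [measurable]: "(\<lambda>z. \<xi> (snd z)) \<in> borel_measurable (borel :: ((real ^ 'n) \<times> real) measure)" by measurable
    have C: "space_time_integral T (\<lambda>x t. contraction (outer_product (v x t) (v x t)) (vector_gradient ?\<phi> x) * \<xi> t)
      = (\<integral>t. indicator {0<..<T} t * (ac t * \<xi> t) \<partial>lborel)"
    proof -
      have "AE t in lborel. t \<in> {0<..<T} \<longrightarrow>
          (AE x in lborel. contraction (outer_product (v x t) (v x t)) (vector_gradient ?\<phi> x) * \<xi> t = con (x, t) * \<xi> (snd (x, t)))"
        using v_eq
      proof eventually_elim
        case (elim t)
        show ?case
        proof
          assume "t \<in> {0<..<T}"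
          with elim have "AE x in lborel. v x t = v' (x, t)" by simp
          then show "AE x in lborel. contraction (outer_product (v x t) (v x t)) (vector_gradient ?\<phi> x) * \<xi> t = con (x, t) * \<xi> (snd (x, t))"
            by eventually_elim (simp add: con_eq[symmetric])
        qed
      qed
      from space_time_integral_eq[where F' = "\<lambda>z. con z * \<xi> (snd z)", OF _ this] show ?thesis by (simp add: ac_def)
    qed
    have D: "space_time_integral T (\<lambda>x t. p x t * divergence ?\<phi> x * \<xi> t)
      = (\<integral>t. indicator {0<..<T} t * (ad t * \<xi> t) \<partial>lborel)"
    proof -
      have "AE t in lborel. t \<in> {0<..<T} \<longrightarrow>
          (AE x in lborel. p x t * divergence ?\<phi> x * \<xi> t = dv (x, t) * \<xi> (snd (x, t)))"
        using p_eq
      proof eventually_elim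
        case (elim t)
        show ?case
        proof
          assume "t \<in> {0<..<T}"
          with elim have "AE x in lborel. p x t = p' (x, t)" by simp
          then show "AE x in lborel. p x t * divergence ?\<phi> x * \<xi> t = dv (x, t) * \<xi> (snd (x, t))"
            by eventually_elim (simp add: dv_eq[symmetric])
        qed
      qed
      from space_time_integral_eq[where F' = "\<lambda>z. dv z * \<xi> (snd z)", OF _ this] show ?thesis by (simp add: ad_def)
    qed
    have grad: "?\<phi> = gradient (radial h y)" by (rule gradient_radial[OF h, symmetric])
    have lap: "laplacian ?\<phi> = gradient (radial (lap_profile (real CARD('n)) h) y)" by (rule laplacian_radial[OF h])
    have f: "f \<in> time_Lr 1 T (Lq_loc_sigma 1) (Lq_loc_seminorms 1)"
      and v: "v \<in> time_Lr 2 T (Lq_loc_sigma 2) (Lq_loc_seminorms 2)"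
      using weak by (auto simp: weak_solution_NS_def)
    have rt: "radial h y \<in> space_test_functions" "radial (lap_profile (real CARD('n)) h) y \<in> space_test_functions"
      using radial_test[OF h] radial_test[OF profile_lap_profile[OF h]] by auto
    have "- space_time_integral T (\<lambda>x t. (v x t \<bullet> ?\<phi> x) * deriv \<xi> t)
        - space_time_integral T
            (\<lambda>x t. contraction (outer_product (v x t) (v x t)) (vector_gradient ?\<phi> x) * \<xi> t)
        = space_time_integral T (\<lambda>x t. p x t * divergence ?\<phi> x * \<xi> t)
          + \<nu> * space_time_integral T (\<lambda>x t. (v x t \<bullet> laplacian ?\<phi> x) * \<xi> t)
          + space_time_integral T (\<lambda>x t. (f x t \<bullet> ?\<phi> x) * \<xi> t)"
      using weak \<xi>(1) radial_grad_test[OF h, of y] unfolding weak_solution_NS_def by blast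
    then have eq: "(\<integral>t. indicator {0<..<T} t * (ac t * \<xi> t) \<partial>lborel) + (\<integral>t. indicator {0<..<T} t * (ad t * \<xi> t) \<partial>lborel) = 0"
      unfolding C D lap unfolding grad
      using space_time_integral_gradient[OF v rt(1)] space_time_integral_gradient[OF v rt(2)] space_time_integral_gradient[OF f rt(1)]
      by simp
    have int: "integrable lborel (\<lambda>t. indicator {0<..<T} t * (k t * \<xi> t))" if k: "integrable lborel k" for k
    proof (rule Bochner_Integration.integrable_bound[OF k])
      show "AE t in lborel. norm (indicator {0<..<T} t * (k t * \<xi> t)) \<le> norm (k t)"
        using \<xi>(3,4) by (intro AE_I2) (auto simp: abs_mult mult_right_le_one_le split: split_indicator)
    qed (use k in measurable)
    have "(\<integral>t. indicator {0<..<T} t * (\<xi> t * (ac t + ad t)) \<partial>lborel)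
      = (\<integral>t. indicator {0<..<T} t * (ac t * \<xi> t) + indicator {0<..<T} t * (ad t * \<xi> t) \<partial>lborel)"
      by (intro Bochner_Integration.integral_cong) (auto simp: algebra_simps)
    also have "\<dots> = 0" using eq by (subst Bochner_Integration.integral_add[OF int[OF iac] int[OF iad]])
    finally show "(\<integral>t. indicator {0<..<T} t * (\<xi> t * (ac t + ad t)) \<partial>lborel) = 0" .
  qed
  with ae_c ae_d show ?thesis
  proof eventually_elim
    case (elim t)
    then show ?case unfolding sum[symmetric] by (simp add: ac_def ad_def)
  qed
qed

section \<open>Vanishing of the velocity\<close>

lemma pressure_identity_cong_AE:
  assumes "pressure_identity u p" and p' [measurable]: "p' \<in> borel_measurable borel" and eq: "AE x in lborel. p x = p' x"
  shows "pressure_identity u p'"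
proof -
  interpret I: pressure_identity u p by fact
  interpret J: radial_identity u p' by unfold_locales (auto intro: I.u_meas)
  have Q: "AE x in lborel. I.Q y x = J.Q y x" for y using eq by eventually_elim (simp add: I.Q_def J.Q_def)
  have S: "AE x in lborel. I.S x = J.S x" using eq by eventually_elim (simp add: I.S_def J.S_def)
  show ?thesis
  proof
    fix y and a :: real
    have "(\<integral>x. indicator {..<a} ((norm (x - y))\<^sup>2) * (2 * J.Q y x) \<partial>lborel) = (\<integral>x. indicator {..<a} ((norm (x - y))\<^sup>2) * (2 * I.Q y x) \<partial>lborel)"
      using Q[of y] by (intro integral_cong_AE) (auto elim!: eventually_mono)
    moreover have "(\<integral>x. max 0 (a - (norm (x - y))\<^sup>2) * J.S x \<partial>lborel) = (\<integral>x. max 0 (a - (norm (x - y))\<^sup>2) * I.S x \<partial>lborel)"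
      using S by (intro integral_cong_AE) (auto elim!: eventually_mono)
    ultimately show "(\<integral>x. indicator {..<a} ((norm (x - y))\<^sup>2) * (2 * J.Q y x) \<partial>lborel) = (\<integral>x. max 0 (a - (norm (x - y))\<^sup>2) * J.S x \<partial>lborel)"
      using I.ident[of a y] by simp
    show "integrable lborel (\<lambda>x. indicator {..<a} ((norm (x - y))\<^sup>2) * (2 * J.Q y x))"
      by (rule integrable_cong_AE_imp[OF I.ident_int(1)[of a y]]) (use Q[of y] in \<open>auto elim!: eventually_mono\<close>)
    show "integrable lborel (\<lambda>x. indicator {..<a} ((norm (x - y))\<^sup>2) * J.S x)"
      by (rule integrable_cong_AE_imp[OF I.ident_int(2)[of a y]]) (use S in \<open>auto elim!: eventually_mono\<close>)
  qed
qed

text \<open>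
  Changing the pressure on a null set turns the essential limit into a pointwise one, and the
  stationary identity is not affected.
\<close>

lemma decay_of_essential_vanishing:
  fixes u :: "'a::euclidean_space \<Rightarrow> 'a"
  assumes "pressure_identity u p" and s: "1 < s" "s < 2" "real DIM('a) < s / (s - 1)"
    and us: "integrable lborel (\<lambda>x. norm (u x) powr (2 * s))"
    and p_loc: "\<And>R. integrable lborel (\<lambda>x. indicator (cball 0 R) x * p x)"
    and vanish: "\<And>e. 0 < e \<Longrightarrow> \<exists>R. AE x in lborel. R \<le> norm x \<longrightarrow> \<bar>p x\<bar> \<le> e"
  shows "integrable lborel (\<lambda>x. ((norm (u x))\<^sup>2 + \<bar>p x\<bar>) / (1 + norm x))"
proof -
  interpret I: pressure_identity u p by fact
  have [measurable]: "p \<in> borel_measurable borel" by (rule I.p_meas)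
  obtain r where r: "\<And>k::nat. AE x in lborel. r k \<le> norm x \<longrightarrow> \<bar>p x\<bar> \<le> 1 / real (Suc k)"
    using vanish[of "1 / real (Suc k)" for k] by (metis of_nat_0_less_iff zero_less_Suc zero_less_divide_1_iff)
  \<comment> \<open>Off the set \<open>G\<close>, which has full measure, the pressure is set to \<open>0\<close>.\<close>
  define G where "G x \<longleftrightarrow> (\<forall>k::nat. r k \<le> norm x \<longrightarrow> \<bar>p x\<bar> \<le> 1 / real (Suc k))" for x
  have [measurable]: "Measurable.pred borel G" unfolding G_def by measurable
  define p' where "p' x = (if G x then p x else 0)" for x
  have p'm [measurable]: "p' \<in> borel_measurable borel" unfolding p'_def by measurable
  have "AE x in lborel. G x" unfolding G_def AE_all_countable using r by blast
  then have eq: "AE x in lborel. p x = p' x" by eventually_elim (simp add: p'_def)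
  interpret J: pressure_identity u p' by (rule pressure_identity_cong_AE[OF assms(1) p'm eq])
  have "integrable lborel (\<lambda>x. J.U x / (1 + norm x))"
  proof (rule J.decay_of_powr_integrable[OF s us])
    have [measurable]: "cball (0::'a) R \<in> sets borel" for R by simp
    show "integrable lborel (\<lambda>x. indicator (cball 0 R) x * p' x)" for R
      by (rule integrable_cong_AE_imp[OF p_loc[of R]]) (use eq in \<open>auto elim!: eventually_mono\<close>)
    fix e :: real assume e: "0 < e"
    obtain k where k: "1 / real (Suc k) < e" using nat_approx_posE[OF e] by blast
    have "\<bar>p' x\<bar> \<le> e" if x: "r k \<le> norm x" for x
    proof (cases "G x")
      case True
      then have "\<bar>p x\<bar> \<le> 1 / real (Suc k)" using x unfolding G_def by blast
      then show ?thesis using True k by (simp add: p'_def)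
    qed (use e in \<open>simp add: p'_def\<close>)
    then show "\<exists>R. \<forall>x. R \<le> norm x \<longrightarrow> \<bar>p' x\<bar> \<le> e" by blast
  qed
  then show ?thesis
    by (rule integrable_cong_AE_imp) (use eq in \<open>auto simp: J.U_def elim!: eventually_mono\<close>)
qed

text \<open>
  The weight is constrained only almost everywhere on the half-line. The representative is clamped
  between \<open>0\<close> and \<open>C / (1 + r)\<close> and is \<open>0\<close> on the negative axis, so that the bounds hold everywhere.
\<close>

lemma weight_representative:
  fixes w :: "real \<Rightarrow> real"
  assumes int: "integrable (lebesgue_on {0<..}) w" and C: "0 < C"
    and w: "AE r in lebesgue_on {0..}. 0 < w r \<and> w r \<le> C / (1 + r)"
  obtains w' where "radial_weight w' C" "AE r in lborel. 0 < r \<longrightarrow> w' r = w r \<and> 0 < w' r"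
    "\<And>r. (LINT s|lebesgue_on {0..r}. w s) = radial_weight.W w' r" "\<And>r. 0 < r \<Longrightarrow> 0 < radial_weight.W w' r"
proof -
  obtain w0 where w0 [measurable]: "w0 \<in> borel_measurable borel" and e0: "AE s in lborel. s \<in> {0<..} \<longrightarrow> w0 s = w s"
    by (rule borel_representative[of w "{0<..}"]) (use int in auto)
  define w' where "w' s = (if 0 < s then max 0 (min (w0 s) (C / (1 + s))) else 0)" for s
  have w'm [measurable]: "w' \<in> borel_measurable borel" unfolding w'_def by measurable
  have bnd: "AE r in lborel. r \<in> {0..} \<longrightarrow> 0 < w r \<and> w r \<le> C / (1 + r)"
    by (rule AE_lebesgue_on_iff[THEN iffD1, OF _ w]) simp
  have eq: "AE r in lborel. 0 < r \<longrightarrow> w' r = w r \<and> 0 < w' r"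
    using e0 bnd by eventually_elim (auto simp: w'_def)
  have w_int: "integrable lborel w'"
  proof -
    have "AE s in lborel. s \<in> {0<..} \<longrightarrow> w s = w' s" using eq by (auto elim!: eventually_mono)
    from lebesgue_on_integrable_eq[OF w'm _ this] int have "integrable lborel (\<lambda>s. indicator {0<..} s *\<^sub>R w' s)" by simp
    moreover have "(\<lambda>s. indicator {0<..} s *\<^sub>R w' s) = w'" by (auto simp: w'_def fun_eq_iff split: split_indicator)
    ultimately show ?thesis by (simp only:)
  qed
  interpret R: radial_weight w' C
  proof
    show "w' s \<le> C / (1 + s)" if "0 \<le> s" for s using that C by (auto simp: w'_def)
  qed (auto simp: w'_def intro: w_int w'm[unfolded w'_def[abs_def]])
  show thesis
  proof (rule that[OF R.radial_weight_axioms eq])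
    fix r
    have "AE s in lborel. s \<in> {0..r} \<longrightarrow> w s = w' s"
      using eq AE_lborel_singleton[of "0::real"] by eventually_elim auto
    from lebesgue_on_integral_eq[OF w'm _ this] show "(LINT s|lebesgue_on {0..r}. w s) = R.W r" by (simp add: R.W_def)
  next
    fix r :: real assume r: "0 < r"
    show "0 < R.W r"
    proof (rule ccontr)
      assume "\<not> 0 < R.W r"
      then have "R.W r = 0" using R.W_nonneg[of r] by simp
      then have "AE s in lborel. indicator {0..r} s * w' s = 0"
        unfolding R.W_def by (subst (asm) integral_nonneg_eq_0_iff_AE) (auto intro!: R.w_set_int mult_nonneg_nonneg R.w_nonneg)
      with eq have "AE s in lborel. s \<notin> {0<..r}" by eventually_elim (auto split: split_indicator)
      then have "{0<..r} \<in> null_sets lborel" by (subst AE_iff_null_sets) auto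
      then show False using r by (simp add: null_sets_def)
    qed
  qed
qed

lemma AE_zero_of_sections:
  fixes F :: "'a::euclidean_space \<times> real \<Rightarrow> 'b::euclidean_space"
  assumes F [measurable]: "F \<in> borel_measurable borel" and ae: "AE t in lborel. AE x in lborel. F (x, t) = 0"
  shows "AE z in lborel. F z = 0"
proof -
  have Fm [measurable]: "F \<in> borel_measurable ((lborel :: 'a measure) \<Otimes>\<^sub>M (lborel :: real measure))"
    unfolding lborel_prod by simp
  have "Measurable.pred ((lborel :: 'a measure) \<Otimes>\<^sub>M (lborel :: real measure)) (\<lambda>z. F z = 0)" by measurable
  then have S: "{z \<in> space ((lborel :: 'a measure) \<Otimes>\<^sub>M (lborel :: real measure)). F z = 0} \<in> sets (lborel \<Otimes>\<^sub>M lborel)"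
    by (simp only: pred_def)
  then have S': "{z \<in> space ((lborel :: 'a measure) \<Otimes>\<^sub>M (lborel :: real measure)). F (fst z, snd z) = 0} \<in> sets (lborel \<Otimes>\<^sub>M lborel)"
    by (simp only: prod.collapse)
  from lborel_pair.AE_commute[where P = "\<lambda>x t. F (x, t) = 0", OF S'] ae
  have "AE x in (lborel :: 'a measure). AE t in lborel. F (x, t) = 0" by blast
  from lborel_pair.AE_pair_measure[OF S this]
  show ?thesis unfolding lborel_prod .
qed

theorem theorem1p2:
  fixes T \<nu> :: real
    and f v :: "real ^ 'n \<Rightarrow> real \<Rightarrow> real ^ 'n"
    and p :: "real ^ 'n \<Rightarrow> real \<Rightarrow> real"
  assumes "CARD('n) \<ge> 2" and "T > 0" and "\<nu> \<ge> 0"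
    and "weak_solution_NS \<nu> T f v p"
    and "decay_A T v p \<or> decay_B T v p"
    and "\<exists>(w :: real \<Rightarrow> real) C. integrable (lebesgue_on {0<..}) w \<and> C > 0 \<and>
           (AE r in lebesgue_on {0..}. 0 < w r \<and> w r \<le> C / (1 + r)) \<and>
           (AE t in lebesgue_on {0<..<T}.
              (LINT x|lebesgue. p x t * (w (norm x) + (real CARD('n) - 1) / norm x *
                 (LINT s|lebesgue_on {0..norm x}. w s))) \<ge> 0)"
  shows "AE z in lebesgue_on (UNIV \<times> {0<..<T}). v (fst z) (snd z) = 0"
proof -
  have v_sp: "v \<in> time_Lr 2 T (Lq_loc_sigma 2) (Lq_loc_seminorms 2)" and p_sp: "p \<in> time_Lr 1 T (Lq_loc 1) (Lq_loc_seminorms 1)"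
    using assms(4) by (auto simp: weak_solution_NS_def)
  obtain v' where v' [measurable]: "v' \<in> borel_measurable borel"
    and v_eq: "AE t in lborel. t \<in> {0<..<T} \<longrightarrow> (AE x in lborel. v x t = v' (x, t))"
    and v_int: "\<And>R. integrable lborel (\<lambda>z. indicator (cball 0 R) (fst z) * norm (v' z) powr 2)"
    and v_out: "\<And>x t. t \<notin> {0<..<T} \<Longrightarrow> v' (x, t) = 0"
    and v_joint: "AE z in lborel. z \<in> UNIV \<times> {0<..<T} \<longrightarrow> v' z = v (fst z) (snd z)"
    by (rule time_Lr_representative[OF v_sp]) (auto simp: Lq_loc_sigma_def)
  obtain p' where p' [measurable]: "p' \<in> borel_measurable borel"
    and p_eq: "AE t in lborel. t \<in> {0<..<T} \<longrightarrow> (AE x in lborel. p x t = p' (x, t))"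
    and p_int: "\<And>R. integrable lborel (\<lambda>z. indicator (cball 0 R) (fst z) * norm (p' z) powr 1)"
    by (rule time_Lr_representative[OF p_sp]) auto
  have loc: "integrable lborel (\<lambda>z. indicator (cball 0 R) (fst z) * ((norm (v' z))\<^sup>2 + \<bar>p' z\<bar>))" for R
    using Bochner_Integration.integrable_add[OF v_int[of R] p_int[of R]] by (simp add: distrib_left)
  obtain h :: "real \<Rightarrow> nat \<Rightarrow> nat \<Rightarrow> real \<Rightarrow> real" where h: "\<And>a n. profile (h a n) a"
    "\<And>n m. continuous_on UNIV (\<lambda>(a, s). h a n m s)"
    "\<And>a n s. \<bar>h a n 2 s\<bar> \<le> 1" "\<And>a n s. \<bar>h a n 1 s\<bar> \<le> max 0 (a - s)"
    "\<And>a s. (\<lambda>n. h a n 2 s) \<longlonglongrightarrow> (if s < a then 1 else 0)"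
    "\<And>a s. (\<lambda>n. h a n 1 s) \<longlonglongrightarrow> - max 0 (a - s)"
    by (rule exists_profiles) blast
  obtain Y :: "(real ^ 'n) set" where Y: "countable Y" "closure Y = UNIV"
    by (rule separable[of "UNIV :: (real ^ 'n) set"]) auto
  \<comment> \<open>The exceptional set of times depends on the test field; a countable family of fields leaves a
    common null set.\<close>
  have smooth: "AE t in lborel. \<forall>y\<in>Y. \<forall>a\<in>\<rat>. \<forall>n. t \<in> {0<..<T} \<longrightarrow>
      (\<integral>x. 2 * h a n 1 ((norm (x - y))\<^sup>2) * ((norm (v' (x, t)))\<^sup>2 + real CARD('n) * p' (x, t))
        + 4 * h a n 2 ((norm (x - y))\<^sup>2) * ((v' (x, t) \<bullet> (x - y))\<^sup>2 + p' (x, t) * (norm (x - y))\<^sup>2) \<partial>lborel) = 0"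
  proof (intro AE_ball_countable[THEN iffD2, rule_format] AE_all_countable[THEN iffD2, rule_format] Y(1) countable_rat)
    fix y a n
    \<comment> \<open>On \<open>s \<ge> 0\<close> the bound \<open>max 0 (a - s)\<close> is at most \<open>\<bar>a\<bar>\<close>.\<close>
    have "\<bar>h a n 1 s\<bar> \<le> \<bar>a\<bar> + 1" "\<bar>h a n 2 s\<bar> \<le> \<bar>a\<bar> + 1" if "0 \<le> s" for s
      using h(3)[of a n s] h(4)[of a n s] that by auto
    from weak_form_radial[OF assms(4) v' p' v_eq p_eq loc h(1)[of a n] this, of y]
    show "AE t in lborel. t \<in> {0<..<T} \<longrightarrow>
      (\<integral>x. 2 * h a n 1 ((norm (x - y))\<^sup>2) * ((norm (v' (x, t)))\<^sup>2 + real CARD('n) * p' (x, t))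
        + 4 * h a n 2 ((norm (x - y))\<^sup>2) * ((v' (x, t) \<bullet> (x - y))\<^sup>2 + p' (x, t) * (norm (x - y))\<^sup>2) \<partial>lborel) = 0"
      by simp
  qed
  have sec: "AE t in lborel. \<forall>k::nat. integrable lborel (\<lambda>x. indicator (cball 0 (real k)) x * ((norm (v' (x, t)))\<^sup>2 + \<bar>p' (x, t)\<bar>))"
    unfolding AE_all_countable
  proof
    fix k
    show "AE t in lborel. integrable lborel (\<lambda>x. indicator (cball 0 (real k)) x * ((norm (v' (x, t)))\<^sup>2 + \<bar>p' (x, t)\<bar>))"
      using lborel_pair.AE_integrable_snd[of "\<lambda>x t. indicator (cball 0 (real k)) x * ((norm (v' (x, t)))\<^sup>2 + \<bar>p' (x, t)\<bar>)"] loc[of "real k"]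
      by (simp add: lborel_prod case_prod_unfold)
  qed
  have locR: "integrable lborel (\<lambda>x. indicator (cball 0 R) x * ((norm (v' (x, t)))\<^sup>2 + \<bar>p' (x, t)\<bar>))"
    if *: "\<forall>k::nat. integrable lborel (\<lambda>x. indicator (cball 0 (real k)) x * ((norm (v' (x, t)))\<^sup>2 + \<bar>p' (x, t)\<bar>))" for t R
  proof -
    obtain k :: nat where k: "R \<le> real k" using real_arch_simple by blast
    have [measurable]: "cball (0::real ^ 'n) R \<in> sets borel" by simp
    show ?thesis
    proof (rule Bochner_Integration.integrable_bound[OF *[rule_format, of k]])
      show "AE x in lborel. norm (indicator (cball 0 R) x * ((norm (v' (x, t)))\<^sup>2 + \<bar>p' (x, t)\<bar>))
          \<le> norm (indicator (cball 0 (real k)) x * ((norm (v' (x, t)))\<^sup>2 + \<bar>p' (x, t)\<bar>))"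
        using k by (intro AE_I2) (auto split: split_indicator)
    qed measurable
  qed
  have identity: "AE t in lborel. t \<in> {0<..<T} \<longrightarrow> pressure_identity (\<lambda>x. v' (x, t)) (\<lambda>x. p' (x, t))"
    using smooth sec
  proof eventually_elim
    case (elim t)
    show ?case
    proof
      assume t: "t \<in> {0<..<T}"
      interpret R: radial_identity "\<lambda>x. v' (x, t)" "\<lambda>x. p' (x, t)" by unfold_locales auto
      note id = radial_identity_of_smooth[where u = "\<lambda>x. v' (x, t)" and p = "\<lambda>x. p' (x, t)", OF _ _ locR[OF elim(2)] h Y(2)]
      have "(\<integral>x. 2 * h a n 1 ((norm (x - y))\<^sup>2) * ((norm (v' (x, t)))\<^sup>2 + real DIM(real ^ 'n) * p' (x, t))
        + 4 * h a n 2 ((norm (x - y))\<^sup>2) * ((v' (x, t) \<bullet> (x - y))\<^sup>2 + p' (x, t) * (norm (x - y))\<^sup>2) \<partial>lborel) = 0"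
        if "y \<in> Y" "a \<in> \<rat>" for y a n
        using elim(1) that t by simp
      note id = id[OF _ _ this]
      show "pressure_identity (\<lambda>x. v' (x, t)) (\<lambda>x. p' (x, t))"
        by unfold_locales (unfold R.Q_def R.S_def, (rule id; simp)+)
    qed
  qed
  have decay: "AE t in lborel. t \<in> {0<..<T} \<longrightarrow> integrable lborel (\<lambda>x. ((norm (v' (x, t)))\<^sup>2 + \<bar>p' (x, t)\<bar>) / (1 + norm x))"
    using assms(5)
  proof
    assume A: "decay_A T v p"
    define g where "g t = (\<integral>\<^sup>+x. ennreal (((norm (v' (x, t)))\<^sup>2 + \<bar>p' (x, t)\<bar>) / (1 + norm x)) \<partial>lborel)" for t
    have gm: "g \<in> borel_measurable borel"
    proof -
      have [measurable]: "(\<lambda>z. v' (snd z, fst z)) \<in> borel_measurable (borel \<Otimes>\<^sub>M lborel)" "(\<lambda>z. p' (snd z, fst z)) \<in> borel_measurable (borel \<Otimes>\<^sub>M lborel)"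
        by (rule measurable_compose[OF _ v'] measurable_compose[OF _ p'], simp add: borel_prod[symmetric])+
      show ?thesis unfolding g_def by (intro lborel.borel_measurable_nn_integral) (simp add: case_prod_unfold)
    qed
    have "AE t in lborel. t \<in> {0<..<T} \<longrightarrow> (\<integral>\<^sup>+x. ennreal (((norm (v x t))\<^sup>2 + \<bar>p x t\<bar>) / (1 + norm x)) \<partial>lebesgue) = g t"
      using v_eq p_eq
    proof eventually_elim
      case (elim t)
      show ?case
      proof
        assume t: "t \<in> {0<..<T}"
        with elim have "AE x in lborel. v x t = v' (x, t)" "AE x in lborel. p x t = p' (x, t)" by auto
        then have "AE x in lborel. ennreal (((norm (v x t))\<^sup>2 + \<bar>p x t\<bar>) / (1 + norm x)) = ennreal (((norm (v' (x, t)))\<^sup>2 + \<bar>p' (x, t)\<bar>) / (1 + norm x))"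
          by eventually_elim simp
        then show "(\<integral>\<^sup>+x. ennreal (((norm (v x t))\<^sup>2 + \<bar>p x t\<bar>) / (1 + norm x)) \<partial>lebesgue) = g t"
          unfolding g_def nn_integral_completion by (rule nn_integral_cong_AE)
      qed
    qed
    then have "(\<integral>\<^sup>+t. (\<integral>\<^sup>+x. ennreal (((norm (v x t))\<^sup>2 + \<bar>p x t\<bar>) / (1 + norm x)) \<partial>lebesgue) \<partial>lebesgue_on {0<..<T}) = (\<integral>\<^sup>+t. g t \<partial>lebesgue_on {0<..<T})"
      by (intro nn_integral_cong_AE) (simp add: AE_lebesgue_on_iff)
    also have "\<dots> = (\<integral>\<^sup>+t. g t * indicator {0<..<T} t \<partial>lborel)"
      by (simp add: nn_integral_restrict_space nn_integral_completion)
    finally have "(\<integral>\<^sup>+t. g t * indicator {0<..<T} t \<partial>lborel) \<noteq> \<infinity>" using A by (simp add: decay_A_def)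
    then have "AE t in lborel. g t * indicator {0<..<T} t \<noteq> \<infinity>" by (rule nn_integral_noteq_infinite[rotated]) (use gm in simp)
    then show ?thesis
    proof eventually_elim
      case (elim t)
      show ?case
      proof
        assume t: "t \<in> {0<..<T}"
        then have "g t < \<infinity>" using elim by (simp add: less_top)
        then show "integrable lborel (\<lambda>x. ((norm (v' (x, t)))\<^sup>2 + \<bar>p' (x, t)\<bar>) / (1 + norm x))"
          unfolding g_def by (intro integrableI_nonneg) (auto intro!: AE_I2 divide_nonneg_nonneg add_nonneg_nonneg)
      qed
    qed
  next
    assume B: "decay_B T v p"
    then obtain q where q: "2 < q" "q < 2 * real CARD('n) / (real CARD('n) - 1)" and vq: "v \<in> time_Lr 2 T (Lq_space q UNIV) {Lq_norm q UNIV}"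
      by (auto simp: decay_B_def)
    define s where "s = q / 2"
    have N: "2 \<le> real CARD('n)" using assms(1) by linarith
    have sN: "s * (real CARD('n) - 1) < real CARD('n)" using q(2) N by (simp add: s_def pos_less_divide_eq)
    have s1: "1 < s" using q by (simp add: s_def)
    have s2: "s < 2"
    proof (rule ccontr)
      assume "\<not> s < 2"
      then have "2 * (real CARD('n) - 1) \<le> s * (real CARD('n) - 1)" using N by (intro mult_right_mono) auto
      from le_less_trans[OF this sN] show False using N by simp
    qed
    \<comment> \<open>The condition \<open>q < 2 N / (N - 1)\<close> says that the exponent dual to \<open>s\<close> exceeds \<open>N\<close>.\<close>
    have s3: "real DIM(real ^ 'n) < s / (s - 1)" using sN s1 by (simp add: pos_less_divide_eq algebra_simps)
    have lq: "AE t in lborel. t \<in> {0<..<T} \<longrightarrow> (\<lambda>x. v x t) \<in> Lq_space q UNIV"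
      using vq by (simp add: time_Lr_def AE_lebesgue_on_iff)
    have lim: "AE t in lborel. t \<in> {0<..<T} \<longrightarrow> ((\<lambda>x. p x t) \<longlongrightarrow> 0) (inf at_infinity (ae_filter lebesgue))"
      using B by (simp add: decay_B_def AE_lebesgue_on_iff)
    show ?thesis using identity sec lq lim v_eq p_eq
    proof eventually_elim
      case (elim t)
      show ?case
      proof
        assume t: "t \<in> {0<..<T}"
        show "integrable lborel (\<lambda>x. ((norm (v' (x, t)))\<^sup>2 + \<bar>p' (x, t)\<bar>) / (1 + norm x))"
        proof (rule decay_of_essential_vanishing[OF _ s1 s2 s3])
          show "pressure_identity (\<lambda>x. v' (x, t)) (\<lambda>x. p' (x, t))" using elim(1) t by simp
          have "AE x in lborel. x \<in> UNIV \<longrightarrow> norm (v x t) powr q = norm (v' (x, t)) powr q"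
            using elim(5) t by (auto elim!: eventually_mono)
          moreover have "integrable (lebesgue_on UNIV) (\<lambda>x. norm (v x t) powr q)" using elim(3) t by (simp add: Lq_space_def)
          ultimately show "integrable lborel (\<lambda>x. norm (v' (x, t)) powr (2 * s))"
            using lebesgue_on_integrable_eq[of "\<lambda>x. norm (v' (x, t)) powr q" UNIV "\<lambda>x. norm (v x t) powr q"] by (simp add: s_def)
          fix R
          show "integrable lborel (\<lambda>x. indicator (cball 0 R) x * p' (x, t))"
          proof (rule Bochner_Integration.integrable_bound[OF locR[OF elim(2), of R]])
            have [measurable]: "cball (0::real ^ 'n) R \<in> sets borel" by simp
            show "(\<lambda>x. indicator (cball 0 R) x * p' (x, t)) \<in> borel_measurable lborel" by measurable
          qed (auto split: split_indicator)
        next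
          fix e :: real assume "0 < e"
          have "((\<lambda>x. p x t) \<longlongrightarrow> 0) (inf at_infinity (ae_filter lebesgue))" using elim(4) t by simp
          from tendstoD[OF this \<open>0 < e\<close>]
          obtain P Q where P: "eventually P at_infinity" and Q: "eventually Q (ae_filter lebesgue)" and PQ: "\<And>x. P x \<Longrightarrow> Q x \<Longrightarrow> \<bar>p x t\<bar> < e"
            unfolding eventually_inf by auto
          obtain R where R: "\<And>x. R \<le> norm x \<Longrightarrow> P x" using P unfolding eventually_at_infinity by blast
          have "AE x in lborel. Q x" using Q by (simp add: AE_completion_iff)
          moreover have "AE x in lborel. p x t = p' (x, t)" using elim(6) t by simp
          ultimately have "AE x in lborel. R \<le> norm x \<longrightarrow> \<bar>p' (x, t)\<bar> \<le> e"
            by eventually_elim (use PQ R in fastforce)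
          then show "\<exists>R. AE x in lborel. R \<le> norm x \<longrightarrow> \<bar>p' (x, t)\<bar> \<le> e" by blast
        qed
      qed
    qed
  qed
  obtain w C where w: "integrable (lebesgue_on {0<..}) w" "0 < C" "AE r in lebesgue_on {0..}. 0 < w r \<and> w r \<le> C / (1 + r)"
    and sign: "AE t in lebesgue_on {0<..<T}. (LINT x|lebesgue. p x t * (w (norm x) + (real CARD('n) - 1) / norm x *
                 (LINT s|lebesgue_on {0..norm x}. w s))) \<ge> 0"
    using assms(6) by blast
  obtain w' where rw: "radial_weight w' C" and w_eq: "AE r in lborel. 0 < r \<longrightarrow> w' r = w r \<and> 0 < w' r"
    and W_eq: "\<And>r. (LINT s|lebesgue_on {0..r}. w s) = radial_weight.W w' r" and W_pos: "\<And>r. 0 < r \<Longrightarrow> 0 < radial_weight.W w' r"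
    by (rule weight_representative[OF w]) blast
  interpret R: radial_weight w' C by (rule rw)
  have w_norm: "AE x in (lborel :: (real ^ 'n) measure). w' (norm x) = w (norm x) \<and> 0 < w' (norm x)" by (rule AE_norm[OF w_eq])
  have sign': "AE t in lborel. t \<in> {0<..<T} \<longrightarrow> 0 \<le> (LINT x|lebesgue. p x t * (w (norm x) + (real CARD('n) - 1) / norm x * R.W (norm x)))"
    using sign by (simp add: AE_lebesgue_on_iff W_eq)
  have "AE t in lborel. t \<in> {0<..<T} \<longrightarrow> (AE x in lborel. v' (x, t) = 0)"
    using identity decay sign' p_eq
  proof eventually_elim
    case (elim t)
    show ?case
    proof
      assume t: "t \<in> {0<..<T}"
      interpret I: pressure_identity "\<lambda>x. v' (x, t)" "\<lambda>x. p' (x, t)" using elim(1) t by simp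
      interpret J: weighted_pressure "\<lambda>x. v' (x, t)" "\<lambda>x. p' (x, t)" w' C
        by unfold_locales (use elim(2) t in \<open>simp add: I.U_def\<close>)
      have "AE x in lborel. p x t = p' (x, t)" using elim(4) t by simp
      with w_norm have "AE x in lborel. p x t * (w (norm x) + (real CARD('n) - 1) / norm x * R.W (norm x))
          = p' (x, t) * (w' (norm x) + (real CARD('n) - 1) / norm x * R.W (norm x))"
        by eventually_elim simp
      then have "(LINT x|lebesgue. p x t * (w (norm x) + (real CARD('n) - 1) / norm x * R.W (norm x)))
          = (\<integral>x. p' (x, t) * (w' (norm x) + (real CARD('n) - 1) / norm x * R.W (norm x)) \<partial>lborel)"
        by (intro lebesgue_integral_eq) auto
      then have sg: "0 \<le> (\<integral>x. p' (x, t) * (w' (norm x) + (real DIM(real ^ 'n) - 1) / norm x * R.W (norm x)) \<partial>lborel)"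
        using elim(3) t by simp
      show "AE x in lborel. v' (x, t) = 0"
      proof (rule J.velocity_vanishes[OF _ W_pos sg])
        show "AE x in (lborel :: (real ^ 'n) measure). 0 < w' (norm x)" using w_norm by (auto elim!: eventually_mono)
      qed
    qed
  qed
  then have "AE t in lborel. AE x in lborel. v' (x, t) = 0"
  proof eventually_elim
    case (elim t)
    then show ?case using v_out by (cases "t \<in> {0<..<T}") auto
  qed
  then have "AE z in lborel. v' z = 0" by (rule AE_zero_of_sections[OF v'])
  with v_joint have "AE z in lborel. z \<in> UNIV \<times> {0<..<T} \<longrightarrow> v (fst z) (snd z) = 0"
    by eventually_elim auto
  moreover have "UNIV \<times> {0<..<T} \<in> sets (borel :: ((real ^ 'n) \<times> real) measure)" by (intro borel_open open_Times) auto
  ultimately show ?thesis by (subst AE_lebesgue_on_iff)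
qed

end
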